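(* Let $\Omega\subset\mathbb{R}^n$ be a bounded open set, $Y=(0,1)^n$, and let $(\varepsilon_h)$ be a decreasing sequence of positive real numbers with $\varepsilon_h\to 0$ as $h\to\infty$. Let $a:\Omega\times\mathbb{R}^n\times\mathbb{R}^n\to\mathbb{R}^n$ be such that $a(x,\cdot,\xi)$ is Lebesgue measurable and $Y$-periodic for all $x\in\Omega$, $\xi\in\mathbb{R}^n$. Assume there are constants $0<\alpha\le\beta<\infty$ and a continuous increasing function $\omega:\mathbb{R}\to\mathbb{R}$ with $\omega(0)=0$ such that for a.e. $y\in\mathbb{R}^n$ and all $x,x_1,x_2\in\Omega$, $\xi,\xi_1,\xi_2\in\mathbb{R}^n$: \[ (a(x,y,\xi_1)-a(x,y,\xi_2),\,\xi_1-\xi_2)\ge\alpha|\xi_1-\xi_2|^2, \] \[ |a(x,y,\xi_1)-a(x,y,\xi_2)|\le\beta|\xi_1-\xi_2|,\qquad a(x,y,0)=0, \] \[ |a(x_1,y,\xi)-a(x_2,y,\xi)|^2\le\omega(|x_1-x_2|)\,|\xi|^2 . \] Let $(f_h)$ be a sequence converging to $f$ in $H^{-1,2}(\Omega)$, and for each $h$ let $u_h\in H_0^{1,2}(\Omega)$ be the unique solution of \[ \int_\Omega\Big(a\Big(x,\frac{x}{\varepsilon_h},Du_h\Big),D\phi\Big)\,dx=\langle f_h,\phi\rangle\quad\text{for every }\phi\in H_0^{1,2}(\Omega). \] Let $u\in H_0^{1,2}(\Omega)$ be the unique solution of the homogenized problem \[ \int_\Omega (b(x,Du),D\phi)\,dx=\langle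 f,\phi\rangle\quad\text{for every }\phi\in H_0^{1,2}(\Omega), \] where $b(x,\xi)=\int_Y a(x,y,\xi+Dv^{\xi,x}(y))\,dy$ and $v^{\xi,x}\in H^{1,2}_\square(Y)$ is the unique solution of \[ \int_Y\big(a(x,y,\xi+Dv^{\xi,x}(y)),D\phi(y)\big)\,dy=0\quad\text{for every }\phi\in H^{1,2}_\square(Y). \] Then, with the correctors $P_h$, the averaging operators $M_h$ and the step functions $\gamma_h$ (for any choice of the points $x_h^j\in Y_h^j$) defined in the context, \[ Du_h-P_h(x,M_hDu,\gamma_h)\to 0\quad\text{in } L^2(\Omega,\mathbb{R}^n)\ \text{ as } h\to\infty . \]
   Context: $(\cdot,\cdot)$ is the Euclidean scalar product on $\mathbb{R}^n$, $D$ denotes the (weak) gradient, and $\langle\cdot,\cdot\rangle$ is the duality pairing between $H^{-1,2}(\Omega)$ and $H_0^{1,2}(\Omega)$. $H_0^{1,2}(\Omega)$ is the usual Sobolev space (closure of $C_0^\infty(\Omega)$ in $H^{1,2}(\Omega)$), and $H^{-1,2}(\Omega)$ is its dual. $H^{1,2}_\square(Y)$ is the set of $u\in H^{1,2}(Y)$ that are $Y$-periodic (i.e. the $Y$-periodic extension of $u$ belongs to $H^{1,2}_{\mathrm{loc}}(\mathbb{R}^n)$) and have mean value $0$ over $Y$. A function on $\mathbb{R}^n$ is $Y$-periodic if it is $1$-periodic in each coordinate. The functions $v^{\xi,x}$ are extended $Y$-periodically to $\mathbb{R}^n$. For $j\in\mathbb{Z}^n$ put $Y_h^j=\varepsilon_h(j+Y)$,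 and let $J_h=\{j\in\mathbb{Z}^n:\overline{Y}_h^j\subset\Omega\}$. With $\chi_E$ the characteristic function of $E$: - For $g\in L^2(\Omega,\mathbb{R}^n)$, $(M_hg)(x)=\sum_{j\in J_h}\chi_{Y_h^j}(x)\,\xi_h^j$, where $\xi_h^j=\frac{1}{|Y_h^j|}\int_{Y_h^j}g\,dx$. - $\gamma_h(x)=\sum_{j\in J_h}\chi_{Y_h^j}(x)\,x_h^j$, where $x_h^j\in Y_h^j$ are chosen points. - For $\xi\in\mathbb{R}^n$, $t\in\Omega$, $P_h(x,\xi,t)=\xi+Dv^{\xi,t}\left(\frac{x}{\varepsilon_h}\right)$. The expression $P_h(x,M_hDu,\gamma_h)$ denotes the function $x\mapsto P_h\big(x,(M_hDu)(x),\gamma_h(x)\big)$ on $\Omega$; thus on $Y_h^j$ with $j\in J_h$ it equals $\xi_h^j+Dv^{\xi_h^j,x_h^j}(x/\varepsilon_h)$ with $\xi_h^j$ the mean of $Du$ over $Y_h^j$, and on $\Omega\setminus\bigcup_{j\in J_h}Y_h^j$, where $M_hDu=0$, it is understood to be $0$ (note $v^{0,t}=0$ for every $t\in\Omega$). *)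

theory Defs
  imports "HOL-Analysis.Analysis"
begin

text \<open>
  Functions on a subset of \<open>real ^ 'n\<close> are total functions whose values off the subset are
  irrelevant, and elements of $L^2$, $H^{1,2}$ etc. are represented by functions rather than by
  classes modulo null sets.
\<close>

definition L2 :: "(real^'n) set \<Rightarrow> (real^'n \<Rightarrow> 'b::euclidean_space) set" where
  "L2 S = {g. g \<in> borel_measurable (lebesgue_on S) \<and>
              integrable (lebesgue_on S) (\<lambda>x. (norm (g x))\<^sup>2)}"

definition L2_norm :: "(real^'n) set \<Rightarrow> (real^'n \<Rightarrow> 'b::euclidean_space) \<Rightarrow> real" where
  "L2_norm S g = sqrt (LINT x|lebesgue_on S. (norm (g x))\<^sup>2)"

definition tendsto_L2 ::
    "(real^'n) set \<Rightarrow> (nat \<Rightarrow> real^'n \<Rightarrow> 'b::euclidean_space) \<Rightarrow> (real^'n \<Rightarrow> 'b) \<Rightarrow> bool" where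
  "tendsto_L2 S G g \<longleftrightarrow> (\<forall>h. G h \<in> L2 S) \<and> g \<in> L2 S \<and>
     (\<lambda>h. L2_norm S (\<lambda>x. G h x - g x)) \<longlonglongrightarrow> 0"

definition loc_integrable :: "(real^'n) set \<Rightarrow> (real^'n \<Rightarrow> 'b::euclidean_space) \<Rightarrow> bool" where
  "loc_integrable S g \<longleftrightarrow> (\<forall>K. compact K \<and> K \<subseteq> S \<longrightarrow> integrable (lebesgue_on K) g)"

definition grad :: "(real^'n \<Rightarrow> real) \<Rightarrow> real^'n \<Rightarrow> real^'n" where
  "grad \<phi> x = (\<chi> i. frechet_derivative \<phi> (at x) (axis i 1))"

primrec C_k :: "nat \<Rightarrow> (real^'n \<Rightarrow> real) \<Rightarrow> bool" where
  "C_k 0 \<phi> \<longleftrightarrow> continuous_on UNIV \<phi>"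
| "C_k (Suc k) \<phi> \<longleftrightarrow> \<phi> differentiable_on UNIV \<and> (\<forall>i. C_k k (\<lambda>x. grad \<phi> x $ i))"

text \<open>$C_0^\infty(S)$, each function being extended by zero to the whole space.\<close>

definition test_functions :: "(real^'n) set \<Rightarrow> (real^'n \<Rightarrow> real) set" where
  "test_functions S = {\<phi>. (\<forall>k. C_k k \<phi>) \<and>
     compact (closure {x. \<phi> x \<noteq> 0}) \<and> closure {x. \<phi> x \<noteq> 0} \<subseteq> S}"

definition is_weak_grad ::
    "(real^'n) set \<Rightarrow> (real^'n \<Rightarrow> real) \<Rightarrow> (real^'n \<Rightarrow> real^'n) \<Rightarrow> bool" where
  "is_weak_grad S u G \<longleftrightarrow> loc_integrable S u \<and> loc_integrable S G \<and>
     (\<forall>\<phi>\<in>test_functions S.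
        (LINT x|lebesgue_on S. u x *\<^sub>R grad \<phi> x) = - (LINT x|lebesgue_on S. \<phi> x *\<^sub>R G x))"

text \<open>
  On an open set the weak gradient is unique up to a null set; the following picks a
  representative.
\<close>

definition weak_grad :: "(real^'n) set \<Rightarrow> (real^'n \<Rightarrow> real) \<Rightarrow> real^'n \<Rightarrow> real^'n" where
  "weak_grad S u = (SOME G. is_weak_grad S u G)"

definition H12 :: "(real^'n) set \<Rightarrow> (real^'n \<Rightarrow> real) set" where
  "H12 S = {u \<in> L2 S. \<exists>G\<in>L2 S. is_weak_grad S u G}"

definition H12_norm :: "(real^'n) set \<Rightarrow> (real^'n \<Rightarrow> real) \<Rightarrow> real" where
  "H12_norm S u = sqrt ((L2_norm S u)\<^sup>2 + (L2_norm S (weak_grad S u))\<^sup>2)"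

definition H12_loc :: "(real^'n \<Rightarrow> real) set" where
  "H12_loc = {u. \<forall>U. open U \<and> bounded U \<longrightarrow> u \<in> H12 U}"

definition H12_0 :: "(real^'n) set \<Rightarrow> (real^'n \<Rightarrow> real) set" where
  "H12_0 S = {u \<in> H12 S. \<forall>e>0. \<exists>\<phi>\<in>test_functions S. H12_norm S (\<lambda>x. u x - \<phi> x) < e}"

text \<open>
  The dual of \<open>H12_0 S\<close>. Only the values of a functional on \<open>H12_0 S\<close> matter; linearity and
  boundedness force it to agree on functions that are equal almost everywhere.
\<close>

definition H_minus :: "(real^'n) set \<Rightarrow> ((real^'n \<Rightarrow> real) \<Rightarrow> real) set" where
  "H_minus S = {f.
     (\<forall>\<phi>\<in>H12_0 S. \<forall>\<psi>\<in>H12_0 S. f (\<lambda>x. \<phi> x + \<psi> x) = f \<phi> + f \<psi>) \<and>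
     (\<forall>c. \<forall>\<phi>\<in>H12_0 S. f (\<lambda>x. c * \<phi> x) = c * f \<phi>) \<and>
     (\<exists>C. \<forall>\<phi>\<in>H12_0 S. \<bar>f \<phi>\<bar> \<le> C * H12_norm S \<phi>)}"

definition H_minus_norm :: "(real^'n) set \<Rightarrow> ((real^'n \<Rightarrow> real) \<Rightarrow> real) \<Rightarrow> real" where
  "H_minus_norm S f = (SUP \<phi>\<in>{\<phi> \<in> H12_0 S. H12_norm S \<phi> \<le> 1}. \<bar>f \<phi>\<bar>)"

definition tendsto_H_minus ::
    "(real^'n) set \<Rightarrow> (nat \<Rightarrow> (real^'n \<Rightarrow> real) \<Rightarrow> real) \<Rightarrow> ((real^'n \<Rightarrow> real) \<Rightarrow> real) \<Rightarrow> bool" where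
  "tendsto_H_minus S F f \<longleftrightarrow> (\<forall>h. F h \<in> H_minus S) \<and> f \<in> H_minus S \<and>
     (\<lambda>h. H_minus_norm S (\<lambda>\<phi>. F h \<phi> - f \<phi>)) \<longlonglongrightarrow> 0"

definition Y :: "(real^'n) set" where
  "Y = {y. \<forall>i. 0 < y $ i \<and> y $ i < 1}"

definition Y_periodic :: "(real^'n \<Rightarrow> 'b) \<Rightarrow> bool" where
  "Y_periodic g \<longleftrightarrow> (\<forall>y i. g (y + axis i 1) = g y)"

text \<open>
  The periodic extension of the restriction of a function to \<open>Y\<close>. On the null set of points with
  an integer coordinate, which no translate of \<open>Y\<close> covers, its values are irrelevant.
\<close>

definition per_ext :: "(real^'n \<Rightarrow> 'b) \<Rightarrow> real^'n \<Rightarrow> 'b" where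
  "per_ext g y = g (\<chi> i. frac (y $ i))"

text \<open>Since \<open>Y\<close> has measure one, the integral over \<open>Y\<close> is the mean value.\<close>

definition H12_per :: "(real^'n \<Rightarrow> real) set" where
  "H12_per = {u \<in> H12 Y. per_ext u \<in> H12_loc \<and> (LINT y|lebesgue_on Y. u y) = 0}"

text \<open>In what follows \<open>v \<xi> x\<close> stands for the cell function $v^{\xi,x}$.\<close>

definition b_hom ::
    "(real^'n \<Rightarrow> real^'n \<Rightarrow> real^'n \<Rightarrow> real^'n) \<Rightarrow> (real^'n \<Rightarrow> real^'n \<Rightarrow> real^'n \<Rightarrow> real)
     \<Rightarrow> real^'n \<Rightarrow> real^'n \<Rightarrow> real^'n" where
  "b_hom a v x \<xi> = (LINT y|lebesgue_on Y. a x y (\<xi> + weak_grad Y (v \<xi> x) y))"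

definition cell :: "real \<Rightarrow> int^'n \<Rightarrow> (real^'n) set" where
  "cell \<epsilon> j = (\<lambda>y. \<epsilon> *\<^sub>R ((\<chi> i. real_of_int (j $ i)) + y)) ` Y"

definition inner_cells :: "(real^'n) set \<Rightarrow> real \<Rightarrow> (int^'n) set" where
  "inner_cells \<Omega> \<epsilon> = {j. closure (cell \<epsilon> j) \<subseteq> \<Omega>}"

definition cell_mean :: "real \<Rightarrow> (real^'n \<Rightarrow> real^'n) \<Rightarrow> int^'n \<Rightarrow> real^'n" where
  "cell_mean \<epsilon> g j = (1 / measure lebesgue (cell \<epsilon> j)) *\<^sub>R (LINT x|lebesgue_on (cell \<epsilon> j). g x)"

text \<open>The sums below are finite for bounded \<open>\<Omega>\<close> and positive \<open>\<epsilon>\<close>.\<close>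

definition M_avg :: "(real^'n) set \<Rightarrow> real \<Rightarrow> (real^'n \<Rightarrow> real^'n) \<Rightarrow> real^'n \<Rightarrow> real^'n" where
  "M_avg \<Omega> \<epsilon> g x = (\<Sum>j\<in>inner_cells \<Omega> \<epsilon>. indicat_real (cell \<epsilon> j) x *\<^sub>R cell_mean \<epsilon> g j)"

definition gamma_step :: "(real^'n) set \<Rightarrow> real \<Rightarrow> (int^'n \<Rightarrow> real^'n) \<Rightarrow> real^'n \<Rightarrow> real^'n" where
  "gamma_step \<Omega> \<epsilon> p x = (\<Sum>j\<in>inner_cells \<Omega> \<epsilon>. indicat_real (cell \<epsilon> j) x *\<^sub>R p j)"

definition P_corr ::
    "(real^'n \<Rightarrow> real^'n \<Rightarrow> real^'n \<Rightarrow> real) \<Rightarrow> real \<Rightarrow> real^'n \<Rightarrow> real^'n \<Rightarrow> real^'n \<Rightarrow> real^'n" where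
  "P_corr v \<epsilon> x \<xi> t = \<xi> + weak_grad UNIV (per_ext (v \<xi> t)) (x /\<^sub>R \<epsilon>)"

text \<open>
  The function $x \mapsto P(x, (Mg)(x), \gamma(x))$. Off the inner cells \<open>gamma_step\<close> has the value
  $0$, which need not lie in \<open>\<Omega>\<close>; there the function is $0$ by convention.
\<close>

definition corrector ::
    "(real^'n) set \<Rightarrow> real \<Rightarrow> (real^'n \<Rightarrow> real^'n \<Rightarrow> real^'n \<Rightarrow> real) \<Rightarrow> (int^'n \<Rightarrow> real^'n)
     \<Rightarrow> (real^'n \<Rightarrow> real^'n) \<Rightarrow> real^'n \<Rightarrow> real^'n" where
  "corrector \<Omega> \<epsilon> v p g x =
     (if x \<in> (\<Union>j\<in>inner_cells \<Omega> \<epsilon>. cell \<epsilon> j)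
      then P_corr v \<epsilon> x (M_avg \<Omega> \<epsilon> g x) (gamma_step \<Omega> \<epsilon> p x) else 0)"

end

theory Submission
  imports Defs
begin

text \<open>
  The corrector $P_h$ is not a gradient, so it cannot be compared with $Du_h$ by monotonicity
  directly. Approximate $Du$ in $L^2$ by $D\psi$ with a test function $\psi$, and use a smooth
  partition of unity $(\eta_k)$ to freeze $D\psi$ at a vector $\xi_k$ and the slow variable at a
  point $z_k$. The function
  $w = \psi + \varepsilon \sum_k \eta_k\, v^{\xi_k,z_k}(x/\varepsilon)$ lies in $H_0^{1,2}$. Its gradient
  is close to $P_h$, because $\xi + Dv^{\xi,x}$ depends continuously on $(\xi,x)$ in $L^2(Y)$, and
  its flux is close to $\sum_k \eta_k \sigma_k(x/\varepsilon)$ with the cell fluxes $\sigma_k$. These are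
  periodic, divergence free and have the mean values $b(z_k,\xi_k)$, so that against a gradient
  $\sum_k \eta_k\,(\sigma_k(x/\varepsilon) - b(z_k,\xi_k))$ is $O(\varepsilon)$ by the Poincare inequality
  on the cells, while $\sum_k \eta_k\, b(z_k,\xi_k)$ is close to $b(x,Du)$. Strong monotonicity,
  tested with $u_h - w$, bounds $Du_h - Dw$ by a constant times the square root of the approximation
  error plus terms that vanish as $h \to \infty$.
\<close>

subsection \<open>Smooth functions\<close>

text \<open>No compactness enters: neither weak limits of the sequence nor compensated compactness
  are used, and every error is explicit. The order of choice makes this possible. An error level
  \<theta> is fixed, then \<psi>, whose gradient is bounded by some L, then the scale \<tau> of the
  partition with \<omega>(2\<tau>) small against L^2, then the partition, and only then \<epsilon>.
  The final constant depends on \<alpha> and \<beta> alone, and constants that depend on the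
  partition always carry a power of \<epsilon>. The obstacle is that Du is merely square integrable,
  while the modulus condition multiplies \<omega> by the square of a field: the cell averages of Du
  are not bounded. A second point is that the slow variable of the flux is x itself. The exceptional
  null set of the structure conditions lies in y and is common to all slow arguments, so it can be
  pulled back along x/\<epsilon>.\<close>

definition smooth :: "(real^'n \<Rightarrow> real) \<Rightarrow> bool" where
  "smooth \<phi> \<longleftrightarrow> (\<forall>k. C_k k \<phi>)"

lemma has_derivative_grad:
  assumes "\<phi> differentiable (at x)"
  shows "(\<phi> has_derivative (\<lambda>h. grad \<phi> x \<bullet> h)) (at x)"
proof -
  let ?D = "frechet_derivative \<phi> (at x)"
  have D: "(\<phi> has_derivative ?D) (at x)"
    using assms frechet_derivative_works by blast
  then interpret D: bounded_linear ?D by (rule has_derivative_bounded_linear)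
  have "?D h = grad \<phi> x \<bullet> h" for h
  proof -
    have "?D h = ?D (\<Sum>i\<in>UNIV. h $ i *\<^sub>R axis i 1)"
      using basis_expansion[of h] by (simp add: scalar_mult_eq_scaleR)
    also have "\<dots> = (\<Sum>i\<in>UNIV. h $ i * ?D (axis i 1))"
      by (simp add: D.sum D.scaleR)
    also have "\<dots> = grad \<phi> x \<bullet> h"
      by (simp add: inner_vec_def grad_def mult.commute)
    finally show ?thesis .
  qed
  then have "?D = (\<lambda>h. grad \<phi> x \<bullet> h)" by auto
  with D show ?thesis by simp
qed

lemma grad_eqI:
  assumes "(\<phi> has_derivative (\<lambda>h. g \<bullet> h)) (at x)"
  shows "grad \<phi> x = g"
  using frechet_derivative_at[OF assms, symmetric]
  by (simp add: grad_def inner_axis vec_eq_iff)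

text \<open>Induction on k with the function generalised suffices because the class reproduces
  itself under differentiation. Most smoothness proofs below only name such a class, so that no
  formula for higher derivatives has to be found.\<close>

lemma smooth_coinduct:
  assumes "\<And>\<phi> x. \<phi> \<in> S \<Longrightarrow> \<phi> differentiable (at x)"
    and "\<And>\<phi> i. \<phi> \<in> S \<Longrightarrow> (\<lambda>x. grad \<phi> x $ i) \<in> S" and "\<phi> \<in> S"
  shows "smooth \<phi>"
proof -
  have "C_k k \<phi>" if "\<phi> \<in> S" for k \<phi>
    using that
  proof (induction k arbitrary: \<phi>)
    case 0
    then show ?case
      using assms(1) by (auto intro!: continuous_at_imp_continuous_on differentiable_imp_continuous_within)
  next
    case (Suc k)
    then show ?case
      using assms(1,2) by (auto simp: differentiable_on_def intro: differentiable_at_withinI)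
  qed
  with assms(3) show ?thesis by (simp add: smooth_def)
qed

lemma smooth_differentiable: "smooth \<phi> \<Longrightarrow> \<phi> differentiable (at x)"
  unfolding smooth_def by (metis C_k.simps(2) differentiable_on_def UNIV_I)

lemma smooth_continuous_on: "smooth \<phi> \<Longrightarrow> continuous_on S \<phi>"
  unfolding smooth_def by (metis C_k.simps(1) continuous_on_subset subset_UNIV)

lemma smooth_grad: "smooth \<phi> \<Longrightarrow> smooth (\<lambda>x. grad \<phi> x $ i)"
  unfolding smooth_def by (metis C_k.simps(2))

lemma smooth_has_derivative: "smooth \<phi> \<Longrightarrow> (\<phi> has_derivative (\<lambda>h. grad \<phi> x \<bullet> h)) (at x)"
  using has_derivative_grad smooth_differentiable by blast

lemma smooth_grad_continuous_on: "smooth \<phi> \<Longrightarrow> continuous_on S (grad \<phi>)"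
  using continuous_on_vec_lambda[of S "\<lambda>i x. grad \<phi> x $ i"] smooth_grad smooth_continuous_on by auto

lemma grad_const [simp]: "grad (\<lambda>x. c) x = 0"
  by (rule grad_eqI) simp

lemma smooth_const [simp]: "smooth (\<lambda>x. c)"
proof (rule smooth_coinduct[where S = "range (\<lambda>c x. c)"])
  fix \<phi> :: "real^'n \<Rightarrow> real" and i
  assume "\<phi> \<in> range (\<lambda>c x. c)"
  then show "(\<lambda>x. grad \<phi> x $ i) \<in> range (\<lambda>c x. c)" by auto
qed auto

lemma grad_add: "smooth f \<Longrightarrow> smooth g \<Longrightarrow> grad (\<lambda>x. f x + g x) x = grad f x + grad g x"
  by (rule grad_eqI) (auto intro!: derivative_eq_intros smooth_has_derivative simp: inner_add_left)

lemma smooth_add: assumes "smooth f" "smooth g" shows "smooth (\<lambda>x. f x + g x)"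
proof (rule smooth_coinduct[where S = "{\<lambda>x. f x + g x | f g. smooth f \<and> smooth g}"])
  fix \<phi> :: "real^'n \<Rightarrow> real" and i
  assume "\<phi> \<in> {\<lambda>x. f x + g x | f g. smooth f \<and> smooth g}"
  then obtain f g where *: "\<phi> = (\<lambda>x. f x + g x)" "smooth f" "smooth g" by auto
  then have "(\<lambda>x. grad \<phi> x $ i) = (\<lambda>x. grad f x $ i + grad g x $ i)" by (simp add: grad_add)
  then show "(\<lambda>x. grad \<phi> x $ i) \<in> {\<lambda>x. f x + g x | f g. smooth f \<and> smooth g}"
    unfolding mem_Collect_eq
    by (intro exI[of _ "\<lambda>x. grad f x $ i"] exI[of _ "\<lambda>x. grad g x $ i"] conjI smooth_grad *(2,3))
qed (use assms smooth_differentiable in \<open>auto intro!: differentiable_add\<close>)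

lemma smooth_sum: "(\<And>i. i \<in> I \<Longrightarrow> smooth (f i)) \<Longrightarrow> smooth (\<lambda>x. \<Sum>i\<in>I. f i x)"
  by (induction I rule: infinite_finite_induct) (auto intro: smooth_add)

lemma grad_sum: "(\<And>i. i \<in> I \<Longrightarrow> smooth (f i)) \<Longrightarrow> grad (\<lambda>x. \<Sum>i\<in>I. f i x) x = (\<Sum>i\<in>I. grad (f i) x)"
  by (induction I rule: infinite_finite_induct) (auto simp: grad_add smooth_sum)

lemma grad_mult:
  "smooth f \<Longrightarrow> smooth g \<Longrightarrow> grad (\<lambda>x. f x * g x) x = f x *\<^sub>R grad g x + g x *\<^sub>R grad f x"
  by (rule grad_eqI) (auto intro!: derivative_eq_intros smooth_has_derivative simp: inner_add_left)

text \<open>The partial derivatives of a product are sums of products, so products alone form no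
  class closed under differentiation. The induction is therefore on the order k; it uses
  \<open>mono\<close> because the Leibniz rule contains the undifferentiated factors, which are
  given at order k + 1.\<close>

lemma smooth_mult: assumes "smooth f" "smooth g" shows "smooth (\<lambda>x. f x * g x)"
proof -
  have mono: "C_k (Suc k) \<phi> \<Longrightarrow> C_k k \<phi>" for k and \<phi> :: "real^'n \<Rightarrow> real"
  proof (induction k arbitrary: \<phi>)
    case 0 then show ?case by (simp add: differentiable_imp_continuous_on)
  next
    case (Suc k) then show ?case by (metis C_k.simps(2))
  qed
  have add: "C_k k f \<Longrightarrow> C_k k g \<Longrightarrow> C_k k (\<lambda>x. f x + g x)" for k and f g :: "real^'n \<Rightarrow> real"
  proof (induction k arbitrary: f g)
    case 0 then show ?case by (auto intro: continuous_on_add)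
  next
    case (Suc k)
    then have d: "f differentiable (at x)" "g differentiable (at x)" for x
      by (auto simp: differentiable_on_def)
    have "grad (\<lambda>x. f x + g x) x = grad f x + grad g x" for x
      by (rule grad_eqI) (auto intro!: derivative_eq_intros has_derivative_grad d simp: inner_add_left)
    with Suc show ?case by (auto intro: differentiable_on_add)
  qed
  have "C_k k f \<Longrightarrow> C_k k g \<Longrightarrow> C_k k (\<lambda>x. f x * g x)" for k and f g :: "real^'n \<Rightarrow> real"
  proof (induction k arbitrary: f g)
    case 0 then show ?case by (auto intro: continuous_on_mult)
  next
    case (Suc k)
    then have d: "f differentiable (at x)" "g differentiable (at x)" for x
      by (auto simp: differentiable_on_def)
    have "grad (\<lambda>x. f x * g x) x = f x *\<^sub>R grad g x + g x *\<^sub>R grad f x" for x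
      by (rule grad_eqI) (auto intro!: derivative_eq_intros has_derivative_grad d simp: inner_add_left)
    moreover have "C_k k (\<lambda>x. f x * grad g x $ i + g x * grad f x $ i)" for i
      using Suc mono[OF Suc.prems(1)] mono[OF Suc.prems(2)] by (auto intro!: add)
    ultimately show ?case using d by (simp add: differentiable_on_def)
  qed
  then show ?thesis using assms unfolding smooth_def by blast
qed

lemma smooth_cmult: "smooth f \<Longrightarrow> smooth (\<lambda>x. c * f x)"
  by (rule smooth_mult) auto

lemma smooth_diff: "smooth f \<Longrightarrow> smooth g \<Longrightarrow> smooth (\<lambda>x. f x - g x)"
  using smooth_add[of f "\<lambda>x. (-1) * g x"] smooth_cmult[of g "-1"] by simp

lemma grad_diff: "smooth f \<Longrightarrow> smooth g \<Longrightarrow> grad (\<lambda>x. f x - g x) x = grad f x - grad g x"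
  by (rule grad_eqI) (auto intro!: derivative_eq_intros smooth_has_derivative simp: inner_diff_left)

lemma smooth_prod: "(\<And>i. i \<in> I \<Longrightarrow> smooth (f i)) \<Longrightarrow> smooth (\<lambda>x. \<Prod>i\<in>I. f i x)"
  by (induction I rule: infinite_finite_induct) (auto intro: smooth_mult)

lemma grad_affine:
  assumes "smooth f" shows "grad (\<lambda>x. f (c *\<^sub>R x + d)) x = c *\<^sub>R grad f (c *\<^sub>R x + d)"
proof (rule grad_eqI)
  have "((\<lambda>x. c *\<^sub>R x + d) has_derivative (\<lambda>h. c *\<^sub>R h)) (at x)"
    by (auto intro!: derivative_eq_intros)
  from diff_chain_at[OF this smooth_has_derivative[OF assms]]
  show "((\<lambda>x. f (c *\<^sub>R x + d)) has_derivative (\<lambda>h. c *\<^sub>R grad f (c *\<^sub>R x + d) \<bullet> h)) (at x)"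
    by (simp add: o_def)
qed

lemma smooth_affine:
  fixes f :: "real^'n \<Rightarrow> real"
  assumes "smooth f" shows "smooth (\<lambda>x. f (c *\<^sub>R x + d))"
proof (rule smooth_coinduct[where S = "{\<lambda>x. f (c *\<^sub>R x + d) | f. smooth f}"])
  fix \<phi> :: "real^'n \<Rightarrow> real" and x
  assume "\<phi> \<in> {\<lambda>x. f (c *\<^sub>R x + d) | f. smooth f}"
  then obtain f where f: "\<phi> = (\<lambda>x. f (c *\<^sub>R x + d))" "smooth f" by auto
  have "((\<lambda>x. c *\<^sub>R x + d) has_derivative (\<lambda>h. c *\<^sub>R h)) (at x)"
    by (auto intro!: derivative_eq_intros)
  from diff_chain_at[OF this smooth_has_derivative[OF f(2)]]
  show "\<phi> differentiable (at x)" unfolding f differentiable_def by (auto simp: o_def)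
  fix i
  have "(\<lambda>x. grad \<phi> x $ i) = (\<lambda>x. (\<lambda>y. c * grad f y $ i) (c *\<^sub>R x + d))"
    by (simp add: f(1) grad_affine[OF f(2)])
  moreover have "smooth (\<lambda>y. c * grad f y $ i)"
    using f(2) by (intro smooth_cmult smooth_grad)
  ultimately show "(\<lambda>x. grad \<phi> x $ i) \<in> {\<lambda>x. f (c *\<^sub>R x + d) | f. smooth f}"
    unfolding mem_Collect_eq by (intro exI[of _ "\<lambda>y. c * grad f y $ i"] conjI)
qed (use assms in auto)

subsection \<open>Bump functions\<close>

text \<open>The functions $q(1/t)\,e^{-1/t}$, extended by $0$, form a class closed under differentiation.\<close>

definition flat :: "real poly \<Rightarrow> real \<Rightarrow> real" where
  "flat q t = (if t > 0 then poly q (1 / t) * exp (- (1 / t)) else 0)"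

lemma poly_exp_tendsto_0: "((\<lambda>s::real. poly p s * exp (- s)) \<longlongrightarrow> 0) at_top"
proof -
  have "((\<lambda>s. \<Sum>i\<le>degree p. coeff p i * (s ^ i / exp s)) \<longlongrightarrow> (\<Sum>i\<le>degree p. coeff p i * 0)) at_top"
    by (intro tendsto_intros tendsto_power_div_exp_0)
  then show ?thesis
    by (simp add: poly_altdef exp_minus divide_inverse sum_distrib_right mult.assoc)
qed

text \<open>With s = 1/t one has ds/dt = -s^2, so differentiating q(s) e^(-s) replaces q by s^2 (q -
  q'); \<open>[:0, 0, 1:]\<close> is s^2. Differentiability at 0 expresses that e^(-s) beats every
  polynomial.\<close>

lemma flat_has_derivative:
  "(flat q has_real_derivative flat ([:0, 0, 1:] * (q - pderiv q)) t) (at t)"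
proof -
  consider "t > 0" | "t < 0" | "t = 0" by linarith
  then show ?thesis
  proof cases
    case 1
    have "((\<lambda>t. poly q (1 / t) * exp (- (1 / t))) has_real_derivative
        flat ([:0, 0, 1:] * (q - pderiv q)) t) (at t)"
      using 1 by (auto intro!: derivative_eq_intros poly_DERIV[THEN DERIV_chain2]
          simp: flat_def field_simps power2_eq_square)
    then show ?thesis
    proof (rule has_field_derivative_transform_within_open[where S = "{0<..}"])
    qed (use 1 in \<open>auto simp: flat_def\<close>)
  next
    case 2
    have "((\<lambda>t. 0) has_real_derivative 0) (at t)" by simp
    then have "(flat q has_real_derivative 0) (at t)"
      by (rule has_field_derivative_transform_within_open[where S = "{..<0}"])
        (use 2 in \<open>auto simp: flat_def\<close>)
    then show ?thesis using 2 by (simp add: flat_def)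
  next
    case 3
    have "((\<lambda>h. flat q h / h) \<longlongrightarrow> 0) (at 0)"
    proof -
      have l: "((\<lambda>h. flat q h / h) \<longlongrightarrow> 0) (at_left 0)"
        by (rule tendsto_eventually) (auto simp: eventually_at_filter flat_def)
      \<comment> \<open>The difference quotient at 0 divides by h, which multiplies the polynomial
        by s = 1/h; this is \<open>pCons 0 q\<close>.\<close>
      have "((\<lambda>h. poly (pCons 0 q) (inverse h) * exp (- inverse h)) \<longlongrightarrow> 0) (at_right (0::real))"
        by (rule filterlim_compose[OF poly_exp_tendsto_0 filterlim_inverse_at_top_right])
      then have r: "((\<lambda>h. flat q h / h) \<longlongrightarrow> 0) (at_right 0)"
        by (rule Lim_transform_eventually)
          (auto simp: eventually_at_filter flat_def divide_inverse)
      from l r show "((\<lambda>h. flat q h / h) \<longlongrightarrow> 0) (at 0)"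
        by (simp add: filterlim_split_at)
    qed
    then show ?thesis using 3 by (simp add: has_field_derivative_iff flat_def)
  qed
qed

text \<open>The factor c in the class absorbs the inner derivative s, and the value 0 of the partial
  derivatives in the other directions.\<close>

lemma smooth_flat_coord: "smooth (\<lambda>x :: real^'n. flat q (s * x $ i + d))"
proof (rule smooth_coinduct[where S = "{\<lambda>x. c * flat q (s * x $ i + d) | c q. True}"])
  fix \<phi> :: "real^'n \<Rightarrow> real"
  assume "\<phi> \<in> {\<lambda>x. c * flat q (s * x $ i + d) | c q. True}"
  then obtain c q where \<phi>: "\<phi> = (\<lambda>x. c * flat q (s * x $ i + d))" by auto
  let ?r = "[:0, 0, 1:] * (q - pderiv q)"
  have d: "(\<phi> has_derivative (\<lambda>h. ((c * flat ?r (s * x $ i + d) * s) *\<^sub>R axis i 1) \<bullet> h)) (at x)" for x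
  proof -
    have "((\<lambda>x. s * x $ i + d) has_derivative (\<lambda>h. s * h $ i)) (at x)"
      by (auto intro!: derivative_eq_intros bounded_linear.has_derivative[OF bounded_linear_vec_nth])
    from diff_chain_at[OF this flat_has_derivative[of q, unfolded has_field_derivative_def]]
    have "((\<lambda>x. flat q (s * x $ i + d)) has_derivative (\<lambda>h. flat ?r (s * x $ i + d) * (s * h $ i))) (at x)"
      by (simp only: o_def)
    then have "(\<phi> has_derivative (\<lambda>h. c * (flat ?r (s * x $ i + d) * (s * h $ i)))) (at x)"
      unfolding \<phi> by (rule has_derivative_mult_right)
    then show ?thesis
      by (simp only: inner_scaleR_left inner_axis' mult.assoc) simp
  qed
  show "\<phi> differentiable (at x)" for x using d unfolding differentiable_def by blast
  fix j
  have "(\<lambda>x. grad \<phi> x $ j) = (\<lambda>x. (c * s * (if j = i then 1 else 0)) * flat ?r (s * x $ i + d))"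
    by (simp add: grad_eqI[OF d] axis_def fun_eq_iff del: mult_pCons_left)
  then show "(\<lambda>x. grad \<phi> x $ j) \<in> {\<lambda>x. c * flat q (s * x $ i + d) | c q. True}" by blast
next
  have "(\<lambda>x :: real^'n. flat q (s * x $ i + d)) = (\<lambda>x. 1 * flat q (s * x $ i + d))" by simp
  then show "(\<lambda>x :: real^'n. flat q (s * x $ i + d)) \<in> {\<lambda>x. c * flat q (s * x $ i + d) | c q. True}" by blast
qed

text \<open>The parameter m steepens the profile without moving the support: exp(-1/(m t)) tends to
  1 for every t > 0, so that the bumps tend to the indicator of the open box as m grows.\<close>

definition bump :: "real \<Rightarrow> real^'n \<Rightarrow> real^'n \<Rightarrow> real^'n \<Rightarrow> real" where
  "bump m a b x = (\<Prod>i\<in>UNIV. flat 1 (m * (x $ i - a $ i)) * flat 1 (m * (b $ i - x $ i)))"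

lemma flat_1_bounds: "0 \<le> flat 1 t" "flat 1 t \<le> 1"
  by (auto simp: flat_def)

lemma bump_nonneg: "0 \<le> bump m a b x" and bump_le_1: "bump m a b x \<le> 1"
  unfolding bump_def by (auto intro!: prod_nonneg prod_le_1 mult_nonneg_nonneg mult_le_one simp: flat_1_bounds)

lemma bump_pos: "m > 0 \<Longrightarrow> x \<in> box a b \<Longrightarrow> 0 < bump m a b x"
  unfolding bump_def by (auto intro!: prod_pos mult_pos_pos simp: flat_def mem_box_cart)

lemma bump_eq_0:
  assumes "m > 0" "x \<notin> box a b" shows "bump m a b x = 0"
proof -
  from assms(2) obtain i where "x $ i \<le> a $ i \<or> b $ i \<le> x $ i"
    by (auto simp: mem_box_cart not_less)
  then have "flat 1 (m * (x $ i - a $ i)) * flat 1 (m * (b $ i - x $ i)) = 0"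
    using assms(1) by (auto simp: flat_def zero_less_mult_iff)
  then show ?thesis unfolding bump_def by (intro prod_zero) auto
qed

lemma bump_tendsto:
  fixes a b x :: "real^'n"
  shows "(\<lambda>m. bump (real (Suc m)) a b x) \<longlonglongrightarrow> indicator (box a b) x"
proof (cases "x \<in> box a b")
  case True
  have l: "(\<lambda>m. flat 1 (real (Suc m) * t)) \<longlonglongrightarrow> 1" if "t > 0" for t
  proof -
    have "(\<lambda>m. exp (- (inverse (real (Suc m)) * (1 / t)))) \<longlonglongrightarrow> exp (- (0 * (1 / t)))"
      by (intro tendsto_intros LIMSEQ_inverse_real_of_nat)
    moreover have "flat 1 (real (Suc m) * t) = exp (- (inverse (real (Suc m)) * (1 / t)))" for m
      using that by (simp add: flat_def divide_inverse del: of_nat_Suc)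
    ultimately show ?thesis by simp
  qed
  have "(\<lambda>m. bump (real (Suc m)) a b x) \<longlonglongrightarrow> (\<Prod>i\<in>(UNIV :: 'n set). 1 * 1)"
    unfolding bump_def
    by (rule tendsto_prod, rule tendsto_mult; rule l; use True in \<open>simp add: mem_box_cart\<close>)
  with True show ?thesis by simp
qed (simp add: bump_eq_0)

lemma smooth_bump: "smooth (bump m a b)"
proof -
  have "smooth (\<lambda>x. \<Prod>i\<in>UNIV. flat 1 (m * x $ i + (- m * a $ i)) * flat 1 ((-m) * x $ i + m * b $ i))"
    by (intro smooth_prod smooth_mult smooth_flat_coord)
  then show ?thesis by (simp add: bump_def[abs_def] algebra_simps)
qed

subsection \<open>Test functions\<close>

lemma test_functionsI:
  assumes "smooth \<phi>" "compact K" "K \<subseteq> S" "\<And>x. x \<notin> K \<Longrightarrow> \<phi> x = 0"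
  shows "\<phi> \<in> test_functions S"
proof -
  have "closure {x. \<phi> x \<noteq> 0} \<subseteq> K"
    using assms by (intro closure_minimal) (auto simp: compact_imp_closed)
  moreover have "compact (closure {x. \<phi> x \<noteq> 0})"
    using calculation assms(2) by (meson closed_closure compact_Int_closed compact_closure bounded_subset compact_imp_bounded closure_subset)
  ultimately show ?thesis using assms by (auto simp: test_functions_def smooth_def)
qed

lemma test_functionsE:
  assumes "\<phi> \<in> test_functions S"
  obtains K where "smooth \<phi>" "compact K" "K \<subseteq> S" "\<And>x. x \<notin> K \<Longrightarrow> \<phi> x = 0"
    "\<And>x. x \<notin> K \<Longrightarrow> grad \<phi> x = 0"
proof
  let ?K = "closure {x. \<phi> x \<noteq> 0}"
  show "smooth \<phi>" "compact ?K" "?K \<subseteq> S"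
    using assms by (auto simp: test_functions_def smooth_def)
  show z: "\<phi> x = 0" if "x \<notin> ?K" for x
    using that closure_subset[of "{x. \<phi> x \<noteq> 0}"] by auto
  show "grad \<phi> x = 0" if "x \<notin> ?K" for x
  proof (rule grad_eqI)
    have "((\<lambda>x. 0) has_derivative (\<lambda>h. 0 \<bullet> h)) (at x)" by simp
    then show "(\<phi> has_derivative (\<lambda>h. 0 \<bullet> h)) (at x)"
      by (rule has_derivative_transform_within_open[where s = "- ?K"])
        (use that in \<open>blast intro: open_Compl closed_closure z[symmetric]\<close>)+
  qed
qed

lemma test_functions_smooth: "\<phi> \<in> test_functions S \<Longrightarrow> smooth \<phi>"
  by (auto simp: test_functions_def smooth_def)

lemma test_functions_mono: "S \<subseteq> T \<Longrightarrow> \<phi> \<in> test_functions S \<Longrightarrow> \<phi> \<in> test_functions T"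
  by (auto simp: test_functions_def)

lemma test_functions_UNIV: "\<phi> \<in> test_functions S \<Longrightarrow> \<phi> \<in> test_functions UNIV"
  by (rule test_functions_mono[of S]) auto

lemma test_functions_mult:
  assumes "smooth f" "g \<in> test_functions S" shows "(\<lambda>x. f x * g x) \<in> test_functions S"
  using assms(2) by (elim test_functionsE) (auto intro!: test_functionsI smooth_mult assms(1))

lemma test_functions_add:
  assumes "f \<in> test_functions S" "g \<in> test_functions S" shows "(\<lambda>x. f x + g x) \<in> test_functions S"
proof -
  obtain K L where "smooth f" "smooth g" "compact K" "K \<subseteq> S" "compact L" "L \<subseteq> S"
    "\<And>x. x \<notin> K \<Longrightarrow> f x = 0" "\<And>x. x \<notin> L \<Longrightarrow> g x = 0"
    using test_functionsE[OF assms(1)] test_functionsE[OF assms(2)] by metis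
  then show ?thesis by (intro test_functionsI[where K = "K \<union> L"]) (auto intro: smooth_add)
qed

lemma test_functions_zero [simp]: "(\<lambda>x. 0) \<in> test_functions S"
  by (rule test_functionsI[where K = "{}"]) auto

lemma test_functions_cmult: "f \<in> test_functions S \<Longrightarrow> (\<lambda>x. c * f x) \<in> test_functions S"
  by (rule test_functions_mult) auto

lemma test_functions_sum:
  "(\<And>i. i \<in> I \<Longrightarrow> f i \<in> test_functions S) \<Longrightarrow> (\<lambda>x. \<Sum>i\<in>I. f i x) \<in> test_functions S"
  by (induction I rule: infinite_finite_induct) (auto intro: test_functions_add)

lemma test_functions_grad:
  assumes "f \<in> test_functions S" shows "(\<lambda>x. grad f x $ i) \<in> test_functions S"
  using assms by (elim test_functionsE) (auto intro!: test_functionsI smooth_grad)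

lemma test_functions_affine:
  assumes "f \<in> test_functions UNIV" "c \<noteq> 0"
  shows "(\<lambda>x. f (c *\<^sub>R x + d)) \<in> test_functions UNIV"
proof -
  obtain K where K: "smooth f" "compact K" "\<And>x. x \<notin> K \<Longrightarrow> f x = 0"
    using test_functionsE[OF assms(1)] by metis
  show ?thesis
  proof (rule test_functionsI)
    show "smooth (\<lambda>x. f (c *\<^sub>R x + d))" using K by (intro smooth_affine)
    show "compact ((\<lambda>x. (1 / c) *\<^sub>R (x - d)) ` K)"
      using K by (intro compact_continuous_image continuous_intros)
    show "f (c *\<^sub>R x + d) = 0" if "x \<notin> (\<lambda>x. (1 / c) *\<^sub>R (x - d)) ` K" for x
    proof (rule K, rule notI)
      assume "c *\<^sub>R x + d \<in> K"
      then have "(1 / c) *\<^sub>R ((c *\<^sub>R x + d) - d) \<in> (\<lambda>x. (1 / c) *\<^sub>R (x - d)) ` K" by blast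
      with that assms(2) show False by simp
    qed
  qed auto
qed

lemma bump_test_function: "m > 0 \<Longrightarrow> cbox a b \<subseteq> S \<Longrightarrow> bump m a b \<in> test_functions S"
  by (rule test_functionsI[where K = "cbox a b"])
    (use box_subset_cbox in \<open>auto simp: smooth_bump intro!: bump_eq_0\<close>)

lemma test_functions_bounded:
  fixes f :: "real^'n \<Rightarrow> real"
  assumes "f \<in> test_functions S"
  obtains B where "B > 0" "\<And>x. \<bar>f x\<bar> \<le> B" "\<And>x. norm (grad f x) \<le> B"
    "\<And>x y. \<bar>f x - f y\<bar> \<le> B * norm (x - y)"
proof -
  obtain K where K: "smooth f" "compact K" "\<And>x. x \<notin> K \<Longrightarrow> f x = 0" "\<And>x. x \<notin> K \<Longrightarrow> grad f x = 0"
    using test_functionsE[OF assms] by metis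
  have "bounded (f ` K)" "bounded (grad f ` K)"
    using K by (auto intro!: compact_imp_bounded compact_continuous_image smooth_continuous_on
        smooth_grad_continuous_on)
  then obtain B1 B2 where B: "\<And>x. x \<in> K \<Longrightarrow> \<bar>f x\<bar> \<le> B1" "\<And>x. x \<in> K \<Longrightarrow> norm (grad f x) \<le> B2"
    unfolding bounded_iff by auto
  define B where "B = max 1 (max B1 B2)"
  show thesis
  proof
    show "B > 0" by (simp add: B_def)
    show "\<bar>f x\<bar> \<le> B" for x using K(3)[of x] B(1)[of x] by (cases "x \<in> K") (auto simp: B_def)
    show g: "norm (grad f x) \<le> B" for x using K(4)[of x] B(2)[of x] by (cases "x \<in> K") (auto simp: B_def)
    show "\<bar>f x - f y\<bar> \<le> B * norm (x - y)" for x y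
      unfolding real_norm_def[symmetric]
    proof (rule differentiable_bound[where S = UNIV])
      show "(f has_derivative (\<lambda>h. grad f x \<bullet> h)) (at x within UNIV)" for x
        using smooth_has_derivative[OF K(1)] by simp
      show "onorm (\<lambda>h. grad f x \<bullet> h) \<le> B" for x
      proof (rule onorm_bound)
        show "0 \<le> B" by (simp add: B_def)
        show "norm (grad f x \<bullet> h) \<le> B * norm h" for h
          by (metis Cauchy_Schwarz_ineq2 g mult_right_mono norm_ge_zero order_trans real_norm_def)
      qed
    qed auto
  qed
qed

lemma test_functions_grad_lipschitz:
  fixes f :: "real^'n \<Rightarrow> real"
  assumes "f \<in> test_functions S"
  obtains B where "B > 0" "\<And>x y. norm (grad f x - grad f y) \<le> B * norm (x - y)"
proof -
  have "\<exists>B>0. \<forall>x y. \<bar>grad f x $ i - grad f y $ i\<bar> \<le> B * norm (x - y)" for i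
    using test_functions_bounded[OF test_functions_grad[OF assms, of i]] by metis
  then obtain B where B: "\<And>i. B i > 0" "\<And>i x y. \<bar>grad f x $ i - grad f y $ i\<bar> \<le> B i * norm (x - y)"
    by metis
  show thesis
  proof
    show "(\<Sum>i\<in>UNIV. B i) > 0" using B by (intro sum_pos) auto
    show "norm (grad f x - grad f y) \<le> (\<Sum>i\<in>UNIV. B i) * norm (x - y)" for x y
      unfolding sum_distrib_right
      by (rule order_trans[OF norm_le_l1_cart sum_mono]) (simp add: B(2))
  qed
qed

subsection \<open>Lebesgue measure on real vectors\<close>

lemma vec_borel_measurableD:
  fixes f :: "'a \<Rightarrow> real^'n"
  assumes "f \<in> borel_measurable M" shows "(\<lambda>x. f x $ i) \<in> borel_measurable M"
proof -
  have "(\<lambda>x. f x \<bullet> axis i 1) \<in> borel_measurable M" using assms by measurable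
  then show ?thesis by (simp add: inner_axis)
qed

lemma AE_lebesgue_on_iff:
  "S \<in> sets lebesgue \<Longrightarrow> (AE x in lebesgue_on S. P x) \<longleftrightarrow> (AE x in lebesgue. x \<in> S \<longrightarrow> P x)"
  by (simp add: AE_restrict_space_iff)

lemma AE_lebesgue_onI: "S \<in> sets lebesgue \<Longrightarrow> (AE x in lebesgue. P x) \<Longrightarrow> AE x in lebesgue_on S. P x"
  by (auto simp: AE_lebesgue_on_iff)

lemma AE_lebesgue_on_subset:
  "S \<subseteq> T \<Longrightarrow> S \<in> sets lebesgue \<Longrightarrow> T \<in> sets lebesgue \<Longrightarrow> (AE x in lebesgue_on T. P x) \<Longrightarrow> (AE x in lebesgue_on S. P x)"
  by (auto simp: AE_lebesgue_on_iff elim!: eventually_mono)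

lemma AE_in_lebesgue_on: "S \<in> sets lebesgue \<Longrightarrow> AE x in lebesgue_on S. x \<in> S"
  by (simp add: AE_lebesgue_on_iff)

lemma borel_measurable_lebesgue_on_AE:
  fixes f g :: "'a::euclidean_space \<Rightarrow> 'b::euclidean_space"
  assumes "f \<in> borel_measurable (lebesgue_on S)" "S \<in> sets lebesgue" "AE x in lebesgue_on S. f x = g x"
  shows "g \<in> borel_measurable (lebesgue_on S)"
proof (rule borel_measurable_if_D, rule borel_measurable_AE)
  show "(\<lambda>x. if x \<in> S then f x else 0) \<in> borel_measurable lebesgue"
    using assms by (intro borel_measurable_if_I)
  show "AE x in lebesgue. (if x \<in> S then f x else 0) = (if x \<in> S then g x else 0)"
    using assms(3) unfolding AE_lebesgue_on_iff[OF assms(2)] by eventually_elim auto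
qed

lemma borel_measurable_lebesgue_on_subset:
  "S \<subseteq> T \<Longrightarrow> f \<in> borel_measurable (lebesgue_on T) \<Longrightarrow> f \<in> borel_measurable (lebesgue_on S)"
  by (rule measurable_restrict_mono)

lemma integral_lebesgue_on_indicator:
  fixes f :: "'a::euclidean_space \<Rightarrow> 'b::{banach, second_countable_topology}"
  assumes "S \<in> sets lebesgue"
  shows "(LINT x|lebesgue_on S. f x) = (LINT x|lebesgue. indicator S x *\<^sub>R f x)"
  using assms by (subst integral_restrict_space) auto

lemma integrable_lebesgue_on_indicator:
  fixes f :: "'a::euclidean_space \<Rightarrow> 'b::{banach, second_countable_topology}"
  assumes "S \<in> sets lebesgue"
  shows "integrable (lebesgue_on S) f \<longleftrightarrow> integrable lebesgue (\<lambda>x. indicator S x *\<^sub>R f x)"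
  using assms by (subst integrable_restrict_space) auto

lemma integrable_lebesgue_on_subset:
  fixes f :: "'a::euclidean_space \<Rightarrow> 'b::{banach, second_countable_topology}"
  assumes "S \<subseteq> T" "S \<in> sets lebesgue" "T \<in> sets lebesgue" "integrable (lebesgue_on T) f"
  shows "integrable (lebesgue_on S) f"
proof -
  have "integrable lebesgue (\<lambda>x. indicator S x *\<^sub>R (indicator T x *\<^sub>R f x))"
    using integrable_mult_indicator[OF assms(2), of "\<lambda>x. indicator T x *\<^sub>R f x"] assms(3,4)
    by (simp only: integrable_lebesgue_on_indicator)
  moreover have "(\<lambda>x. indicator S x *\<^sub>R (indicator T x *\<^sub>R f x)) = (\<lambda>x. indicator S x *\<^sub>R f x)"
    using assms(1) by (auto simp: fun_eq_iff indicator_def)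
  ultimately show ?thesis using assms by (simp add: integrable_lebesgue_on_indicator)
qed

lemma integral_lebesgue_on_support:
  fixes f :: "'a::euclidean_space \<Rightarrow> 'b::{banach, second_countable_topology}"
  assumes "S \<subseteq> T" "S \<in> sets lebesgue" "T \<in> sets lebesgue" "\<And>x. x \<in> T \<Longrightarrow> x \<notin> S \<Longrightarrow> f x = 0"
  shows "(LINT x|lebesgue_on S. f x) = (LINT x|lebesgue_on T. f x)"
    "integrable (lebesgue_on S) f \<longleftrightarrow> integrable (lebesgue_on T) f"
proof -
  have "(\<lambda>x. indicator S x *\<^sub>R f x) = (\<lambda>x. indicator T x *\<^sub>R f x)"
    using assms(1,4) by (auto simp: fun_eq_iff indicator_def)
  then show "(LINT x|lebesgue_on S. f x) = (LINT x|lebesgue_on T. f x)"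
    "integrable (lebesgue_on S) f \<longleftrightarrow> integrable (lebesgue_on T) f"
    using assms(2,3) by (simp_all add: integral_lebesgue_on_indicator integrable_lebesgue_on_indicator)
qed

lemma integral_lebesgue_on_le:
  fixes f :: "'a::euclidean_space \<Rightarrow> real"
  assumes "S \<subseteq> T" "S \<in> sets lebesgue" "T \<in> sets lebesgue" "integrable (lebesgue_on T) f"
    and "\<And>x. 0 \<le> f x"
  shows "(LINT x|lebesgue_on S. f x) \<le> (LINT x|lebesgue_on T. f x)"
  using assms by (intro integral_mono_lebesgue_on_AE) auto

section \<open>Affine changes of variables\<close>

lemma
  fixes d :: "real^'n"
  assumes "\<epsilon> \<noteq> 0"
  shows measurable_affine: "(\<lambda>x. \<epsilon> *\<^sub>R x + d) \<in> lebesgue \<rightarrow>\<^sub>M lebesgue"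
    and lebesgue_affine:
      "lebesgue = density (distr lebesgue lebesgue (\<lambda>x. \<epsilon> *\<^sub>R x + d)) (\<lambda>_. ennreal (\<bar>\<epsilon>\<bar> ^ CARD('n)))"
proof -
  have "(\<lambda>x. d + (\<Sum>j\<in>Basis. (\<epsilon> * (x \<bullet> j)) *\<^sub>R j)) = (\<lambda>x. \<epsilon> *\<^sub>R x + d)"
    unfolding scaleR_scaleR[symmetric] scaleR_sum_right[symmetric] euclidean_representation by auto
  then show "(\<lambda>x. \<epsilon> *\<^sub>R x + d) \<in> lebesgue \<rightarrow>\<^sub>M lebesgue"
      "lebesgue = density (distr lebesgue lebesgue (\<lambda>x. \<epsilon> *\<^sub>R x + d)) (\<lambda>_. ennreal (\<bar>\<epsilon>\<bar> ^ CARD('n)))"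
    using lebesgue_affine_euclidean[of "\<lambda>_. \<epsilon>" d] lebesgue_affine_measurable[of "\<lambda>_. \<epsilon>" d] assms
    by (simp_all add: prod_constant)
qed

lemma integrable_affineI:
  fixes f :: "real^'n \<Rightarrow> 'b::{banach, second_countable_topology}"
  assumes "\<epsilon> \<noteq> 0" "integrable lebesgue f"
  shows "integrable lebesgue (\<lambda>x. f (\<epsilon> *\<^sub>R x + d))"
    and "(LINT x|lebesgue. f x) = \<bar>\<epsilon>\<bar> ^ CARD('n) *\<^sub>R (LINT x|lebesgue. f (\<epsilon> *\<^sub>R x + d))"
proof -
  let ?T = "\<lambda>x. \<epsilon> *\<^sub>R x + d :: real^'n"
  have T [measurable]: "?T \<in> lebesgue \<rightarrow>\<^sub>M lebesgue" using assms(1) by (rule measurable_affine)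
  have f [measurable]: "f \<in> borel_measurable lebesgue" using assms(2) by auto
  have "integrable (density (distr lebesgue lebesgue ?T) (\<lambda>_. ennreal (\<bar>\<epsilon>\<bar> ^ CARD('n)))) f"
    using assms(2) by (subst lebesgue_affine[OF assms(1), of d, symmetric])
  then have "integrable lebesgue (\<lambda>x. \<bar>\<epsilon>\<bar> ^ CARD('n) *\<^sub>R f (?T x))"
    by (simp add: integrable_density integrable_distr_eq)
  from integrable_scaleR_right[OF this, of "1 / \<bar>\<epsilon>\<bar> ^ CARD('n)"]
  show "integrable lebesgue (\<lambda>x. f (?T x))" using assms(1) by simp
  show "(LINT x|lebesgue. f x) = \<bar>\<epsilon>\<bar> ^ CARD('n) *\<^sub>R (LINT x|lebesgue. f (?T x))"
    by (subst lebesgue_affine[OF assms(1), of d]) (simp add: integral_density integral_distr)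
qed

lemma integrable_affine_iff:
  fixes f :: "real^'n \<Rightarrow> 'b::{banach, second_countable_topology}"
  assumes "\<epsilon> \<noteq> 0"
  shows "integrable lebesgue (\<lambda>x. f (\<epsilon> *\<^sub>R x + d)) \<longleftrightarrow> integrable lebesgue f"
  using integrable_affineI(1)[of "1 / \<epsilon>" "\<lambda>x. f (\<epsilon> *\<^sub>R x + d)" "- ((1 / \<epsilon>) *\<^sub>R d)"]
    integrable_affineI(1)[OF assms, of f d] assms
  by (auto simp: scaleR_add_right scaleR_diff_right)

text \<open>Integrability is invariant under the substitution, and a function that is not integrable
  has Bochner integral 0, so both sides vanish in that case.\<close>

lemma integral_affine:
  fixes f :: "real^'n \<Rightarrow> 'b::{banach, second_countable_topology}"
  assumes "\<epsilon> \<noteq> 0"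
  shows "(LINT x|lebesgue. f x) = \<bar>\<epsilon>\<bar> ^ CARD('n) *\<^sub>R (LINT x|lebesgue. f (\<epsilon> *\<^sub>R x + d))"
  using integrable_affineI(2)[OF assms, of f d] integrable_affine_iff[OF assms, of f d]
  by (cases "integrable lebesgue f") (auto simp: not_integrable_integral_eq)

lemma AE_affine:
  fixes d :: "real^'n"
  assumes "\<epsilon> \<noteq> 0" "AE x in lebesgue. P x" shows "AE x in lebesgue. P (\<epsilon> *\<^sub>R x + d)"
proof -
  have "AE x in density (distr lebesgue lebesgue (\<lambda>x. \<epsilon> *\<^sub>R x + d)) (\<lambda>_. ennreal (\<bar>\<epsilon>\<bar> ^ CARD('n))). P x"
    using assms(2) by (subst lebesgue_affine[OF assms(1), of d, symmetric])
  then have "AE x in distr lebesgue lebesgue (\<lambda>x. \<epsilon> *\<^sub>R x + d). P x"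
    using assms(1) by (subst (asm) AE_density) auto
  then show ?thesis by (rule AE_distrD[OF measurable_affine[OF assms(1)]])
qed

lemma sets_affine_image:
  fixes S :: "(real^'n) set"
  assumes "\<epsilon> \<noteq> 0" "S \<in> sets lebesgue"
  shows "(\<lambda>x. \<epsilon> *\<^sub>R x + d) ` S \<in> sets lebesgue"
proof -
  have "(\<lambda>x. \<epsilon> *\<^sub>R x + d) ` S = (\<lambda>x. (1 / \<epsilon>) *\<^sub>R x + (- ((1 / \<epsilon>) *\<^sub>R d))) -` S \<inter> space lebesgue"
    using assms(1) by (force simp: image_iff algebra_simps intro!: bexI)
  then show ?thesis
    using measurable_sets[OF measurable_affine assms(2), of "1 / \<epsilon>" "- ((1 / \<epsilon>) *\<^sub>R d)"] assms(1) by simp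
qed

lemma indicator_affine_image:
  fixes S :: "(real^'n) set"
  assumes "\<epsilon> \<noteq> 0"
  shows "indicator ((\<lambda>x. \<epsilon> *\<^sub>R x + d) ` S) (\<epsilon> *\<^sub>R y + d) = indicator S y"
  using assms by (auto simp: indicator_def)

lemma
  fixes f :: "real^'n \<Rightarrow> 'b::{banach, second_countable_topology}"
  assumes "\<epsilon> \<noteq> 0" "S \<in> sets lebesgue"
  shows integral_affine_image: "(LINT x|lebesgue_on ((\<lambda>x. \<epsilon> *\<^sub>R x + d) ` S). f x)
      = \<bar>\<epsilon>\<bar> ^ CARD('n) *\<^sub>R (LINT x|lebesgue_on S. f (\<epsilon> *\<^sub>R x + d))"
    and integrable_affine_image: "integrable (lebesgue_on ((\<lambda>x. \<epsilon> *\<^sub>R x + d) ` S)) f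
      \<longleftrightarrow> integrable (lebesgue_on S) (\<lambda>x. f (\<epsilon> *\<^sub>R x + d))"
  using assms sets_affine_image[OF assms, of d]
    integral_affine[OF assms(1), of "\<lambda>x. indicator ((\<lambda>x. \<epsilon> *\<^sub>R x + d) ` S) x *\<^sub>R f x" d]
    integrable_affine_iff[OF assms(1), of "\<lambda>x. indicator ((\<lambda>x. \<epsilon> *\<^sub>R x + d) ` S) x *\<^sub>R f x" d]
  by (simp_all add: integral_lebesgue_on_indicator integrable_lebesgue_on_indicator indicator_affine_image)

lemma borel_measurable_affine_image:
  fixes f :: "real^'n \<Rightarrow> 'b::euclidean_space"
  assumes "\<epsilon> \<noteq> 0" "S \<in> sets lebesgue" "(\<lambda>x. f (\<epsilon> *\<^sub>R x + d)) \<in> borel_measurable (lebesgue_on S)"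
  shows "f \<in> borel_measurable (lebesgue_on ((\<lambda>x. \<epsilon> *\<^sub>R x + d) ` S))"
proof (rule borel_measurable_if_D)
  let ?T = "\<lambda>x. \<epsilon> *\<^sub>R x + d" and ?U = "\<lambda>x. (1 / \<epsilon>) *\<^sub>R x + (- ((1 / \<epsilon>) *\<^sub>R d))"
  have TU: "?T (?U x) = x" "?U (?T x) = x" for x using assms(1) by (auto simp: algebra_simps)
  have "(\<lambda>x. if x \<in> S then f (?T x) else 0) \<in> borel_measurable lebesgue"
    using assms by (intro borel_measurable_if_I)
  from measurable_compose[OF measurable_affine this, of "1 / \<epsilon>" "- ((1 / \<epsilon>) *\<^sub>R d)"]
  have "(\<lambda>x. if ?U x \<in> S then f (?T (?U x)) else 0) \<in> borel_measurable lebesgue" using assms(1) by simp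
  moreover have "(?U x \<in> S) = (x \<in> ?T ` S)" for x
    using TU by (metis (no_types, lifting) image_iff)
  ultimately show "(\<lambda>x. if x \<in> ?T ` S then f x else 0) \<in> borel_measurable lebesgue"
    unfolding TU by simp
qed

subsection \<open>Square-integrable functions\<close>

text \<open>The squared norm is the main working quantity because it is additive over disjoint sets,
  so that estimates can be made cell by cell. The norm itself serves for Cauchy-Schwarz and the
  triangle inequality.\<close>

abbreviation sqn :: "(real^'n) set \<Rightarrow> (real^'n \<Rightarrow> 'b::euclidean_space) \<Rightarrow> real" where
  "sqn S g \<equiv> (LINT x|lebesgue_on S. (norm (g x))\<^sup>2)"

lemma sqn_nonneg: "0 \<le> sqn S g"
  by simp

lemma L2_norm_power2: "(L2_norm S g)\<^sup>2 = sqn S g"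
  by (simp add: L2_norm_def)

lemma L2_norm_nonneg: "0 \<le> L2_norm S g"
  by (simp add: L2_norm_def)

lemma norm_add_power2_le: "(norm (a + b))\<^sup>2 \<le> 2 * (norm a)\<^sup>2 + 2 * (norm b)\<^sup>2"
  for a b :: "'a::real_normed_vector"
proof -
  have "(norm (a + b))\<^sup>2 \<le> (norm a + norm b)\<^sup>2" by (simp add: norm_triangle_ineq power_mono)
  also have "\<dots> \<le> 2 * (norm a)\<^sup>2 + 2 * (norm b)\<^sup>2"
    using sum_squares_bound[of "norm a" "norm b"] by (simp add: power2_sum)
  finally show ?thesis .
qed

lemma L2_measurable: "g \<in> L2 S \<Longrightarrow> g \<in> borel_measurable (lebesgue_on S)"
  and L2_integrable_sq: "g \<in> L2 S \<Longrightarrow> integrable (lebesgue_on S) (\<lambda>x. (norm (g x))\<^sup>2)"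
  by (auto simp: L2_def)

lemma
  fixes f :: "real^'n \<Rightarrow> 'b::euclidean_space" and g :: "real^'n \<Rightarrow> 'c::euclidean_space"
  assumes "f \<in> borel_measurable (lebesgue_on S)" "g \<in> L2 S"
    and "AE x in lebesgue_on S. norm (f x) \<le> C * norm (g x)"
  shows L2_bound: "f \<in> L2 S" and sqn_bound: "sqn S f \<le> C\<^sup>2 * sqn S g"
proof -
  have *: "AE x in lebesgue_on S. (norm (f x))\<^sup>2 \<le> C\<^sup>2 * (norm (g x))\<^sup>2"
    using assms(3) by eventually_elim (metis norm_ge_zero power_mono power_mult_distrib)
  have i: "integrable (lebesgue_on S) (\<lambda>x. C\<^sup>2 * (norm (g x))\<^sup>2)"
    using assms(2) by (simp add: L2_integrable_sq)
  have "integrable (lebesgue_on S) (\<lambda>x. (norm (f x))\<^sup>2)"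
    by (rule Bochner_Integration.integrable_bound[OF i]) (use assms(1) * in auto)
  then show "f \<in> L2 S" using assms(1) by (simp add: L2_def)
  have "sqn S f \<le> (LINT x|lebesgue_on S. C\<^sup>2 * (norm (g x))\<^sup>2)"
    by (rule integral_mono_AE) (use * i \<open>integrable (lebesgue_on S) (\<lambda>x. (norm (f x))\<^sup>2)\<close> in auto)
  then show "sqn S f \<le> C\<^sup>2 * sqn S g" by simp
qed

lemma L2_cong_AE:
  assumes "f \<in> L2 S" "S \<in> sets lebesgue" "AE x in lebesgue_on S. f x = g x"
  shows "g \<in> L2 S"
proof (rule L2_bound)
  show "g \<in> borel_measurable (lebesgue_on S)"
    by (rule borel_measurable_lebesgue_on_AE[OF L2_measurable[OF assms(1)] assms(2,3)])
  show "AE x in lebesgue_on S. norm (g x) \<le> 1 * norm (f x)" using assms(3) by eventually_elim simp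
qed (rule assms(1))

lemma sqn_cong_AE:
  assumes "f \<in> L2 S" "S \<in> sets lebesgue" "AE x in lebesgue_on S. f x = g x"
  shows "sqn S f = sqn S g"
proof (rule integral_cong_AE)
  show "(\<lambda>x. (norm (f x))\<^sup>2) \<in> borel_measurable (lebesgue_on S)"
    using L2_integrable_sq[OF assms(1)] by auto
  show "(\<lambda>x. (norm (g x))\<^sup>2) \<in> borel_measurable (lebesgue_on S)"
    using L2_integrable_sq[OF L2_cong_AE[OF assms]] by auto
  show "AE x in lebesgue_on S. (norm (f x))\<^sup>2 = (norm (g x))\<^sup>2"
    using assms(3) by eventually_elim simp
qed

lemma L2_cong:
  assumes "f \<in> L2 S" "\<And>x. x \<in> S \<Longrightarrow> f x = g x"
  shows "g \<in> L2 S"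
proof (rule L2_bound)
  show "g \<in> borel_measurable (lebesgue_on S)"
    using assms measurable_lebesgue_cong[of S f g borel] L2_measurable by blast
  show "AE x in lebesgue_on S. norm (g x) \<le> 1 * norm (f x)" using assms(2) by (intro AE_I2) auto
qed (rule assms(1))

lemma L2_add:
  assumes "f \<in> L2 S" "g \<in> L2 S"
  shows "(\<lambda>x. f x + g x) \<in> L2 S" and sqn_add_le: "sqn S (\<lambda>x. f x + g x) \<le> 2 * sqn S f + 2 * sqn S g"
proof -
  have [measurable]: "f \<in> borel_measurable (lebesgue_on S)" "g \<in> borel_measurable (lebesgue_on S)"
    using assms by (auto simp: L2_measurable)
  have i: "integrable (lebesgue_on S) (\<lambda>x. 2 * (norm (f x))\<^sup>2 + 2 * (norm (g x))\<^sup>2)"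
    using assms by (simp add: L2_integrable_sq)
  have j: "integrable (lebesgue_on S) (\<lambda>x. (norm (f x + g x))\<^sup>2)"
    by (rule Bochner_Integration.integrable_bound[OF i]) (auto simp: norm_add_power2_le)
  then show "(\<lambda>x. f x + g x) \<in> L2 S" by (simp add: L2_def)
  have "sqn S (\<lambda>x. f x + g x) \<le> (LINT x|lebesgue_on S. 2 * (norm (f x))\<^sup>2 + 2 * (norm (g x))\<^sup>2)"
    by (rule integral_mono[OF j i]) (rule norm_add_power2_le)
  also have "\<dots> = 2 * sqn S f + 2 * sqn S g"
    using assms by (simp add: L2_integrable_sq)
  finally show "sqn S (\<lambda>x. f x + g x) \<le> 2 * sqn S f + 2 * sqn S g" .
qed

lemma L2_zero [simp]: "(\<lambda>x. 0) \<in> L2 S"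
  by (simp add: L2_def)

lemma L2_scaleR: "f \<in> L2 S \<Longrightarrow> (\<lambda>x. c *\<^sub>R f x) \<in> L2 S"
  unfolding L2_def by (auto simp: power_mult_distrib intro!: borel_measurable_scaleR)

lemma sqn_scaleR: "sqn S (\<lambda>x. c *\<^sub>R f x) = c\<^sup>2 * sqn S f"
  by (simp add: power_mult_distrib)

lemma L2_minus: "f \<in> L2 S \<Longrightarrow> (\<lambda>x. - f x) \<in> L2 S"
  using L2_scaleR[of f S "-1"] by simp

lemma L2_diff: "f \<in> L2 S \<Longrightarrow> g \<in> L2 S \<Longrightarrow> (\<lambda>x. f x - g x) \<in> L2 S"
  using L2_add(1)[of f S "\<lambda>x. - g x"] L2_minus[of g S] by simp

lemma sqn_diff_le:
  "f \<in> L2 S \<Longrightarrow> g \<in> L2 S \<Longrightarrow> sqn S (\<lambda>x. f x - g x) \<le> 2 * sqn S f + 2 * sqn S g"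
  using sqn_add_le[of f S "\<lambda>x. - g x"] L2_minus[of g S] by simp

lemma L2_sum: "(\<And>i. i \<in> I \<Longrightarrow> f i \<in> L2 S) \<Longrightarrow> (\<lambda>x. \<Sum>i\<in>I. f i x) \<in> L2 S"
  by (induction I rule: infinite_finite_induct) (auto intro: L2_add)

lemma L2_subset:
  assumes "f \<in> L2 T" "S \<subseteq> T" "S \<in> sets lebesgue" "T \<in> sets lebesgue"
  shows "f \<in> L2 S"
  using assms by (auto simp: L2_def intro: borel_measurable_lebesgue_on_subset integrable_lebesgue_on_subset)

lemma sqn_subset_le:
  assumes "f \<in> L2 T" "S \<subseteq> T" "S \<in> sets lebesgue" "T \<in> sets lebesgue"
  shows "sqn S f \<le> sqn T f"
  using assms by (intro integral_lebesgue_on_le) (auto simp: L2_integrable_sq)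

lemma L2_scaleR_bounded:
  fixes f :: "real^'n \<Rightarrow> 'b::euclidean_space"
  assumes "f \<in> L2 S" "\<eta> \<in> borel_measurable (lebesgue_on S)" "\<And>x. x \<in> S \<Longrightarrow> \<bar>\<eta> x\<bar> \<le> C"
  shows "(\<lambda>x. \<eta> x *\<^sub>R f x) \<in> L2 S" and "sqn S (\<lambda>x. \<eta> x *\<^sub>R f x) \<le> C\<^sup>2 * sqn S f"
proof -
  have m: "(\<lambda>x. \<eta> x *\<^sub>R f x) \<in> borel_measurable (lebesgue_on S)"
    using assms L2_measurable by (intro borel_measurable_scaleR) auto
  have b: "AE x in lebesgue_on S. norm (\<eta> x *\<^sub>R f x) \<le> C * norm (f x)"
    using assms(3) by (intro AE_I2) (auto intro: mult_right_mono)
  show "(\<lambda>x. \<eta> x *\<^sub>R f x) \<in> L2 S" "sqn S (\<lambda>x. \<eta> x *\<^sub>R f x) \<le> C\<^sup>2 * sqn S f"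
    using L2_bound[OF m assms(1) b] sqn_bound[OF m assms(1) b] .
qed

lemma L2_inner_integrable:
  fixes f g :: "real^'n \<Rightarrow> 'b::euclidean_space"
  assumes "f \<in> L2 S" "g \<in> L2 S" shows "integrable (lebesgue_on S) (\<lambda>x. f x \<bullet> g x)"
proof (rule Bochner_Integration.integrable_bound)
  show "integrable (lebesgue_on S) (\<lambda>x. (norm (f x))\<^sup>2 + (norm (g x))\<^sup>2)"
    using assms by (simp add: L2_integrable_sq)
  show "(\<lambda>x. f x \<bullet> g x) \<in> borel_measurable (lebesgue_on S)"
    using assms by (auto intro: borel_measurable_inner L2_measurable)
  have "\<bar>f x \<bullet> g x\<bar> \<le> (norm (f x))\<^sup>2 + (norm (g x))\<^sup>2" for x
    using Cauchy_Schwarz_ineq2[of "f x" "g x"] sum_squares_bound[of "norm (f x)" "norm (g x)"]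
      mult_nonneg_nonneg[OF norm_ge_zero[of "f x"] norm_ge_zero[of "g x"]] by linarith
  then show "AE x in lebesgue_on S. norm (f x \<bullet> g x) \<le> norm ((norm (f x))\<^sup>2 + (norm (g x))\<^sup>2)"
    by (intro AE_I2) (auto intro: order_trans)
qed

text \<open>The square of the norm of f - t g is a nonnegative quadratic polynomial in t; evaluating
  it at its minimum gives the bound, and a vanishing leading coefficient forces the linear one to
  vanish.\<close>

lemma L2_Cauchy_Schwarz:
  fixes f g :: "real^'n \<Rightarrow> 'b::euclidean_space"
  assumes "f \<in> L2 S" "g \<in> L2 S"
  shows "\<bar>LINT x|lebesgue_on S. f x \<bullet> g x\<bar> \<le> L2_norm S f * L2_norm S g"
proof -
  let ?A = "sqn S f" and ?B = "sqn S g" and ?C = "LINT x|lebesgue_on S. f x \<bullet> g x"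
  have q: "0 \<le> ?A - 2 * t * ?C + t\<^sup>2 * ?B" for t
  proof -
    have "0 \<le> sqn S (\<lambda>x. f x - t *\<^sub>R g x)" by simp
    also have "\<dots> = (LINT x|lebesgue_on S. (norm (f x))\<^sup>2 - 2 * t * (f x \<bullet> g x) + t\<^sup>2 * (norm (g x))\<^sup>2)"
      unfolding power2_norm_eq_inner
      by (intro Bochner_Integration.integral_cong)
        (simp_all add: inner_diff inner_commute algebra_simps power2_eq_square)
    also have "\<dots> = ?A - 2 * t * ?C + t\<^sup>2 * ?B"
      using assms by (simp add: L2_integrable_sq L2_inner_integrable)
    finally show ?thesis .
  qed
  have "?C\<^sup>2 \<le> ?A * ?B"
  proof (cases "?B = 0")
    case True
    have "?C = 0"
    proof (rule ccontr)
      assume "?C \<noteq> 0"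
      \<comment> \<open>At this value of t, with \<open>?B\<close> equal to 0, the quadratic takes
        the value \<open>?A - (?A + 1)\<close>, which is -1.\<close>
      with q[of "(?A + 1) / (2 * ?C)"] True show False by (simp add: field_simps)
    qed
    with True show ?thesis by simp
  next
    case False
    then have "?B > 0" using sqn_nonneg[of S g] by linarith
    with q[of "?C / ?B"] show ?thesis
      by (simp add: field_simps power2_eq_square)
  qed
  then have "\<bar>?C\<bar> \<le> sqrt (?A * ?B)" by (intro real_le_rsqrt) simp
  then show ?thesis by (simp add: L2_norm_def real_sqrt_mult)
qed

lemma L2_norm_add:
  fixes f g :: "real^'n \<Rightarrow> 'b::euclidean_space"
  assumes "f \<in> L2 S" "g \<in> L2 S"
  shows "L2_norm S (\<lambda>x. f x + g x) \<le> L2_norm S f + L2_norm S g"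
proof (rule power2_le_imp_le)
  have "(L2_norm S (\<lambda>x. f x + g x))\<^sup>2
      = (LINT x|lebesgue_on S. (norm (f x))\<^sup>2 + 2 * (f x \<bullet> g x) + (norm (g x))\<^sup>2)"
    unfolding L2_norm_power2 by (intro Bochner_Integration.integral_cong)
      (simp_all add: power2_norm_eq_inner inner_add inner_commute)
  also have "\<dots> = sqn S f + 2 * (LINT x|lebesgue_on S. f x \<bullet> g x) + sqn S g"
    using assms by (simp add: L2_integrable_sq L2_inner_integrable)
  also have "\<dots> \<le> (L2_norm S f + L2_norm S g)\<^sup>2"
    using L2_Cauchy_Schwarz[OF assms] by (simp add: power2_sum L2_norm_power2)
  finally show "(L2_norm S (\<lambda>x. f x + g x))\<^sup>2 \<le> (L2_norm S f + L2_norm S g)\<^sup>2" .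
qed (simp add: L2_norm_nonneg)

lemma L2_bounded:
  fixes f :: "real^'n \<Rightarrow> 'b::euclidean_space"
  assumes "f \<in> borel_measurable (lebesgue_on S)" "S \<in> lmeasurable" "\<And>x. x \<in> S \<Longrightarrow> norm (f x) \<le> C"
  shows "f \<in> L2 S" and "sqn S f \<le> C\<^sup>2 * measure lebesgue S"
proof -
  have S: "S \<in> sets lebesgue" using assms(2) by (rule fmeasurableD)
  have 1: "(\<lambda>x. 1 :: real) \<in> L2 S"
    using assms(2) S by (simp add: L2_def integrable_lebesgue_on_indicator lmeasurable_iff_integrable)
  have b: "AE x in lebesgue_on S. norm (f x) \<le> C * norm (1::real)"
    using assms(3) by (intro AE_I2) auto
  show "f \<in> L2 S" using L2_bound[OF assms(1) 1 b] .
  show "sqn S f \<le> C\<^sup>2 * measure lebesgue S"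
    using sqn_bound[OF assms(1) 1 b] S by (simp add: measure_restrict_space)
qed

lemma
  fixes f :: "real^'n \<Rightarrow> 'b::euclidean_space"
  assumes "f \<in> L2 S" "S \<in> lmeasurable"
  shows L2_imp_integrable: "integrable (lebesgue_on S) f"
    and norm_integral_power2_le: "(norm (LINT x|lebesgue_on S. f x))\<^sup>2 \<le> measure lebesgue S * sqn S f"
proof -
  have S: "S \<in> sets lebesgue" using assms(2) by (rule fmeasurableD)
  have 1: "(\<lambda>x. 1 :: real) \<in> L2 S" by (rule L2_bounded[OF _ assms(2), of _ 1]) auto
  have n: "(\<lambda>x. norm (f x)) \<in> L2 S"
    using assms(1) by (auto simp: L2_def)
  have i: "integrable (lebesgue_on S) (\<lambda>x. norm (f x))"
    using L2_inner_integrable[OF n 1] by simp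
  show "integrable (lebesgue_on S) f"
    using i L2_measurable[OF assms(1)] by (simp add: integrable_norm_iff)
  have "norm (LINT x|lebesgue_on S. f x) \<le> (LINT x|lebesgue_on S. norm (f x))"
    by (rule integral_norm_bound)
  also have "\<dots> \<le> L2_norm S f * L2_norm S (\<lambda>x. 1 :: real)"
    using L2_Cauchy_Schwarz[OF n 1] by (auto simp: L2_norm_def)
  finally have "(norm (LINT x|lebesgue_on S. f x))\<^sup>2 \<le> (L2_norm S f * L2_norm S (\<lambda>x. 1 :: real))\<^sup>2"
    by (intro power_mono) auto
  also have "\<dots> = measure lebesgue S * sqn S f"
    using S by (simp add: power_mult_distrib L2_norm_power2 measure_restrict_space)
  finally show "(norm (LINT x|lebesgue_on S. f x))\<^sup>2 \<le> measure lebesgue S * sqn S f" .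
qed

lemma L2_affine_image:
  fixes f :: "real^'n \<Rightarrow> 'b::euclidean_space"
  assumes "\<epsilon> \<noteq> 0" "S \<in> sets lebesgue" "(\<lambda>x. f (\<epsilon> *\<^sub>R x + d)) \<in> L2 S"
  shows "f \<in> L2 ((\<lambda>x. \<epsilon> *\<^sub>R x + d) ` S)"
    and "sqn ((\<lambda>x. \<epsilon> *\<^sub>R x + d) ` S) f = \<bar>\<epsilon>\<bar> ^ CARD('n) * sqn S (\<lambda>x. f (\<epsilon> *\<^sub>R x + d))"
  using assms by (auto simp: L2_def borel_measurable_affine_image integrable_affine_image integral_affine_image)

lemma L2_continuous:
  fixes f :: "real^'n \<Rightarrow> 'b::euclidean_space"
  assumes "continuous_on UNIV f" "compact K" "\<And>x. x \<notin> K \<Longrightarrow> f x = 0" "S \<in> sets lebesgue"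
  shows "f \<in> L2 S"
proof -
  have K: "K \<in> lmeasurable" using assms(2) by (rule lmeasurable_compact)
  have m: "f \<in> borel_measurable lebesgue"
    using continuous_imp_measurable_on_sets_lebesgue[OF assms(1)] by (simp add: lebesgue_on_UNIV_eq)
  have "bounded (f ` K)" using assms(1,2)
    by (intro compact_imp_bounded compact_continuous_image) (auto intro: continuous_on_subset)
  then obtain C where "\<And>x. x \<in> K \<Longrightarrow> norm (f x) \<le> C" unfolding bounded_iff by auto
  then have "f \<in> L2 K"
    using K m by (intro L2_bounded(1)[of _ _ C]) (auto intro: measurable_restrict_space1)
  then have "f \<in> L2 UNIV" unfolding L2_def
    using m K integral_lebesgue_on_support(2)[of K UNIV "\<lambda>x. (norm (f x))\<^sup>2"] assms(3)
    by (auto simp: lebesgue_on_UNIV_eq)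
  then show ?thesis by (rule L2_subset) (use assms(4) in auto)
qed

lemma test_functions_L2:
  assumes "\<phi> \<in> test_functions T" "S \<in> sets lebesgue"
  shows "\<phi> \<in> L2 S" "grad \<phi> \<in> L2 S"
  using assms
  by (auto elim!: test_functionsE intro!: L2_continuous smooth_continuous_on smooth_grad_continuous_on)

subsection \<open>Integrals of test functions\<close>

lemma open_sets_lebesgue: "open S \<Longrightarrow> S \<in> sets lebesgue"
  by (simp add: borel_open sets_completionI_sets)

lemma integrable_continuous_compact_support:
  fixes f :: "'a::euclidean_space \<Rightarrow> 'b::euclidean_space"
  assumes "continuous_on UNIV f" "compact K" "\<And>x. x \<notin> K \<Longrightarrow> f x = 0" "S \<in> sets lebesgue"
  shows "integrable (lebesgue_on S) f"
proof -
  have "integrable lborel (\<lambda>x. indicator K x *\<^sub>R f x)"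
    using assms(1,2) by (intro borel_integrable_compact) (auto intro: continuous_on_subset)
  moreover have "(\<lambda>x. indicator K x *\<^sub>R f x) = f" using assms(3) by (auto simp: indicator_def)
  ultimately have "integrable lebesgue f" by (simp add: integrable_completion borel_measurable_integrable)
  then show ?thesis
    using integrable_lebesgue_on_subset[of S UNIV f] assms(4) by (simp add: lebesgue_on_UNIV_eq)
qed

lemma test_functions_integrable:
  assumes "\<phi> \<in> test_functions T" "S \<in> sets lebesgue"
  shows "integrable (lebesgue_on S) \<phi>" "integrable (lebesgue_on S) (grad \<phi>)"
  using assms by (auto elim!: test_functionsE
      intro!: integrable_continuous_compact_support smooth_continuous_on smooth_grad_continuous_on)

text \<open>The remainder is uniform in x, which lets difference quotients be integrated directly in
  the two places where a derivative is exchanged with an integral. The constant is a Lipschitz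
  constant of the gradient.\<close>

lemma test_functions_taylor:
  fixes f :: "real^'n \<Rightarrow> real"
  assumes "f \<in> test_functions S"
  obtains C where "C > 0" "\<And>x k. \<bar>f (x + k) - f x - grad f x \<bullet> k\<bar> \<le> C * (norm k)\<^sup>2"
proof -
  obtain B where B: "B > 0" "\<And>x y. norm (grad f x - grad f y) \<le> B * norm (x - y)"
    using test_functions_grad_lipschitz[OF assms] by metis
  show thesis
  proof
    show "B > 0" by fact
    fix x k :: "real^'n"
    have "norm (f (x + k) - f x - (\<lambda>h. grad f x \<bullet> h) (x + k - x)) \<le> norm (x + k - x) * (B * norm k)"
    proof (rule differentiable_bound_linearization[where S = "cball x (norm k)" and f' = "\<lambda>y h. grad f y \<bullet> h" and ?x0.0 = x])
      show "x + t *\<^sub>R (x + k - x) \<in> cball x (norm k)" if "t \<in> {0..1}" for t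
        using that by (auto simp: dist_norm intro: mult_left_le_one_le)
      show "(f has_derivative (\<lambda>h. grad f y \<bullet> h)) (at y within cball x (norm k))" for y
        using smooth_has_derivative[OF test_functions_smooth[OF assms]] has_derivative_at_withinI by blast
      show "onorm ((\<lambda>h. grad f y \<bullet> h) - (\<lambda>h. grad f x \<bullet> h)) \<le> B * norm k" if "y \<in> cball x (norm k)" for y
      proof (rule onorm_bound)
        show "0 \<le> B * norm k" using B(1) by simp
        have "norm (grad f y - grad f x) \<le> B * norm k"
          using B(2)[of y x] that B(1) by (auto simp: dist_norm norm_minus_commute intro: order_trans mult_left_mono)
        then show "norm (((\<lambda>h. grad f y \<bullet> h) - (\<lambda>h. grad f x \<bullet> h)) h) \<le> B * norm k * norm h" for h
          using order_trans[OF Cauchy_Schwarz_ineq2[of "grad f y - grad f x" h] mult_right_mono]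
          by (simp add: inner_diff_left)
      qed
    qed simp
    then show "\<bar>f (x + k) - f x - grad f x \<bullet> k\<bar> \<le> B * (norm k)\<^sup>2"
      by (simp add: power2_eq_square mult_ac)
  qed
qed

text \<open>By translation invariance f(x + h e) - f(x) has integral 0, and it differs from h times
  the partial derivative by O(h^2) on a fixed ball. Dividing by h and letting it tend to 0 leaves
  the integral of the partial derivative.\<close>

lemma integral_grad_test_function:
  fixes f :: "real^'n \<Rightarrow> real"
  assumes "f \<in> test_functions UNIV"
  shows "(LINT x|lebesgue. grad f x) = 0"
proof -
  obtain K where K: "compact K" "\<And>x. x \<notin> K \<Longrightarrow> f x = 0" "\<And>x. x \<notin> K \<Longrightarrow> grad f x = 0"
    using test_functionsE[OF assms] by metis
  obtain R where R: "\<And>x. x \<in> K \<Longrightarrow> norm x \<le> R"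
    using compact_imp_bounded[OF K(1)] unfolding bounded_iff by auto
  obtain C where C: "C > 0" "\<And>x k. \<bar>f (x + k) - f x - grad f x \<bullet> k\<bar> \<le> C * (norm k)\<^sup>2"
    using test_functions_taylor[OF assms] by metis
  let ?B = "cball 0 (R + 1) :: (real^'n) set"
  have i: "integrable lebesgue f" "integrable lebesgue (grad f)"
    using test_functions_integrable[OF assms, of UNIV] by (auto simp: lebesgue_on_UNIV_eq)
  have "(LINT x|lebesgue. grad f x) \<bullet> axis i 1 = 0" for i
  proof -
    let ?e = "axis i 1 :: real^'n" and ?I = "LINT x|lebesgue. grad f x \<bullet> axis i 1"
    have b: "\<bar>?I\<bar> * h \<le> C * h\<^sup>2 * measure lebesgue ?B" if h: "0 < h" "h \<le> 1" for h
    proof -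
      have ih: "integrable lebesgue (\<lambda>x. f (x + h *\<^sub>R ?e))"
        using integrable_affineI(1)[of 1 f "h *\<^sub>R ?e"] i(1) by simp
      have "(LINT x|lebesgue. f (x + h *\<^sub>R ?e)) = (LINT x|lebesgue. f x)"
        using integral_affine[of 1 f "h *\<^sub>R ?e"] by simp
      then have "\<bar>?I * h\<bar> = \<bar>LINT x|lebesgue. f (x + h *\<^sub>R ?e) - f x - grad f x \<bullet> (h *\<^sub>R ?e)\<bar>"
        using i ih by (simp add: integrable_inner_left mult.commute)
      also have "\<dots> \<le> (LINT x|lebesgue. \<bar>f (x + h *\<^sub>R ?e) - f x - grad f x \<bullet> (h *\<^sub>R ?e)\<bar>)"
        using integral_norm_bound[of lebesgue "\<lambda>x. f (x + h *\<^sub>R ?e) - f x - grad f x \<bullet> (h *\<^sub>R ?e)"] by simp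
      also have "\<dots> \<le> (LINT x|lebesgue. indicator ?B x * (C * h\<^sup>2))"
      proof (rule integral_mono)
        show "integrable lebesgue (\<lambda>x. \<bar>f (x + h *\<^sub>R ?e) - f x - grad f x \<bullet> (h *\<^sub>R ?e)\<bar>)"
          using i ih by (intro integrable_abs Bochner_Integration.integrable_diff integrable_inner_left) auto
        show "integrable lebesgue (\<lambda>x. indicator ?B x * (C * h\<^sup>2))"
          using lmeasurable_cball by (intro integrable_mult_left) (simp add: lmeasurable_iff_integrable)
        show "\<bar>f (x + h *\<^sub>R ?e) - f x - grad f x \<bullet> (h *\<^sub>R ?e)\<bar> \<le> indicator ?B x * (C * h\<^sup>2)" for x
        proof (cases "x \<in> ?B")
          case True then show ?thesis using C(2)[of x "h *\<^sub>R ?e"] h by simp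
        next
          case False
          then have n: "norm x > R + 1" by simp
          have "norm x \<le> norm (x + h *\<^sub>R ?e) + norm (h *\<^sub>R ?e)" by (metis add_diff_cancel_right' norm_triangle_ineq4)
          then have "norm (x + h *\<^sub>R ?e) > R" using n h by simp
          with n R have "x \<notin> K" "x + h *\<^sub>R ?e \<notin> K" by force+
          then show ?thesis using K C(1) by simp
        qed
      qed
      also have "\<dots> = C * h\<^sup>2 * measure lebesgue ?B" by simp
      finally show ?thesis using h by (simp add: abs_mult)
    qed
    have "\<bar>?I\<bar> \<le> 0"
    proof (rule ccontr)
      assume "\<not> \<bar>?I\<bar> \<le> 0"
      then have I: "\<bar>?I\<bar> > 0" by simp
      \<comment> \<open>The added 1 keeps the divisor positive. The choice of h makes the quadratic
        bound at most half of the linear left-hand side.\<close>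
      define M where "M = C * measure lebesgue ?B + 1"
      have M: "M > 0" using C by (simp add: M_def add_nonneg_pos)
      define h where "h = min 1 (\<bar>?I\<bar> / (2 * M))"
      have h: "0 < h" "h \<le> 1" "h \<le> \<bar>?I\<bar> / (2 * M)" using I M by (auto simp: h_def)
      have "\<bar>?I\<bar> * h \<le> (C * measure lebesgue ?B * h) * h" using b[OF h(1,2)] by (simp add: power2_eq_square mult_ac)
      then have "\<bar>?I\<bar> \<le> C * measure lebesgue ?B * h" using h(1) by simp
      also have "\<dots> \<le> M * h" using h by (intro mult_right_mono) (auto simp: M_def)
      also have "\<dots> \<le> \<bar>?I\<bar> / 2" using h(3) M by (simp add: field_simps)
      finally show False using I by simp
    qed
    then show ?thesis using i(2) by (simp add: integral_inner_left)
  qed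
  then show ?thesis by (simp add: vec_eq_iff inner_axis)
qed

text \<open>The product of u and \<phi> is a test function on the whole space even if u has no
  compact support, so its gradient integrates to zero, and the Leibniz rule splits this
  integral.\<close>

lemma integration_by_parts_smooth:
  fixes u \<phi> :: "real^'n \<Rightarrow> real"
  assumes "smooth u" "\<phi> \<in> test_functions S" "S \<in> sets lebesgue"
  shows "(LINT x|lebesgue_on S. u x *\<^sub>R grad \<phi> x) = - (LINT x|lebesgue_on S. \<phi> x *\<^sub>R grad u x)"
proof -
  obtain K where K: "smooth \<phi>" "compact K" "K \<subseteq> S" "\<And>x. x \<notin> K \<Longrightarrow> \<phi> x = 0" "\<And>x. x \<notin> K \<Longrightarrow> grad \<phi> x = 0"
    using test_functionsE[OF assms(2)] by metis
  have t: "(\<lambda>x. u x * \<phi> x) \<in> test_functions UNIV"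
    using test_functions_mult[OF assms(1)] test_functions_UNIV[OF assms(2)] by blast
  have i: "integrable lebesgue (\<lambda>x. u x *\<^sub>R grad \<phi> x)" "integrable lebesgue (\<lambda>x. \<phi> x *\<^sub>R grad u x)"
    using integrable_continuous_compact_support[of "\<lambda>x. u x *\<^sub>R grad \<phi> x" K UNIV]
      integrable_continuous_compact_support[of "\<lambda>x. \<phi> x *\<^sub>R grad u x" K UNIV] K assms(1)
    by (auto simp: lebesgue_on_UNIV_eq intro!: continuous_on_scaleR smooth_continuous_on smooth_grad_continuous_on)
  have "0 = (LINT x|lebesgue. u x *\<^sub>R grad \<phi> x + \<phi> x *\<^sub>R grad u x)"
    using integral_grad_test_function[OF t] by (simp add: grad_mult[OF assms(1) K(1)])
  then have byp: "(LINT x|lebesgue. u x *\<^sub>R grad \<phi> x) = - (LINT x|lebesgue. \<phi> x *\<^sub>R grad u x)"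
    using i by (simp add: eq_neg_iff_add_eq_0)
  have supp: "\<phi> x = 0" "grad \<phi> x = 0" if "x \<notin> S" for x
    using that K(3-5) by auto
  have "(LINT x|lebesgue_on S. u x *\<^sub>R grad \<phi> x) = (LINT x|lebesgue_on UNIV. u x *\<^sub>R grad \<phi> x)"
    "(LINT x|lebesgue_on S. \<phi> x *\<^sub>R grad u x) = (LINT x|lebesgue_on UNIV. \<phi> x *\<^sub>R grad u x)"
    using assms(3) supp by (auto intro!: integral_lebesgue_on_support(1))
  with byp show ?thesis by (simp add: lebesgue_on_UNIV_eq)
qed

subsection \<open>The fundamental lemma of the calculus of variations\<close>

text \<open>Bumps converge boundedly to indicators of boxes, so g has integral zero over every
  closed box in S. Lebesgue differentiation then recovers the values of g from these integrals
  almost everywhere in a box, and countably many boxes exhaust S.\<close>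

lemma fundamental_lemma:
  fixes g :: "real^'n \<Rightarrow> 'b::euclidean_space"
  assumes "open S" "loc_integrable S g"
    and z: "\<And>\<phi>. \<phi> \<in> test_functions S \<Longrightarrow> (LINT x|lebesgue_on S. \<phi> x *\<^sub>R g x) = 0"
  shows "AE x in lebesgue_on S. g x = 0"
proof -
  have S: "S \<in> sets lebesgue" using assms(1) by (rule open_sets_lebesgue)
  have cb: "AE x in lebesgue. x \<in> cbox c d \<longrightarrow> g x = 0" if cd: "cbox c d \<subseteq> S" for c d
  proof -
    let ?B = "cbox c d"
    let ?f = "\<lambda>x. indicator ?B x *\<^sub>R g x"
    have gi: "integrable (lebesgue_on ?B) g" using assms(2) cd by (simp add: loc_integrable_def)
    have sub: "integrable (lebesgue_on (cbox a b)) g"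
      "(LINT x|lebesgue_on (cbox a b). g x) = 0" if ab: "cbox a b \<subseteq> ?B" for a b
    proof -
      show ig: "integrable (lebesgue_on (cbox a b)) g"
        by (rule integrable_lebesgue_on_subset[OF ab _ _ gi]) auto
      have "(\<lambda>m. LINT x|lebesgue_on (cbox a b). bump (real (Suc m)) a b x *\<^sub>R g x)
          \<longlonglongrightarrow> (LINT x|lebesgue_on (cbox a b). indicator (box a b) x *\<^sub>R g x)"
      proof (rule integral_dominated_convergence[where w = "\<lambda>x. norm (g x)"])
        show "(\<lambda>x. indicator (box a b) x *\<^sub>R g x) \<in> borel_measurable (lebesgue_on (cbox a b))"
          using ig by (intro borel_measurable_scaleR measurable_restrict_space1[OF borel_measurable_indicator] open_sets_lebesgue) auto
        show "(\<lambda>x. bump (real (Suc m)) a b x *\<^sub>R g x) \<in> borel_measurable (lebesgue_on (cbox a b))" for m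
          using continuous_imp_measurable_on_sets_lebesgue[OF smooth_continuous_on[OF smooth_bump], of "cbox a b"] ig
          by (intro borel_measurable_scaleR) auto
        show "AE x in lebesgue_on (cbox a b). (\<lambda>m. bump (real (Suc m)) a b x *\<^sub>R g x)
            \<longlonglongrightarrow> indicator (box a b) x *\<^sub>R g x"
          by (intro AE_I2 tendsto_scaleR bump_tendsto tendsto_const)
        show "AE x in lebesgue_on (cbox a b). norm (bump (real (Suc m)) a b x *\<^sub>R g x) \<le> norm (g x)" for m
          using bump_nonneg[of "real (Suc m)" a b] bump_le_1[of "real (Suc m)" a b]
          by (intro AE_I2) (simp add: mult_left_le_one_le)
      qed (use ig in auto)
      moreover have "(LINT x|lebesgue_on (cbox a b). bump (real (Suc m)) a b x *\<^sub>R g x) = 0" for m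
      proof -
        have "(LINT x|lebesgue_on (cbox a b). bump (real (Suc m)) a b x *\<^sub>R g x)
            = (LINT x|lebesgue_on S. bump (real (Suc m)) a b x *\<^sub>R g x)"
          using ab cd S box_subset_cbox[of a b]
          by (intro integral_lebesgue_on_support(1)) (auto simp: subset_iff intro!: bump_eq_0)
        also have "\<dots> = 0" using ab cd by (intro z bump_test_function) auto
        finally show ?thesis .
      qed
      ultimately have "(LINT x|lebesgue_on (cbox a b). indicator (box a b) x *\<^sub>R g x) = 0"
        using LIMSEQ_unique[OF _ tendsto_const] by simp
      moreover have "(LINT x|lebesgue_on (cbox a b). indicator (box a b) x *\<^sub>R g x) = (LINT x|lebesgue_on (cbox a b). g x)"
      proof (rule integral_cong_AE)
        have "cbox a b - box a b \<in> null_sets lebesgue"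
          using negligible_frontier_interval[of a b] negligible_iff_null_sets by blast
        then have "AE x in lebesgue. x \<notin> cbox a b - box a b" by (rule AE_not_in)
        then show "AE x in lebesgue_on (cbox a b). indicator (box a b) x *\<^sub>R g x = g x"
          unfolding AE_lebesgue_on_iff[OF lmeasurable_cbox[THEN fmeasurableD]] by eventually_elim auto
        show "(\<lambda>x. indicator (box a b) x *\<^sub>R g x) \<in> borel_measurable (lebesgue_on (cbox a b))"
          using ig by (intro borel_measurable_scaleR measurable_restrict_space1[OF borel_measurable_indicator] open_sets_lebesgue) auto
      qed (use ig in auto)
      ultimately show "(LINT x|lebesgue_on (cbox a b). g x) = 0" by simp
    qed
    have f: "integrable (lebesgue_on (cbox a b)) ?f" "(LINT x|lebesgue_on (cbox a b). ?f x) = 0" for a b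
    proof -
      \<comment> \<open>The differentiation theorem asks for integrals over all boxes, not only
        those in \<open>?B\<close>. The extension of g by zero is integrated over the intersection
        with \<open>?B\<close>, which is again a box.\<close>
      define a' b' where "a' = (\<chi> i. max (a $ i) (c $ i))" and "b' = (\<chi> i. min (b $ i) (d $ i))"
      have e: "cbox a' b' = cbox a b \<inter> ?B" by (auto simp: a'_def b'_def mem_box_cart)
      have "integrable (lebesgue_on (cbox a' b')) ?f \<longleftrightarrow> integrable (lebesgue_on (cbox a b)) ?f"
        "(LINT x|lebesgue_on (cbox a' b'). ?f x) = (LINT x|lebesgue_on (cbox a b). ?f x)"
        by (rule integral_lebesgue_on_support; auto simp: e)+
      moreover have "integrable (lebesgue_on (cbox a' b')) ?f \<longleftrightarrow> integrable (lebesgue_on (cbox a' b')) g"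
        by (rule Bochner_Integration.integrable_cong) (auto simp: e)
      moreover have "(LINT x|lebesgue_on (cbox a' b'). ?f x) = (LINT x|lebesgue_on (cbox a' b'). g x)"
        by (rule Bochner_Integration.integral_cong) (auto simp: e)
      moreover have "cbox a' b' \<subseteq> ?B" by (simp add: e)
      ultimately show "integrable (lebesgue_on (cbox a b)) ?f" "(LINT x|lebesgue_on (cbox a b). ?f x) = 0"
        using sub[of a' b'] by simp_all
    qed
    have hk: "?f integrable_on cbox a b" "integral (cbox a b) ?f = 0" for a b
      using f[of a b] lebesgue_integral_eq_integral[OF f(1)[of a b]] integrable_on_lebesgue_on[OF f(1)[of a b]] by auto
    \<comment> \<open>Lebesgue differentiation along cubes with corner x: the averages, which are
      all zero, converge to \<open>?f x\<close> off a negligible set.\<close>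
    obtain N where N: "negligible N"
      "\<And>x e. \<lbrakk>x \<notin> N; 0 < e\<rbrakk> \<Longrightarrow> \<exists>h0>0. \<forall>h. 0 < h \<and> h < h0 \<longrightarrow>
          norm (integral (cbox x (x + h *\<^sub>R One)) ?f /\<^sub>R h ^ DIM(real^'n) - ?f x) < e"
      by (rule integrable_ccontinuous_explicit[of ?f, OF hk(1)]) (rule that)
    have "?f x = 0" if x: "x \<notin> N" for x
    proof (rule ccontr)
      assume "?f x \<noteq> 0"
      then have "0 < norm (?f x)" by (simp only: zero_less_norm_iff not_False_eq_True)
      from N(2)[OF x this] obtain h0 where h0: "h0 > 0"
        "\<forall>h. 0 < h \<and> h < h0 \<longrightarrow> norm (0 /\<^sub>R h ^ DIM(real^'n) - ?f x) < norm (?f x)"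
        unfolding hk(2) by blast
      from h0(2)[rule_format, of "h0 / 2"] h0(1) show False by simp
    qed
    then have g0: "g x = 0" if "x \<notin> N" "x \<in> ?B" for x using that by fastforce
    have "AE x in lebesgue. x \<notin> N"
      using N(1) negligible_iff_null_sets AE_not_in by blast
    then show ?thesis by eventually_elim (auto simp: g0)
  qed
  obtain \<D> where D: "countable \<D>" "\<D> \<subseteq> Pow S" "\<And>X. X \<in> \<D> \<Longrightarrow> \<exists>a b. X = cbox a b" "\<Union>\<D> = S"
    using open_countable_Union_open_cbox[OF assms(1)] by metis
  have "AE x in lebesgue. \<forall>X\<in>\<D>. x \<in> X \<longrightarrow> g x = 0"
    using D cb by (subst AE_ball_countable) (auto, metis PowD subsetD)
  then show ?thesis unfolding AE_lebesgue_on_iff[OF S]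
    using D(4) by (auto elim!: eventually_mono)
qed

subsection \<open>Translation estimate\<close>

text \<open>The increment is the integral of the directional derivative over the segment from x to x
  + z. Jensen on [0,1] moves the square inside, and after Tonelli the shift by t z disappears by
  translation invariance. Both Poincare inequalities below rest on this estimate.\<close>

lemma translation_estimate:
  fixes f :: "real^'n \<Rightarrow> real"
  assumes "f \<in> test_functions UNIV"
  shows "(LINT x|lebesgue. (f (x + z) - f x)\<^sup>2) \<le> (norm z)\<^sup>2 * (LINT x|lebesgue. (norm (grad f x))\<^sup>2)"
proof -
  have sm: "smooth f" using assms by (rule test_functions_smooth)
  have cf: "continuous_on UNIV f" and cg: "continuous_on UNIV (grad f)"
    using sm smooth_continuous_on smooth_grad_continuous_on by auto
  have gb [measurable]: "grad f \<in> borel_measurable borel" and fb: "f \<in> borel_measurable borel"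
    using cg cf by (simp_all add: borel_measurable_continuous_onI)
  have pt: "ennreal ((f (x + z) - f x)\<^sup>2)
      \<le> (\<integral>\<^sup>+t. indicator {0..1} t * ennreal ((norm z)\<^sup>2 * (norm (grad f (x + t *\<^sub>R z)))\<^sup>2) \<partial>lborel)" for x
  proof -
    let ?g = "\<lambda>t. grad f (x + t *\<^sub>R z) \<bullet> z"
    have cont: "continuous_on A ?g" for A
      by (intro continuous_intros continuous_on_compose2[OF cg]) auto
    have d: "((\<lambda>t. f (x + t *\<^sub>R z)) has_vector_derivative ?g t) (at t within A)" for t A
    proof -
      have "((\<lambda>t. x + t *\<^sub>R z) has_derivative (\<lambda>s. s *\<^sub>R z)) (at t within A)"
        by (auto intro!: derivative_eq_intros)
      from has_derivative_compose[OF this smooth_has_derivative[OF sm]]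
      show ?thesis by (simp add: has_vector_derivative_def)
    qed
    define c where "c = f (x + z) - f x"
    have I: "(LINT t|lborel. indicator {0..1} t *\<^sub>R ?g t) = c"
      using integral_FTC_atLeastAtMost[of 0 1 "\<lambda>t. f (x + t *\<^sub>R z)" ?g] d cont by (simp add: c_def)
    have i1: "integrable lborel (\<lambda>t. indicator {0..1} t *\<^sub>R ?g t)"
      by (intro borel_integrable_compact cont) auto
    have i2: "integrable lborel (\<lambda>t. indicator {0..1} t *\<^sub>R (?g t)\<^sup>2)"
      by (intro borel_integrable_compact continuous_intros cont) auto
    \<comment> \<open>The variance of \<open>?g\<close> on [0,1] about its mean c is nonnegative,
      which is Jensen's inequality for the square.\<close>
    have "0 \<le> (LINT t|lborel. indicator {0..1} t *\<^sub>R (?g t - c)\<^sup>2)"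
      by (intro integral_nonneg_AE AE_I2) simp
    also have "\<dots> = (LINT t|lborel. indicator {0..1} t *\<^sub>R (?g t)\<^sup>2 - 2 * c * (indicator {0..1} t *\<^sub>R ?g t)
        + c\<^sup>2 * indicator {0..1} t)"
      by (intro Bochner_Integration.integral_cong) (auto simp: power2_diff algebra_simps indicator_def)
    also have "\<dots> = (LINT t|lborel. indicator {0..1} t *\<^sub>R (?g t)\<^sup>2) - 2 * c * c + c\<^sup>2"
      using i1 i2 I by (subst Bochner_Integration.integral_add, simp, simp) (subst Bochner_Integration.integral_diff, auto)
    finally have "c\<^sup>2 \<le> (LINT t|lborel. indicator {0..1} t *\<^sub>R (?g t)\<^sup>2)" by (simp add: power2_eq_square)
    then have "ennreal (c\<^sup>2) \<le> ennreal (LINT t|lborel. indicator {0..1} t *\<^sub>R (?g t)\<^sup>2)" by (rule ennreal_leI)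
    also have "\<dots> = (\<integral>\<^sup>+t. ennreal (indicator {0..1} t *\<^sub>R (?g t)\<^sup>2) \<partial>lborel)"
      by (rule nn_integral_eq_integral[symmetric, OF i2]) auto
    also have "\<dots> \<le> (\<integral>\<^sup>+t. indicator {0..1} t * ennreal ((norm z)\<^sup>2 * (norm (grad f (x + t *\<^sub>R z)))\<^sup>2) \<partial>lborel)"
    proof (rule nn_integral_mono)
      fix t
      have "(?g t)\<^sup>2 \<le> (norm (grad f (x + t *\<^sub>R z)) * norm z)\<^sup>2"
        by (metis Cauchy_Schwarz_ineq2 abs_le_square_iff abs_mult abs_norm_cancel)
      then show "ennreal (indicator {0..1} t *\<^sub>R (?g t)\<^sup>2)
          \<le> indicator {0..1} t * ennreal ((norm z)\<^sup>2 * (norm (grad f (x + t *\<^sub>R z)))\<^sup>2)"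
        by (auto simp: indicator_def power_mult_distrib mult_ac intro: ennreal_leI)
    qed
    finally show ?thesis by (simp add: c_def)
  qed
  let ?G = "\<integral>\<^sup>+x. ennreal ((norm z)\<^sup>2 * (norm (grad f x))\<^sup>2) \<partial>lborel"
  have m: "(\<lambda>(x, t). indicator {0..1} t * ennreal ((norm z)\<^sup>2 * (norm (grad f (x + t *\<^sub>R z)))\<^sup>2))
      \<in> borel_measurable ((lborel :: (real^'n) measure) \<Otimes>\<^sub>M (lborel :: real measure))"
  proof -
    have "(\<lambda>p :: (real^'n) \<times> real. grad f (fst p + snd p *\<^sub>R z)) \<in> borel_measurable borel"
      by (intro borel_measurable_continuous_onI continuous_on_compose2[OF cg] continuous_intros) auto
    then have "(\<lambda>p :: (real^'n) \<times> real. grad f (fst p + snd p *\<^sub>R z)) \<in> borel_measurable (lborel \<Otimes>\<^sub>M lborel)"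
      by (simp add: lborel_prod)
    then show ?thesis unfolding case_prod_beta by measurable
  qed
  have "(\<integral>\<^sup>+x. ennreal ((f (x + z) - f x)\<^sup>2) \<partial>lborel)
      \<le> (\<integral>\<^sup>+x. \<integral>\<^sup>+t. indicator {0..1} t * ennreal ((norm z)\<^sup>2 * (norm (grad f (x + t *\<^sub>R z)))\<^sup>2) \<partial>lborel \<partial>lborel)"
    by (rule nn_integral_mono) (rule pt)
  also have "\<dots> = (\<integral>\<^sup>+t. \<integral>\<^sup>+x. indicator {0..1} t * ennreal ((norm z)\<^sup>2 * (norm (grad f (x + t *\<^sub>R z)))\<^sup>2) \<partial>lborel \<partial>lborel)"
    using lborel_pair.Fubini'[OF m] by simp
  also have "\<dots> = (\<integral>\<^sup>+t. indicator {0..1} t * ?G \<partial>(lborel :: real measure))"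
  proof (rule nn_integral_cong)
    fix t :: real
    have [measurable]: "(\<lambda>x. ennreal ((norm z)\<^sup>2 * (norm (grad f x))\<^sup>2)) \<in> borel_measurable borel"
      using gb by measurable
    have "?G = (\<integral>\<^sup>+x. ennreal ((norm z)\<^sup>2 * (norm (grad f x))\<^sup>2) \<partial>distr lborel borel ((+) (t *\<^sub>R z)))"
      by (simp add: lborel_distr_plus)
    also have "\<dots> = (\<integral>\<^sup>+x. ennreal ((norm z)\<^sup>2 * (norm (grad f (x + t *\<^sub>R z)))\<^sup>2) \<partial>lborel)"
      by (subst nn_integral_distr; (measurable; fail | simp add: add.commute))
    finally have *: "?G = (\<integral>\<^sup>+x. ennreal ((norm z)\<^sup>2 * (norm (grad f (x + t *\<^sub>R z)))\<^sup>2) \<partial>lborel)" .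
    have "(\<lambda>x. grad f (x + t *\<^sub>R z)) \<in> borel_measurable lborel"
      using gb by measurable
    then show "(\<integral>\<^sup>+x. indicator {0..1} t * ennreal ((norm z)\<^sup>2 * (norm (grad f (x + t *\<^sub>R z)))\<^sup>2) \<partial>lborel)
        = indicator {0..1} t * ?G"
      unfolding * by (subst nn_integral_cmult) measurable
  qed
  also have "\<dots> = (\<integral>\<^sup>+t. indicator {0..1} t \<partial>(lborel :: real measure)) * ?G"
    by (rule nn_integral_multc) auto
  also have "\<dots> = ?G" by simp
  finally have le: "(\<integral>\<^sup>+x. ennreal ((f (x + z) - f x)\<^sup>2) \<partial>lborel) \<le> ?G" .
  have fz: "(\<lambda>x. f (x + z)) \<in> test_functions UNIV"
    using test_functions_affine[OF assms, of 1 z] by simp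
  have "(\<lambda>x. f (x + z) - f x) \<in> L2 UNIV"
    using test_functions_L2(1)[OF fz, of UNIV] test_functions_L2(1)[OF assms, of UNIV] by (intro L2_diff) auto
  then have i1: "integrable lebesgue (\<lambda>x. (f (x + z) - f x)\<^sup>2)"
    by (auto dest: L2_integrable_sq simp: lebesgue_on_UNIV_eq)
  have i2: "integrable lebesgue (\<lambda>x. (norm z)\<^sup>2 * (norm (grad f x))\<^sup>2)"
    using L2_integrable_sq[OF test_functions_L2(2)[OF assms, of UNIV]] by (auto simp: lebesgue_on_UNIV_eq)
  have "ennreal (LINT x|lebesgue. (f (x + z) - f x)\<^sup>2) \<le> ennreal (LINT x|lebesgue. (norm z)\<^sup>2 * (norm (grad f x))\<^sup>2)"
    using le nn_integral_eq_integral[OF i1] nn_integral_eq_integral[OF i2] by (simp add: nn_integral_completion)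
  then show ?thesis by (simp add: ennreal_le_iff)
qed

subsection \<open>Caratheodory functions\<close>

text \<open>The inner function is replaced by functions with countably many values in a dense subset
  of P; each composition is measurable, and continuity in the parameter gives the limit. This serves
  the flux, where the slow variable and the field both vary with the point.\<close>

lemma caratheodory_measurable:
  fixes A :: "'p::{metric_space, second_countable_topology} \<Rightarrow> 'a::euclidean_space \<Rightarrow> 'b::euclidean_space"
  assumes S: "S \<in> sets lebesgue" and g: "g \<in> borel_measurable (lebesgue_on S)" "\<And>y. y \<in> S \<Longrightarrow> g y \<in> P"
    and m: "\<And>p. p \<in> P \<Longrightarrow> A p \<in> borel_measurable (lebesgue_on S)"
    and c: "AE y in lebesgue_on S. continuous_on P (\<lambda>p. A p y)"
  shows "(\<lambda>y. A (g y) y) \<in> borel_measurable (lebesgue_on S)"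
proof (cases "S = {}")
  case True then show ?thesis by (simp add: measurable_def space_restrict_space)
next
  case False
  obtain T where T: "countable T" "T \<subseteq> P" "P \<subseteq> closure T" using separable .
  have ne: "T \<noteq> {}" using False g(2) T(3) by auto
  define d where "d = from_nat_into T"
  have d: "d k \<in> T" for k using ne by (simp add: d_def from_nat_into)
  \<comment> \<open>Taking the least admissible index makes the choice of a nearby point of the
    dense sequence measurable in y.\<close>
  define K where "K = (\<lambda>m y. LEAST k. dist (d k) (g y) < inverse (real (Suc m)))"
  have K: "dist (d (K m y)) (g y) < inverse (real (Suc m))" if "y \<in> S" for m y
  proof -
    have "g y \<in> closure T" using that g(2) T(3) by auto
    then obtain t where "t \<in> T" "dist t (g y) < inverse (real (Suc m))"
      by (meson closure_approachable inverse_positive_iff_positive of_nat_0_less_iff zero_less_Suc)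
    then have "\<exists>k. dist (d k) (g y) < inverse (real (Suc m))"
      using T(1) from_nat_into_surj unfolding d_def by metis
    then show ?thesis unfolding K_def by (rule LeastI_ex)
  qed
  let ?F = "\<lambda>m y. A (d (K m y)) y"
  have F: "?F m \<in> borel_measurable (lebesgue_on S)" for m
  proof -
    have "K m \<in> measurable (lebesgue_on S) (count_space UNIV)"
      unfolding K_def using g(1) by (intro measurable_Least) measurable
    then show ?thesis
      using measurable_compose_countable'[where f = "\<lambda>k y. A (d k) y" and g = "K m" and I = UNIV] m d T(2) by blast
  qed
  show ?thesis
  proof (rule borel_measurable_lebesgue_on_AE[OF _ S])
    show "(\<lambda>y. lim (\<lambda>m. ?F m y)) \<in> borel_measurable (lebesgue_on S)"
      by (rule borel_measurable_lim_metric) (rule F)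
    show "AE y in lebesgue_on S. lim (\<lambda>m. ?F m y) = A (g y) y"
      using c AE_in_lebesgue_on[OF S]
    proof eventually_elim
      case (elim y)
      have "(\<lambda>m. d (K m y)) \<longlonglongrightarrow> g y"
      proof (rule metric_LIMSEQ_I)
        fix r :: real assume "r > 0"
        then obtain N where N: "inverse (real (Suc N)) < r" using reals_Archimedean by blast
        have "dist (d (K m y)) (g y) < r" if "m \<ge> N" for m
        proof -
          have "dist (d (K m y)) (g y) < inverse (real (Suc m))" using K elim(2) by blast
          also have "\<dots> \<le> inverse (real (Suc N))" using that by (simp add: le_imp_inverse_le)
          finally show ?thesis using N by simp
        qed
        then show "\<exists>N. \<forall>m\<ge>N. dist (d (K m y)) (g y) < r" by blast
      qed
      then have "(\<lambda>m. A (d (K m y)) y) \<longlonglongrightarrow> A (g y) y"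
        by (rule continuous_on_tendsto_compose[OF elim(1)]) (use g(2)[OF elim(2)] d T(2) in \<open>auto intro!: always_eventually\<close>)
      then show ?case by (rule limI)
    qed
  qed
qed

subsection \<open>Weak gradients\<close>

lemma loc_integrable_bounded_mult:
  fixes g :: "real^'n \<Rightarrow> 'c::euclidean_space" and f :: "real^'n \<Rightarrow> 'b::euclidean_space"
  assumes "loc_integrable S g" "S \<in> sets lebesgue" "compact K" "K \<subseteq> S" "\<And>x. x \<notin> K \<Longrightarrow> f x = 0"
    and "f \<in> borel_measurable (lebesgue_on K)" "\<And>x. norm (f x) \<le> B * norm (g x)"
  shows "integrable (lebesgue_on S) f"
proof -
  have K: "K \<in> sets lebesgue" using assms(3) by (simp add: lmeasurable_compact fmeasurableD)
  have "integrable (lebesgue_on K) (\<lambda>x. B * norm (g x))"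
    using assms(1,3,4) by (auto simp: loc_integrable_def)
  then have "integrable (lebesgue_on K) f"
    by (rule Bochner_Integration.integrable_bound) (use assms(6,7) in \<open>auto intro: order_trans abs_ge_self\<close>)
  then show ?thesis using integral_lebesgue_on_support(2)[OF assms(4) K assms(2), of f] assms(5) by blast
qed

lemma loc_integrable_measurable:
  "loc_integrable S g \<Longrightarrow> compact K \<Longrightarrow> K \<subseteq> S \<Longrightarrow> g \<in> borel_measurable (lebesgue_on K)"
  by (auto simp: loc_integrable_def)

lemma smooth_measurable:
  assumes "smooth \<phi>"
  shows "\<phi> \<in> borel_measurable (lebesgue_on S)" "grad \<phi> \<in> borel_measurable (lebesgue_on S)"
  using continuous_imp_measurable_on_sets_lebesgue[of UNIV \<phi>]
    continuous_imp_measurable_on_sets_lebesgue[of UNIV "grad \<phi>"]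
    smooth_continuous_on[OF assms, of UNIV] smooth_grad_continuous_on[OF assms, of UNIV]
  by (auto intro: borel_measurable_lebesgue_on_subset[of S UNIV])

lemma test_function_scaleR_integrable:
  fixes g :: "real^'n \<Rightarrow> 'b::euclidean_space"
  assumes "\<phi> \<in> test_functions S" "loc_integrable S g" "S \<in> sets lebesgue"
  shows "integrable (lebesgue_on S) (\<lambda>x. \<phi> x *\<^sub>R g x)"
proof -
  obtain K where K: "compact K" "K \<subseteq> S" "\<And>x. x \<notin> K \<Longrightarrow> \<phi> x = 0"
    using test_functionsE[OF assms(1)] by metis
  obtain B where B: "\<And>x. \<bar>\<phi> x\<bar> \<le> B" using test_functions_bounded[OF assms(1)] by metis
  show ?thesis
    by (rule loc_integrable_bounded_mult[OF assms(2,3) K(1,2), of _ B])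
      (use K B assms in \<open>auto intro!: borel_measurable_scaleR mult_right_mono loc_integrable_measurable[OF assms(2)]
        smooth_measurable test_functions_smooth[OF assms(1)]\<close>)
qed

lemma scaleR_grad_integrable:
  fixes u :: "real^'n \<Rightarrow> real"
  assumes "\<phi> \<in> test_functions S" "loc_integrable S u" "S \<in> sets lebesgue"
  shows "integrable (lebesgue_on S) (\<lambda>x. u x *\<^sub>R grad \<phi> x)"
proof -
  obtain K where K: "compact K" "K \<subseteq> S" "\<And>x. x \<notin> K \<Longrightarrow> grad \<phi> x = 0"
    using test_functionsE[OF assms(1)] by metis
  obtain B where B: "\<And>x. norm (grad \<phi> x) \<le> B" using test_functions_bounded[OF assms(1)] by metis
  have "norm (u x *\<^sub>R grad \<phi> x) \<le> B * norm (u x)" for x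
    using mult_left_mono[OF B[of x] abs_ge_zero[of "u x"]] by (simp add: mult.commute)
  then show ?thesis
    by (intro loc_integrable_bounded_mult[OF assms(2,3) K(1,2), of _ B] borel_measurable_scaleR
        loc_integrable_measurable[OF assms(2) K(1,2)] smooth_measurable(2)[OF test_functions_smooth[OF assms(1)]])
      (simp_all add: K(3))
qed

lemma loc_integrable_add:
  "loc_integrable S f \<Longrightarrow> loc_integrable S g \<Longrightarrow> loc_integrable S (\<lambda>x. f x + g x)"
  by (auto simp: loc_integrable_def)

lemma loc_integrable_scaleR_const: "loc_integrable S f \<Longrightarrow> loc_integrable S (\<lambda>x. c *\<^sub>R f x)"
  by (auto simp: loc_integrable_def)

lemma loc_integrable_subset: "loc_integrable S f \<Longrightarrow> T \<subseteq> S \<Longrightarrow> loc_integrable T f"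
  by (auto simp: loc_integrable_def)

lemma loc_integrable_cong_AE:
  fixes f g :: "real^'n \<Rightarrow> 'b::euclidean_space"
  assumes "loc_integrable S f" "S \<in> sets lebesgue" "AE x in lebesgue_on S. f x = g x"
  shows "loc_integrable S g"
  unfolding loc_integrable_def
proof (intro allI impI)
  fix K assume K: "compact K \<and> K \<subseteq> S"
  then have Ks: "K \<in> sets lebesgue" by (simp add: lmeasurable_compact fmeasurableD)
  have fi: "integrable (lebesgue_on K) f" using assms(1) K by (simp add: loc_integrable_def)
  have ae: "AE x in lebesgue_on K. f x = g x"
    using AE_lebesgue_on_subset[OF _ Ks assms(2,3)] K by blast
  have "g \<in> borel_measurable (lebesgue_on K)"
    using borel_measurable_lebesgue_on_AE[OF _ Ks ae] fi by auto
  then show "integrable (lebesgue_on K) g"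
    by (rule integrable_cong_AE_imp[OF fi _ ae])
qed

lemma continuous_loc_integrable:
  fixes f :: "real^'n \<Rightarrow> 'b::euclidean_space"
  assumes "continuous_on UNIV f" shows "loc_integrable S f"
  unfolding loc_integrable_def
proof (intro allI impI)
  fix K assume K: "compact K \<and> K \<subseteq> S"
  then have Ks: "K \<in> lmeasurable" by (simp add: lmeasurable_compact)
  have c: "continuous_on K f" using assms continuous_on_subset by blast
  then have "bounded (f ` K)" using K compact_continuous_image compact_imp_bounded by blast
  then obtain C where "\<And>x. x \<in> K \<Longrightarrow> norm (f x) \<le> C" unfolding bounded_iff by auto
  then have "f \<in> L2 K"
    using Ks c by (intro L2_bounded(1)[of _ _ C] continuous_imp_measurable_on_sets_lebesgue) (auto dest: fmeasurableD)
  then show "integrable (lebesgue_on K) f" using Ks by (rule L2_imp_integrable)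
qed

text \<open>A general bilinear map covers the three products in the product rule: scalar times
  vector in either order and scalar times scalar.\<close>

lemma loc_integrable_scaleR:
  fixes f :: "real^'n \<Rightarrow> 'b::euclidean_space" and \<eta> :: "real^'n \<Rightarrow> 'c::euclidean_space"
    and pr :: "'c \<Rightarrow> 'b \<Rightarrow> 'd::euclidean_space"
  assumes "loc_integrable S f" "continuous_on UNIV \<eta>" "bounded_bilinear pr"
  shows "loc_integrable S (\<lambda>x. pr (\<eta> x) (f x))"
  unfolding loc_integrable_def
proof (intro allI impI)
  interpret bounded_bilinear pr by fact
  obtain M where M: "M > 0" "\<And>a b. norm (pr a b) \<le> norm a * norm b * M" using pos_bounded by blast
  fix K assume K: "compact K \<and> K \<subseteq> S"
  then have Ks: "K \<in> sets lebesgue" by (simp add: lmeasurable_compact fmeasurableD)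
  have c: "continuous_on K \<eta>" using assms(2) continuous_on_subset by blast
  then have "bounded (\<eta> ` K)" using K compact_continuous_image compact_imp_bounded by blast
  then obtain C where C: "\<And>x. x \<in> K \<Longrightarrow> norm (\<eta> x) \<le> C" unfolding bounded_iff by auto
  have fi: "integrable (lebesgue_on K) f" using assms(1) K by (simp add: loc_integrable_def)
  then have "integrable (lebesgue_on K) (\<lambda>x. C * M * norm (f x))" by auto
  then show "integrable (lebesgue_on K) (\<lambda>x. pr (\<eta> x) (f x))"
  proof (rule Bochner_Integration.integrable_bound)
    have "(\<lambda>p. pr (fst p) (snd p)) \<in> borel_measurable borel"
      by (intro borel_measurable_continuous_onI continuous_on continuous_intros)
    moreover have "(\<lambda>x. (\<eta> x, f x)) \<in> borel_measurable (lebesgue_on K)"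
      using continuous_imp_measurable_on_sets_lebesgue[OF c Ks] fi by (auto intro: borel_measurable_Pair)
    ultimately show "(\<lambda>x. pr (\<eta> x) (f x)) \<in> borel_measurable (lebesgue_on K)"
      using measurable_compose[of "\<lambda>x. (\<eta> x, f x)" "lebesgue_on K" borel "\<lambda>p. pr (fst p) (snd p)"] by simp
    show "AE x in lebesgue_on K. norm (pr (\<eta> x) (f x)) \<le> norm (C * M * norm (f x))"
    proof (rule AE_I2)
      fix x assume "x \<in> space (lebesgue_on K)"
      then have "norm (\<eta> x) * (norm (f x) * M) \<le> C * (norm (f x) * M)"
        using C M(1) by (intro mult_right_mono) auto
      with M(2)[of "\<eta> x" "f x"] have "norm (pr (\<eta> x) (f x)) \<le> C * M * norm (f x)"
        by (simp add: mult_ac)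
      then show "norm (pr (\<eta> x) (f x)) \<le> norm (C * M * norm (f x))"
        unfolding real_norm_def by (rule order_trans[OF _ abs_ge_self])
    qed
  qed
qed

lemma is_weak_gradD:
  assumes "is_weak_grad S u G"
  shows "loc_integrable S u" "loc_integrable S G"
    "\<phi> \<in> test_functions S \<Longrightarrow> (LINT x|lebesgue_on S. u x *\<^sub>R grad \<phi> x) = - (LINT x|lebesgue_on S. \<phi> x *\<^sub>R G x)"
  using assms by (auto simp: is_weak_grad_def)

lemma is_weak_grad_unique:
  assumes "open S" "is_weak_grad S u G" "is_weak_grad S u G'"
  shows "AE x in lebesgue_on S. G x = G' x"
proof -
  note S = open_sets_lebesgue[OF assms(1)]
  note D = is_weak_gradD[OF assms(2)] and D' = is_weak_gradD[OF assms(3)]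
  have "AE x in lebesgue_on S. G x - G' x = 0"
  proof (rule fundamental_lemma[OF assms(1)])
    show "loc_integrable S (\<lambda>x. G x - G' x)" using D(2) D'(2) by (auto simp: loc_integrable_def)
    fix \<phi> assume p: "\<phi> \<in> test_functions S"
    show "(LINT x|lebesgue_on S. \<phi> x *\<^sub>R (G x - G' x)) = 0"
      using D(3)[OF p] D'(3)[OF p] test_function_scaleR_integrable[OF p D(2) S]
        test_function_scaleR_integrable[OF p D'(2) S]
      by (simp add: scaleR_diff_right)
  qed
  then show ?thesis by eventually_elim simp
qed

lemma is_weak_grad_smooth:
  assumes "smooth u" "S \<in> sets lebesgue" shows "is_weak_grad S u (grad u)"
  unfolding is_weak_grad_def using assms
  by (auto intro: continuous_loc_integrable smooth_continuous_on smooth_grad_continuous_on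
      integration_by_parts_smooth)

lemma is_weak_grad_add:
  assumes "is_weak_grad S u G" "is_weak_grad S v H" "S \<in> sets lebesgue"
  shows "is_weak_grad S (\<lambda>x. u x + v x) (\<lambda>x. G x + H x)"
  unfolding is_weak_grad_def
proof (intro conjI ballI)
  note D = is_weak_gradD[OF assms(1)] and D' = is_weak_gradD[OF assms(2)]
  show "loc_integrable S (\<lambda>x. u x + v x)" "loc_integrable S (\<lambda>x. G x + H x)"
    using D D' by (auto intro: loc_integrable_add)
  fix \<phi> assume p: "\<phi> \<in> test_functions S"
  show "(LINT x|lebesgue_on S. (u x + v x) *\<^sub>R grad \<phi> x) = - (LINT x|lebesgue_on S. \<phi> x *\<^sub>R (G x + H x))"
    using D(3)[OF p] D'(3)[OF p] test_function_scaleR_integrable[OF p D(2) assms(3)]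
      test_function_scaleR_integrable[OF p D'(2) assms(3)]
      scaleR_grad_integrable[OF p D(1) assms(3)] scaleR_grad_integrable[OF p D'(1) assms(3)]
    by (simp add: scaleR_add_left scaleR_add_right)
qed

lemma is_weak_grad_cmult:
  assumes "is_weak_grad S u G"
  shows "is_weak_grad S (\<lambda>x. c * u x) (\<lambda>x. c *\<^sub>R G x)"
  unfolding is_weak_grad_def
proof (intro conjI ballI)
  note D = is_weak_gradD[OF assms(1)]
  show "loc_integrable S (\<lambda>x. c * u x)" "loc_integrable S (\<lambda>x. c *\<^sub>R G x)"
    using D loc_integrable_scaleR_const[of S u c] loc_integrable_scaleR_const[of S G c] by auto
  fix \<phi> assume p: "\<phi> \<in> test_functions S"
  have "(LINT x|lebesgue_on S. (c * u x) *\<^sub>R grad \<phi> x) = c *\<^sub>R (LINT x|lebesgue_on S. u x *\<^sub>R grad \<phi> x)"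
    by (simp flip: integral_scaleR_right)
  also have "\<dots> = - (LINT x|lebesgue_on S. \<phi> x *\<^sub>R c *\<^sub>R G x)"
    unfolding D(3)[OF p] by (simp add: mult.commute flip: integral_scaleR_right)
  finally show "(LINT x|lebesgue_on S. (c * u x) *\<^sub>R grad \<phi> x) = - (LINT x|lebesgue_on S. \<phi> x *\<^sub>R c *\<^sub>R G x)" .
qed

lemma is_weak_grad_diff:
  assumes "is_weak_grad S u G" "is_weak_grad S v H" "S \<in> sets lebesgue"
  shows "is_weak_grad S (\<lambda>x. u x - v x) (\<lambda>x. G x - H x)"
  using is_weak_grad_add[OF assms(1) is_weak_grad_cmult[OF assms(2), of "-1"] assms(3)] by simp

lemma is_weak_grad_sum:
  assumes "\<And>i. i \<in> I \<Longrightarrow> is_weak_grad S (u i) (G i)" "S \<in> sets lebesgue"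
  shows "is_weak_grad S (\<lambda>x. \<Sum>i\<in>I. u i x) (\<lambda>x. \<Sum>i\<in>I. G i x)"
  using assms(1)
proof (induction I rule: infinite_finite_induct)
  case (insert i I)
  then show ?case using is_weak_grad_add[OF _ _ assms(2)] by simp
qed (use is_weak_grad_smooth[OF smooth_const assms(2), of 0] in \<open>auto simp: grad_const[abs_def]\<close>)

lemma is_weak_grad_cong_AE:
  assumes "is_weak_grad S u G" "S \<in> sets lebesgue"
    and "AE x in lebesgue_on S. u x = v x" "AE x in lebesgue_on S. G x = H x"
  shows "is_weak_grad S v H"
  unfolding is_weak_grad_def
proof (intro conjI ballI)
  note D = is_weak_gradD[OF assms(1)]
  show v: "loc_integrable S v" and H: "loc_integrable S H"
    using loc_integrable_cong_AE[OF D(1) assms(2,3)] loc_integrable_cong_AE[OF D(2) assms(2,4)] .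
  fix \<phi> assume p: "\<phi> \<in> test_functions S"
  have "AE x in lebesgue_on S. v x *\<^sub>R grad \<phi> x = u x *\<^sub>R grad \<phi> x"
    using assms(3) by eventually_elim simp
  then have eq1: "(LINT x|lebesgue_on S. v x *\<^sub>R grad \<phi> x) = (LINT x|lebesgue_on S. u x *\<^sub>R grad \<phi> x)"
    using scaleR_grad_integrable[OF p D(1) assms(2)] scaleR_grad_integrable[OF p v assms(2)]
    by (intro integral_cong_AE borel_measurable_integrable)
  have "AE x in lebesgue_on S. \<phi> x *\<^sub>R H x = \<phi> x *\<^sub>R G x"
    using assms(4) by eventually_elim simp
  then have eq2: "(LINT x|lebesgue_on S. \<phi> x *\<^sub>R H x) = (LINT x|lebesgue_on S. \<phi> x *\<^sub>R G x)"
    using test_function_scaleR_integrable[OF p D(2) assms(2)] test_function_scaleR_integrable[OF p H assms(2)]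
    by (intro integral_cong_AE borel_measurable_integrable)
  from eq1 eq2 show "(LINT x|lebesgue_on S. v x *\<^sub>R grad \<phi> x) = - (LINT x|lebesgue_on S. \<phi> x *\<^sub>R H x)"
    using D(3)[OF p] by simp
qed

lemma test_functions_integral_subset:
  fixes g :: "real^'n \<Rightarrow> 'b::euclidean_space"
  assumes "\<phi> \<in> test_functions T" "T \<subseteq> S" "S \<in> sets lebesgue" "T \<in> sets lebesgue"
  shows "(LINT x|lebesgue_on T. \<phi> x *\<^sub>R g x) = (LINT x|lebesgue_on S. \<phi> x *\<^sub>R g x)"
    "(LINT x|lebesgue_on T. u x *\<^sub>R grad \<phi> x) = (LINT x|lebesgue_on S. u x *\<^sub>R grad \<phi> x)"
    "(LINT x|lebesgue_on T. w x \<bullet> grad \<phi> x) = (LINT x|lebesgue_on S. w x \<bullet> grad \<phi> x)"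
proof -
  obtain K where "K \<subseteq> T" "\<And>x. x \<notin> K \<Longrightarrow> \<phi> x = 0" "\<And>x. x \<notin> K \<Longrightarrow> grad \<phi> x = 0"
    using test_functionsE[OF assms(1)] by metis
  then have "\<phi> x = 0" "grad \<phi> x = 0" if "x \<notin> T" for x using that by auto
  then show "(LINT x|lebesgue_on T. \<phi> x *\<^sub>R g x) = (LINT x|lebesgue_on S. \<phi> x *\<^sub>R g x)"
    "(LINT x|lebesgue_on T. u x *\<^sub>R grad \<phi> x) = (LINT x|lebesgue_on S. u x *\<^sub>R grad \<phi> x)"
    "(LINT x|lebesgue_on T. w x \<bullet> grad \<phi> x) = (LINT x|lebesgue_on S. w x \<bullet> grad \<phi> x)"
    using assms(2-4) by (auto intro!: integral_lebesgue_on_support(1))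
qed

lemma is_weak_grad_subset:
  assumes "is_weak_grad S u G" "T \<subseteq> S" "S \<in> sets lebesgue" "T \<in> sets lebesgue"
  shows "is_weak_grad T u G"
  unfolding is_weak_grad_def
proof (intro conjI ballI)
  note D = is_weak_gradD[OF assms(1)]
  show "loc_integrable T u" "loc_integrable T G"
    using D(1,2) loc_integrable_subset[OF _ assms(2)] by blast+
  fix \<phi> assume p: "\<phi> \<in> test_functions T"
  show "(LINT x|lebesgue_on T. u x *\<^sub>R grad \<phi> x) = - (LINT x|lebesgue_on T. \<phi> x *\<^sub>R G x)"
    using D(3)[OF test_functions_mono[OF assms(2) p]]
    by (simp only: test_functions_integral_subset[OF p assms(2-4)])
qed

text \<open>The weak gradient of u is tested with \<eta>\<phi>, whose classical gradient splits into
  the term that is wanted and the one that joins the new gradient.\<close>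

lemma is_weak_grad_mult:
  assumes "is_weak_grad S u G" "smooth \<eta>" "S \<in> sets lebesgue"
  shows "is_weak_grad S (\<lambda>x. \<eta> x * u x) (\<lambda>x. \<eta> x *\<^sub>R G x + u x *\<^sub>R grad \<eta> x)"
  unfolding is_weak_grad_def
proof (intro conjI ballI)
  note D = is_weak_gradD[OF assms(1)]
  have c: "continuous_on UNIV \<eta>" "continuous_on UNIV (grad \<eta>)"
    using assms(2) by (auto intro: smooth_continuous_on smooth_grad_continuous_on)
  have 1: "loc_integrable S (\<lambda>x. \<eta> x *\<^sub>R G x)"
    by (rule loc_integrable_scaleR[OF D(2) c(1) bounded_bilinear_scaleR])
  have 2: "loc_integrable S (\<lambda>x. u x *\<^sub>R grad \<eta> x)"
    by (rule loc_integrable_scaleR[OF D(1) c(2) bounded_bilinear.flip[OF bounded_bilinear_scaleR]])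
  show 3: "loc_integrable S (\<lambda>x. \<eta> x * u x)"
    by (rule loc_integrable_scaleR[OF D(1) c(1) bounded_bilinear_mult])
  show "loc_integrable S (\<lambda>x. \<eta> x *\<^sub>R G x + u x *\<^sub>R grad \<eta> x)" using 1 2 by (rule loc_integrable_add)
  fix \<phi> assume p: "\<phi> \<in> test_functions S"
  have q: "(\<lambda>x. \<eta> x * \<phi> x) \<in> test_functions S" using assms(2) p by (rule test_functions_mult)
  note ps = test_functions_smooth[OF p]
  have i1: "integrable (lebesgue_on S) (\<lambda>x. (\<eta> x * u x) *\<^sub>R grad \<phi> x)"
    by (rule scaleR_grad_integrable[OF p 3 assms(3)])
  have i2: "integrable (lebesgue_on S) (\<lambda>x. \<phi> x *\<^sub>R u x *\<^sub>R grad \<eta> x)"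
    by (rule test_function_scaleR_integrable[OF p 2 assms(3)])
  have i3: "integrable (lebesgue_on S) (\<lambda>x. \<phi> x *\<^sub>R \<eta> x *\<^sub>R G x)"
    by (rule test_function_scaleR_integrable[OF p 1 assms(3)])
  have "(LINT x|lebesgue_on S. u x *\<^sub>R grad (\<lambda>x. \<eta> x * \<phi> x) x)
      = (LINT x|lebesgue_on S. (\<eta> x * u x) *\<^sub>R grad \<phi> x + \<phi> x *\<^sub>R u x *\<^sub>R grad \<eta> x)"
    by (simp add: grad_mult[OF assms(2) ps] scaleR_add_right mult.commute)
  also have "\<dots> = (LINT x|lebesgue_on S. (\<eta> x * u x) *\<^sub>R grad \<phi> x) + (LINT x|lebesgue_on S. \<phi> x *\<^sub>R u x *\<^sub>R grad \<eta> x)"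
    using i1 i2 by simp
  finally have "(LINT x|lebesgue_on S. (\<eta> x * u x) *\<^sub>R grad \<phi> x)
      = - (LINT x|lebesgue_on S. (\<eta> x * \<phi> x) *\<^sub>R G x) - (LINT x|lebesgue_on S. \<phi> x *\<^sub>R u x *\<^sub>R grad \<eta> x)"
    using D(3)[OF q] by (simp add: algebra_simps)
  also have "\<dots> = - (LINT x|lebesgue_on S. \<phi> x *\<^sub>R (\<eta> x *\<^sub>R G x + u x *\<^sub>R grad \<eta> x))"
    using i2 i3 by (simp add: scaleR_add_right mult.commute)
  finally show "(LINT x|lebesgue_on S. (\<eta> x * u x) *\<^sub>R grad \<phi> x)
      = - (LINT x|lebesgue_on S. \<phi> x *\<^sub>R (\<eta> x *\<^sub>R G x + u x *\<^sub>R grad \<eta> x))" .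
qed

lemma loc_integrable_affine:
  fixes f :: "real^'n \<Rightarrow> 'b::euclidean_space"
  assumes "loc_integrable UNIV f" "c \<noteq> 0"
  shows "loc_integrable UNIV (\<lambda>x. f (c *\<^sub>R x + d))"
  unfolding loc_integrable_def
proof (intro allI impI)
  fix K :: "(real^'n) set" assume K: "compact K \<and> K \<subseteq> UNIV"
  then have "compact ((\<lambda>x. c *\<^sub>R x + d) ` K)"
    by (intro compact_continuous_image continuous_intros) auto
  then have "integrable (lebesgue_on ((\<lambda>x. c *\<^sub>R x + d) ` K)) f" using assms(1) by (simp add: loc_integrable_def)
  then show "integrable (lebesgue_on K) (\<lambda>x. f (c *\<^sub>R x + d))"
    using integrable_affine_image[OF assms(2), where S = K and f = f and d = d] K
    by (simp add: lmeasurable_compact fmeasurableD)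
qed

lemma is_weak_grad_affine:
  fixes u :: "real^'n \<Rightarrow> real"
  assumes "is_weak_grad UNIV u G" "c \<noteq> 0"
  shows "is_weak_grad UNIV (\<lambda>x. u (c *\<^sub>R x + d)) (\<lambda>x. c *\<^sub>R G (c *\<^sub>R x + d))"
  unfolding is_weak_grad_def
proof (intro conjI ballI)
  note D = is_weak_gradD[OF assms(1)]
  show "loc_integrable UNIV (\<lambda>x. u (c *\<^sub>R x + d))" "loc_integrable UNIV (\<lambda>x. c *\<^sub>R G (c *\<^sub>R x + d))"
    using D assms(2) by (auto intro!: loc_integrable_scaleR_const loc_integrable_affine)
  fix \<phi> :: "real^'n \<Rightarrow> real" assume p: "\<phi> \<in> test_functions UNIV"
  define \<psi> where "\<psi> = (\<lambda>y. \<phi> ((1 / c) *\<^sub>R y + (- ((1 / c) *\<^sub>R d))))"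
  have t: "\<psi> \<in> test_functions UNIV" unfolding \<psi>_def
    by (rule test_functions_affine[OF p]) (simp add: assms(2))
  have inv: "(1 / c) *\<^sub>R (c *\<^sub>R x + d) + (- ((1 / c) *\<^sub>R d)) = x" for x using assms(2) by (simp add: algebra_simps)
  have g: "grad \<psi> (c *\<^sub>R x + d) = (1 / c) *\<^sub>R grad \<phi> x" for x
    unfolding \<psi>_def grad_affine[OF test_functions_smooth[OF p]] inv ..
  have v: "\<psi> (c *\<^sub>R x + d) = \<phi> x" for x unfolding \<psi>_def inv ..
  have "(LINT x|lebesgue. u x *\<^sub>R grad \<psi> x) = \<bar>c\<bar> ^ CARD('n) *\<^sub>R (LINT x|lebesgue. (1 / c) *\<^sub>R u (c *\<^sub>R x + d) *\<^sub>R grad \<phi> x)"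
    by (subst integral_affine[OF assms(2), of _ d]) (simp add: g mult.commute)
  moreover have "(LINT x|lebesgue. \<psi> x *\<^sub>R G x) = \<bar>c\<bar> ^ CARD('n) *\<^sub>R (LINT x|lebesgue. (1 / c) *\<^sub>R \<phi> x *\<^sub>R c *\<^sub>R G (c *\<^sub>R x + d))"
    using assms(2) by (subst integral_affine[OF assms(2), of _ d]) (simp add: v)
  ultimately have "\<bar>c\<bar> ^ CARD('n) *\<^sub>R (1 / c) *\<^sub>R (LINT x|lebesgue. u (c *\<^sub>R x + d) *\<^sub>R grad \<phi> x)
      = \<bar>c\<bar> ^ CARD('n) *\<^sub>R (1 / c) *\<^sub>R (- (LINT x|lebesgue. \<phi> x *\<^sub>R c *\<^sub>R G (c *\<^sub>R x + d)))"
    using D(3)[OF t] unfolding lebesgue_on_UNIV_eq integral_scaleR_right by simp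
  then show "(LINT x|lebesgue_on UNIV. u (c *\<^sub>R x + d) *\<^sub>R grad \<phi> x)
      = - (LINT x|lebesgue_on UNIV. \<phi> x *\<^sub>R c *\<^sub>R G (c *\<^sub>R x + d))"
    using assms(2) by (simp add: lebesgue_on_UNIV_eq del: scaleR_minus_right)
qed

lemma weak_grad_is_weak_grad: "is_weak_grad S u G \<Longrightarrow> is_weak_grad S u (weak_grad S u)"
  unfolding weak_grad_def by (rule someI[of "is_weak_grad S u"])

lemma weak_grad_AE: "open S \<Longrightarrow> is_weak_grad S u G \<Longrightarrow> AE x in lebesgue_on S. weak_grad S u x = G x"
  using is_weak_grad_unique[OF _ weak_grad_is_weak_grad] by blast

subsection \<open>Sobolev spaces\<close>

lemma H12I: "u \<in> L2 S \<Longrightarrow> G \<in> L2 S \<Longrightarrow> is_weak_grad S u G \<Longrightarrow> u \<in> H12 S"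
  by (auto simp: H12_def)

lemma H12D:
  assumes "u \<in> H12 S" "open S"
  shows "u \<in> L2 S" "weak_grad S u \<in> L2 S" "is_weak_grad S u (weak_grad S u)"
proof -
  obtain G where G: "u \<in> L2 S" "G \<in> L2 S" "is_weak_grad S u G" using assms(1) by (auto simp: H12_def)
  show "u \<in> L2 S" "is_weak_grad S u (weak_grad S u)" using G weak_grad_is_weak_grad by auto
  have "AE x in lebesgue_on S. G x = weak_grad S u x"
    using weak_grad_AE[OF assms(2) G(3)] by eventually_elim simp
  then show "weak_grad S u \<in> L2 S" using G(2) L2_cong_AE open_sets_lebesgue[OF assms(2)] by blast
qed

lemma sqn_weak_grad:
  assumes "open S" "is_weak_grad S u G" "G \<in> L2 S"
  shows "sqn S (weak_grad S u) = sqn S G"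
proof -
  have "AE x in lebesgue_on S. G x = weak_grad S u x"
    using weak_grad_AE[OF assms(1,2)] by eventually_elim simp
  from sqn_cong_AE[OF assms(3) open_sets_lebesgue[OF assms(1)] this] show ?thesis by simp
qed

lemma H12_norm_power2: "(H12_norm S u)\<^sup>2 = sqn S u + sqn S (weak_grad S u)"
  by (simp add: H12_norm_def L2_norm_power2)

lemma H12_norm_nonneg: "0 \<le> H12_norm S u"
  by (simp add: H12_norm_def)

lemma H12_0D:
  assumes "u \<in> H12_0 S" "open S" "e > 0"
  obtains \<phi> where "\<phi> \<in> test_functions S" "sqn S (\<lambda>x. u x - \<phi> x) < e"
    "sqn S (\<lambda>x. weak_grad S u x - grad \<phi> x) < e"
proof -
  have u: "u \<in> H12 S" using assms(1) by (auto simp: H12_0_def)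
  note D = H12D[OF u assms(2)] and S = open_sets_lebesgue[OF assms(2)]
  obtain \<phi> where p: "\<phi> \<in> test_functions S" "H12_norm S (\<lambda>x. u x - \<phi> x) < sqrt e"
    using assms(1) real_sqrt_gt_zero[OF assms(3)] unfolding H12_0_def by blast
  have "is_weak_grad S (\<lambda>x. u x - \<phi> x) (\<lambda>x. weak_grad S u x - grad \<phi> x)"
    by (intro is_weak_grad_diff D is_weak_grad_smooth test_functions_smooth[OF p(1)] S)
  moreover have "(\<lambda>x. weak_grad S u x - grad \<phi> x) \<in> L2 S"
    by (intro L2_diff D test_functions_L2[OF p(1) S])
  ultimately have "(H12_norm S (\<lambda>x. u x - \<phi> x))\<^sup>2 = sqn S (\<lambda>x. u x - \<phi> x) + sqn S (\<lambda>x. weak_grad S u x - grad \<phi> x)"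
    unfolding H12_norm_power2 using sqn_weak_grad[OF assms(2)] by simp
  moreover have "(H12_norm S (\<lambda>x. u x - \<phi> x))\<^sup>2 < (sqrt e)\<^sup>2"
    using p(2) H12_norm_nonneg by (intro power_strict_mono) auto
  ultimately have *: "sqn S (\<lambda>x. u x - \<phi> x) + sqn S (\<lambda>x. weak_grad S u x - grad \<phi> x) < e" using assms(3) by simp
  show thesis
    by (rule that[OF p(1)])
      (use * sqn_nonneg[of S "\<lambda>x. u x - \<phi> x"] sqn_nonneg[of S "\<lambda>x. weak_grad S u x - grad \<phi> x"] in linarith)+
qed

text \<open>Any square-integrable representative G of the gradient may be used here, whereas
  \<open>H12_norm\<close> refers to the one selected by \<open>weak_grad\<close>; the two agree
  almost everywhere.\<close>

lemma H12_0I: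
  assumes "open S" "u \<in> L2 S" "G \<in> L2 S" "is_weak_grad S u G"
    and "\<And>e. e > 0 \<Longrightarrow> \<exists>\<phi>\<in>test_functions S. sqn S (\<lambda>x. u x - \<phi> x) < e \<and> sqn S (\<lambda>x. G x - grad \<phi> x) < e"
  shows "u \<in> H12_0 S"
proof -
  note S = open_sets_lebesgue[OF assms(1)]
  have "\<exists>\<phi>\<in>test_functions S. H12_norm S (\<lambda>x. u x - \<phi> x) < e" if "e > 0" for e
  proof -
    have e2: "0 < e\<^sup>2 / 2" using that by simp
    obtain \<phi> where p: "\<phi> \<in> test_functions S" "sqn S (\<lambda>x. u x - \<phi> x) < e\<^sup>2 / 2" "sqn S (\<lambda>x. G x - grad \<phi> x) < e\<^sup>2 / 2"
      using assms(5)[OF e2] by blast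
    have w: "is_weak_grad S (\<lambda>x. u x - \<phi> x) (\<lambda>x. G x - grad \<phi> x)"
      by (intro is_weak_grad_diff assms is_weak_grad_smooth test_functions_smooth[OF p(1)] S)
    have l: "(\<lambda>x. G x - grad \<phi> x) \<in> L2 S"
      by (intro L2_diff assms test_functions_L2[OF p(1) S])
    have "(H12_norm S (\<lambda>x. u x - \<phi> x))\<^sup>2 < e\<^sup>2"
      unfolding H12_norm_power2 sqn_weak_grad[OF assms(1) w l] using p(2,3) by simp
    then have "H12_norm S (\<lambda>x. u x - \<phi> x) < e" using that power2_less_imp_less by (metis less_imp_le)
    with p(1) show ?thesis by blast
  qed
  with assms show ?thesis by (auto simp: H12_0_def intro: H12I)
qed

lemma H12_0_H12: "u \<in> H12_0 S \<Longrightarrow> u \<in> H12 S"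
  by (simp add: H12_0_def)

lemma test_functions_H12_0:
  assumes "\<phi> \<in> test_functions S" "open S" shows "\<phi> \<in> H12_0 S"
  using assms open_sets_lebesgue[OF assms(2)]
  by (intro H12_0I[of S \<phi> "grad \<phi>"] test_functions_L2 is_weak_grad_smooth test_functions_smooth)
    (auto intro!: bexI[of _ \<phi>])

lemma H12_0_diff:
  assumes "u \<in> H12_0 S" "v \<in> H12_0 S" "open S" shows "(\<lambda>x. u x - v x) \<in> H12_0 S"
proof (rule H12_0I[OF assms(3)])
  note S = open_sets_lebesgue[OF assms(3)]
  note Du = H12D[OF H12_0_H12[OF assms(1)] assms(3)] and Dv = H12D[OF H12_0_H12[OF assms(2)] assms(3)]
  show "(\<lambda>x. u x - v x) \<in> L2 S" "(\<lambda>x. weak_grad S u x - weak_grad S v x) \<in> L2 S"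
    "is_weak_grad S (\<lambda>x. u x - v x) (\<lambda>x. weak_grad S u x - weak_grad S v x)"
    by (intro L2_diff is_weak_grad_diff Du Dv S)+
  fix e :: real assume e: "e > 0"
  obtain \<phi> where p: "\<phi> \<in> test_functions S" "sqn S (\<lambda>x. u x - \<phi> x) < e / 4" "sqn S (\<lambda>x. weak_grad S u x - grad \<phi> x) < e / 4"
    using H12_0D[OF assms(1,3), of "e / 4"] e by auto
  obtain \<psi> where q: "\<psi> \<in> test_functions S" "sqn S (\<lambda>x. v x - \<psi> x) < e / 4" "sqn S (\<lambda>x. weak_grad S v x - grad \<psi> x) < e / 4"
    using H12_0D[OF assms(2,3), of "e / 4"] e by auto
  have t: "(\<lambda>x. \<phi> x - \<psi> x) \<in> test_functions S"
    using test_functions_add[OF p(1) test_functions_cmult[OF q(1), of "-1"]] by simp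
  have "sqn S (\<lambda>x. (u x - \<phi> x) - (v x - \<psi> x)) \<le> 2 * sqn S (\<lambda>x. u x - \<phi> x) + 2 * sqn S (\<lambda>x. v x - \<psi> x)"
    by (intro sqn_diff_le L2_diff Du Dv test_functions_L2[OF p(1) S] test_functions_L2[OF q(1) S])
  then have 1: "sqn S (\<lambda>x. (u x - v x) - (\<phi> x - \<psi> x)) < e"
    using p(2) q(2) by (simp add: algebra_simps)
  have "sqn S (\<lambda>x. (weak_grad S u x - grad \<phi> x) - (weak_grad S v x - grad \<psi> x))
      \<le> 2 * sqn S (\<lambda>x. weak_grad S u x - grad \<phi> x) + 2 * sqn S (\<lambda>x. weak_grad S v x - grad \<psi> x)"
    by (intro sqn_diff_le L2_diff Du Dv test_functions_L2[OF p(1) S] test_functions_L2[OF q(1) S])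
  then have 2: "sqn S (\<lambda>x. (weak_grad S u x - weak_grad S v x) - grad (\<lambda>x. \<phi> x - \<psi> x) x) < e"
    using p(3) q(3) test_functions_smooth[OF p(1)] test_functions_smooth[OF q(1)]
    by (simp add: grad_diff algebra_simps)
  show "\<exists>\<phi>\<in>test_functions S. sqn S (\<lambda>x. u x - v x - \<phi> x) < e \<and>
      sqn S (\<lambda>x. weak_grad S u x - weak_grad S v x - grad \<phi> x) < e"
    by (intro bexI[OF _ t] conjI 1 2)
qed

subsection \<open>Mollification\<close>

definition conv :: "(real^'n \<Rightarrow> real) \<Rightarrow> (real^'n \<Rightarrow> real) \<Rightarrow> real^'n \<Rightarrow> real" where
  "conv g \<rho> x = (LINT y|lebesgue. g y * \<rho> (x - y))"

lemma test_functions_reflect: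
  assumes "\<rho> \<in> test_functions UNIV"
  shows "(\<lambda>y. \<rho> (x - y)) \<in> test_functions UNIV" "grad (\<lambda>y. \<rho> (x - y)) y = - grad \<rho> (x - y)"
proof -
  have e: "(-1) *\<^sub>R z + x = x - z" for z by simp
  show "(\<lambda>y. \<rho> (x - y)) \<in> test_functions UNIV" "grad (\<lambda>y. \<rho> (x - y)) y = - grad \<rho> (x - y)"
    using test_functions_affine[OF assms, of "-1" x] grad_affine[OF test_functions_smooth[OF assms], of "-1" x y]
    unfolding e by simp_all
qed

lemma conv_integrable:
  assumes "\<rho> \<in> test_functions UNIV" "integrable lebesgue g"
  shows "integrable lebesgue (\<lambda>y. g y * \<rho> (x - y))" "integrable lebesgue (\<lambda>y. g y *\<^sub>R grad \<rho> (x - y))"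
proof -
  note t = test_functions_reflect[OF assms(1), of x]
  have l: "loc_integrable UNIV g" using assms(2) integrable_lebesgue_on_subset[of _ UNIV g]
    by (auto simp: loc_integrable_def lebesgue_on_UNIV_eq lmeasurable_compact fmeasurableD)
  show "integrable lebesgue (\<lambda>y. g y * \<rho> (x - y))"
    using test_function_scaleR_integrable[OF t(1) l] by (simp add: lebesgue_on_UNIV_eq mult.commute)
  show "integrable lebesgue (\<lambda>y. g y *\<^sub>R grad \<rho> (x - y))"
    using scaleR_grad_integrable[OF t(1) l] by (simp add: lebesgue_on_UNIV_eq t(2))
qed

lemma has_derivative_quadratic:
  fixes f :: "'a::real_normed_vector \<Rightarrow> real"
  assumes "bounded_linear D" "\<And>k. \<bar>f (x + k) - f x - D k\<bar> \<le> C * (norm k)\<^sup>2"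
  shows "(f has_derivative D) (at x)"
  unfolding has_derivative_at
proof (intro conjI assms(1))
  show "(\<lambda>h. norm (f (x + h) - f x - D h) / norm h) \<midarrow>0\<rightarrow> 0"
  proof (rule Lim_null_comparison)
    show "\<forall>\<^sub>F h in at 0. norm (norm (f (x + h) - f x - D h) / norm h) \<le> C * norm h"
      using assms(2) unfolding eventually_at_filter
      by (intro always_eventually) (auto simp: divide_le_eq power2_eq_square mult.assoc)
    show "(\<lambda>h. C * norm h) \<midarrow>0\<rightarrow> 0" by (auto intro!: tendsto_eq_intros)
  qed
qed

text \<open>The quadratic remainder of the kernel is uniform, so its integral against |g| is still
  quadratic in the increment. This is differentiation under the integral sign.\<close>

lemma conv_has_derivative:
  assumes "\<rho> \<in> test_functions UNIV" "integrable lebesgue g"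
  shows "(conv g \<rho> has_derivative (\<lambda>h. (LINT y|lebesgue. g y *\<^sub>R grad \<rho> (x - y)) \<bullet> h)) (at x)"
proof -
  obtain C where C: "C > 0" "\<And>x k. \<bar>\<rho> (x + k) - \<rho> x - grad \<rho> x \<bullet> k\<bar> \<le> C * (norm k)\<^sup>2"
    using test_functions_taylor[OF assms(1)] by metis
  show ?thesis
  proof (rule has_derivative_quadratic[where C = "C * (LINT y|lebesgue. \<bar>g y\<bar>)"])
    fix k
    note i = conv_integrable[OF assms]
    have i3: "integrable lebesgue (\<lambda>y. g y * (grad \<rho> (x - y) \<bullet> k))"
      using integrable_inner_left[OF i(2)[of x], of k] by simp
    have e: "conv g \<rho> (x + k) - conv g \<rho> x - (LINT y|lebesgue. g y *\<^sub>R grad \<rho> (x - y)) \<bullet> k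
      = (LINT y|lebesgue. g y * \<rho> (x + k - y) - g y * \<rho> (x - y) - g y * (grad \<rho> (x - y) \<bullet> k))"
      unfolding conv_def using i(1)[of "x + k"] i(1)[of x] i(2)[of x] i3
      by (subst Bochner_Integration.integral_diff, simp, simp)
        (subst Bochner_Integration.integral_diff, simp, simp, simp flip: integral_inner_left)
    have "\<bar>conv g \<rho> (x + k) - conv g \<rho> x - (LINT y|lebesgue. g y *\<^sub>R grad \<rho> (x - y)) \<bullet> k\<bar>
        \<le> (LINT y|lebesgue. \<bar>g y * \<rho> (x + k - y) - g y * \<rho> (x - y) - g y * (grad \<rho> (x - y) \<bullet> k)\<bar>)"
      unfolding e using integral_norm_bound[of lebesgue "\<lambda>y. g y * \<rho> (x + k - y) - g y * \<rho> (x - y) - g y * (grad \<rho> (x - y) \<bullet> k)"]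
      by simp
    also have "\<dots> \<le> (LINT y|lebesgue. C * (norm k)\<^sup>2 * \<bar>g y\<bar>)"
    proof (rule integral_mono)
      show "integrable lebesgue (\<lambda>y. \<bar>g y * \<rho> (x + k - y) - g y * \<rho> (x - y) - g y * (grad \<rho> (x - y) \<bullet> k)\<bar>)"
        using i(1)[of "x + k"] i(1)[of x] i3 by (intro integrable_abs Bochner_Integration.integrable_diff)
      show "integrable lebesgue (\<lambda>y. C * (norm k)\<^sup>2 * \<bar>g y\<bar>)" using assms(2) by auto
      fix y
      have "\<bar>g y * \<rho> (x + k - y) - g y * \<rho> (x - y) - g y * (grad \<rho> (x - y) \<bullet> k)\<bar>
          = \<bar>g y\<bar> * \<bar>\<rho> ((x - y) + k) - \<rho> (x - y) - grad \<rho> (x - y) \<bullet> k\<bar>"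
        unfolding abs_mult[symmetric] by (simp add: algebra_simps)
      also have "\<dots> \<le> \<bar>g y\<bar> * (C * (norm k)\<^sup>2)" by (intro mult_left_mono C) auto
      finally show "\<bar>g y * \<rho> (x + k - y) - g y * \<rho> (x - y) - g y * (grad \<rho> (x - y) \<bullet> k)\<bar> \<le> C * (norm k)\<^sup>2 * \<bar>g y\<bar>"
        by (simp add: mult_ac)
    qed
    finally show "\<bar>conv g \<rho> (x + k) - conv g \<rho> x - (LINT y|lebesgue. g y *\<^sub>R grad \<rho> (x - y)) \<bullet> k\<bar>
        \<le> C * (LINT y|lebesgue. \<bar>g y\<bar>) * (norm k)\<^sup>2" by (simp add: mult_ac)
  qed (rule bounded_linear_inner_right)
qed

lemma grad_conv:
  assumes "\<rho> \<in> test_functions UNIV" "integrable lebesgue g"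
  shows "grad (conv g \<rho>) x = (LINT y|lebesgue. g y *\<^sub>R grad \<rho> (x - y))"
    and "grad (conv g \<rho>) x $ i = conv g (\<lambda>y. grad \<rho> y $ i) x"
proof -
  show 1: "grad (conv g \<rho>) x = (LINT y|lebesgue. g y *\<^sub>R grad \<rho> (x - y))"
    by (rule grad_eqI[OF conv_has_derivative[OF assms]])
  have "grad (conv g \<rho>) x $ i = (LINT y|lebesgue. g y *\<^sub>R grad \<rho> (x - y)) \<bullet> axis i 1"
    by (simp add: 1 inner_axis)
  also have "\<dots> = (LINT y|lebesgue. (g y *\<^sub>R grad \<rho> (x - y)) \<bullet> axis i 1)"
    using conv_integrable(2)[OF assms] by (intro integral_inner_left[symmetric])
  finally show "grad (conv g \<rho>) x $ i = conv g (\<lambda>y. grad \<rho> y $ i) x" by (simp add: conv_def inner_axis)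
qed

lemma smooth_conv:
  assumes "\<rho> \<in> test_functions UNIV" "integrable lebesgue g"
  shows "smooth (conv g \<rho>)"
proof (rule smooth_coinduct[where S = "conv g ` test_functions UNIV"])
  fix \<phi> i x assume "\<phi> \<in> conv g ` test_functions UNIV"
  then obtain \<rho> where r: "\<phi> = conv g \<rho>" "\<rho> \<in> test_functions UNIV" by auto
  show "\<phi> differentiable (at x)"
    using conv_has_derivative[OF r(2) assms(2)] unfolding r(1) differentiable_def by blast
  have "(\<lambda>x. grad \<phi> x $ i) = conv g (\<lambda>y. grad \<rho> y $ i)"
    by (simp add: r(1) fun_eq_iff grad_conv(2)[OF r(2) assms(2)])
  then show "(\<lambda>x. grad \<phi> x $ i) \<in> conv g ` test_functions UNIV"
    using test_functions_grad[OF r(2)] by blast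
qed (use assms in blast)

lemma conv_eq_0:
  assumes "\<And>y. y \<notin> K \<Longrightarrow> g y = 0" "\<And>y. norm y > r \<Longrightarrow> \<rho> y = 0" "\<And>y. y \<in> K \<Longrightarrow> dist x y > r"
  shows "conv g \<rho> x = 0"
proof -
  have "(\<lambda>y. g y * \<rho> (x - y)) = (\<lambda>y. 0)"
  proof
    show "g y * \<rho> (x - y) = 0" for y using assms by (cases "y \<in> K") (auto simp: dist_norm)
  qed
  then show ?thesis by (simp add: conv_def)
qed

lemma conv_test_function:
  fixes g :: "real^'n \<Rightarrow> real"
  assumes "\<rho> \<in> test_functions UNIV" "integrable lebesgue g" "compact K" "\<And>y. y \<notin> K \<Longrightarrow> g y = 0"
    "\<And>y. norm y > r \<Longrightarrow> \<rho> y = 0" "\<And>x y. y \<in> K \<Longrightarrow> dist x y \<le> r \<Longrightarrow> x \<in> S"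
  shows "conv g \<rho> \<in> test_functions S"
proof (rule test_functionsI)
  let ?L = "{y + z | y z. y \<in> K \<and> z \<in> cball 0 r}"
  show "smooth (conv g \<rho>)" using assms(1,2) by (rule smooth_conv)
  show "compact ?L" using assms(3) by (intro compact_sums) auto
  show "?L \<subseteq> S"
  proof clarify
    fix y z :: "real^'n" assume yz: "y \<in> K" "z \<in> cball 0 r"
    show "y + z \<in> S" by (rule assms(6)[OF yz(1)]) (use yz(2) in \<open>simp add: dist_norm\<close>)
  qed
  show "conv g \<rho> x = 0" if "x \<notin> ?L" for x
  proof (rule conv_eq_0[OF assms(4,5)])
    fix y assume y: "y \<in> K"
    show "dist x y > r"
    proof (rule ccontr)
      assume "\<not> dist x y > r"
      then have "x - y \<in> cball 0 r" by (simp add: dist_norm norm_minus_commute)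
      with y have "x \<in> ?L" by (intro CollectI exI[of _ y] exI[of _ "x - y"]) simp
      with that show False by contradiction
    qed
  qed
qed

text \<open>The reflected kernel is a test function in y. The sign from the reflection cancels the
  sign in the definition of the weak gradient, so mollification commutes with the weak
  derivative.\<close>

lemma grad_conv_weak:
  assumes "\<rho> \<in> test_functions UNIV" "integrable lebesgue V" "integrable lebesgue G" "is_weak_grad UNIV V G"
  shows "grad (conv V \<rho>) x $ i = conv (\<lambda>y. G y $ i) \<rho> x"
proof -
  note t = test_functions_reflect[OF assms(1), of x]
  have l: "loc_integrable UNIV G" using is_weak_gradD(2)[OF assms(4)] .
  have "(LINT y|lebesgue. V y *\<^sub>R grad (\<lambda>y. \<rho> (x - y)) y) = - (LINT y|lebesgue. \<rho> (x - y) *\<^sub>R G y)"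
    using is_weak_gradD(3)[OF assms(4) t(1)] by (simp add: lebesgue_on_UNIV_eq)
  then have "grad (conv V \<rho>) x = (LINT y|lebesgue. \<rho> (x - y) *\<^sub>R G y)"
    unfolding grad_conv(1)[OF assms(1,2)] by (simp add: t(2))
  then have "grad (conv V \<rho>) x $ i = (LINT y|lebesgue. \<rho> (x - y) *\<^sub>R G y) \<bullet> axis i 1" by (simp add: inner_axis)
  also have "\<dots> = (LINT y|lebesgue. (\<rho> (x - y) *\<^sub>R G y) \<bullet> axis i 1)"
    using test_function_scaleR_integrable[OF t(1) l] by (intro integral_inner_left[symmetric]) (simp add: lebesgue_on_UNIV_eq)
  finally show ?thesis by (simp add: conv_def inner_axis mult.commute)
qed

section \<open>Mollifiers and approximation in L2\<close>

lemma mollifier_exists: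
  assumes "r > 0"
  obtains \<rho> :: "real^'n \<Rightarrow> real" where "\<rho> \<in> test_functions UNIV" "\<And>x. 0 \<le> \<rho> x"
    "\<And>x. norm x > r \<Longrightarrow> \<rho> x = 0" "(LINT x|lebesgue. \<rho> x) = 1"
proof -
  \<comment> \<open>The Euclidean norm is at most the sum of the moduli of the coordinates, so the
    cube of half side s lies in the ball of radius r.\<close>
  define s where "s = r / real CARD('n)"
  have s: "s > 0" using assms by (simp add: s_def)
  define b :: "real^'n \<Rightarrow> real" where "b = bump 1 (\<chi> i. - s) (\<chi> i. s)"
  have t: "b \<in> test_functions UNIV" unfolding b_def by (rule bump_test_function) auto
  have nn: "0 \<le> b x" for x by (simp add: b_def bump_nonneg)
  have i: "integrable lebesgue b" using test_functions_integrable(1)[OF t, of UNIV] by (simp add: lebesgue_on_UNIV_eq)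
  have z: "b x = 0" if "norm x > r" for x
  proof -
    have "x \<notin> box (\<chi> i. - s) (\<chi> i. s)"
    proof
      assume "x \<in> box (\<chi> i. - s) (\<chi> i. s)"
      then have "\<bar>x $ i\<bar> \<le> s" for i by (auto simp: mem_box_cart abs_le_iff dest!: spec[of _ i])
      then have "norm x \<le> (\<Sum>i\<in>(UNIV :: 'n set). s)"
        using norm_le_l1_cart[of x] by (meson order_trans sum_mono)
      with that show False by (simp add: s_def)
    qed
    then show ?thesis by (simp add: b_def bump_eq_0)
  qed
  have "(LINT x|lebesgue. b x) \<noteq> 0"
  proof
    assume "(LINT x|lebesgue. b x) = 0"
    then have "AE x in lebesgue. b x = 0" using integral_nonneg_eq_0_iff_AE[OF i] nn by simp
    then have "AE x::real^'n in lebesgue. x \<notin> box (\<chi> i. - s) (\<chi> i. s)"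
    proof eventually_elim
      case (elim x)
      then show ?case using bump_pos[of 1 x "\<chi> i. - s" "\<chi> i. s"] by (auto simp: b_def)
    qed
    then have "box (\<chi> i. - s) (\<chi> i. s) \<in> null_sets (lebesgue :: (real^'n) measure)"
      by (subst AE_iff_null_sets) (auto intro: open_sets_lebesgue)
    then have "negligible (box (\<chi> i. - s) (\<chi> i. s) :: (real^'n) set)" by (simp add: negligible_iff_null_sets)
    then have "box (\<chi> i. - s) (\<chi> i. s) = ({} :: (real^'n) set)" using open_not_negligible open_box by blast
    moreover have "(0 :: real^'n) \<in> box (\<chi> i. - s) (\<chi> i. s)" using s by (simp add: mem_box_cart)
    ultimately show False by blast
  qed
  then have p: "(LINT x|lebesgue. b x) > 0" using integral_nonneg_AE[of b lebesgue] nn by (simp add: order_less_le)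
  define c where "c = 1 / (LINT x|lebesgue. b x)"
  have c: "c > 0" "c * (LINT x|lebesgue. b x) = 1" using p by (simp_all add: c_def)
  show thesis
  proof (rule that[of "\<lambda>x. c * b x"])
    show "(\<lambda>x. c * b x) \<in> test_functions UNIV" using t by (rule test_functions_cmult)
    show "0 \<le> c * b x" for x using c(1) nn by simp
    show "c * b x = 0" if "norm x > r" for x using z[OF that] by simp
    show "(LINT x|lebesgue. c * b x) = 1" using c(2) by simp
  qed
qed

lemma integral_reflect:
  fixes f :: "real^'n \<Rightarrow> 'b::{banach, second_countable_topology}"
  shows "(LINT y|lebesgue. f (x - y)) = (LINT y|lebesgue. f y)"
proof -
  have e: "(-1) *\<^sub>R z + x = x - z" for z by simp
  show ?thesis using integral_affine[of "-1" f x] unfolding e by simp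
qed

text \<open>Jensen for the probability density \<rho>(x - y): the kernel is written as a product of
  two square roots and Cauchy-Schwarz is applied.\<close>

lemma conv_power2_le:
  assumes "\<rho> \<in> test_functions UNIV" "\<And>x. 0 \<le> \<rho> x" "(LINT x|lebesgue. \<rho> x) = 1" "g \<in> L2 UNIV"
  shows "(conv g \<rho> x)\<^sup>2 \<le> (LINT y|lebesgue. (g y)\<^sup>2 * \<rho> (x - y))" "integrable lebesgue (\<lambda>y. (g y)\<^sup>2 * \<rho> (x - y))"
proof -
  note t = test_functions_reflect(1)[OF assms(1), of x]
  obtain B where B: "\<And>x. \<bar>\<rho> x\<bar> \<le> B" using test_functions_bounded[OF assms(1)] by metis
  have m: "(\<lambda>y. sqrt (\<rho> (x - y))) \<in> borel_measurable (lebesgue_on UNIV)"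
    using smooth_measurable(1)[OF test_functions_smooth[OF t]] by measurable
  have f: "(\<lambda>y. g y * sqrt (\<rho> (x - y))) \<in> L2 UNIV"
  proof (rule L2_bound[OF _ assms(4)])
    show "(\<lambda>y. g y * sqrt (\<rho> (x - y))) \<in> borel_measurable (lebesgue_on UNIV)"
      using m L2_measurable[OF assms(4)] by (intro borel_measurable_times)
    have "norm (g y * sqrt (\<rho> (x - y))) \<le> sqrt B * norm (g y)" for y
    proof -
      have "\<rho> (x - y) \<le> B" using B[of "x - y"] by simp
      then have "sqrt (\<rho> (x - y)) * \<bar>g y\<bar> \<le> sqrt B * \<bar>g y\<bar>" by (intro mult_right_mono) auto
      then show ?thesis using assms(2)[of "x - y"] by (simp add: abs_mult mult.commute)
    qed
    then show "AE y in lebesgue_on UNIV. norm (g y * sqrt (\<rho> (x - y))) \<le> sqrt B * norm (g y)"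
      by (intro AE_I2)
  qed
  have h: "(\<lambda>y. sqrt (\<rho> (x - y))) \<in> L2 UNIV"
    unfolding L2_def using m test_functions_integrable(1)[OF t, of UNIV] assms(2) by simp
  have fs: "(norm (g y * sqrt (\<rho> (x - y))))\<^sup>2 = (g y)\<^sup>2 * \<rho> (x - y)" for y
    using assms(2) by (simp add: power_mult_distrib abs_mult)
  show "integrable lebesgue (\<lambda>y. (g y)\<^sup>2 * \<rho> (x - y))"
    using L2_integrable_sq[OF f] unfolding fs by (simp add: lebesgue_on_UNIV_eq)
  have e: "g y * sqrt (\<rho> (x - y)) * sqrt (\<rho> (x - y)) = g y * \<rho> (x - y)" for y
    using assms(2) by (simp add: mult.assoc)
  have "\<bar>conv g \<rho> x\<bar> \<le> L2_norm UNIV (\<lambda>y. g y * sqrt (\<rho> (x - y))) * L2_norm UNIV (\<lambda>y. sqrt (\<rho> (x - y)))"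
    using L2_Cauchy_Schwarz[OF f h] by (simp add: e conv_def lebesgue_on_UNIV_eq)
  also have "L2_norm UNIV (\<lambda>y. sqrt (\<rho> (x - y))) = 1"
    using assms(2,3) integral_reflect[of \<rho> x] by (simp add: L2_norm_def lebesgue_on_UNIV_eq)
  finally have "\<bar>conv g \<rho> x\<bar>\<^sup>2 \<le> (L2_norm UNIV (\<lambda>y. g y * sqrt (\<rho> (x - y))))\<^sup>2" by (intro power_mono) auto
  then show "(conv g \<rho> x)\<^sup>2 \<le> (LINT y|lebesgue. (g y)\<^sup>2 * \<rho> (x - y))"
    unfolding L2_norm_power2 fs by (simp add: lebesgue_on_UNIV_eq)
qed

text \<open>The pointwise Jensen bound is integrated over x; after Tonelli the kernel integrates to
  1. Contraction in L2 lets the approximation be proved for continuous functions only.\<close>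

lemma conv_L2:
  fixes g :: "real^'n \<Rightarrow> real"
  assumes "\<rho> \<in> test_functions UNIV" "\<And>x. 0 \<le> \<rho> x" "(LINT x|lebesgue. \<rho> x) = 1" "g \<in> L2 UNIV" "integrable lebesgue g"
  shows "conv g \<rho> \<in> L2 UNIV" "sqn UNIV (conv g \<rho>) \<le> sqn UNIV g"
proof -
  have gi: "integrable lebesgue (\<lambda>x. (g x)\<^sup>2)" using L2_integrable_sq[OF assms(4)] by (simp add: lebesgue_on_UNIV_eq)
  \<comment> \<open>Tonelli is applied to Borel functions on the product space, so g is replaced by
    a Borel function equal to it almost everywhere.\<close>
  obtain g' where g' [measurable]: "g' \<in> borel_measurable lborel" and ae: "AE x in lborel. g x = g' x"
    using completion_ex_borel_measurable_real[OF borel_measurable_integrable[OF assms(5)]] by blast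
  have rc: "continuous_on UNIV \<rho>" using assms(1) test_functions_smooth smooth_continuous_on by blast
  then have rb [measurable]: "\<rho> \<in> borel_measurable borel" by (rule borel_measurable_continuous_onI)
  have cm: "conv g \<rho> \<in> borel_measurable lebesgue"
    using smooth_measurable(1)[OF smooth_conv[OF assms(1,5)], of UNIV] by (simp add: lebesgue_on_UNIV_eq)
  have "(\<integral>\<^sup>+x. ennreal ((conv g \<rho> x)\<^sup>2) \<partial>lebesgue) \<le> (\<integral>\<^sup>+x. \<integral>\<^sup>+y. ennreal ((g' y)\<^sup>2 * \<rho> (x - y)) \<partial>lborel \<partial>lborel)"
    unfolding nn_integral_completion
  proof (rule nn_integral_mono)
    fix x
    have "ennreal ((conv g \<rho> x)\<^sup>2) \<le> ennreal (LINT y|lebesgue. (g y)\<^sup>2 * \<rho> (x - y))"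
      by (intro ennreal_leI conv_power2_le assms)
    also have "\<dots> = (\<integral>\<^sup>+y. ennreal ((g y)\<^sup>2 * \<rho> (x - y)) \<partial>lebesgue)"
      using conv_power2_le(2)[OF assms(1-4)] assms(2) by (intro nn_integral_eq_integral[symmetric]) auto
    also have "\<dots> = (\<integral>\<^sup>+y. ennreal ((g' y)\<^sup>2 * \<rho> (x - y)) \<partial>lborel)"
      unfolding nn_integral_completion using ae by (intro nn_integral_cong_AE, eventually_elim) simp
    finally show "ennreal ((conv g \<rho> x)\<^sup>2) \<le> (\<integral>\<^sup>+y. ennreal ((g' y)\<^sup>2 * \<rho> (x - y)) \<partial>lborel)" .
  qed
  also have "\<dots> = (\<integral>\<^sup>+y. \<integral>\<^sup>+x. ennreal ((g' y)\<^sup>2 * \<rho> (x - y)) \<partial>lborel \<partial>lborel)"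
  proof (rule lborel_pair.Fubini')
    have "(\<lambda>p :: (real^'n) \<times> (real^'n). \<rho> (snd p - fst p)) \<in> borel_measurable borel"
      by (intro borel_measurable_continuous_onI continuous_on_compose2[OF rc] continuous_intros) auto
    then have [measurable]: "(\<lambda>p :: (real^'n) \<times> (real^'n). \<rho> (snd p - fst p)) \<in> borel_measurable (lborel \<Otimes>\<^sub>M lborel)"
      by (simp add: lborel_prod)
    show "(\<lambda>(y, x). ennreal ((g' y)\<^sup>2 * \<rho> (x - y))) \<in> borel_measurable (lborel \<Otimes>\<^sub>M lborel)"
      unfolding case_prod_beta by measurable
  qed
  also have "\<dots> = (\<integral>\<^sup>+y. ennreal ((g' y)\<^sup>2) \<partial>lborel)"
  proof (rule nn_integral_cong)
    fix y
    have ri: "integrable lebesgue (\<lambda>x. \<rho> (x - y))" "(LINT x|lebesgue. \<rho> (x - y)) = 1"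
      using integrable_affineI[of 1 \<rho> "- y"] test_functions_integrable(1)[OF assms(1), of UNIV] assms(3)
      by (simp_all add: lebesgue_on_UNIV_eq)
    have "(\<integral>\<^sup>+x. ennreal ((g' y)\<^sup>2 * \<rho> (x - y)) \<partial>lborel) = (\<integral>\<^sup>+x. ennreal ((g' y)\<^sup>2 * \<rho> (x - y)) \<partial>lebesgue)"
      by (simp add: nn_integral_completion)
    also have "\<dots> = ennreal (LINT x|lebesgue. (g' y)\<^sup>2 * \<rho> (x - y))"
      using ri(1) assms(2) by (intro nn_integral_eq_integral) auto
    finally show "(\<integral>\<^sup>+x. ennreal ((g' y)\<^sup>2 * \<rho> (x - y)) \<partial>lborel) = ennreal ((g' y)\<^sup>2)" using ri by simp
  qed
  also have "\<dots> = (\<integral>\<^sup>+y. ennreal ((g y)\<^sup>2) \<partial>lebesgue)"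
    unfolding nn_integral_completion using ae by (intro nn_integral_cong_AE, eventually_elim) simp
  also have "\<dots> = ennreal (LINT y|lebesgue. (g y)\<^sup>2)" using gi by (intro nn_integral_eq_integral) auto
  finally have le: "(\<integral>\<^sup>+x. ennreal ((conv g \<rho> x)\<^sup>2) \<partial>lebesgue) \<le> ennreal (LINT y|lebesgue. (g y)\<^sup>2)" .
  have ci: "integrable lebesgue (\<lambda>x. (conv g \<rho> x)\<^sup>2)"
    using cm le by (intro integrableI_bounded) (auto simp: order_le_less_trans[OF le])
  then show "conv g \<rho> \<in> L2 UNIV" using cm by (simp add: L2_def lebesgue_on_UNIV_eq)
  have "ennreal (LINT x|lebesgue. (conv g \<rho> x)\<^sup>2) \<le> ennreal (LINT y|lebesgue. (g y)\<^sup>2)"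
    using le nn_integral_eq_integral[OF ci] by simp
  then show "sqn UNIV (conv g \<rho>) \<le> sqn UNIV g" by (simp add: lebesgue_on_UNIV_eq ennreal_le_iff)
qed

definition mollifier :: "real \<Rightarrow> (real^'n \<Rightarrow> real) \<Rightarrow> bool" where
  "mollifier r \<rho> \<longleftrightarrow> \<rho> \<in> test_functions UNIV \<and> (\<forall>x. 0 \<le> \<rho> x) \<and> (\<forall>x. norm x > r \<longrightarrow> \<rho> x = 0)
     \<and> (LINT x|lebesgue. \<rho> x) = 1"

lemma L2_compact_support_integrable:
  fixes g :: "real^'n \<Rightarrow> 'b::euclidean_space"
  assumes "g \<in> L2 UNIV" "compact K" "\<And>x. x \<notin> K \<Longrightarrow> g x = 0"
  shows "integrable lebesgue g"
proof -
  have K: "K \<in> lmeasurable" using assms(2) by (rule lmeasurable_compact)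
  have "g \<in> L2 K" using L2_subset[OF assms(1), of K] K by (auto dest: fmeasurableD)
  then have "integrable (lebesgue_on K) g" using K by (rule L2_imp_integrable)
  then show ?thesis
    using integral_lebesgue_on_support(2)[of K UNIV g] assms(3) K by (auto simp: lebesgue_on_UNIV_eq dest: fmeasurableD)
qed

text \<open>Clipping g at height m costs little in L2. The clipped function is approximated almost
  everywhere by continuous functions which, after the same clipping and a cut-off, are dominated by
  a constant on a fixed ball.\<close>

lemma L2_continuous_dense:
  fixes g :: "real^'n \<Rightarrow> real"
  assumes g: "g \<in> L2 UNIV" and K: "compact K" "\<And>x. x \<notin> K \<Longrightarrow> g x = 0" and e: "e > 0"
  obtains \<psi> R where "continuous_on UNIV \<psi>" "\<And>x. norm x > R \<Longrightarrow> \<psi> x = 0" "sqn UNIV (\<lambda>x. g x - \<psi> x) < e"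
proof -
  have gm: "g \<in> borel_measurable lebesgue" using L2_measurable[OF g] by (simp add: lebesgue_on_UNIV_eq)
  have gi: "integrable lebesgue (\<lambda>x. (g x)\<^sup>2)" using L2_integrable_sq[OF g] by (simp add: lebesgue_on_UNIV_eq)
  define cl where "cl = (\<lambda>m t. max (- m) (min m t) :: real)"
  have cl_le: "\<bar>t - cl m t\<bar> \<le> \<bar>t\<bar>" "\<bar>cl m t\<bar> \<le> m" if "m \<ge> 0" for m t using that by (auto simp: cl_def max_def min_def)
  have clc: "continuous_on UNIV (\<lambda>t. cl m t)" for m unfolding cl_def by (intro continuous_intros)
  have "(\<lambda>m. LINT x|lebesgue. (g x - cl (real m) (g x))\<^sup>2) \<longlonglongrightarrow> (LINT x|(lebesgue :: (real^'n) measure). 0)"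
  proof (rule integral_dominated_convergence[where w = "\<lambda>x. (g x)\<^sup>2"])
    show "(\<lambda>x. (g x - cl (real m) (g x))\<^sup>2) \<in> borel_measurable lebesgue" for m
      unfolding cl_def using gm by measurable
    show "AE x in lebesgue. (\<lambda>m. (g x - cl (real m) (g x))\<^sup>2) \<longlonglongrightarrow> 0"
    proof (rule AE_I2)
      fix x
      obtain n where n: "\<bar>g x\<bar> \<le> real n" using real_arch_simple by blast
      have "\<forall>\<^sub>F m in sequentially. (g x - cl (real m) (g x))\<^sup>2 = 0"
        using eventually_ge_at_top[of n]
      proof eventually_elim
        case (elim m)
        then have "real n \<le> real m" by simp
        with n have "\<bar>g x\<bar> \<le> real m" by linarith
        then show ?case by (auto simp: cl_def max_def min_def abs_le_iff)
      qed
      then show "(\<lambda>m. (g x - cl (real m) (g x))\<^sup>2) \<longlonglongrightarrow> 0" by (rule tendsto_eventually)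
    qed
    show "AE x in lebesgue. norm ((g x - cl (real m) (g x))\<^sup>2) \<le> (g x)\<^sup>2" for m
      using cl_le(1)[of "real m"] by (intro AE_I2) (simp add: abs_le_square_iff)
  qed (use gi in auto)
  then have "\<forall>\<^sub>F m in sequentially. (LINT x|lebesgue. (g x - cl (real m) (g x))\<^sup>2) < e / 4"
    using e by (intro order_tendstoD) auto
  then obtain m where m: "(LINT x|lebesgue. (g x - cl (real m) (g x))\<^sup>2) < e / 4"
    by (auto simp: eventually_sequentially)
  obtain R where R: "\<And>x. x \<in> K \<Longrightarrow> norm x \<le> R"
    using compact_imp_bounded[OF K(1)] unfolding bounded_iff by auto
  define ct :: "real^'n \<Rightarrow> real" where "ct x = max 0 (min 1 (R + 1 - norm x))" for x
  have chi: "0 \<le> ct x" "ct x \<le> 1" "norm x > R + 1 \<Longrightarrow> ct x = 0" "norm x \<le> R \<Longrightarrow> ct x = 1" for x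
    by (auto simp: ct_def)
  have chic: "continuous_on UNIV ct" unfolding ct_def by (intro continuous_intros)
  \<comment> \<open>The continuous approximants h obey no common bound and have no common support;
    \<open>cl\<close> and \<open>ct\<close> supply both without changing the limit, since g vanishes
    off K.\<close>
  obtain N h where N: "negligible N" and hc: "\<And>n. continuous_on UNIV (h n)"
    and h: "\<And>x. x \<notin> N \<Longrightarrow> (\<lambda>n. h n x) \<longlonglongrightarrow> g x"
    using lebesgue_measurable_imp_measurable_on[OF gm, of UNIV] unfolding measurable_on_def by auto
  define \<psi> where "\<psi> = (\<lambda>n x. ct x * cl (real m) (h n x))"
  have pc: "continuous_on UNIV (\<psi> n)" for n
    unfolding \<psi>_def by (intro continuous_on_mult chic continuous_on_compose2[OF clc hc]) auto
  have "(\<lambda>n. LINT x|lebesgue. (cl (real m) (g x) - \<psi> n x)\<^sup>2) \<longlonglongrightarrow> (LINT x|(lebesgue :: (real^'n) measure). 0)"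
  proof (rule integral_dominated_convergence[where w = "\<lambda>x. indicator (cball 0 (R + 1)) x * (2 * real m)\<^sup>2"])
    show "(\<lambda>x. (cl (real m) (g x) - \<psi> n x)\<^sup>2) \<in> borel_measurable lebesgue" for n
      using gm continuous_imp_measurable_on_sets_lebesgue[OF pc[of n]]
      unfolding cl_def lebesgue_on_UNIV_eq by simp measurable
    show "integrable lebesgue (\<lambda>x::real^'n. indicator (cball 0 (R + 1)) x * (2 * real m)\<^sup>2)"
      using lmeasurable_cball by (intro integrable_mult_left) (simp add: lmeasurable_iff_integrable)
    have "AE x in lebesgue. x \<notin> N" using N negligible_iff_null_sets AE_not_in by blast
    then show "AE x in lebesgue. (\<lambda>n. (cl (real m) (g x) - \<psi> n x)\<^sup>2) \<longlonglongrightarrow> 0"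
    proof eventually_elim
      case (elim x)
      have "(\<lambda>n. cl (real m) (h n x)) \<longlonglongrightarrow> cl (real m) (g x)"
        by (rule continuous_on_tendsto_compose[OF clc h[OF elim]]) auto
      then have "(\<lambda>n. (cl (real m) (g x) - \<psi> n x)\<^sup>2) \<longlonglongrightarrow> (cl (real m) (g x) - ct x * cl (real m) (g x))\<^sup>2"
        unfolding \<psi>_def by (intro tendsto_intros)
      moreover have "cl (real m) (g x) = ct x * cl (real m) (g x)"
      proof (cases "x \<in> K")
        case True then show ?thesis using R chi(4) by simp
      next
        case False then show ?thesis using K(2) by (simp add: cl_def)
      qed
      ultimately show ?case by simp
    qed
    show "AE x in lebesgue. norm ((cl (real m) (g x) - \<psi> n x)\<^sup>2) \<le> indicator (cball 0 (R + 1)) x * (2 * real m)\<^sup>2" for n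
    proof (rule AE_I2)
      fix x :: "real^'n"
      show "norm ((cl (real m) (g x) - \<psi> n x)\<^sup>2) \<le> indicator (cball 0 (R + 1)) x * (2 * real m)\<^sup>2"
      proof (cases "norm x \<le> R + 1")
        case True
        have "\<bar>\<psi> n x\<bar> \<le> 1 * real m"
          unfolding \<psi>_def abs_mult using chi cl_le(2)[of "real m"] by (intro mult_mono) auto
        then have "\<bar>cl (real m) (g x) - \<psi> n x\<bar> \<le> \<bar>2 * real m\<bar>" using cl_le(2)[of "real m" "g x"] by simp
        then show ?thesis using True by (simp only: abs_le_square_iff) simp
      next
        case False
        then have "x \<notin> K" using R by force
        then show ?thesis using False K(2) chi(3) by (simp add: \<psi>_def cl_def)
      qed
    qed
  qed auto
  then have "\<forall>\<^sub>F n in sequentially. (LINT x|lebesgue. (cl (real m) (g x) - \<psi> n x)\<^sup>2) < e / 4"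
    using e by (intro order_tendstoD) auto
  then obtain n where n: "(LINT x|lebesgue. (cl (real m) (g x) - \<psi> n x)\<^sup>2) < e / 4"
    by (auto simp: eventually_sequentially)
  have p0: "\<psi> n x = 0" if "norm x > R + 1" for x using chi(3)[OF that] by (simp add: \<psi>_def)
  have clm: "(\<lambda>x. cl (real m) (g x)) \<in> borel_measurable lebesgue" unfolding cl_def using gm by measurable
  have clL: "(\<lambda>x. cl (real m) (g x)) \<in> L2 UNIV"
  proof (rule L2_bound[OF _ g])
    show "(\<lambda>x. cl (real m) (g x)) \<in> borel_measurable (lebesgue_on UNIV)" using clm by (simp add: lebesgue_on_UNIV_eq)
    show "AE x in lebesgue_on UNIV. norm (cl (real m) (g x)) \<le> 1 * norm (g x)"
      by (intro AE_I2) (auto simp: cl_def max_def min_def)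
  qed
  have pL: "\<psi> n \<in> L2 UNIV"
    by (rule L2_continuous[OF pc, of "cball 0 (R + 1)"]) (use p0 in auto)
  have "sqn UNIV (\<lambda>x. g x - \<psi> n x) = sqn UNIV (\<lambda>x. (g x - cl (real m) (g x)) + (cl (real m) (g x) - \<psi> n x))" by simp
  also have "\<dots> \<le> 2 * sqn UNIV (\<lambda>x. g x - cl (real m) (g x)) + 2 * sqn UNIV (\<lambda>x. cl (real m) (g x) - \<psi> n x)"
    by (intro sqn_add_le L2_diff g clL pL)
  also have "\<dots> < e" using m n by (simp add: lebesgue_on_UNIV_eq)
  finally show thesis using that[of "\<psi> n" "R + 1"] pc p0 by blast
qed

text \<open>The radius r0 works for every mollifier of radius at most r0. This uniformity allows one
  mollifier to approximate a function and all components of its gradient at once.\<close>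

lemma conv_approx:
  fixes g :: "real^'n \<Rightarrow> real"
  assumes g: "g \<in> L2 UNIV" and K: "compact K" "\<And>x. x \<notin> K \<Longrightarrow> g x = 0" and e: "e > 0"
  obtains r0 where "r0 > 0" "\<And>r \<rho>. mollifier r \<rho> \<Longrightarrow> r \<le> r0 \<Longrightarrow> sqn UNIV (\<lambda>x. g x - conv g \<rho> x) < e"
proof -
  \<comment> \<open>The error is split into three parts with weights 2, 4 and 4. The first two parts
    are at most e/12 and the last at most e/16, which gives 3e/4 in total.\<close>
  obtain \<psi> R where p: "continuous_on UNIV \<psi>" "\<And>x. norm x > R \<Longrightarrow> \<psi> x = 0" "sqn UNIV (\<lambda>x. g x - \<psi> x) < e / 12"
    by (rule L2_continuous_dense[OF g K(1) K(2), of "e / 12"]) (use e that in auto)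
  have pL: "\<psi> \<in> L2 UNIV" by (rule L2_continuous[OF p(1), of "cball 0 R"]) (use p(2) in auto)
  have gi: "integrable lebesgue g" by (rule L2_compact_support_integrable[OF g K])
  have pi: "integrable lebesgue \<psi>" by (rule L2_compact_support_integrable[OF pL, of "cball 0 R"]) (use p(2) in auto)
  let ?m = "measure lebesgue (cball 0 (R + 1) :: (real^'n) set)"
  define M where "M = ?m + 1"
  \<comment> \<open>The difference between \<psi> and its mollification lives on the ball of radius
    R + 1; a uniform error \<eta> there costs at most e/16 in the squared norm.\<close>
  define \<eta> where "\<eta> = sqrt (e / (16 * M))"
  have M: "M > 0" "?m \<le> M" unfolding M_def using measure_nonneg[of lebesgue "cball 0 (R + 1) :: (real^'n) set"] by linarith+
  have eta: "\<eta> > 0" "\<eta>\<^sup>2 * ?m \<le> e / 16"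
  proof -
    show "\<eta> > 0" unfolding \<eta>_def using e M by simp
    have "\<eta>\<^sup>2 * ?m \<le> \<eta>\<^sup>2 * M" using M(2) by (intro mult_left_mono) auto
    also have "\<dots> = e / 16" unfolding \<eta>_def using e M(1) by simp
    finally show "\<eta>\<^sup>2 * ?m \<le> e / 16" .
  qed
  have "uniformly_continuous_on (cball 0 (R + 2)) \<psi>"
    by (intro compact_uniformly_continuous continuous_on_subset[OF p(1)]) auto
  then obtain d where d: "d > 0" "\<And>x y. norm x \<le> R + 2 \<Longrightarrow> norm y \<le> R + 2 \<Longrightarrow> dist x y < d \<Longrightarrow> dist (\<psi> x) (\<psi> y) < \<eta>"
    unfolding uniformly_continuous_on_def using eta(1) by (auto simp: dist_commute)
  define r0 where "r0 = min 1 (d / 2)"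
  have "sqn UNIV (\<lambda>x. g x - conv g \<rho> x) < e" if r: "mollifier r \<rho>" "r \<le> r0" for r \<rho>
  proof -
    have rho: "\<rho> \<in> test_functions UNIV" "\<And>x. 0 \<le> \<rho> x" "\<And>x. norm x > r \<Longrightarrow> \<rho> x = 0" "(LINT x|lebesgue. \<rho> x) = 1"
      using r(1) by (auto simp: mollifier_def)
    note ip = conv_integrable(1)[OF rho(1) pi] and ig = conv_integrable(1)[OF rho(1) gi]
    have rd: "r \<le> 1" "r < d" using r(2) d(1) by (auto simp: r0_def)
    have ir: "integrable lebesgue (\<lambda>y. \<rho> (x - y))" for x
      using test_functions_integrable(1)[OF test_functions_reflect(1)[OF rho(1)], of UNIV] by (simp add: lebesgue_on_UNIV_eq)
    have I1: "(LINT y|lebesgue. \<rho> (x - y)) = 1" for x using integral_reflect[of \<rho> x] rho(4) by simp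
    have near: "\<bar>\<psi> x - conv \<psi> \<rho> x\<bar> \<le> \<eta>" for x
    proof (cases "norm x \<le> R + 1")
      case True
      have "\<psi> x - conv \<psi> \<rho> x = (LINT y|lebesgue. \<psi> x * \<rho> (x - y) - \<psi> y * \<rho> (x - y))"
        unfolding conv_def using ir[of x] ip[of x] I1[of x] by simp
      then have "\<bar>\<psi> x - conv \<psi> \<rho> x\<bar> \<le> (LINT y|lebesgue. \<bar>\<psi> x * \<rho> (x - y) - \<psi> y * \<rho> (x - y)\<bar>)"
        using integral_norm_bound[of lebesgue "\<lambda>y. \<psi> x * \<rho> (x - y) - \<psi> y * \<rho> (x - y)"] by simp
      also have "\<dots> \<le> (LINT y|lebesgue. \<eta> * \<rho> (x - y))"
      proof (rule integral_mono)
        show "integrable lebesgue (\<lambda>y. \<bar>\<psi> x * \<rho> (x - y) - \<psi> y * \<rho> (x - y)\<bar>)" using ir[of x] ip[of x] by auto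
        show "integrable lebesgue (\<lambda>y. \<eta> * \<rho> (x - y))" using ir by auto
        fix y
        show "\<bar>\<psi> x * \<rho> (x - y) - \<psi> y * \<rho> (x - y)\<bar> \<le> \<eta> * \<rho> (x - y)"
        proof (cases "norm (x - y) > r")
          case True then show ?thesis using rho(3) by simp
        next
          case False
          have "norm y \<le> norm x + norm (x - y)" using norm_triangle_ineq4[of x "x - y"] by simp
          then have "norm y \<le> R + 2" using False True rd by simp
          then have "dist (\<psi> x) (\<psi> y) < \<eta>" using False True rd by (intro d) (auto simp: dist_norm)
          then have "\<bar>\<psi> x - \<psi> y\<bar> * \<rho> (x - y) \<le> \<eta> * \<rho> (x - y)"
            using rho(2) by (intro mult_right_mono) (auto simp: dist_real_def)
          then show ?thesis using rho(2)[of "x - y"] by (simp add: left_diff_distrib[symmetric] abs_mult)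
        qed
      qed
      also have "\<dots> = \<eta>" using I1 by simp
      finally show ?thesis .
    next
      case False
      have "conv \<psi> \<rho> x = 0"
      proof (rule conv_eq_0[where K = "cball 0 R", OF _ rho(3)])
        show "\<psi> y = 0" if "y \<notin> cball 0 R" for y using that p(2) by simp
        fix y :: "real^'n" assume "y \<in> cball 0 R"
        then have "norm y \<le> R" by simp
        then show "r < dist x y" using False norm_triangle_ineq2[of x y] rd by (simp add: dist_norm)
      qed
      then show ?thesis using p(2)[of x] False eta(1) by simp
    qed
    have cpL: "conv \<psi> \<rho> \<in> L2 UNIV" by (rule conv_L2(1)[OF rho(1,2,4) pL pi])
    have B: "sqn UNIV (\<lambda>x. \<psi> x - conv \<psi> \<rho> x) \<le> e / 16"
    proof -
      let ?B = "cball 0 (R + 1) :: (real^'n) set"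
      have z: "\<psi> x - conv \<psi> \<rho> x = 0" if "x \<notin> ?B" for x
      proof -
        have x: "norm x > R + 1" using that by simp
        have "conv \<psi> \<rho> x = 0"
        proof (rule conv_eq_0[where K = "cball 0 R", OF _ rho(3)])
          show "\<psi> y = 0" if "y \<notin> cball 0 R" for y using that p(2) by simp
          fix y :: "real^'n" assume "y \<in> cball 0 R"
          then have "norm y \<le> R" by simp
          then show "r < dist x y" using x norm_triangle_ineq2[of x y] rd by (simp add: dist_norm)
        qed
        then show ?thesis using p(2)[of x] x by simp
      qed
      have "sqn ?B (\<lambda>x. \<psi> x - conv \<psi> \<rho> x) = sqn UNIV (\<lambda>x. \<psi> x - conv \<psi> \<rho> x)"
        by (rule integral_lebesgue_on_support(1)) (auto simp: z)
      moreover have "sqn ?B (\<lambda>x. \<psi> x - conv \<psi> \<rho> x) \<le> \<eta>\<^sup>2 * ?m"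
      proof (rule L2_bounded(2))
        have "(\<lambda>x. \<psi> x - conv \<psi> \<rho> x) \<in> L2 ?B" by (rule L2_subset[OF L2_diff[OF pL cpL]]) auto
        then show "(\<lambda>x. \<psi> x - conv \<psi> \<rho> x) \<in> borel_measurable (lebesgue_on ?B)" by (rule L2_measurable)
        show "norm (\<psi> x - conv \<psi> \<rho> x) \<le> \<eta>" for x using near by simp
      qed auto
      ultimately show ?thesis using eta(2) by simp
    qed
    have cd: "conv (\<lambda>x. \<psi> x - g x) \<rho> x = conv \<psi> \<rho> x - conv g \<rho> x" for x
      unfolding conv_def using ip[of x] ig[of x] by (simp add: left_diff_distrib)
    have pg: "sqn UNIV (\<lambda>x. \<psi> x - g x) < e / 12" using p(3) by (simp add: power2_commute)
    have A: "conv (\<lambda>x. \<psi> x - g x) \<rho> \<in> L2 UNIV" "sqn UNIV (conv (\<lambda>x. \<psi> x - g x) \<rho>) < e / 12"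
      using conv_L2[OF rho(1,2,4) L2_diff[OF pL g] Bochner_Integration.integrable_diff[OF pi gi]] pg by auto
    have "sqn UNIV (\<lambda>x. g x - conv g \<rho> x)
        = sqn UNIV (\<lambda>x. conv (\<lambda>x. \<psi> x - g x) \<rho> x + ((g x - \<psi> x) + (\<psi> x - conv \<psi> \<rho> x)))"
      by (simp add: cd)
    also have "\<dots> \<le> 2 * sqn UNIV (conv (\<lambda>x. \<psi> x - g x) \<rho>) + 2 * sqn UNIV (\<lambda>x. (g x - \<psi> x) + (\<psi> x - conv \<psi> \<rho> x))"
      by (intro sqn_add_le A L2_add L2_diff g pL cpL)
    also have "\<dots> \<le> 2 * sqn UNIV (conv (\<lambda>x. \<psi> x - g x) \<rho>)
        + 2 * (2 * sqn UNIV (\<lambda>x. g x - \<psi> x) + 2 * sqn UNIV (\<lambda>x. \<psi> x - conv \<psi> \<rho> x))"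
      by (intro add_left_mono mult_left_mono sqn_add_le L2_diff g pL cpL) auto
    also have "\<dots> < e" using A(2) p(3) B e by simp
    finally show ?thesis .
  qed
  moreover have "r0 > 0" using d(1) by (simp add: r0_def)
  ultimately show thesis using that by blast
qed

lemma sqn_components:
  fixes G :: "real^'n \<Rightarrow> real^'n"
  assumes "G \<in> L2 S"
  shows "\<And>i. (\<lambda>x. G x $ i) \<in> L2 S" "sqn S G = (\<Sum>i\<in>UNIV. sqn S (\<lambda>x. G x $ i))"
proof -
  show i: "(\<lambda>x. G x $ i) \<in> L2 S" for i
    by (rule L2_bound[where C = 1, OF vec_borel_measurableD[OF L2_measurable[OF assms]] assms])
      (simp add: component_le_norm_cart)
  have "(norm (G x))\<^sup>2 = (\<Sum>i\<in>UNIV. (norm (G x $ i))\<^sup>2)" for x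
    by (simp only: power2_norm_eq_inner inner_vec_def)
  then show "sqn S G = (\<Sum>i\<in>UNIV. sqn S (\<lambda>x. G x $ i))"
    by (simp only:) (rule Bochner_Integration.integral_sum[OF L2_integrable_sq[OF i]])
qed

text \<open>Mollification at a radius below the distance from K to the complement of S yields test
  functions on S. No regularity of the boundary enters, because the support stays away from
  it.\<close>

lemma compact_support_H12_0:
  fixes V :: "real^'n \<Rightarrow> real"
  assumes S: "open S" and V: "V \<in> L2 UNIV" "G \<in> L2 UNIV" "is_weak_grad UNIV V G"
    and K: "compact K" "K \<subseteq> S" "\<And>x. x \<notin> K \<Longrightarrow> V x = 0" "\<And>x. x \<notin> K \<Longrightarrow> G x = 0"
  shows "V \<in> H12_0 S" "is_weak_grad S V G"
proof -
  note Sl = open_sets_lebesgue[OF S]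
  show w: "is_weak_grad S V G" by (rule is_weak_grad_subset[OF V(3)]) (use Sl in auto)
  have Vi: "integrable lebesgue V" and Gi: "integrable lebesgue G"
    using L2_compact_support_integrable[OF V(1) K(1,3)] L2_compact_support_integrable[OF V(2) K(1,4)] by auto
  obtain d where d: "d > 0" "\<And>x y. y \<in> K \<Longrightarrow> dist x y \<le> d \<Longrightarrow> x \<in> S"
  proof -
    obtain d where D: "d > 0" "(\<Union>x\<in>K. ball x d) \<subseteq> S"
      using compact_subset_open_imp_ball_epsilon_subset[OF K(1) S K(2)] by blast
    show thesis
    proof (rule that[of "d / 2"])
      show "d / 2 > 0" using D(1) by simp
      fix x y assume xy: "y \<in> K" "dist x y \<le> d / 2"
      then have "x \<in> ball y d" using D(1) by (simp add: dist_commute)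
      with xy(1) show "x \<in> S" using D(2) by blast
    qed
  qed
  show "V \<in> H12_0 S"
  proof (rule H12_0I[OF S _ _ w])
    show "V \<in> L2 S" "G \<in> L2 S" using V Sl by (auto intro: L2_subset)
    fix e :: real assume e: "e > 0"
    obtain r1 where r1: "r1 > 0" "\<And>r \<rho>. mollifier r \<rho> \<Longrightarrow> r \<le> r1 \<Longrightarrow> sqn UNIV (\<lambda>x. V x - conv V \<rho> x) < e"
      by (rule conv_approx[OF V(1) K(1) _ e]) (use K(3) that in blast)+
    define e' where "e' = e / real CARD('n)"
    have e': "e' > 0" using e by (simp add: e'_def)
    have "\<exists>r1>0. \<forall>r \<rho>. mollifier r \<rho> \<longrightarrow> r \<le> r1 \<longrightarrow> sqn UNIV (\<lambda>x. G x $ i - conv (\<lambda>x. G x $ i) \<rho> x) < e'" for i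
    proof -
      have z: "G x $ i = 0" if "x \<notin> K" for x using K(4)[OF that] by simp
      show ?thesis by (rule conv_approx[OF sqn_components(1)[OF V(2)] K(1) z e']) blast+
    qed
    then have "\<forall>i. \<exists>r1>0. \<forall>r \<rho>. mollifier r \<rho> \<longrightarrow> r \<le> r1 \<longrightarrow> sqn UNIV (\<lambda>x. G x $ i - conv (\<lambda>x. G x $ i) \<rho> x) < e'" ..
    from choice[OF this] obtain r2 where r2': "\<forall>i. r2 i > 0 \<and>
      (\<forall>r \<rho>. mollifier r \<rho> \<longrightarrow> r \<le> r2 i \<longrightarrow> sqn UNIV (\<lambda>x. G x $ i - conv (\<lambda>x. G x $ i) \<rho> x) < e')" ..
    then have r2: "\<And>i. r2 i > 0"
      "\<And>i r \<rho>. mollifier r \<rho> \<Longrightarrow> r \<le> r2 i \<Longrightarrow> sqn UNIV (\<lambda>x. G x $ i - conv (\<lambda>x. G x $ i) \<rho> x) < e'"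
      by blast+
    \<comment> \<open>One radius serves V and all components of G; the bound by d keeps the support
      inside S.\<close>
    define r where "r = Min (insert d (insert r1 (range r2)))"
    have r: "r > 0" "r \<le> d" "r \<le> r1" using d(1) r1(1) r2(1) by (auto simp: r_def)
    have ri: "r \<le> r2 i" for i unfolding r_def by (rule Min_le) auto
    obtain \<rho> :: "real^'n \<Rightarrow> real" where rho: "\<rho> \<in> test_functions UNIV" "\<And>x. 0 \<le> \<rho> x"
      "\<And>x. norm x > r \<Longrightarrow> \<rho> x = 0" "(LINT x|lebesgue. \<rho> x) = 1" by (rule mollifier_exists[OF r(1)]) (rule that)
    then have mo: "mollifier r \<rho>" by (simp add: mollifier_def)
    have t: "conv V \<rho> \<in> test_functions S"
    proof (rule conv_test_function[OF rho(1) Vi K(1)])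
      show "V y = 0" if "y \<notin> K" for y using that by (rule K(3))
      show "\<rho> y = 0" if "norm y > r" for y using that by (rule rho(3))
      show "x \<in> S" if "y \<in> K" "dist x y \<le> r" for x y
        using that(1) order_trans[OF that(2) r(2)] by (rule d(2))
    qed
    have tU: "(\<lambda>x. V x - conv V \<rho> x) \<in> L2 UNIV" "(\<lambda>x. G x - grad (conv V \<rho>) x) \<in> L2 UNIV"
      using V test_functions_L2[OF t, of UNIV] by (auto intro: L2_diff)
    have "sqn S (\<lambda>x. V x - conv V \<rho> x) \<le> sqn UNIV (\<lambda>x. V x - conv V \<rho> x)"
      by (rule sqn_subset_le[OF tU(1)]) (use Sl in auto)
    also have "\<dots> < e" using r1(2)[OF mo r(3)] .
    finally have 1: "sqn S (\<lambda>x. V x - conv V \<rho> x) < e" .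
    have "sqn S (\<lambda>x. G x - grad (conv V \<rho>) x) \<le> sqn UNIV (\<lambda>x. G x - grad (conv V \<rho>) x)"
      by (rule sqn_subset_le[OF tU(2)]) (use Sl in auto)
    also have "\<dots> = (\<Sum>i\<in>UNIV. sqn UNIV (\<lambda>x. G x $ i - conv (\<lambda>x. G x $ i) \<rho> x))"
      by (subst sqn_components(2)[OF tU(2)]) (simp add: grad_conv_weak[OF rho(1) Vi Gi V(3)])
    also have "\<dots> < (\<Sum>i\<in>(UNIV :: 'n set). e')"
      using r2(2)[OF mo ri] by (intro sum_strict_mono) auto
    also have "\<dots> = e" by (simp add: e'_def)
    finally have 2: "sqn S (\<lambda>x. G x - grad (conv V \<rho>) x) < e" .
    show "\<exists>\<phi>\<in>test_functions S. sqn S (\<lambda>x. V x - \<phi> x) < e \<and> sqn S (\<lambda>x. G x - grad \<phi> x) < e"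
      by (intro bexI[OF _ t] conjI 1 2)
  qed
qed

subsection \<open>The lattice of cells\<close>

definition lat :: "int^'n \<Rightarrow> real^'n" where
  "lat k = (\<chi> i. real_of_int (k $ i))"

lemma lat_add: "lat (j + k) = lat j + lat k" and lat_uminus: "lat (- k) = - lat k"
  by (simp_all add: lat_def vec_eq_iff)

lemma cell_eq: "cell \<epsilon> j = (\<lambda>x. \<epsilon> *\<^sub>R x + \<epsilon> *\<^sub>R lat j) ` Y"
  unfolding cell_def lat_def[symmetric] by (simp add: scaleR_add_right add.commute)

lemma Y_box: "(Y :: (real^'n) set) = box 0 (\<chi> i. 1)"
  by (auto simp: Y_def mem_box_cart)

lemma Y_open: "open (Y :: (real^'n) set)" and Y_bounded: "bounded (Y :: (real^'n) set)"
  and Y_lmeasurable: "(Y :: (real^'n) set) \<in> lmeasurable"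
  by (simp_all add: Y_box open_box)

lemma Y_sets: "(Y :: (real^'n) set) \<in> sets lebesgue"
  using Y_lmeasurable by (rule fmeasurableD)

lemma Y_measure: "measure lebesgue (Y :: (real^'n) set) = 1"
proof -
  have "((\<chi> i. 1) - 0 :: real^'n) \<bullet> b = 1" if "b \<in> Basis" for b
    using that by (auto simp: Basis_vec_def inner_axis)
  moreover have "(0 :: real^'n) \<bullet> b \<le> (\<chi> i. 1) \<bullet> b" if "b \<in> Basis" for b
    using that by (auto simp: Basis_vec_def inner_axis)
  ultimately show ?thesis unfolding Y_box by (simp add: measure_lborel_box_eq measure_completion)
qed

lemma mem_cell_iff:
  assumes "\<epsilon> > 0"
  shows "x \<in> cell \<epsilon> j \<longleftrightarrow> (\<forall>i. \<epsilon> * real_of_int (j $ i) < x $ i \<and> x $ i < \<epsilon> * (real_of_int (j $ i) + 1))"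
proof
  assume "x \<in> cell \<epsilon> j"
  then show "\<forall>i. \<epsilon> * real_of_int (j $ i) < x $ i \<and> x $ i < \<epsilon> * (real_of_int (j $ i) + 1)"
    using assms by (auto simp: cell_eq Y_def lat_def algebra_simps)
next
  assume *: "\<forall>i. \<epsilon> * real_of_int (j $ i) < x $ i \<and> x $ i < \<epsilon> * (real_of_int (j $ i) + 1)"
  have "(1 / \<epsilon>) *\<^sub>R x - lat j \<in> Y"
    using * assms by (auto simp: Y_def lat_def field_simps)
  moreover have "x = \<epsilon> *\<^sub>R ((1 / \<epsilon>) *\<^sub>R x - lat j) + \<epsilon> *\<^sub>R lat j" using assms by (simp add: scaleR_diff_right)
  ultimately show "x \<in> cell \<epsilon> j" unfolding cell_eq by blast
qed

lemma cell_unique: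
  assumes "\<epsilon> > 0" "x \<in> cell \<epsilon> j" "x \<in> cell \<epsilon> k" shows "j = k"
proof -
  have "j $ i = k $ i" for i
  proof -
    have "\<epsilon> * real_of_int (j $ i) < \<epsilon> * (real_of_int (k $ i) + 1)" "\<epsilon> * real_of_int (k $ i) < \<epsilon> * (real_of_int (j $ i) + 1)"
      using assms(2,3) unfolding mem_cell_iff[OF assms(1)] by (meson less_trans)+
    then have "real_of_int (j $ i) < real_of_int (k $ i) + 1" "real_of_int (k $ i) < real_of_int (j $ i) + 1"
      using assms(1) by simp_all
    then show ?thesis by linarith
  qed
  then show ?thesis by (simp add: vec_eq_iff)
qed

lemma cell_sets: "\<epsilon> > 0 \<Longrightarrow> cell \<epsilon> j \<in> sets lebesgue"
  unfolding cell_eq by (intro sets_affine_image Y_sets) auto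

lemma cell_measure: "\<epsilon> > 0 \<Longrightarrow> measure lebesgue (cell \<epsilon> j :: (real^'n) set) = \<epsilon> ^ CARD('n)"
  unfolding cell_eq by (subst measure_lebesgue_affine) (simp add: Y_measure)

lemma cell_dist:
  assumes "\<epsilon> > 0" "x \<in> cell \<epsilon> j" "y \<in> cell \<epsilon> j"
  shows "norm (x - y :: real^'n) \<le> real CARD('n) * \<epsilon>" "\<bar>(x - y) $ i\<bar> < \<epsilon>"
proof -
  have *: "\<bar>(x - y) $ i\<bar> < \<epsilon>" for i
  proof -
    have "\<epsilon> * real_of_int (j $ i) < x $ i" "x $ i < \<epsilon> * (real_of_int (j $ i) + 1)"
      "\<epsilon> * real_of_int (j $ i) < y $ i" "y $ i < \<epsilon> * (real_of_int (j $ i) + 1)"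
      using assms unfolding mem_cell_iff[OF assms(1)] by auto
    then show ?thesis by (simp add: algebra_simps abs_less_iff)
  qed
  then show "\<bar>(x - y) $ i\<bar> < \<epsilon>" .
  have "norm (x - y) \<le> (\<Sum>i\<in>UNIV. \<bar>(x - y) $ i\<bar>)" by (rule norm_le_l1_cart)
  also have "\<dots> \<le> (\<Sum>i\<in>(UNIV :: 'n set). \<epsilon>)" using * by (intro sum_mono) (simp add: less_imp_le)
  finally show "norm (x - y) \<le> real CARD('n) * \<epsilon>" by simp
qed

lemma cell_bounded: "\<epsilon> > 0 \<Longrightarrow> bounded (cell \<epsilon> j)"
  using bounded_translation[OF bounded_scaling[OF Y_bounded, of \<epsilon>], of "\<epsilon> *\<^sub>R lat j"]
  by (simp add: cell_eq image_image add.commute)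

lemma cell_lmeasurable: "\<epsilon> > 0 \<Longrightarrow> cell \<epsilon> j \<in> lmeasurable"
  by (intro bounded_set_imp_lmeasurable cell_bounded cell_sets)

lemma cell_open: "\<epsilon> > 0 \<Longrightarrow> open (cell \<epsilon> j :: (real^'n) set)"
  unfolding cell_eq using open_affinity[OF Y_open, of \<epsilon> "\<epsilon> *\<^sub>R lat j"] by (simp add: add.commute)

text \<open>Cells are open, so the points with a coordinate in \<epsilon> times the integers belong
  to none. They form a countable union of hyperplanes.\<close>

lemma AE_cells:
  assumes "\<epsilon> > 0" shows "AE x :: real^'n in lebesgue. \<exists>j. x \<in> cell \<epsilon> j"
proof -
  have "AE x :: real^'n in lebesgue. \<forall>i. \<forall>m :: int. x $ i \<noteq> \<epsilon> * real_of_int m"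
  proof (subst AE_all_countable, intro allI, subst AE_all_countable, intro allI)
    fix i :: 'n and m :: int
    have "negligible {x :: real^'n. x $ i = \<epsilon> * real_of_int m}"
      using negligible_standard_hyperplane[of "axis i 1 :: real^'n"] by (auto simp: Basis_vec_def inner_axis)
    then show "AE x :: real^'n in lebesgue. x $ i \<noteq> \<epsilon> * real_of_int m"
      using AE_not_in[of "{x :: real^'n. x $ i = \<epsilon> * real_of_int m}" lebesgue] by (simp add: negligible_iff_null_sets)
  qed
  then show ?thesis
  proof eventually_elim
    case (elim x)
    have "x \<in> cell \<epsilon> (\<chi> i. \<lfloor>x $ i / \<epsilon>\<rfloor>)"
      unfolding mem_cell_iff[OF assms]
    proof
      fix i
      have "real_of_int \<lfloor>x $ i / \<epsilon>\<rfloor> \<le> x $ i / \<epsilon>" "x $ i / \<epsilon> < real_of_int \<lfloor>x $ i / \<epsilon>\<rfloor> + 1" by linarith+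
      then have "\<epsilon> * real_of_int \<lfloor>x $ i / \<epsilon>\<rfloor> \<le> x $ i" "x $ i < \<epsilon> * (real_of_int \<lfloor>x $ i / \<epsilon>\<rfloor> + 1)"
        using assms by (simp_all only: pos_le_divide_eq pos_divide_less_eq mult.commute)
      moreover have "x $ i \<noteq> \<epsilon> * real_of_int \<lfloor>x $ i / \<epsilon>\<rfloor>" using elim by blast
      ultimately show "\<epsilon> * real_of_int ((\<chi> i. \<lfloor>x $ i / \<epsilon>\<rfloor>) $ i) < x $ i \<and> x $ i < \<epsilon> * (real_of_int ((\<chi> i. \<lfloor>x $ i / \<epsilon>\<rfloor>) $ i) + 1)"
        by simp
    qed
    then show ?case by blast
  qed
qed

text \<open>These cells cover the ball of radius R up to a null set. For \<epsilon> at most 1 they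
  stay in the ball of radius R + n, n being the dimension, which bounds their total volume
  independently of \<epsilon>.\<close>

definition hit :: "real \<Rightarrow> real \<Rightarrow> (int^'n) set" where
  "hit R \<epsilon> = {j. cell \<epsilon> j \<inter> cball 0 R \<noteq> {}}"

lemma finite_int_vec: "finite {j :: int^'n. \<forall>i. j $ i \<in> {- m..m}}"
proof (rule finite_subset)
  show "{j :: int^'n. \<forall>i. j $ i \<in> {- m..m}} \<subseteq> (\<lambda>f. \<chi> i. f i) ` (PiE UNIV (\<lambda>_. {- m..m}))"
  proof
    fix j :: "int^'n" assume "j \<in> {j. \<forall>i. j $ i \<in> {- m..m}}"
    then have "(\<lambda>i. j $ i) \<in> PiE UNIV (\<lambda>_. {- m..m})" by auto
    moreover have "j = (\<chi> i. (\<lambda>i. j $ i) i)" by simp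
    ultimately show "j \<in> (\<lambda>f. \<chi> i. f i) ` (PiE UNIV (\<lambda>_. {- m..m}))" by blast
  qed
qed (intro finite_imageI finite_PiE; simp)

lemma finite_hit:
  assumes "\<epsilon> > 0" shows "finite (hit R \<epsilon> :: (int^'n) set)"
proof (rule finite_subset[OF _ finite_int_vec])
  show "hit R \<epsilon> \<subseteq> {j :: int^'n. \<forall>i. j $ i \<in> {- (\<lceil>R / \<epsilon>\<rceil> + 1)..\<lceil>R / \<epsilon>\<rceil> + 1}}"
  proof (clarsimp simp: hit_def)
    fix j :: "int^'n" and i :: 'n
    assume "cell \<epsilon> j \<inter> cball 0 R \<noteq> {}"
    then obtain x where x: "x \<in> cell \<epsilon> j" "norm x \<le> R" by auto
    have "\<bar>x $ i\<bar> \<le> R" using component_le_norm_cart[of x i] x(2) by linarith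
    moreover have "\<epsilon> * real_of_int (j $ i) < x $ i" "x $ i < \<epsilon> * (real_of_int (j $ i) + 1)"
      using x(1) unfolding mem_cell_iff[OF assms] by auto
    ultimately have "real_of_int (j $ i) < R / \<epsilon>" "- (R / \<epsilon>) < real_of_int (j $ i) + 1"
      using assms by (auto simp: field_simps)
    then show "- \<lceil>R / \<epsilon>\<rceil> - 1 \<le> j $ i \<and> j $ i \<le> \<lceil>R / \<epsilon>\<rceil> + 1" by linarith
  qed
qed

lemma integral_cells:
  fixes f :: "real^'n \<Rightarrow> 'b::{banach, second_countable_topology}"
  assumes "\<epsilon> > 0" "finite J" "\<And>j. j \<in> J \<Longrightarrow> integrable (lebesgue_on (cell \<epsilon> j)) f"
  shows "integrable (lebesgue_on (\<Union>j\<in>J. cell \<epsilon> j)) f"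
    and "(LINT x|lebesgue_on (\<Union>j\<in>J. cell \<epsilon> j). f x) = (\<Sum>j\<in>J. LINT x|lebesgue_on (cell \<epsilon> j). f x)"
proof -
  have U: "(\<Union>j\<in>J. cell \<epsilon> j) \<in> sets lebesgue" using assms(1,2) cell_sets by (intro sets.finite_UN) auto
  have ind: "indicator (\<Union>j\<in>J. cell \<epsilon> j) x = (\<Sum>j\<in>J. indicator (cell \<epsilon> j) x :: real)" for x :: "real^'n"
    using assms(1,2) cell_unique by (intro indicator_UN_disjoint) (auto simp: disjoint_family_on_def)
  have eq: "(\<lambda>x. indicator (\<Union>j\<in>J. cell \<epsilon> j) x *\<^sub>R f x) = (\<lambda>x. \<Sum>j\<in>J. indicator (cell \<epsilon> j) x *\<^sub>R f x)"
    unfolding ind scaleR_sum_left ..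
  have i: "integrable lebesgue (\<lambda>x. indicator (cell \<epsilon> j) x *\<^sub>R f x)" if "j \<in> J" for j
    using assms(3)[OF that] integrable_lebesgue_on_indicator[OF cell_sets[OF assms(1)]] by blast
  show "integrable (lebesgue_on (\<Union>j\<in>J. cell \<epsilon> j)) f"
    unfolding integrable_lebesgue_on_indicator[OF U] eq using i by (intro Bochner_Integration.integrable_sum)
  show "(LINT x|lebesgue_on (\<Union>j\<in>J. cell \<epsilon> j). f x) = (\<Sum>j\<in>J. LINT x|lebesgue_on (cell \<epsilon> j). f x)"
    unfolding integral_lebesgue_on_indicator[OF U] eq integral_lebesgue_on_indicator[OF cell_sets[OF assms(1)]]
    using i by (intro Bochner_Integration.integral_sum)
qed

lemma AE_hit:
  assumes "\<epsilon> > 0" shows "AE x :: real^'n in lebesgue. x \<in> cball 0 R \<longrightarrow> x \<in> (\<Union>j\<in>hit R \<epsilon>. cell \<epsilon> j)"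
  using AE_cells[OF assms]
proof eventually_elim
  case (elim x)
  then obtain j where "x \<in> cell \<epsilon> j" ..
  then show ?case by (intro impI UN_I[of j]) (auto simp: hit_def)
qed

lemma hit_subset:
  assumes "\<epsilon> > 0" "\<epsilon> \<le> 1" "j \<in> hit R \<epsilon>"
  shows "cell \<epsilon> j \<subseteq> cball (0 :: real^'n) (R + real CARD('n))"
proof
  fix x assume x: "x \<in> cell \<epsilon> j"
  obtain y where y: "y \<in> cell \<epsilon> j" "norm y \<le> R" using assms(3) by (auto simp: hit_def)
  have "norm x \<le> norm y + norm (x - y)" using norm_triangle_ineq[of y "x - y"] by simp
  also have "\<dots> \<le> R + real CARD('n) * 1"
    using y(2) cell_dist(1)[OF assms(1) x y(1)] mult_left_mono[OF assms(2), of "real CARD('n)"] by linarith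
  finally show "x \<in> cball 0 (R + real CARD('n))" by simp
qed

text \<open>The cells are disjoint, have volume \<epsilon>^n and lie in one fixed ball. This
  converts a bound per cell into a bound uniform in \<epsilon>.\<close>

lemma card_hit:
  assumes "\<epsilon> > 0" "\<epsilon> \<le> 1"
  shows "real (card (hit R \<epsilon> :: (int^'n) set)) * \<epsilon> ^ CARD('n) \<le> measure lebesgue (cball (0 :: real^'n) (R + real CARD('n)))"
proof -
  let ?U = "\<Union>j\<in>hit R \<epsilon>. cell \<epsilon> j :: (real^'n) set"
  have 1: "integrable (lebesgue_on (cell \<epsilon> j)) (\<lambda>x. 1 :: real)" for j :: "int^'n"
    by (rule L2_imp_integrable[OF L2_bounded(1)[where C = 1] cell_lmeasurable[OF assms(1)]])
      (use cell_lmeasurable[OF assms(1)] in auto)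
  have U: "?U \<in> sets lebesgue" using finite_hit[OF assms(1)] cell_sets[OF assms(1)] by (intro sets.finite_UN) auto
  have "real (card (hit R \<epsilon> :: (int^'n) set)) * \<epsilon> ^ CARD('n) = (\<Sum>j\<in>hit R \<epsilon>. LINT x|lebesgue_on (cell \<epsilon> j :: (real^'n) set). 1)"
    by (simp add: measure_restrict_space cell_sets[OF assms(1)] cell_measure[OF assms(1)])
  also have "\<dots> = (LINT x|lebesgue_on ?U. 1)"
    by (rule integral_cells(2)[OF assms(1) finite_hit[OF assms(1)] 1, symmetric])
  also have "\<dots> = measure lebesgue ?U" using U by (simp add: measure_restrict_space)
  also have "\<dots> \<le> measure lebesgue (cball (0 :: real^'n) (R + real CARD('n)))"
    using hit_subset[OF assms] U by (intro measure_mono_fmeasurable) auto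
  finally show ?thesis .
qed

lemma integral_eq_sum_cells:
  fixes f :: "real^'n \<Rightarrow> 'b::{banach, second_countable_topology}"
  assumes "\<epsilon> > 0" "\<And>x. norm x > R \<Longrightarrow> f x = 0" "integrable lebesgue f"
  shows "(LINT x|lebesgue. f x) = (\<Sum>j\<in>hit R \<epsilon>. LINT x|lebesgue_on (cell \<epsilon> j). f x)"
proof -
  let ?U = "\<Union>j\<in>hit R \<epsilon>. cell \<epsilon> j :: (real^'n) set"
  have U: "?U \<in> sets lebesgue" using finite_hit[OF assms(1)] cell_sets[OF assms(1)] by (intro sets.finite_UN) auto
  have ae: "AE x in lebesgue. f x = indicator ?U x *\<^sub>R f x"
    using AE_hit[OF assms(1), of R]
  proof eventually_elim
    case (elim x)
    then show ?case using assms(2)[of x] by (cases "norm x \<le> R") (auto simp: indicator_def)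
  qed
  have "(LINT x|lebesgue. f x) = (LINT x|lebesgue. indicator ?U x *\<^sub>R f x)"
    using assms(3) U ae by (intro integral_cong_AE borel_measurable_integrable integrable_mult_indicator)
  also have "\<dots> = (LINT x|lebesgue_on ?U. f x)" by (simp only: integral_lebesgue_on_indicator[OF U])
  also have "\<dots> = (\<Sum>j\<in>hit R \<epsilon>. LINT x|lebesgue_on (cell \<epsilon> j). f x)"
    using assms(1,3) integrable_lebesgue_on_subset[of _ UNIV f] cell_sets[OF assms(1)]
    by (intro integral_cells finite_hit) (auto simp: lebesgue_on_UNIV_eq)
  finally show ?thesis .
qed

subsection \<open>Periodic functions\<close>

definition ae_periodic :: "(real^'n \<Rightarrow> 'b) \<Rightarrow> bool" where
  "ae_periodic f \<longleftrightarrow> (\<forall>k. AE y in lebesgue. f (y + lat k) = f y)"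

lemma
  fixes f :: "real^'n \<Rightarrow> 'b::euclidean_space"
  assumes "ae_periodic f" "\<epsilon> > 0"
  shows L2_cell: "f \<in> L2 Y \<Longrightarrow> (\<lambda>x. f (x /\<^sub>R \<epsilon>)) \<in> L2 (cell \<epsilon> j)"
    and sqn_cell: "f \<in> L2 Y \<Longrightarrow> sqn (cell \<epsilon> j) (\<lambda>x. f (x /\<^sub>R \<epsilon>)) = \<epsilon> ^ CARD('n) * sqn Y f"
    and integral_cell: "f \<in> L2 Y \<Longrightarrow> (LINT x|lebesgue_on (cell \<epsilon> j). f (x /\<^sub>R \<epsilon>)) = \<epsilon> ^ CARD('n) *\<^sub>R (LINT x|lebesgue_on Y. f x)"
proof -
  have e: "(\<epsilon> *\<^sub>R x + \<epsilon> *\<^sub>R lat j) /\<^sub>R \<epsilon> = x + lat j" for x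
    using assms(2) by (simp add: scaleR_add_right)
  have ae: "AE x in lebesgue_on Y. f x = f (x + lat j)"
  proof (rule AE_lebesgue_onI[OF Y_sets])
    have "AE x in lebesgue. f (x + lat j) = f x" using assms(1) by (simp add: ae_periodic_def)
    then show "AE x in lebesgue. f x = f (x + lat j)" by eventually_elim simp
  qed
  assume f: "f \<in> L2 Y"
  have l: "(\<lambda>x. f ((\<epsilon> *\<^sub>R x + \<epsilon> *\<^sub>R lat j) /\<^sub>R \<epsilon>)) \<in> L2 Y"
    unfolding e by (rule L2_cong_AE[OF f Y_sets ae])
  have e0: "\<epsilon> \<noteq> 0" using assms(2) by simp
  show "(\<lambda>x. f (x /\<^sub>R \<epsilon>)) \<in> L2 (cell \<epsilon> j)"
    unfolding cell_eq by (rule L2_affine_image(1)[OF e0 Y_sets l])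
  show "sqn (cell \<epsilon> j) (\<lambda>x. f (x /\<^sub>R \<epsilon>)) = \<epsilon> ^ CARD('n) * sqn Y f"
    unfolding cell_eq L2_affine_image(2)[OF e0 Y_sets l] e sqn_cong_AE[OF f Y_sets ae, symmetric] using assms(2) by simp
  have "(LINT x|lebesgue_on Y. f (x + lat j)) = (LINT x|lebesgue_on Y. f x)"
  proof (rule integral_cong_AE)
    show "AE x in lebesgue_on Y. f (x + lat j) = f x" using ae by eventually_elim simp
  qed (use L2_measurable[OF f] L2_measurable[OF L2_cong_AE[OF f Y_sets ae]] in auto)
  then show "(LINT x|lebesgue_on (cell \<epsilon> j). f (x /\<^sub>R \<epsilon>)) = \<epsilon> ^ CARD('n) *\<^sub>R (LINT x|lebesgue_on Y. f x)"
    unfolding cell_eq integral_affine_image[OF e0 Y_sets] e using assms(2) by simp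
qed

text \<open>On each cell the scaled function has \<epsilon>^n times the energy of one period, and
  the number of cells is of order \<epsilon>^(-n). Hence rapidly oscillating functions stay bounded
  as \<epsilon> tends to 0.\<close>

lemma periodic_L2_bounded:
  fixes f :: "real^'n \<Rightarrow> 'b::euclidean_space"
  assumes "ae_periodic f" "f \<in> L2 Y" "\<epsilon> > 0" "S \<in> sets lebesgue" "S \<subseteq> cball 0 R"
  shows "(\<lambda>x. f (x /\<^sub>R \<epsilon>)) \<in> L2 S"
    and "\<epsilon> \<le> 1 \<Longrightarrow> sqn S (\<lambda>x. f (x /\<^sub>R \<epsilon>)) \<le> measure lebesgue (cball (0 :: real^'n) (R + real CARD('n))) * sqn Y f"
proof -
  let ?U = "\<Union>j\<in>hit R \<epsilon>. cell \<epsilon> j :: (real^'n) set" and ?f = "\<lambda>x. f (x /\<^sub>R \<epsilon>)"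
  note fin = finite_hit[OF assms(3), of R]
  have U: "?U \<in> sets lebesgue" using fin cell_sets[OF assms(3)] by (intro sets.finite_UN) auto
  have i: "integrable (lebesgue_on (cell \<epsilon> j)) (\<lambda>x. (norm (?f x))\<^sup>2)" for j
    using L2_integrable_sq[OF L2_cell[OF assms(1,3,2)]] .
  have m: "?f \<in> borel_measurable (lebesgue_on ?U)"
  proof (rule borel_measurable_if_D)
    have "(\<lambda>x. \<Sum>j\<in>hit R \<epsilon>. if x \<in> cell \<epsilon> j then ?f x else 0) \<in> borel_measurable lebesgue"
      using L2_measurable[OF L2_cell[OF assms(1,3,2)]] cell_sets[OF assms(3)]
      by (intro borel_measurable_sum borel_measurable_if_I)
    moreover have "(\<Sum>j\<in>hit R \<epsilon>. if x \<in> cell \<epsilon> j then ?f x else 0) = (if x \<in> ?U then ?f x else 0)" for x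
    proof (cases "x \<in> ?U")
      case True
      then obtain j where j: "j \<in> hit R \<epsilon>" "x \<in> cell \<epsilon> j" by auto
      then have "(\<Sum>j\<in>hit R \<epsilon>. if x \<in> cell \<epsilon> j then ?f x else 0) = (\<Sum>k\<in>hit R \<epsilon>. if k = j then ?f x else 0)"
        using cell_unique[OF assms(3)] by (intro sum.cong) auto
      also have "\<dots> = ?f x" using j(1) fin by (subst sum.delta) auto
      finally show ?thesis using True by (simp only: if_True)
    qed auto
    ultimately show "(\<lambda>x. if x \<in> ?U then ?f x else 0) \<in> borel_measurable lebesgue" by simp
  qed
  have fU: "?f \<in> L2 ?U" using m integral_cells(1)[OF assms(3) fin i] by (simp add: L2_def)
  have SU: "S \<inter> ?U \<in> sets lebesgue" using U assms(4) by auto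
  have fSU: "?f \<in> L2 (S \<inter> ?U)" by (rule L2_subset[OF fU _ SU U]) auto
  have ae: "AE x in lebesgue_on S. (if x \<in> S \<inter> ?U then ?f x else 0) = ?f x"
    unfolding AE_lebesgue_on_iff[OF assms(4)] using AE_hit[OF assms(3), of R]
    by eventually_elim (use assms(5) in auto)
  have "(\<lambda>x. if x \<in> S \<inter> ?U then ?f x else 0) \<in> L2 S"
  proof -
    have "(\<lambda>x. if x \<in> S \<inter> ?U then ?f x else 0) \<in> borel_measurable lebesgue"
      by (rule borel_measurable_if_I[OF L2_measurable[OF fSU] SU])
    moreover have "integrable (lebesgue_on S) (\<lambda>x. (norm (if x \<in> S \<inter> ?U then ?f x else 0))\<^sup>2)"
    proof -
      have "integrable (lebesgue_on (S \<inter> ?U)) (\<lambda>x. (norm (if x \<in> S \<inter> ?U then ?f x else 0))\<^sup>2)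
          \<longleftrightarrow> integrable (lebesgue_on S) (\<lambda>x. (norm (if x \<in> S \<inter> ?U then ?f x else 0))\<^sup>2)"
        by (rule integral_lebesgue_on_support(2)) (use SU assms(4) in auto)
      moreover have "integrable (lebesgue_on (S \<inter> ?U)) (\<lambda>x. (norm (if x \<in> S \<inter> ?U then ?f x else 0))\<^sup>2)
          \<longleftrightarrow> integrable (lebesgue_on (S \<inter> ?U)) (\<lambda>x. (norm (?f x))\<^sup>2)"
        by (rule Bochner_Integration.integrable_cong) auto
      ultimately show ?thesis using L2_integrable_sq[OF fSU] by blast
    qed
    ultimately show ?thesis by (simp add: L2_def measurable_restrict_space1)
  qed
  from L2_cong_AE[OF this assms(4) ae] show fS: "?f \<in> L2 S" .
  assume le: "\<epsilon> \<le> 1"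
  have "sqn S ?f = sqn S (\<lambda>x. if x \<in> S \<inter> ?U then ?f x else 0)"
  proof (rule sqn_cong_AE[OF fS assms(4)])
    show "AE x in lebesgue_on S. ?f x = (if x \<in> S \<inter> ?U then ?f x else 0)" using ae by eventually_elim simp
  qed
  also have "\<dots> = sqn (S \<inter> ?U) (\<lambda>x. if x \<in> S \<inter> ?U then ?f x else 0)"
    by (rule integral_lebesgue_on_support(1)[symmetric]) (use SU assms(4) in auto)
  also have "\<dots> = sqn (S \<inter> ?U) ?f" by (rule Bochner_Integration.integral_cong) auto
  also have "\<dots> \<le> sqn ?U ?f" by (rule sqn_subset_le[OF fU _ SU U]) auto
  also have "\<dots> = (\<Sum>j\<in>(hit R \<epsilon> :: (int^'n) set). \<epsilon> ^ CARD('n) * sqn Y f)"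
    unfolding integral_cells(2)[OF assms(3) fin i] sqn_cell[OF assms(1,3,2)] ..
  also have "\<dots> = (real (card (hit R \<epsilon> :: (int^'n) set)) * \<epsilon> ^ CARD('n)) * sqn Y f" by simp
  also have "\<dots> \<le> measure lebesgue (cball (0 :: real^'n) (R + real CARD('n))) * sqn Y f"
    by (intro mult_right_mono card_hit assms le sqn_nonneg)
  finally show "sqn S ?f \<le> measure lebesgue (cball (0 :: real^'n) (R + real CARD('n))) * sqn Y f" .
qed


subsection \<open>A Poincare inequality summed over cells\<close>

lemma nn_integral_lborel_eq_integral:
  fixes f :: "'a::euclidean_space \<Rightarrow> real"
  assumes "integrable lebesgue f" "\<And>x. 0 \<le> f x"
  shows "(\<integral>\<^sup>+x. ennreal (f x) \<partial>lborel) = ennreal (LINT x|lebesgue. f x)"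
  using nn_integral_eq_integral[OF assms(1)] assms(2) by (simp add: nn_integral_completion)

text \<open>Jensen on the cell: the deviation of f(x) from the mean is the mean of f(x) - f(y) over
  y.\<close>

lemma test_function_cell_mean_deviation:
  fixes f :: "real^'n \<Rightarrow> real"
  assumes "f \<in> test_functions UNIV" "\<epsilon> > 0"
  shows "(f x - (LINT y|lebesgue_on (cell \<epsilon> j). f y) / \<epsilon> ^ CARD('n))\<^sup>2
    \<le> (LINT y|lebesgue_on (cell \<epsilon> j). (f y - f x)\<^sup>2) / \<epsilon> ^ CARD('n)"
proof -
  let ?C = "cell \<epsilon> j :: (real^'n) set" and ?m = "\<epsilon> ^ CARD('n)"
  have m: "?m > 0" using assms(2) by simp
  note Cs = cell_sets[OF assms(2), of j] and Cl = cell_lmeasurable[OF assms(2), of j]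
  have c: "(\<lambda>y. f x) \<in> L2 ?C" by (rule L2_bounded(1)[where C = "\<bar>f x\<bar>"]) (use Cl in auto)
  have d: "(\<lambda>y. f y - f x) \<in> L2 ?C" by (intro L2_diff c test_functions_L2(1)[OF assms(1) Cs])
  have "(LINT y|lebesgue_on ?C. f y - f x) = (LINT y|lebesgue_on ?C. f y) - ?m * f x"
    using test_functions_integrable(1)[OF assms(1) Cs] L2_imp_integrable[OF c Cl]
    by (simp add: measure_restrict_space Cs cell_measure[OF assms(2)])
  then have I1: "(LINT y|lebesgue_on ?C. f y) = (LINT y|lebesgue_on ?C. f y - f x) + ?m * f x" by simp
  have "f x - (LINT y|lebesgue_on ?C. f y) / ?m = - ((LINT y|lebesgue_on ?C. f y - f x) / ?m)"
    unfolding I1 using m assms(2) by (simp add: add_divide_distrib)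
  then have "(f x - (LINT y|lebesgue_on ?C. f y) / ?m)\<^sup>2 = (LINT y|lebesgue_on ?C. f y - f x)\<^sup>2 / ?m\<^sup>2"
    by (simp only: power2_minus power_divide)
  also have "\<dots> \<le> (?m * sqn ?C (\<lambda>y. f y - f x)) / ?m\<^sup>2"
    using norm_integral_power2_le[OF d Cl] by (intro divide_right_mono) (simp_all add: cell_measure[OF assms(2)])
  also have "\<dots> = (LINT y|lebesgue_on ?C. (f y - f x)\<^sup>2) / ?m"
    using m by (simp add: power2_eq_square)
  finally show ?thesis .
qed

text \<open>The deviation from the cell mean is bounded by increments f(x + z) - f(x) with x and x +
  z in one cell. Releasing x to the whole space and z to the cube Q makes the translation estimate
  applicable. The constant collects |Q| / \<epsilon>^n = 2^n and |z| <= n \<epsilon>. The bound is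
  for the sum over cells against the global gradient, which is the form needed.\<close>

lemma sum_cells_poincare:
  fixes f :: "real^'n \<Rightarrow> real"
  assumes f: "f \<in> test_functions UNIV" and eps: "\<epsilon> > 0" and J: "finite J"
  shows "(\<Sum>j\<in>J. sqn (cell \<epsilon> j) (\<lambda>x. f x - (LINT y|lebesgue_on (cell \<epsilon> j). f y) / \<epsilon> ^ CARD('n)))
    \<le> 2 ^ CARD('n) * (real CARD('n))\<^sup>2 * \<epsilon>\<^sup>2 * sqn UNIV (grad f)"
proof -
  let ?m = "\<epsilon> ^ CARD('n)" and ?G = "sqn UNIV (grad f)"
  define M where "M = (\<lambda>j. (LINT y|lebesgue_on (cell \<epsilon> j). f y) / ?m)"
  \<comment> \<open>Q contains all differences of two points of a common cell, whichever cell it is;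
    this decouples z from j.\<close>
  define Q :: "(real^'n) set" where "Q = {z. \<forall>i. \<bar>z $ i\<bar> < \<epsilon>}"
  define h where "h = (\<lambda>x. \<integral>\<^sup>+z. indicator Q z * ennreal ((f (x + z) - f x)\<^sup>2) \<partial>lborel)"
  have m: "?m > 0" using eps by simp
  have Qbox: "Q = box (\<chi> i. - \<epsilon>) (\<chi> i. \<epsilon>)" by (auto simp: Q_def mem_box_cart abs_less_iff minus_less_iff)
  have Qb [measurable]: "Q \<in> sets borel" unfolding Qbox by simp
  have Qim: "Q = (\<lambda>x. (2 * \<epsilon>) *\<^sub>R x + (\<chi> i. - \<epsilon>)) ` Y"
  proof
    show "(\<lambda>x. (2 * \<epsilon>) *\<^sub>R x + (\<chi> i. - \<epsilon>)) ` Y \<subseteq> Q"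
      using eps by (auto simp: Q_def Y_def abs_less_iff algebra_simps)
    show "Q \<subseteq> (\<lambda>x. (2 * \<epsilon>) *\<^sub>R x + (\<chi> i. - \<epsilon>)) ` Y"
    proof
      fix z assume "z \<in> Q"
      then have "0 < z $ i + \<epsilon>" "z $ i + \<epsilon> < 2 * \<epsilon>" for i
        unfolding Q_def by (auto dest!: spec[of _ i])
      then have "(\<chi> i. (z $ i + \<epsilon>) / (2 * \<epsilon>)) \<in> Y"
        using eps by (auto simp: Y_def)
      moreover have "z = (2 * \<epsilon>) *\<^sub>R (\<chi> i. (z $ i + \<epsilon>) / (2 * \<epsilon>)) + (\<chi> i. - \<epsilon>)"
        using eps by (simp add: vec_eq_iff)
      ultimately show "z \<in> (\<lambda>x. (2 * \<epsilon>) *\<^sub>R x + (\<chi> i. - \<epsilon>)) ` Y" by blast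
    qed
  qed
  have Ql: "Q \<in> lmeasurable" unfolding Qbox by simp
  have Qm: "emeasure lborel Q = ennreal ((2 * \<epsilon>) ^ CARD('n))"
  proof -
    have "measure lebesgue Q = (2 * \<epsilon>) ^ CARD('n)"
      unfolding Qim using eps by (subst measure_lebesgue_affine) (simp add: Y_measure)
    moreover have "emeasure lebesgue Q = ennreal (measure lebesgue Q)"
      using Ql by (simp add: emeasure_eq_measure2)
    ultimately show ?thesis by (simp add: emeasure_completion Qb)
  qed
  have fc: "continuous_on UNIV f" using test_functions_smooth[OF f] smooth_continuous_on by blast
  have fb [measurable]: "f \<in> borel_measurable borel" using fc by (rule borel_measurable_continuous_onI)
  have dev: "ennreal ((f x - M j)\<^sup>2) \<le> ennreal (1 / ?m) * h x" if x: "x \<in> cell \<epsilon> j" for x j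
  proof -
    note Cs = cell_sets[OF eps, of j] and Cl = cell_lmeasurable[OF eps, of j]
    have Cb [measurable]: "cell \<epsilon> j \<in> sets borel" using cell_open[OF eps] by (rule borel_open)
    have c: "(\<lambda>y. f x) \<in> L2 (cell \<epsilon> j)" by (rule L2_bounded(1)[where C = "\<bar>f x\<bar>"]) (use Cl in auto)
    have d: "(\<lambda>y. f y - f x) \<in> L2 (cell \<epsilon> j)" by (intro L2_diff c test_functions_L2(1)[OF f Cs])
    have i: "integrable lebesgue (\<lambda>y. indicator (cell \<epsilon> j) y * (f y - f x)\<^sup>2)"
      using L2_integrable_sq[OF d] Cs by (simp add: integrable_lebesgue_on_indicator)
    have "ennreal (LINT y|lebesgue_on (cell \<epsilon> j). (f y - f x)\<^sup>2)
        = ennreal (LINT y|lebesgue. indicator (cell \<epsilon> j) y * (f y - f x)\<^sup>2)"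
      by (simp add: integral_lebesgue_on_indicator[OF Cs])
    also have "\<dots> = (\<integral>\<^sup>+y. ennreal (indicator (cell \<epsilon> j) y * (f y - f x)\<^sup>2) \<partial>lborel)"
      by (rule nn_integral_lborel_eq_integral[symmetric, OF i]) auto
    also have "\<dots> = (\<integral>\<^sup>+y. ennreal (indicator (cell \<epsilon> j) y * (f y - f x)\<^sup>2) \<partial>distr lborel borel ((+) x))"
      by (simp add: lborel_distr_plus)
    also have "\<dots> = (\<integral>\<^sup>+z. ennreal (indicator (cell \<epsilon> j) (x + z) * (f (x + z) - f x)\<^sup>2) \<partial>lborel)"
      by (subst nn_integral_distr) measurable
    also have "\<dots> \<le> h x" unfolding h_def
    proof (rule nn_integral_mono)
      fix z
      have "z \<in> Q" if "x + z \<in> cell \<epsilon> j" using cell_dist(2)[OF eps that x] by (auto simp: Q_def)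
      then show "ennreal (indicator (cell \<epsilon> j) (x + z) * (f (x + z) - f x)\<^sup>2) \<le> indicator Q z * ennreal ((f (x + z) - f x)\<^sup>2)"
        by (auto simp: indicator_def)
    qed
    finally have le: "ennreal (LINT y|lebesgue_on (cell \<epsilon> j). (f y - f x)\<^sup>2) \<le> h x" .
    have "ennreal ((f x - M j)\<^sup>2) \<le> ennreal (1 / ?m * (LINT y|lebesgue_on (cell \<epsilon> j). (f y - f x)\<^sup>2))"
      using test_function_cell_mean_deviation[OF f eps, of x j] by (intro ennreal_leI) (simp add: M_def)
    also have "\<dots> = ennreal (1 / ?m) * ennreal (LINT y|lebesgue_on (cell \<epsilon> j). (f y - f x)\<^sup>2)"
      using m by (subst ennreal_mult) auto
    also have "\<dots> \<le> ennreal (1 / ?m) * h x" using le by (rule mult_left_mono) simp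
    finally show ?thesis .
  qed
  have m1: "(\<lambda>p :: (real^'n) \<times> (real^'n). f (fst p + snd p)) \<in> borel_measurable (lborel \<Otimes>\<^sub>M lborel)"
  proof -
    have "(\<lambda>p :: (real^'n) \<times> (real^'n). f (fst p + snd p)) \<in> borel_measurable borel"
      by (intro borel_measurable_continuous_onI continuous_on_compose2[OF fc] continuous_intros) auto
    then show ?thesis by (simp add: lborel_prod)
  qed
  have m2: "(\<lambda>(x, z). indicator Q z * ennreal ((f (x + z) - f x)\<^sup>2)) \<in> borel_measurable (lborel \<Otimes>\<^sub>M lborel)"
    unfolding case_prod_beta using m1 by measurable
  have hm [measurable]: "h \<in> borel_measurable lborel"
    unfolding h_def using lborel.borel_measurable_nn_integral[OF m2] by simp
  have "(\<integral>\<^sup>+x. h x \<partial>lborel) = (\<integral>\<^sup>+z. \<integral>\<^sup>+x. indicator Q z * ennreal ((f (x + z) - f x)\<^sup>2) \<partial>lborel \<partial>lborel)"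
    unfolding h_def using lborel_pair.Fubini'[OF m2] by simp
  also have "\<dots> \<le> (\<integral>\<^sup>+z. ennreal ((real CARD('n) * \<epsilon>)\<^sup>2 * ?G) * indicator Q z \<partial>lborel)"
  proof (rule nn_integral_mono)
    fix z :: "real^'n"
    show "(\<integral>\<^sup>+x. indicator Q z * ennreal ((f (x + z) - f x)\<^sup>2) \<partial>lborel) \<le> ennreal ((real CARD('n) * \<epsilon>)\<^sup>2 * ?G) * indicator Q z"
    proof (cases "z \<in> Q")
      case True
      have "norm z \<le> (\<Sum>i\<in>UNIV. \<bar>z $ i\<bar>)" by (rule norm_le_l1_cart)
      also have "\<dots> \<le> (\<Sum>i\<in>(UNIV :: 'n set). \<epsilon>)" using True by (intro sum_mono) (auto simp: Q_def less_imp_le)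
      finally have nz: "norm z \<le> real CARD('n) * \<epsilon>" by simp
      have fz: "(\<lambda>x. f (x + z)) \<in> test_functions UNIV" using test_functions_affine[OF f, of 1 z] by simp
      have "(\<lambda>x. f (x + z) - f x) \<in> L2 UNIV" by (intro L2_diff test_functions_L2(1)[OF f] test_functions_L2(1)[OF fz]) auto
      then have "integrable lebesgue (\<lambda>x. (f (x + z) - f x)\<^sup>2)" by (auto dest: L2_integrable_sq simp: lebesgue_on_UNIV_eq)
      then have "(\<integral>\<^sup>+x. ennreal ((f (x + z) - f x)\<^sup>2) \<partial>lborel) = ennreal (LINT x|lebesgue. (f (x + z) - f x)\<^sup>2)"
        by (intro nn_integral_lborel_eq_integral) auto
      also have "\<dots> \<le> ennreal ((norm z)\<^sup>2 * ?G)"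
        using translation_estimate[OF f, of z] by (intro ennreal_leI) (simp add: lebesgue_on_UNIV_eq)
      also have "\<dots> \<le> ennreal ((real CARD('n) * \<epsilon>)\<^sup>2 * ?G)"
        using nz by (intro ennreal_leI mult_right_mono power_mono) auto
      finally show ?thesis using True by simp
    qed simp
  qed
  also have "\<dots> = ennreal ((real CARD('n) * \<epsilon>)\<^sup>2 * ?G) * ennreal ((2 * \<epsilon>) ^ CARD('n))"
    by (subst nn_integral_cmult_indicator) (auto simp: Qm)
  also have "\<dots> = ennreal ((real CARD('n) * \<epsilon>)\<^sup>2 * ?G * (2 * \<epsilon>) ^ CARD('n))"
    using eps by (subst ennreal_mult) auto
  finally have hI: "(\<integral>\<^sup>+x. h x \<partial>lborel) \<le> ennreal ((real CARD('n) * \<epsilon>)\<^sup>2 * ?G * (2 * \<epsilon>) ^ CARD('n))" .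
  have cellnn: "ennreal (sqn (cell \<epsilon> j) (\<lambda>x. f x - M j)) \<le> (\<integral>\<^sup>+x. indicator (cell \<epsilon> j) x * (ennreal (1 / ?m) * h x) \<partial>lborel)" for j
  proof -
    note Cs = cell_sets[OF eps, of j] and Cl = cell_lmeasurable[OF eps, of j]
    have c: "(\<lambda>y. M j) \<in> L2 (cell \<epsilon> j)" by (rule L2_bounded(1)[where C = "\<bar>M j\<bar>"]) (use Cl in auto)
    have d: "(\<lambda>y. f y - M j) \<in> L2 (cell \<epsilon> j)" by (intro L2_diff c test_functions_L2(1)[OF f Cs])
    have i: "integrable lebesgue (\<lambda>y. indicator (cell \<epsilon> j) y * (f y - M j)\<^sup>2)"
      using L2_integrable_sq[OF d] Cs by (simp add: integrable_lebesgue_on_indicator)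
    have "ennreal (sqn (cell \<epsilon> j) (\<lambda>x. f x - M j)) = ennreal (LINT y|lebesgue. indicator (cell \<epsilon> j) y * (f y - M j)\<^sup>2)"
      by (simp add: integral_lebesgue_on_indicator[OF Cs])
    also have "\<dots> = (\<integral>\<^sup>+y. ennreal (indicator (cell \<epsilon> j) y * (f y - M j)\<^sup>2) \<partial>lborel)"
      by (rule nn_integral_lborel_eq_integral[symmetric, OF i]) auto
    also have "\<dots> \<le> (\<integral>\<^sup>+x. indicator (cell \<epsilon> j) x * (ennreal (1 / ?m) * h x) \<partial>lborel)"
      by (rule nn_integral_mono) (auto simp: indicator_def dev)
    finally show ?thesis .
  qed
  have "ennreal (\<Sum>j\<in>J. sqn (cell \<epsilon> j) (\<lambda>x. f x - M j)) = (\<Sum>j\<in>J. ennreal (sqn (cell \<epsilon> j) (\<lambda>x. f x - M j)))"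
    by (rule sum_ennreal[symmetric]) (rule sqn_nonneg)
  also have "\<dots> \<le> (\<Sum>j\<in>J. \<integral>\<^sup>+x. indicator (cell \<epsilon> j) x * (ennreal (1 / ?m) * h x) \<partial>lborel)"
    by (intro sum_mono cellnn)
  also have "\<dots> = (\<integral>\<^sup>+x. (\<Sum>j\<in>J. indicator (cell \<epsilon> j) x * (ennreal (1 / ?m) * h x)) \<partial>lborel)"
  proof (rule nn_integral_sum[symmetric])
    fix j :: "int^'n"
    have [measurable]: "cell \<epsilon> j \<in> sets borel" using cell_open[OF eps] by (rule borel_open)
    show "(\<lambda>x. indicator (cell \<epsilon> j) x * (ennreal (1 / ?m) * h x)) \<in> borel_measurable lborel" by measurable
  qed
  also have "\<dots> \<le> (\<integral>\<^sup>+x. ennreal (1 / ?m) * h x \<partial>lborel)"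
  proof (rule nn_integral_mono)
    fix x :: "real^'n"
    have "indicator (\<Union>j\<in>J. cell \<epsilon> j) x = (\<Sum>j\<in>J. indicator (cell \<epsilon> j) x :: ennreal)"
      using eps J cell_unique by (intro indicator_UN_disjoint) (auto simp: disjoint_family_on_def)
    then have "(\<Sum>j\<in>J. indicator (cell \<epsilon> j) x * (ennreal (1 / ?m) * h x)) = indicator (\<Union>j\<in>J. cell \<epsilon> j) x * (ennreal (1 / ?m) * h x)"
      by (simp add: sum_distrib_right)
    also have "\<dots> \<le> ennreal (1 / ?m) * h x" by (simp add: indicator_def)
    finally show "(\<Sum>j\<in>J. indicator (cell \<epsilon> j) x * (ennreal (1 / ?m) * h x)) \<le> ennreal (1 / ?m) * h x" .
  qed
  also have "\<dots> = ennreal (1 / ?m) * (\<integral>\<^sup>+x. h x \<partial>lborel)" by (rule nn_integral_cmult) (rule hm)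
  also have "\<dots> \<le> ennreal (1 / ?m) * ennreal ((real CARD('n) * \<epsilon>)\<^sup>2 * ?G * (2 * \<epsilon>) ^ CARD('n))"
    using hI by (rule mult_left_mono) simp
  also have "\<dots> = ennreal (1 / ?m * ((real CARD('n) * \<epsilon>)\<^sup>2 * ?G * (2 * \<epsilon>) ^ CARD('n)))"
    using m eps by (subst ennreal_mult) auto
  also have "1 / ?m * ((real CARD('n) * \<epsilon>)\<^sup>2 * ?G * (2 * \<epsilon>) ^ CARD('n)) = 2 ^ CARD('n) * (real CARD('n))\<^sup>2 * \<epsilon>\<^sup>2 * ?G"
    using m by (simp add: power_mult_distrib)
  finally show ?thesis unfolding M_def using eps by (subst (asm) ennreal_le_iff) auto
qed

text \<open>Since s has mean zero on every cell, f may be replaced by its deviation from the cell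
  mean. Cauchy-Schwarz on each cell and then over the cells leaves the summed Poincare inequality
  and a uniformly bounded energy of s. This is the source of the factor \<epsilon>.\<close>

lemma oscillating_integral_bound:
  fixes f s :: "real^'n \<Rightarrow> real"
  assumes f: "f \<in> test_functions UNIV" "\<And>x. norm x > R \<Longrightarrow> f x = 0"
    and s: "ae_periodic s" "s \<in> L2 Y" "(LINT y|lebesgue_on Y. s y) = 0" and eps: "\<epsilon> > 0" "\<epsilon> \<le> 1"
  shows "(LINT x|lebesgue. f x * s (x /\<^sub>R \<epsilon>))\<^sup>2
    \<le> 2 ^ CARD('n) * (real CARD('n))\<^sup>2 * measure lebesgue (cball (0 :: real^'n) (R + real CARD('n)))
      * \<epsilon>\<^sup>2 * sqn UNIV (grad f) * sqn Y s"
proof -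
  let ?J = "hit R \<epsilon> :: (int^'n) set" and ?s = "\<lambda>x. s (x /\<^sub>R \<epsilon>)"
  let ?K = "measure lebesgue (cball (0 :: real^'n) (R + real CARD('n)))"
  define M where "M = (\<lambda>j. (LINT y|lebesgue_on (cell \<epsilon> j). f y) / \<epsilon> ^ CARD('n))"
  have i: "integrable lebesgue (\<lambda>x. f x * ?s x)"
  proof -
    have "integrable (lebesgue_on (cball 0 R)) (\<lambda>x. f x \<bullet> ?s x)"
      by (intro L2_inner_integrable test_functions_L2(1)[OF f(1)] periodic_L2_bounded(1)[OF s(1,2) eps(1), of _ R]) auto
    moreover have "integrable (lebesgue_on (cball 0 R)) (\<lambda>x. f x * ?s x) \<longleftrightarrow> integrable (lebesgue_on UNIV) (\<lambda>x. f x * ?s x)"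
      by (rule integral_lebesgue_on_support(2)) (use f(2) in auto)
    ultimately show ?thesis by (simp add: lebesgue_on_UNIV_eq)
  qed
  have c: "(LINT x|lebesgue_on (cell \<epsilon> j). f x * ?s x) = (LINT x|lebesgue_on (cell \<epsilon> j). (f x - M j) \<bullet> ?s x)"
    and le: "\<bar>LINT x|lebesgue_on (cell \<epsilon> j). (f x - M j) \<bullet> ?s x\<bar>
      \<le> L2_norm (cell \<epsilon> j) (\<lambda>x. f x - M j) * L2_norm (cell \<epsilon> j) ?s" for j :: "int^'n"
  proof -
    note Cs = cell_sets[OF eps(1), of j] and Cl = cell_lmeasurable[OF eps(1), of j]
    have sL: "?s \<in> L2 (cell \<epsilon> j)" by (rule L2_cell[OF s(1) eps(1) s(2)])
    have fL: "f \<in> L2 (cell \<epsilon> j)" by (rule test_functions_L2(1)[OF f(1) Cs])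
    have cL: "(\<lambda>y. M j) \<in> L2 (cell \<epsilon> j)" by (rule L2_bounded(1)[where C = "\<bar>M j\<bar>"]) (use Cl in auto)
    have "(LINT x|lebesgue_on (cell \<epsilon> j). ?s x) = 0"
      using integral_cell[OF s(1) eps(1) s(2), of j] s(3) by simp
    then show "(LINT x|lebesgue_on (cell \<epsilon> j). f x * ?s x) = (LINT x|lebesgue_on (cell \<epsilon> j). (f x - M j) \<bullet> ?s x)"
      using L2_inner_integrable[OF fL sL] L2_imp_integrable[OF sL Cl] by (simp add: left_diff_distrib)
    show "\<bar>LINT x|lebesgue_on (cell \<epsilon> j). (f x - M j) \<bullet> ?s x\<bar>
      \<le> L2_norm (cell \<epsilon> j) (\<lambda>x. f x - M j) * L2_norm (cell \<epsilon> j) ?s"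
      by (intro L2_Cauchy_Schwarz L2_diff fL cL sL)
  qed
  have "\<bar>LINT x|lebesgue. f x * ?s x\<bar> \<le> (\<Sum>j\<in>?J. \<bar>LINT x|lebesgue_on (cell \<epsilon> j). (f x - M j) \<bullet> ?s x\<bar>)"
    unfolding integral_eq_sum_cells[OF eps(1) _ i, of R, simplified f(2) mult_zero_left, OF refl] c by (rule sum_abs)
  also have "\<dots> \<le> (\<Sum>j\<in>?J. \<bar>L2_norm (cell \<epsilon> j) (\<lambda>x. f x - M j)\<bar> * \<bar>L2_norm (cell \<epsilon> j) ?s\<bar>)"
    using le by (intro sum_mono) (simp add: L2_norm_nonneg)
  also have "\<dots> \<le> L2_set (\<lambda>j. L2_norm (cell \<epsilon> j) (\<lambda>x. f x - M j)) ?J * L2_set (\<lambda>j. L2_norm (cell \<epsilon> j) ?s) ?J"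
    by (rule L2_set_mult_ineq)
  finally have "\<bar>LINT x|lebesgue. f x * ?s x\<bar>\<^sup>2
      \<le> (L2_set (\<lambda>j. L2_norm (cell \<epsilon> j) (\<lambda>x. f x - M j)) ?J * L2_set (\<lambda>j. L2_norm (cell \<epsilon> j) ?s) ?J)\<^sup>2"
    by (intro power_mono) auto
  also have "\<dots> = (\<Sum>j\<in>?J. sqn (cell \<epsilon> j) (\<lambda>x. f x - M j)) * (\<Sum>j\<in>?J. sqn (cell \<epsilon> j) ?s)"
    unfolding power_mult_distrib L2_set_def by (simp add: sum_nonneg L2_norm_power2)
  also have "(\<Sum>j\<in>?J. sqn (cell \<epsilon> j) ?s) = (real (card ?J) * \<epsilon> ^ CARD('n)) * sqn Y s"
    by (simp only: sqn_cell[OF s(1) eps(1) s(2)] sum_constant mult.assoc)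
  also have "(\<Sum>j\<in>?J. sqn (cell \<epsilon> j) (\<lambda>x. f x - M j)) * ((real (card ?J) * \<epsilon> ^ CARD('n)) * sqn Y s)
      \<le> (2 ^ CARD('n) * (real CARD('n))\<^sup>2 * \<epsilon>\<^sup>2 * sqn UNIV (grad f)) * (?K * sqn Y s)"
    using sum_cells_poincare[OF f(1) eps(1) finite_hit[OF eps(1)], of R] card_hit[OF eps, of R] eps
    by (intro mult_mono mult_right_mono) (auto simp: M_def)
  finally show ?thesis by (simp add: mult_ac)
qed

subsection \<open>Periodic Sobolev functions\<close>

text \<open>Membership in \<open>H12_loc\<close> gives one gradient for each bounded open set.
  Uniqueness makes those on growing balls agree almost everywhere, so they glue to a gradient on the
  whole space.\<close>

lemma H12_loc_weak_grad:
  fixes W :: "real^'n \<Rightarrow> real"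
  assumes "W \<in> H12_loc"
  obtains G where "is_weak_grad UNIV W G" "\<And>S. S \<in> sets lebesgue \<Longrightarrow> bounded S \<Longrightarrow> W \<in> L2 S"
    "\<And>S. S \<in> sets lebesgue \<Longrightarrow> bounded S \<Longrightarrow> G \<in> L2 S"
proof -
  let ?U = "\<lambda>m. ball (0 :: real^'n) (real (Suc m))"
  have W: "W \<in> H12 (?U m)" for m using assms by (simp add: H12_loc_def)
  have Uo: "open (?U m)" "?U m \<in> sets lebesgue" for m by (auto intro: open_sets_lebesgue)
  define g where "g m = weak_grad (?U m) W" for m
  note D = H12D[OF W Uo(1), folded g_def]
  \<comment> \<open>The index \<open>nat \<lfloor>norm x\<rfloor>\<close> is the least m for which x
    lies in the open ball of radius m + 1.\<close>
  define G where "G = (\<lambda>x :: real^'n. g (nat \<lfloor>norm x\<rfloor>) x)"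
  have ae: "AE x in lebesgue. \<forall>m k. k \<le> m \<longrightarrow> x \<in> ?U k \<longrightarrow> g m x = g k x"
  proof (subst AE_all_countable, intro allI, subst AE_all_countable, intro allI)
    fix m k
    show "AE x in lebesgue. k \<le> m \<longrightarrow> x \<in> ?U k \<longrightarrow> g m x = g k x"
    proof (cases "k \<le> m")
      case True
      have "is_weak_grad (?U k) W (g m)"
        by (rule is_weak_grad_subset[OF D(3)[of m] _ Uo(2) Uo(2)]) (use True in auto)
      from is_weak_grad_unique[OF Uo(1) this D(3)[of k]]
      show ?thesis unfolding AE_lebesgue_on_iff[OF Uo(2)] by eventually_elim auto
    qed simp
  qed
  have GU: "AE x in lebesgue_on (?U m). g m x = G x" for m
    unfolding AE_lebesgue_on_iff[OF Uo(2)] using ae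
  proof eventually_elim
    case (elim x)
    show ?case
    proof
      assume "x \<in> ?U m"
      then have x: "norm x < real (Suc m)" by simp
      have "nat \<lfloor>norm x\<rfloor> \<le> m" "norm x < real (Suc (nat \<lfloor>norm x\<rfloor>))" using x by linarith+
      then show "g m x = G x" using elim unfolding G_def by simp
    qed
  qed
  have GL: "G \<in> L2 (?U m)" for m by (rule L2_cong_AE[OF D(2) Uo(2) GU])
  have w: "is_weak_grad (?U m) W G" for m
    by (rule is_weak_grad_cong_AE[OF D(3) Uo(2) _ GU]) auto
  have ex: "\<exists>m. S \<subseteq> ?U m" if b: "bounded S" for S :: "(real^'n) set"
  proof -
    obtain R where R: "\<And>x. x \<in> S \<Longrightarrow> norm x \<le> R" using b unfolding bounded_iff by blast
    obtain m where "R < real m" using reals_Archimedean2 by blast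
    then have "S \<subseteq> ?U m" using R by force
    then show ?thesis by blast
  qed
  show thesis
  proof (rule that[of G])
    show L: "W \<in> L2 S" "G \<in> L2 S" if "S \<in> sets lebesgue" "bounded S" for S
    proof -
      obtain m where "S \<subseteq> ?U m" using ex[OF \<open>bounded S\<close>] ..
      then show "W \<in> L2 S" "G \<in> L2 S" using L2_subset[OF D(1) _ _ Uo(2)] L2_subset[OF GL _ _ Uo(2)] that by blast+
    qed
    show "is_weak_grad UNIV W G" unfolding is_weak_grad_def
    proof (intro conjI ballI)
      have "integrable (lebesgue_on K) W" "integrable (lebesgue_on K) G" if "compact K" for K
        using that L by (auto intro!: L2_imp_integrable simp: lmeasurable_compact fmeasurableD compact_imp_bounded)
      then show "loc_integrable UNIV W" "loc_integrable UNIV G" by (auto simp: loc_integrable_def)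
      fix \<phi> :: "real^'n \<Rightarrow> real" assume "\<phi> \<in> test_functions UNIV"
      then obtain K where K: "smooth \<phi>" "compact K" "\<And>x. x \<notin> K \<Longrightarrow> \<phi> x = 0" using test_functionsE by metis
      obtain m where m: "K \<subseteq> ?U m" using ex compact_imp_bounded[OF K(2)] by blast
      have t: "\<phi> \<in> test_functions (?U m)" by (rule test_functionsI[OF K(1,2) m K(3)])
      show "(LINT x|lebesgue_on UNIV. W x *\<^sub>R grad \<phi> x) = - (LINT x|lebesgue_on UNIV. \<phi> x *\<^sub>R G x)"
        using is_weak_gradD(3)[OF w t] test_functions_integral_subset(1,2)[OF t, of UNIV] Uo(2) by simp
    qed
  qed
qed

lemma per_ext_lat: "per_ext u (y + lat k) = per_ext u y"
proof -
  have "(\<chi> i. frac ((y + lat k) $ i)) = (\<chi> i. frac (y $ i))" by (simp add: vec_eq_iff lat_def frac_def)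
  then show ?thesis by (simp only: per_ext_def)
qed

lemma per_ext_Y: "y \<in> Y \<Longrightarrow> per_ext u y = u y"
proof -
  assume "y \<in> Y"
  then have "(\<chi> i. frac (y $ i)) = y" by (auto simp: Y_def vec_eq_iff frac_eq less_imp_le)
  then show ?thesis by (simp add: per_ext_def)
qed

text \<open>\<open>weak_grad\<close> chooses representatives separately on Y and on the whole space,
  and its choice need not be periodic. Uniqueness of weak gradients gives agreement on Y, and
  applied to a lattice translate it gives periodicity almost everywhere.\<close>

lemma per_ext_weak_grad:
  fixes u :: "real^'n \<Rightarrow> real"
  assumes "u \<in> H12_per"
  defines "G \<equiv> weak_grad UNIV (per_ext u)"
  shows "is_weak_grad UNIV (per_ext u) G"
    and "\<And>S. S \<in> sets lebesgue \<Longrightarrow> bounded S \<Longrightarrow> per_ext u \<in> L2 S"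
    and "\<And>S. S \<in> sets lebesgue \<Longrightarrow> bounded S \<Longrightarrow> G \<in> L2 S"
    and "ae_periodic G" and "AE y in lebesgue_on Y. weak_grad Y u y = G y"
proof -
  have "per_ext u \<in> H12_loc" using assms(1) by (simp add: H12_per_def)
  then obtain G' where G': "is_weak_grad UNIV (per_ext u) G'"
    "\<And>S. S \<in> sets lebesgue \<Longrightarrow> bounded S \<Longrightarrow> per_ext u \<in> L2 S"
    "\<And>S. S \<in> sets lebesgue \<Longrightarrow> bounded S \<Longrightarrow> G' \<in> L2 S"
    by (rule H12_loc_weak_grad) (rule that)
  show w: "is_weak_grad UNIV (per_ext u) G" unfolding G_def by (rule weak_grad_is_weak_grad[OF G'(1)])
  show "\<And>S. S \<in> sets lebesgue \<Longrightarrow> bounded S \<Longrightarrow> per_ext u \<in> L2 S" by (rule G'(2))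
  have ae: "AE x in lebesgue. G' x = G x"
    by (rule is_weak_grad_unique[OF open_UNIV G'(1) w, unfolded lebesgue_on_UNIV_eq])
  show "G \<in> L2 S" if "S \<in> sets lebesgue" "bounded S" for S
    by (rule L2_cong_AE[OF G'(3)[OF that] that(1) AE_lebesgue_onI[OF that(1) ae]])
  show "ae_periodic G" unfolding ae_periodic_def
  proof
    fix k
    have "is_weak_grad UNIV (\<lambda>x. per_ext u (1 *\<^sub>R x + lat k)) (\<lambda>x. 1 *\<^sub>R G (1 *\<^sub>R x + lat k))"
      by (rule is_weak_grad_affine[OF w]) simp
    then have "is_weak_grad UNIV (per_ext u) (\<lambda>x. G (x + lat k))" by (simp add: per_ext_lat)
    from is_weak_grad_unique[OF open_UNIV this w, unfolded lebesgue_on_UNIV_eq]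
    show "AE y in lebesgue. G (y + lat k) = G y" .
  qed
  have "is_weak_grad Y (per_ext u) G" by (rule is_weak_grad_subset[OF w]) (use Y_sets in auto)
  then have "is_weak_grad Y u G"
    by (rule is_weak_grad_cong_AE[OF _ Y_sets]) (auto intro!: AE_I2 per_ext_Y)
  then show "AE y in lebesgue_on Y. weak_grad Y u y = G y" by (rule weak_grad_AE[OF Y_open])
qed

subsection \<open>Periodization of test functions\<close>

text \<open>Summing over the nonvanishing terms keeps the sum finite at every point when f has
  bounded support, without fixing a set of indices that works for all y.\<close>

definition periodize :: "(real^'n \<Rightarrow> real) \<Rightarrow> real^'n \<Rightarrow> real" where
  "periodize f y = (\<Sum>k | f (y + lat k) \<noteq> 0. f (y + lat k))"

lemma periodize_lat: "periodize f (y + lat j) = periodize f y"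
  unfolding periodize_def
  by (rule sum.reindex_bij_witness[of _ "\<lambda>k. k - j" "\<lambda>k. j + k"])
    (simp_all add: lat_add[symmetric] add.assoc)

lemma per_ext_periodize:
  fixes f :: "real^'n \<Rightarrow> real"
  shows "per_ext (\<lambda>y. periodize f y - c) = (\<lambda>y. periodize f y - c)"
proof
  fix y :: "real^'n"
  have "(\<chi> i. frac (y $ i)) = y + lat (\<chi> i. - \<lfloor>y $ i\<rfloor>)" by (simp add: lat_def vec_eq_iff frac_def)
  then show "per_ext (\<lambda>y. periodize f y - c) y = periodize f y - c" by (simp add: per_ext_def periodize_lat)
qed

lemma periodize_finite:
  assumes "finite K" "\<And>k. f (y + lat k) \<noteq> 0 \<Longrightarrow> k \<in> K"
  shows "periodize f y = (\<Sum>k\<in>K. f (y + lat k))"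
  unfolding periodize_def by (rule sum.mono_neutral_left) (use assms in auto)

lemma test_functions_shift_sum:
  assumes "f \<in> test_functions UNIV"
  shows "(\<lambda>y. \<Sum>k\<in>K. f (y + lat k)) \<in> test_functions UNIV"
    and "grad (\<lambda>y. \<Sum>k\<in>K. f (y + lat k)) y = (\<Sum>k\<in>K. grad f (y + lat k))"
proof -
  have t: "(\<lambda>y. f (y + lat k)) \<in> test_functions UNIV" for k
    using test_functions_affine[OF assms, of 1 "lat k"] by simp
  then show "(\<lambda>y. \<Sum>k\<in>K. f (y + lat k)) \<in> test_functions UNIV" by (intro test_functions_sum)
  have "grad (\<lambda>y. f (y + lat k)) y = grad f (y + lat k)" for k
    using grad_affine[OF test_functions_smooth[OF assms], of 1 "lat k"] by simp
  then show "grad (\<lambda>y. \<Sum>k\<in>K. f (y + lat k)) y = (\<Sum>k\<in>K. grad f (y + lat k))"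
    using test_functions_smooth[OF t] by (simp add: grad_sum)
qed

text \<open>On a bounded set a fixed finite set of translates suffices, so there the periodization
  is a finite sum of test functions. The constant c is later the mean value.\<close>

lemma periodize_H12:
  assumes f: "f \<in> test_functions UNIV" and S: "open S" "bounded S" and K: "finite K"
    "\<And>y k. y \<in> S \<Longrightarrow> f (y + lat k) \<noteq> 0 \<Longrightarrow> k \<in> K"
  shows "(\<lambda>y. periodize f y - c) \<in> H12 S"
    and "is_weak_grad S (\<lambda>y. periodize f y - c) (\<lambda>y. \<Sum>k\<in>K. grad f (y + lat k))"
proof -
  let ?P = "\<lambda>y. \<Sum>k\<in>K. f (y + lat k)"
  note Ss = open_sets_lebesgue[OF S(1)]
  have Sl: "S \<in> lmeasurable" using S(2) Ss by (rule bounded_set_imp_lmeasurable)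
  note t = test_functions_shift_sum[OF f, of K]
  have sm: "smooth (\<lambda>y. ?P y - c)" by (intro smooth_diff test_functions_smooth[OF t(1)] smooth_const)
  have g: "grad (\<lambda>y. ?P y - c) y = (\<Sum>k\<in>K. grad f (y + lat k))" for y
    using grad_diff[OF test_functions_smooth[OF t(1)] smooth_const, of c y] t(2)[of y] by simp
  have eq: "?P y = periodize f y" if "y \<in> S" for y
    using periodize_finite[OF K(1), of f y] K(2)[OF that] by simp
  have "is_weak_grad S (\<lambda>y. ?P y - c) (grad (\<lambda>y. ?P y - c))" by (rule is_weak_grad_smooth[OF sm Ss])
  then show w: "is_weak_grad S (\<lambda>y. periodize f y - c) (\<lambda>y. \<Sum>k\<in>K. grad f (y + lat k))"
    by (rule is_weak_grad_cong_AE[OF _ Ss]) (auto intro!: AE_I2 simp: eq g)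
  have "(\<lambda>y. c) \<in> L2 S" by (rule L2_bounded(1)[where C = "\<bar>c\<bar>"]) (use Sl in auto)
  then have "(\<lambda>y. ?P y - c) \<in> L2 S" by (intro L2_diff test_functions_L2(1)[OF t(1) Ss])
  then have l: "(\<lambda>y. periodize f y - c) \<in> L2 S" by (rule L2_cong) (simp add: eq)
  have "(\<lambda>y. \<Sum>k\<in>K. grad f (y + lat k)) \<in> L2 S"
    using test_functions_L2(2)[OF t(1) Ss] by (simp add: t(2)[abs_def])
  then show "(\<lambda>y. periodize f y - c) \<in> H12 S" using l w by (intro H12I)
qed

lemma periodize_H12_per:
  fixes f :: "real^'n \<Rightarrow> real"
  assumes f: "f \<in> test_functions UNIV" "\<And>x. norm x > R \<Longrightarrow> f x = 0"
  defines "\<Phi> \<equiv> \<lambda>y. periodize f y - (LINT y|lebesgue_on Y. periodize f y)"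
  shows "\<Phi> \<in> H12_per"
    and "AE y in lebesgue_on Y. weak_grad Y \<Phi> y = (\<Sum>k\<in>hit R 1. grad f (y + lat k))"
proof -
  have cell1: "y + lat k \<in> cell 1 k" if "y \<in> Y" for y :: "real^'n" and k using that by (auto simp: cell_eq)
  have KY: "k \<in> hit R 1" if "y \<in> Y" "f (y + lat k) \<noteq> 0" for y k
  proof -
    have "norm (y + lat k) \<le> R" using f(2) that(2) by force
    with cell1[OF that(1), of k] show ?thesis by (auto simp: hit_def)
  qed
  note Yp = periodize_H12[OF f(1) Y_open Y_bounded finite_hit[OF zero_less_one, of R] KY]
  show "AE y in lebesgue_on Y. weak_grad Y \<Phi> y = (\<Sum>k\<in>hit R 1. grad f (y + lat k))"
    unfolding \<Phi>_def by (rule weak_grad_AE[OF Y_open Yp(2)])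
  have "\<Phi> \<in> H12 U" if U: "open U" "bounded U" for U
  proof -
    obtain R' where R': "\<And>x. x \<in> U \<Longrightarrow> norm x \<le> R'" using U(2) unfolding bounded_iff by auto
    have K: "k \<in> {j :: int^'n. \<forall>i. j $ i \<in> {- \<lceil>R + R'\<rceil>..\<lceil>R + R'\<rceil>}}" if y: "y \<in> U" "f (y + lat k) \<noteq> 0" for y k
    proof -
      have "norm (y + lat k) \<le> R" using f(2) y(2) by force
      then have "norm (lat k) \<le> R + R'" using R'[OF y(1)] norm_triangle_ineq4[of "y + lat k" y] by simp
      then have "\<bar>real_of_int (k $ i)\<bar> \<le> R + R'" for i
        using component_le_norm_cart[of "lat k" i] by (simp add: lat_def)
      then have "- \<lceil>R + R'\<rceil> \<le> k $ i \<and> k $ i \<le> \<lceil>R + R'\<rceil>" for i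
        by (simp add: abs_le_iff) (smt (verit) ceiling_mono ceiling_of_int of_int_minus ceiling_le_iff le_of_int_ceiling of_int_le_iff)
      then show ?thesis by simp
    qed
    show ?thesis unfolding \<Phi>_def by (rule periodize_H12(1)[OF f(1) U finite_int_vec K])
  qed
  then have "per_ext \<Phi> \<in> H12_loc" unfolding \<Phi>_def per_ext_periodize by (simp add: H12_loc_def)
  moreover have "\<Phi> \<in> H12 Y" unfolding \<Phi>_def by (rule Yp(1))
  moreover have "(LINT y|lebesgue_on Y. \<Phi> y) = 0"
  proof -
    define c where "c = (LINT y|lebesgue_on Y. periodize f y)"
    have "periodize f \<in> L2 Y" using H12D(1)[OF Yp(1)[where c = 0] Y_open] by simp
    then have "integrable (lebesgue_on Y) (periodize f)" by (rule L2_imp_integrable[OF _ Y_lmeasurable])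
    moreover have "(\<lambda>y :: real^'n. c) \<in> L2 Y" by (rule L2_bounded(1)[where C = "\<bar>c\<bar>"]) (use Y_lmeasurable in auto)
    then have "integrable (lebesgue_on Y) (\<lambda>y :: real^'n. c)" by (rule L2_imp_integrable[OF _ Y_lmeasurable])
    ultimately have "(LINT y|lebesgue_on Y. periodize f y - c) = (LINT y|lebesgue_on Y. periodize f y) - (LINT y|lebesgue_on (Y :: (real^'n) set). c)"
      by (rule Bochner_Integration.integral_diff)
    also have "\<dots> = 0" unfolding c_def[symmetric] by (simp add: measure_restrict_space Y_sets Y_measure)
    finally show ?thesis by (simp only: \<Phi>_def c_def)
  qed
  ultimately show "\<Phi> \<in> H12_per" by (simp add: H12_per_def)
qed

text \<open>The integral over the whole space folds into one over Y, where the translates of grad f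
  add up to the gradient of the periodization of f. That function minus its mean is admissible in
  the cell problem. This turns periodic test functions into compactly supported ones.\<close>

lemma periodic_divergence_free:
  fixes \<sigma> :: "real^'n \<Rightarrow> real^'n"
  assumes s: "ae_periodic \<sigma>" "\<sigma> \<in> L2 Y"
    and z: "\<And>\<phi>. \<phi> \<in> H12_per \<Longrightarrow> (LINT y|lebesgue_on Y. \<sigma> y \<bullet> weak_grad Y \<phi> y) = 0"
    and f: "f \<in> test_functions UNIV" and eps: "\<epsilon> > 0"
  shows "(LINT x|lebesgue. \<sigma> (x /\<^sub>R \<epsilon>) \<bullet> grad f x) = 0"
proof -
  have unit: "(LINT x|lebesgue. \<sigma> x \<bullet> grad f x) = 0" if f: "f \<in> test_functions UNIV" for f
  proof -
    obtain K where K: "compact K" "\<And>x. x \<notin> K \<Longrightarrow> f x = 0" "\<And>x. x \<notin> K \<Longrightarrow> grad f x = 0"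
      using test_functionsE[OF f] by metis
    obtain R where R: "\<And>x. x \<in> K \<Longrightarrow> norm x \<le> R" using compact_imp_bounded[OF K(1)] unfolding bounded_iff by auto
    have f0: "f x = 0" "grad f x = 0" if "norm x > R" for x using that R[of x] K(2,3)[of x] by auto
    have sB: "\<sigma> \<in> L2 (cball 0 R)" using periodic_L2_bounded(1)[OF s zero_less_one, of "cball 0 R" R] by simp
    have i: "integrable lebesgue (\<lambda>x. \<sigma> x \<bullet> grad f x)"
    proof -
      have "integrable (lebesgue_on (cball 0 R)) (\<lambda>x. \<sigma> x \<bullet> grad f x)"
        by (intro L2_inner_integrable sB test_functions_L2(2)[OF f]) auto
      moreover have "integrable (lebesgue_on (cball 0 R)) (\<lambda>x. \<sigma> x \<bullet> grad f x) \<longleftrightarrow> integrable (lebesgue_on UNIV) (\<lambda>x. \<sigma> x \<bullet> grad f x)"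
        by (rule integral_lebesgue_on_support(2)) (use f0(2) in auto)
      ultimately show ?thesis by (simp add: lebesgue_on_UNIV_eq)
    qed
    have gk: "(\<lambda>y. grad f (y + lat k)) \<in> L2 Y" for k
    proof -
      have t: "(\<lambda>y. f (y + lat k)) \<in> test_functions UNIV" using test_functions_affine[OF f, of 1 "lat k"] by simp
      have "grad (\<lambda>y. f (y + lat k)) = (\<lambda>y. grad f (y + lat k))"
        using grad_affine[OF test_functions_smooth[OF f], of 1 "lat k"] by (simp add: fun_eq_iff)
      then show ?thesis using test_functions_L2(2)[OF t Y_sets] by simp
    qed
    have cell: "(LINT x|lebesgue_on (cell 1 k). \<sigma> x \<bullet> grad f x) = (LINT y|lebesgue_on Y. \<sigma> y \<bullet> grad f (y + lat k))" for k
    proof -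
      have ae: "AE y in lebesgue_on Y. \<sigma> (y + lat k) = \<sigma> y"
        using s(1) by (intro AE_lebesgue_onI Y_sets) (simp add: ae_periodic_def)
      then have ae': "AE y in lebesgue_on Y. \<sigma> y = \<sigma> (y + lat k)" by eventually_elim simp
      have "(LINT x|lebesgue_on (cell 1 k). \<sigma> x \<bullet> grad f x) = (LINT y|lebesgue_on Y. \<sigma> (y + lat k) \<bullet> grad f (y + lat k))"
        unfolding cell_eq by (subst integral_affine_image[OF _ Y_sets]) simp_all
      also have "\<dots> = (LINT y|lebesgue_on Y. \<sigma> y \<bullet> grad f (y + lat k))"
      proof (rule integral_cong_AE)
        show "AE y in lebesgue_on Y. \<sigma> (y + lat k) \<bullet> grad f (y + lat k) = \<sigma> y \<bullet> grad f (y + lat k)"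
          using ae by eventually_elim simp
      qed (use L2_inner_integrable[OF s(2) gk] L2_inner_integrable[OF L2_cong_AE[OF s(2) Y_sets ae'] gk] in auto)
      finally show ?thesis .
    qed
    have P: "(\<lambda>y. periodize f y - (LINT y|lebesgue_on Y. periodize f y)) \<in> H12_per"
      "AE y in lebesgue_on Y. weak_grad Y (\<lambda>y. periodize f y - (LINT y|lebesgue_on Y. periodize f y)) y
        = (\<Sum>k\<in>hit R 1. grad f (y + lat k))"
      using periodize_H12_per[OF f, of R] f0(1) by blast+
    have "(LINT x|lebesgue. \<sigma> x \<bullet> grad f x) = (\<Sum>k\<in>hit R 1. LINT y|lebesgue_on Y. \<sigma> y \<bullet> grad f (y + lat k))"
      unfolding cell[symmetric] by (rule integral_eq_sum_cells[OF zero_less_one _ i]) (simp add: f0(2))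
    also have "\<dots> = (LINT y|lebesgue_on Y. (\<Sum>k\<in>hit R 1. \<sigma> y \<bullet> grad f (y + lat k)))"
      by (rule Bochner_Integration.integral_sum[symmetric]) (rule L2_inner_integrable[OF s(2) gk])
    also have "\<dots> = (LINT y|lebesgue_on Y. \<sigma> y \<bullet> (\<Sum>k\<in>hit R 1. grad f (y + lat k)))"
      by (simp add: inner_sum_right)
    also have "\<dots> = (LINT y|lebesgue_on Y. \<sigma> y \<bullet> weak_grad Y (\<lambda>y. periodize f y - (LINT y|lebesgue_on Y. periodize f y)) y)"
    proof (rule integral_cong_AE)
      show "AE y in lebesgue_on Y. \<sigma> y \<bullet> (\<Sum>k\<in>hit R 1. grad f (y + lat k))
          = \<sigma> y \<bullet> weak_grad Y (\<lambda>y. periodize f y - (LINT y|lebesgue_on Y. periodize f y)) y"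
        using P(2) by eventually_elim simp
      have "weak_grad Y (\<lambda>y. periodize f y - (LINT y|lebesgue_on Y. periodize f y)) \<in> L2 Y"
        using P(1) by (intro H12D(2) Y_open) (simp add: H12_per_def)
      then show "(\<lambda>y. \<sigma> y \<bullet> weak_grad Y (\<lambda>y. periodize f y - (LINT y|lebesgue_on Y. periodize f y)) y) \<in> borel_measurable (lebesgue_on Y)"
        using L2_inner_integrable[OF s(2)] by blast
      have "(\<lambda>y. \<Sum>k\<in>hit R 1. grad f (y + lat k)) \<in> L2 Y" by (intro L2_sum gk)
      then show "(\<lambda>y. \<sigma> y \<bullet> (\<Sum>k\<in>hit R 1. grad f (y + lat k))) \<in> borel_measurable (lebesgue_on Y)"
        using L2_inner_integrable[OF s(2)] by blast
    qed
    also have "\<dots> = 0" by (rule z[OF P(1)])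
    finally show ?thesis .
  qed
  \<comment> \<open>Rescaling reduces to period 1: the test function becomes f(\<epsilon> x), whose
    gradient only gains a factor \<epsilon>.\<close>
  have t: "(\<lambda>x. f (\<epsilon> *\<^sub>R x + 0)) \<in> test_functions UNIV" using test_functions_affine[OF f, of \<epsilon> 0] eps by simp
  have "(LINT x|lebesgue. \<sigma> (x /\<^sub>R \<epsilon>) \<bullet> grad f x) = \<bar>\<epsilon>\<bar> ^ CARD('n) *\<^sub>R (LINT x|lebesgue. \<sigma> x \<bullet> grad f (\<epsilon> *\<^sub>R x))"
    using eps by (subst integral_affine[of \<epsilon> _ 0]) auto
  moreover have "\<epsilon> * (LINT x|lebesgue. \<sigma> x \<bullet> grad f (\<epsilon> *\<^sub>R x)) = (LINT x|lebesgue. \<sigma> x \<bullet> grad (\<lambda>x. f (\<epsilon> *\<^sub>R x + 0)) x)"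
    unfolding grad_affine[OF test_functions_smooth[OF f]] by simp
  ultimately show ?thesis using unit[OF t] eps by simp
qed

subsection \<open>The cell problem\<close>

lemma L2_norm_le:
  fixes f :: "real^'n \<Rightarrow> 'b::euclidean_space" and g :: "real^'n \<Rightarrow> 'c::euclidean_space"
  assumes "f \<in> borel_measurable (lebesgue_on S)" "g \<in> L2 S" "0 \<le> C"
    and "AE x in lebesgue_on S. norm (f x) \<le> C * norm (g x)"
  shows "L2_norm S f \<le> C * L2_norm S g"
proof -
  have "sqrt (sqn S f) \<le> sqrt (C\<^sup>2 * sqn S g)" using sqn_bound[OF assms(1,2,4)] by simp
  then show ?thesis using assms(3) by (simp add: L2_norm_def real_sqrt_mult)
qed

lemma L2_const: "S \<in> lmeasurable \<Longrightarrow> (\<lambda>x :: real^'n. c :: 'b::euclidean_space) \<in> L2 S"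
  by (rule L2_bounded(1)[where C = "norm c"]) auto

lemma L2_inner_le:
  fixes f g :: "real^'n \<Rightarrow> 'b::euclidean_space"
  assumes "f \<in> L2 S" "g \<in> L2 S" shows "(LINT x|lebesgue_on S. f x \<bullet> g x) \<le> L2_norm S f * L2_norm S g"
  using L2_Cauchy_Schwarz[OF assms] by linarith

text \<open>Young's inequality is used for A D and for \<beta> D X, each time with a remainder
  \<alpha> D^2 / 4 that is absorbed on the left. The leftover \<alpha> D^2 / 2 explains the factor
  2/\<alpha>.\<close>

lemma energy_algebra:
  fixes A D X :: real
  assumes "\<alpha> > 0" "0 \<le> \<beta>" "0 \<le> A" "0 \<le> D" "0 \<le> X" and "\<alpha> * D\<^sup>2 \<le> (A + \<beta> * D) * X + A * D"
  shows "D\<^sup>2 \<le> (2 / \<alpha>) * (1 / \<alpha> + 1 + \<beta>\<^sup>2 / \<alpha>) * (A\<^sup>2 + X\<^sup>2)"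
proof -
  have 1: "A * D \<le> A\<^sup>2 / \<alpha> + \<alpha> * D\<^sup>2 / 4"
  proof -
    have "0 \<le> (A - \<alpha> * D / 2)\<^sup>2" by simp
    then have "\<alpha> * (A * D) \<le> A\<^sup>2 + \<alpha>\<^sup>2 * D\<^sup>2 / 4" by (simp add: power2_eq_square algebra_simps)
    then show ?thesis using assms(1) by (simp add: field_simps power2_eq_square)
  qed
  have 2: "\<beta> * D * X \<le> \<beta>\<^sup>2 * X\<^sup>2 / \<alpha> + \<alpha> * D\<^sup>2 / 4"
  proof -
    have "0 \<le> (\<beta> * X - \<alpha> * D / 2)\<^sup>2" by simp
    then have "\<alpha> * (\<beta> * D * X) \<le> \<beta>\<^sup>2 * X\<^sup>2 + \<alpha>\<^sup>2 * D\<^sup>2 / 4" by (simp add: power2_eq_square algebra_simps)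
    then show ?thesis using assms(1) by (simp add: field_simps power2_eq_square)
  qed
  have 3: "A * X \<le> A\<^sup>2 + X\<^sup>2" using sum_squares_bound[of A X] mult_nonneg_nonneg[OF assms(3,5)] by linarith
  have "(A + \<beta> * D) * X + A * D = A * X + \<beta> * D * X + A * D" by (simp add: algebra_simps)
  then have "\<alpha> * D\<^sup>2 / 2 \<le> A\<^sup>2 / \<alpha> + A\<^sup>2 + X\<^sup>2 + \<beta>\<^sup>2 * X\<^sup>2 / \<alpha>" using assms(6) 1 2 3 by linarith
  also have "\<dots> \<le> (1 / \<alpha> + 1 + \<beta>\<^sup>2 / \<alpha>) * (A\<^sup>2 + X\<^sup>2)"
  proof -
    have "0 \<le> X\<^sup>2 / \<alpha>" "0 \<le> \<beta>\<^sup>2 * A\<^sup>2 / \<alpha>" using assms(1) by auto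
    then show ?thesis by (simp add: algebra_simps add_divide_distrib)
  qed
  finally have h: "\<alpha> * D\<^sup>2 / 2 \<le> (1 / \<alpha> + 1 + \<beta>\<^sup>2 / \<alpha>) * (A\<^sup>2 + X\<^sup>2)" .
  have "D\<^sup>2 = (2 / \<alpha>) * (\<alpha> * D\<^sup>2 / 2)" using assms(1) by simp
  also have "\<dots> \<le> (2 / \<alpha>) * ((1 / \<alpha> + 1 + \<beta>\<^sup>2 / \<alpha>) * (A\<^sup>2 + X\<^sup>2))"
    using h assms(1) by (intro mult_left_mono) auto
  finally show ?thesis by (simp only: mult.assoc)
qed

text \<open>The locale contains the data of the problem but no sequence: all estimates are for a
  single \<epsilon>, and the limit is taken only at the very end.\<close>

locale homogenization =
  fixes \<Omega> :: "(real^'n) set"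
    and a :: "real^'n \<Rightarrow> real^'n \<Rightarrow> real^'n \<Rightarrow> real^'n"
    and \<alpha> \<beta> :: real and \<omega> :: "real \<Rightarrow> real"
    and v :: "real^'n \<Rightarrow> real^'n \<Rightarrow> real^'n \<Rightarrow> real"
  assumes \<Omega>: "open \<Omega>" "bounded \<Omega>"
    and a_measurable: "\<And>x \<xi>. x \<in> \<Omega> \<Longrightarrow> (\<lambda>y. a x y \<xi>) \<in> borel_measurable lebesgue"
    and a_periodic: "\<And>x \<xi>. x \<in> \<Omega> \<Longrightarrow> Y_periodic (\<lambda>y. a x y \<xi>)"
    and \<alpha>\<beta>: "0 < \<alpha>" "\<alpha> \<le> \<beta>"
    and \<omega>: "continuous_on UNIV \<omega>" "mono \<omega>" "\<omega> 0 = 0"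
    and a_monotone: "AE y in lebesgue. \<forall>x\<in>\<Omega>. \<forall>\<xi>1 \<xi>2.
          (a x y \<xi>1 - a x y \<xi>2) \<bullet> (\<xi>1 - \<xi>2) \<ge> \<alpha> * (norm (\<xi>1 - \<xi>2))\<^sup>2"
    and a_lipschitz: "AE y in lebesgue. \<forall>x\<in>\<Omega>. \<forall>\<xi>1 \<xi>2.
          norm (a x y \<xi>1 - a x y \<xi>2) \<le> \<beta> * norm (\<xi>1 - \<xi>2)"
    and a_zero: "AE y in lebesgue. \<forall>x\<in>\<Omega>. a x y 0 = 0"
    and a_modulus: "AE y in lebesgue. \<forall>x1\<in>\<Omega>. \<forall>x2\<in>\<Omega>. \<forall>\<xi>.
          (norm (a x1 y \<xi> - a x2 y \<xi>))\<^sup>2 \<le> \<omega> (norm (x1 - x2)) * (norm \<xi>)\<^sup>2"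
    and v_space: "\<And>\<xi> x. x \<in> \<Omega> \<Longrightarrow> v \<xi> x \<in> H12_per"
    and v_solution: "\<And>\<xi> x \<phi>. x \<in> \<Omega> \<Longrightarrow> \<phi> \<in> H12_per \<Longrightarrow>
          (LINT y|lebesgue_on Y. a x y (\<xi> + weak_grad Y (v \<xi> x) y) \<bullet> weak_grad Y \<phi> y) = 0"
begin

section \<open>Pointwise properties of the coefficient and measurability of fluxes\<close>

lemma \<Omega>_sets: "\<Omega> \<in> sets lebesgue"
  using \<Omega>(1) by (rule open_sets_lebesgue)

lemma \<Omega>_lmeasurable: "\<Omega> \<in> lmeasurable"
  using \<Omega>(2) \<Omega>_sets by (rule bounded_set_imp_lmeasurable)

lemma \<beta>_pos: "0 < \<beta>"
  using \<alpha>\<beta> by simp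

lemma \<omega>_nonneg: "0 \<le> r \<Longrightarrow> 0 \<le> \<omega> r"
  using \<omega>(2,3) by (metis monoD)

text \<open>The exceptional null set in y is common to all slow arguments and all vectors. Almost
  every x therefore has a good x/\<epsilon>, and there the conditions may be used with slow variable
  x itself.\<close>

definition good :: "real^'n \<Rightarrow> bool" where
  "good y \<longleftrightarrow> (\<forall>x\<in>\<Omega>. \<forall>\<xi>1 \<xi>2. (a x y \<xi>1 - a x y \<xi>2) \<bullet> (\<xi>1 - \<xi>2) \<ge> \<alpha> * (norm (\<xi>1 - \<xi>2))\<^sup>2)
    \<and> (\<forall>x\<in>\<Omega>. \<forall>\<xi>1 \<xi>2. norm (a x y \<xi>1 - a x y \<xi>2) \<le> \<beta> * norm (\<xi>1 - \<xi>2))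
    \<and> (\<forall>x\<in>\<Omega>. a x y 0 = 0)
    \<and> (\<forall>x1\<in>\<Omega>. \<forall>x2\<in>\<Omega>. \<forall>\<xi>. (norm (a x1 y \<xi> - a x2 y \<xi>))\<^sup>2 \<le> \<omega> (norm (x1 - x2)) * (norm \<xi>)\<^sup>2)"

lemma AE_good: "AE y in lebesgue. good y"
  using a_monotone a_lipschitz a_zero a_modulus by eventually_elim (simp add: good_def)

lemma AE_good_scaled: "\<epsilon> > 0 \<Longrightarrow> AE x in lebesgue. good (x /\<^sub>R \<epsilon>)"
  using AE_affine[OF _ AE_good, of "inverse \<epsilon>" 0] by simp

lemma
  assumes "good y" "t \<in> \<Omega>"
  shows good_mono: "\<alpha> * (norm (\<xi>1 - \<xi>2))\<^sup>2 \<le> (a t y \<xi>1 - a t y \<xi>2) \<bullet> (\<xi>1 - \<xi>2)"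
    and good_lip: "norm (a t y \<xi>1 - a t y \<xi>2) \<le> \<beta> * norm (\<xi>1 - \<xi>2)"
    and good_zero: "a t y 0 = 0"
    and good_bound: "norm (a t y \<xi>) \<le> \<beta> * norm \<xi>"
    and good_coercive: "\<alpha> * (norm \<xi>)\<^sup>2 \<le> a t y \<xi> \<bullet> \<xi>"
proof -
  show z: "a t y 0 = 0" using assms by (simp add: good_def)
  show m: "\<alpha> * (norm (\<xi>1 - \<xi>2))\<^sup>2 \<le> (a t y \<xi>1 - a t y \<xi>2) \<bullet> (\<xi>1 - \<xi>2)" for \<xi>1 \<xi>2
    using assms by (simp add: good_def)
  show l: "norm (a t y \<xi>1 - a t y \<xi>2) \<le> \<beta> * norm (\<xi>1 - \<xi>2)" for \<xi>1 \<xi>2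
    using assms by (simp add: good_def)
  show "norm (a t y \<xi>) \<le> \<beta> * norm \<xi>" using l[of \<xi> 0] z by simp
  show "\<alpha> * (norm \<xi>)\<^sup>2 \<le> a t y \<xi> \<bullet> \<xi>" using m[of \<xi> 0] z by simp
qed

lemma good_modulus:
  assumes "good y" "t1 \<in> \<Omega>" "t2 \<in> \<Omega>"
  shows "norm (a t1 y \<xi> - a t2 y \<xi>) \<le> sqrt (\<omega> (norm (t1 - t2))) * norm \<xi>"
proof (rule power2_le_imp_le)
  show "(norm (a t1 y \<xi> - a t2 y \<xi>))\<^sup>2 \<le> (sqrt (\<omega> (norm (t1 - t2))) * norm \<xi>)\<^sup>2"
    using assms \<omega>_nonneg[of "norm (t1 - t2)"] by (simp add: good_def power_mult_distrib)
qed (use \<omega>_nonneg in auto)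

lemma \<omega>_tendsto: "(f \<longlongrightarrow> 0) F \<Longrightarrow> ((\<lambda>x. \<omega> (norm (f x))) \<longlongrightarrow> 0) F" for f :: "'b \<Rightarrow> 'c::real_normed_vector"
  using continuous_on_tendsto_compose[OF \<omega>(1), of "\<lambda>x. norm (f x)" 0 F] tendsto_norm_zero[of f F] \<omega>(3) by simp

text \<open>The Lipschitz bound controls the vector, the modulus controls the slow variable. Joint
  continuity is the hypothesis under which varying arguments may be substituted measurably.\<close>

lemma good_continuous:
  assumes "good y" shows "continuous_on (\<Omega> \<times> UNIV) (\<lambda>q. a (fst q) y (snd q))"
  unfolding continuous_on
proof
  fix q assume q: "q \<in> \<Omega> \<times> (UNIV :: (real^'n) set)"
  let ?F = "at q within \<Omega> \<times> (UNIV :: (real^'n) set)"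
  let ?h = "\<lambda>s. \<beta> * norm (snd s - snd q) + sqrt (\<omega> (norm (fst s - fst q))) * norm (snd q)"
  have "((\<lambda>s. a (fst s) y (snd s) - a (fst q) y (snd q)) \<longlongrightarrow> 0) ?F"
  proof (rule Lim_null_comparison)
    have "norm (a (fst s) y (snd s) - a (fst q) y (snd q)) \<le> ?h s" if "s \<in> \<Omega> \<times> UNIV" for s
    proof -
      have "norm (a (fst s) y (snd s) - a (fst s) y (snd q)) \<le> \<beta> * norm (snd s - snd q)"
        using that by (intro good_lip[OF assms]) auto
      moreover have "norm (a (fst s) y (snd q) - a (fst q) y (snd q)) \<le> sqrt (\<omega> (norm (fst s - fst q))) * norm (snd q)"
        using that q by (intro good_modulus[OF assms]) auto
      ultimately show ?thesis
        using norm_triangle_ineq[of "a (fst s) y (snd s) - a (fst s) y (snd q)" "a (fst s) y (snd q) - a (fst q) y (snd q)"]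
        by simp
    qed
    then show "\<forall>\<^sub>F s in ?F. norm (a (fst s) y (snd s) - a (fst q) y (snd q)) \<le> ?h s"
      by (auto simp: eventually_at_filter)
    have id: "((\<lambda>s. s) \<longlongrightarrow> q) ?F" by (rule tendsto_ident_at)
    have "((\<lambda>s. fst s - fst q) \<longlongrightarrow> fst q - fst q) ?F" "((\<lambda>s. snd s - snd q) \<longlongrightarrow> snd q - snd q) ?F"
      by (intro tendsto_diff tendsto_fst tendsto_snd id tendsto_const)+
    then have d: "((\<lambda>s. fst s - fst q) \<longlongrightarrow> 0) ?F" "((\<lambda>s. snd s - snd q) \<longlongrightarrow> 0) ?F" by simp_all
    have "(?h \<longlongrightarrow> \<beta> * norm (0 :: real^'n) + sqrt 0 * norm (snd q)) ?F"
      by (intro tendsto_intros \<omega>_tendsto d)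
    then show "(?h \<longlongrightarrow> 0) ?F" by simp
  qed
  then show "((\<lambda>s. a (fst s) y (snd s)) \<longlongrightarrow> a (fst q) y (snd q)) ?F" by (simp add: Lim_null[symmetric])
qed

text \<open>The slow argument is a function so that one statement covers both uses: a frozen point
  for the cell fluxes and the identity for the equation on \<Omega>.\<close>

lemma flux_measurable:
  assumes S: "S \<in> sets lebesgue" and t: "t \<in> borel_measurable (lebesgue_on S)" "\<And>x. x \<in> S \<Longrightarrow> t x \<in> \<Omega>"
    and g: "g \<in> borel_measurable (lebesgue_on S)" and e: "\<epsilon> > 0"
  shows "(\<lambda>x. a (t x) (x /\<^sub>R \<epsilon>) (g x)) \<in> borel_measurable (lebesgue_on S)"
proof -
  have "(\<lambda>x. (\<lambda>q x. a (fst q) (x /\<^sub>R \<epsilon>) (snd q)) (t x, g x) x) \<in> borel_measurable (lebesgue_on S)"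
  proof (rule caratheodory_measurable[OF S, where P = "\<Omega> \<times> UNIV"])
    show "(\<lambda>x. (t x, g x)) \<in> borel_measurable (lebesgue_on S)" using t(1) g by (rule borel_measurable_Pair)
    show "(t x, g x) \<in> \<Omega> \<times> UNIV" if "x \<in> S" for x using t(2)[OF that] by simp
    show "(\<lambda>x. a (fst q) (x /\<^sub>R \<epsilon>) (snd q)) \<in> borel_measurable (lebesgue_on S)" if "q \<in> \<Omega> \<times> UNIV" for q
      using that measurable_compose[OF lebesgue_measurable_scaling a_measurable, of "fst q" "inverse \<epsilon>" "snd q"]
      by (auto intro: measurable_restrict_space1)
    show "AE x in lebesgue_on S. continuous_on (\<Omega> \<times> UNIV) (\<lambda>q. a (fst q) (x /\<^sub>R \<epsilon>) (snd q))"
      using AE_lebesgue_onI[OF S AE_good_scaled[OF e]] by eventually_elim (rule good_continuous)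
  qed
  then show ?thesis by simp
qed

lemma a_lat:
  assumes "t \<in> \<Omega>" shows "a t (y + lat k) \<xi> = a t y \<xi>"
proof -
  have P: "a t (y + axis i 1) \<xi> = a t y \<xi>" for y i using a_periodic[OF assms, of \<xi>] by (simp add: Y_periodic_def)
  have N: "a t (y + real m *\<^sub>R axis i 1) \<xi> = a t y \<xi>" for y i m
  proof (induction m)
    case (Suc m)
    then show ?case using P[of "y + real m *\<^sub>R axis i 1" i] by (simp add: algebra_simps)
  qed simp
  have Z: "a t (y + real_of_int m *\<^sub>R axis i 1) \<xi> = a t y \<xi>" for y i m
  proof (cases "m \<ge> 0")
    case True then show ?thesis using N[of y "nat m" i] by simp
  next
    case False
    then show ?thesis using N[of "y + real_of_int m *\<^sub>R axis i 1" "nat (- m)" i] by simp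
  qed
  have "a t (y + (\<Sum>i\<in>A. real_of_int (k $ i) *\<^sub>R axis i 1)) \<xi> = a t y \<xi>" if "finite A" for A
    using that
  proof induction
    case (insert i A)
    then show ?case using Z[of "y + (\<Sum>i\<in>A. real_of_int (k $ i) *\<^sub>R axis i 1)" "k $ i" i] by (simp add: algebra_simps)
  qed simp
  from this[of UNIV] have "a t (y + (\<Sum>i\<in>UNIV. real_of_int (k $ i) *\<^sub>R axis i 1)) \<xi> = a t y \<xi>" by simp
  moreover have "(\<Sum>i\<in>UNIV. real_of_int (k $ i) *\<^sub>R axis i 1) = lat k"
    using basis_expansion[of "lat k"] by (simp add: lat_def scalar_mult_eq_scaleR)
  ultimately show ?thesis by simp
qed

text \<open>
  \<open>wg\<close> is $Dv^{\xi,t}$ on the whole space, \<open>pc\<close> the cell field $\xi + Dv^{\xi,t}$ and \<open>sig\<close> its flux.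
\<close>

definition wg :: "real^'n \<Rightarrow> real^'n \<Rightarrow> real^'n \<Rightarrow> real^'n" where
  "wg \<xi> t = weak_grad UNIV (per_ext (v \<xi> t))"

definition pc :: "real^'n \<Rightarrow> real^'n \<Rightarrow> real^'n \<Rightarrow> real^'n" where
  "pc \<xi> t y = \<xi> + wg \<xi> t y"

definition sig :: "real^'n \<Rightarrow> real^'n \<Rightarrow> real^'n \<Rightarrow> real^'n" where
  "sig \<xi> t y = a t y (pc \<xi> t y)"

lemma P_corr_eq: "P_corr v \<epsilon> x \<xi> t = pc \<xi> t (x /\<^sub>R \<epsilon>)"
  by (simp add: P_corr_def pc_def wg_def)

lemma
  assumes t: "t \<in> \<Omega>"
  shows wg_L2: "wg \<xi> t \<in> L2 Y" and wg_periodic: "ae_periodic (wg \<xi> t)"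
    and wg_Y: "AE y in lebesgue_on Y. weak_grad Y (v \<xi> t) y = wg \<xi> t y"
    and pc_L2: "pc \<xi> t \<in> L2 Y" and pc_periodic: "ae_periodic (pc \<xi> t)"
    and sig_L2: "sig \<xi> t \<in> L2 Y" and sig_periodic: "ae_periodic (sig \<xi> t)"
    and sig_le: "L2_norm Y (sig \<xi> t) \<le> \<beta> * L2_norm Y (pc \<xi> t)"
proof -
  note W = per_ext_weak_grad[OF v_space[OF t, of \<xi>], folded wg_def]
  show w: "wg \<xi> t \<in> L2 Y" by (rule W(3)[OF Y_sets Y_bounded])
  show wp: "ae_periodic (wg \<xi> t)" by (rule W(4))
  show "AE y in lebesgue_on Y. weak_grad Y (v \<xi> t) y = wg \<xi> t y" by (rule W(5))
  show p: "pc \<xi> t \<in> L2 Y" unfolding pc_def[abs_def] by (intro L2_add(1) L2_const Y_lmeasurable w)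
  show "ae_periodic (pc \<xi> t)" using wp unfolding ae_periodic_def pc_def by (auto elim!: eventually_mono)
  show "ae_periodic (sig \<xi> t)"
    unfolding ae_periodic_def
  proof
    fix k
    have "AE y in lebesgue. wg \<xi> t (y + lat k) = wg \<xi> t y" using wp by (simp add: ae_periodic_def)
    then show "AE y in lebesgue. sig \<xi> t (y + lat k) = sig \<xi> t y"
      by eventually_elim (simp add: sig_def pc_def a_lat[OF t])
  qed
  have m: "sig \<xi> t \<in> borel_measurable (lebesgue_on Y)"
    using flux_measurable[OF Y_sets _ _ L2_measurable[OF p], of "\<lambda>_. t" 1] t by (simp add: sig_def[abs_def])
  have b: "AE y in lebesgue_on Y. norm (sig \<xi> t y) \<le> \<beta> * norm (pc \<xi> t y)"
    using AE_lebesgue_onI[OF Y_sets AE_good] by eventually_elim (simp add: sig_def good_bound[OF _ t])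
  show "sig \<xi> t \<in> L2 Y" by (rule L2_bound[OF m p b])
  show "L2_norm Y (sig \<xi> t) \<le> \<beta> * L2_norm Y (pc \<xi> t)"
    using \<beta>_pos by (intro L2_norm_le[OF m p _ b]) simp
qed

lemma sig_orthogonal:
  assumes t: "t \<in> \<Omega>" and \<phi>: "\<phi> \<in> H12_per"
  shows "(LINT y|lebesgue_on Y. sig \<xi> t y \<bullet> weak_grad Y \<phi> y) = 0"
proof -
  have wp: "weak_grad Y \<phi> \<in> L2 Y" using \<phi> by (intro H12D(2) Y_open) (simp add: H12_per_def)
  have ae: "AE y in lebesgue_on Y. sig \<xi> t y = a t y (\<xi> + weak_grad Y (v \<xi> t) y)"
    using wg_Y[OF t, of \<xi>] by eventually_elim (simp add: sig_def pc_def)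
  have l: "(\<lambda>y. a t y (\<xi> + weak_grad Y (v \<xi> t) y)) \<in> L2 Y" by (rule L2_cong_AE[OF sig_L2[OF t] Y_sets ae])
  have "(LINT y|lebesgue_on Y. sig \<xi> t y \<bullet> weak_grad Y \<phi> y) = (LINT y|lebesgue_on Y. a t y (\<xi> + weak_grad Y (v \<xi> t) y) \<bullet> weak_grad Y \<phi> y)"
  proof (rule integral_cong_AE)
    show "AE y in lebesgue_on Y. sig \<xi> t y \<bullet> weak_grad Y \<phi> y = a t y (\<xi> + weak_grad Y (v \<xi> t) y) \<bullet> weak_grad Y \<phi> y"
      using ae by eventually_elim simp
  qed (use L2_inner_integrable[OF sig_L2[OF t] wp] L2_inner_integrable[OF l wp] in blast)+
  then show ?thesis using v_solution[OF t \<phi>, of \<xi>] by simp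
qed

text \<open>The test space of the cell problem does not depend on its parameters, so every cell
  gradient is admissible against every cell flux. This cancels the mixed terms when two cell
  problems are compared.\<close>

lemma sig_orthogonal_wg:
  assumes t: "t \<in> \<Omega>" "s \<in> \<Omega>"
  shows "(LINT y|lebesgue_on Y. sig \<xi> t y \<bullet> wg \<zeta> s y) = 0"
proof -
  have wp: "weak_grad Y (v \<zeta> s) \<in> L2 Y" using v_space[OF t(2)] by (intro H12D(2) Y_open) (simp add: H12_per_def)
  have "(LINT y|lebesgue_on Y. sig \<xi> t y \<bullet> wg \<zeta> s y) = (LINT y|lebesgue_on Y. sig \<xi> t y \<bullet> weak_grad Y (v \<zeta> s) y)"
  proof (rule integral_cong_AE)
    show "AE y in lebesgue_on Y. sig \<xi> t y \<bullet> wg \<zeta> s y = sig \<xi> t y \<bullet> weak_grad Y (v \<zeta> s) y"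
      using wg_Y[OF t(2), of \<zeta>] by eventually_elim simp
  qed (use L2_inner_integrable[OF sig_L2[OF t(1)] wp] L2_inner_integrable[OF sig_L2[OF t(1)] wg_L2[OF t(2)]] in blast)+
  then show ?thesis using sig_orthogonal[OF t(1) v_space[OF t(2)]] by simp
qed

lemma b_hom_eq:
  assumes t: "t \<in> \<Omega>" shows "b_hom a v t \<xi> = (LINT y|lebesgue_on Y. sig \<xi> t y)"
  unfolding b_hom_def
proof (rule integral_cong_AE)
  have ae: "AE y in lebesgue_on Y. sig \<xi> t y = a t y (\<xi> + weak_grad Y (v \<xi> t) y)"
    using wg_Y[OF t, of \<xi>] by eventually_elim (simp add: sig_def pc_def)
  show "AE y in lebesgue_on Y. a t y (\<xi> + weak_grad Y (v \<xi> t) y) = sig \<xi> t y" using ae by eventually_elim simp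
  show "(\<lambda>y. a t y (\<xi> + weak_grad Y (v \<xi> t) y)) \<in> borel_measurable (lebesgue_on Y)"
    by (rule L2_measurable[OF L2_cong_AE[OF sig_L2[OF t] Y_sets ae]])
  show "sig \<xi> t \<in> borel_measurable (lebesgue_on Y)" by (rule L2_measurable[OF sig_L2[OF t]])
qed

section \<open>Energy and continuity estimates for the cell fields\<close>

lemma L2_norm_const_Y: "L2_norm Y (\<lambda>y :: real^'n. c :: real^'n) = norm c"
  by (simp add: L2_norm_def measure_restrict_space Y_sets Y_measure)

text \<open>\<open>C0\<close> bounds the energy of a cell field, \<open>C1\<close> the squared
  distance of two cell fields and \<open>C2\<close> that of their mean fluxes. They depend on
  \<alpha> and \<beta> only; \<open>C1\<close> is the constant of \<open>energy_algebra\<close>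
  times \<open>C0\<close>.\<close>

definition C0 :: real where "C0 = (\<beta> / \<alpha>)\<^sup>2"
definition C1 :: real where "C1 = (2 / \<alpha>) * (1 / \<alpha> + 1 + \<beta>\<^sup>2 / \<alpha>) * C0"
definition C2 :: real where "C2 = 2 * C0 + 2 * \<beta>\<^sup>2 * C1 + \<beta>\<^sup>2 * C0"

lemma C0_ge: "1 \<le> C0"
  using \<alpha>\<beta> by (simp add: C0_def one_le_power le_divide_eq)

lemma C1_nonneg: "0 \<le> C1" and C2_nonneg: "0 \<le> C2"
proof -
  show "0 \<le> C1" using \<alpha>\<beta> C0_ge by (simp add: C1_def)
  then show "0 \<le> C2" using C0_ge by (simp add: C2_def)
qed

text \<open>The flux is orthogonal to the cell gradient, so the energy reduces to the flux tested
  with the constant \<xi>. Coercivity below and the linear bound above give the ratio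
  \<beta>/\<alpha>.\<close>

lemma pc_energy:
  assumes t: "t \<in> \<Omega>"
  shows "L2_norm Y (pc \<xi> t) \<le> \<beta> / \<alpha> * norm \<xi>" and "sqn Y (pc \<xi> t) \<le> C0 * (norm \<xi>)\<^sup>2"
proof -
  let ?p = "pc \<xi> t" and ?D = "L2_norm Y (pc \<xi> t)"
  note L = pc_L2[OF t, of \<xi>] sig_L2[OF t, of \<xi>] wg_L2[OF t, of \<xi>]
  have c: "(\<lambda>y. \<xi>) \<in> L2 Y" by (rule L2_const[OF Y_lmeasurable])
  have "\<alpha> * ?D\<^sup>2 = (LINT y|lebesgue_on Y. \<alpha> * (norm (?p y))\<^sup>2)" by (simp add: L2_norm_power2)
  also have "\<dots> \<le> (LINT y|lebesgue_on Y. sig \<xi> t y \<bullet> ?p y)"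
  proof (rule integral_mono_AE)
    show "AE y in lebesgue_on Y. \<alpha> * (norm (?p y))\<^sup>2 \<le> sig \<xi> t y \<bullet> ?p y"
      using AE_lebesgue_onI[OF Y_sets AE_good] by eventually_elim (simp add: sig_def good_coercive[OF _ t])
  qed (use L2_integrable_sq[OF L(1)] L2_inner_integrable[OF L(2,1)] in auto)
  also have "\<dots> = (LINT y|lebesgue_on Y. sig \<xi> t y \<bullet> \<xi>) + (LINT y|lebesgue_on Y. sig \<xi> t y \<bullet> wg \<xi> t y)"
    using L2_inner_integrable[OF L(2) c] L2_inner_integrable[OF L(2,3)] by (simp add: pc_def inner_add_right)
  also have "\<dots> \<le> (\<beta> * ?D) * norm \<xi>"
  proof -
    have "(LINT y|lebesgue_on Y. sig \<xi> t y \<bullet> \<xi>) \<le> L2_norm Y (sig \<xi> t) * L2_norm Y (\<lambda>y :: real^'n. \<xi>)"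
      by (rule L2_inner_le[OF L(2) c])
    also have "\<dots> \<le> (\<beta> * ?D) * norm \<xi>"
      unfolding L2_norm_const_Y by (intro mult_right_mono sig_le t) auto
    finally show ?thesis using sig_orthogonal_wg[OF t t] by simp
  qed
  finally have le: "\<alpha> * ?D\<^sup>2 \<le> (\<beta> * ?D) * norm \<xi>" .
  show n: "?D \<le> \<beta> / \<alpha> * norm \<xi>"
  proof (cases "?D = 0")
    case True then show ?thesis using \<alpha>\<beta> by simp
  next
    case False
    then have D: "?D > 0" using L2_norm_nonneg[of Y ?p] by simp
    have "(\<alpha> * ?D) * ?D \<le> (\<beta> * norm \<xi>) * ?D" using le by (simp add: power2_eq_square mult_ac)
    then have "\<alpha> * ?D \<le> \<beta> * norm \<xi>" using D by (rule mult_right_le_imp_le)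
    then show ?thesis using \<alpha>\<beta> by (simp add: field_simps)
  qed
  have "?D\<^sup>2 \<le> (\<beta> / \<alpha> * norm \<xi>)\<^sup>2" using n L2_norm_nonneg by (rule power_mono)
  then show "sqn Y ?p \<le> C0 * (norm \<xi>)\<^sup>2" by (simp add: L2_norm_power2 C0_def power_mult_distrib power_divide)
qed

text \<open>The energy estimate kills the field on Y, and periodicity carries this to every cell.
  Hence indices of the partition with zero vector contribute nothing.\<close>

lemma pc_zero: "t \<in> \<Omega> \<Longrightarrow> AE y in lebesgue. pc 0 t y = 0"
proof -
  assume t: "t \<in> \<Omega>"
  have "sqn Y (pc 0 t) = 0" using pc_energy(2)[OF t, of 0] sqn_nonneg[of Y "pc 0 t"] by simp
  then have "AE y in lebesgue_on Y. pc 0 t y = 0"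
    using integral_nonneg_eq_0_iff_AE[OF L2_integrable_sq[OF pc_L2[OF t, of 0]]] by simp
  then have "AE y in lebesgue. y \<in> Y \<longrightarrow> pc 0 t y = 0" by (simp add: AE_lebesgue_on_iff Y_sets)
  then have A: "AE y in lebesgue. (y - lat k) \<in> Y \<longrightarrow> pc 0 t (y - lat k) = 0" for k
    using AE_affine[of 1 "\<lambda>y. y \<in> Y \<longrightarrow> pc 0 t y = 0" "- lat k"] by simp
  have B: "AE y in lebesgue. pc 0 t (y - lat k) = pc 0 t y" for k
    using pc_periodic[OF t, of 0, unfolded ae_periodic_def, rule_format, of "- k"] by (simp add: lat_uminus)
  have 1: "AE y in lebesgue. (y - lat k) \<in> Y \<longrightarrow> pc 0 t y = 0" for k
    using A[of k] B[of k] by eventually_elim simp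
  have "AE y in lebesgue. \<forall>k :: int^'n. (y - lat k) \<in> Y \<longrightarrow> pc 0 t y = 0"
    unfolding AE_all_countable by (intro allI 1)
  with AE_cells[OF zero_less_one] show "AE y in lebesgue. pc 0 t y = 0"
  proof eventually_elim
    case (elim y)
    then obtain k where "y \<in> cell 1 k" by blast
    then have "y - lat k \<in> Y" by (auto simp: cell_eq)
    then show ?case using elim by blast
  qed
qed

text \<open>Monotonicity is tested with the difference of the two fields. Its gradient part drops
  out by orthogonality of the full flux difference, so only the constant \<xi>1 - \<xi>2 and the
  change of the slow variable remain. The modulus meets \<xi>1 alone, which is essential when \<xi>2
  is an average without a uniform bound.\<close>

lemma pc_lipschitz:
  assumes t: "t1 \<in> \<Omega>" "t2 \<in> \<Omega>"
  shows "sqn Y (\<lambda>y. pc \<xi>1 t1 y - pc \<xi>2 t2 y) \<le> C1 * ((norm (\<xi>1 - \<xi>2))\<^sup>2 + \<omega> (norm (t1 - t2)) * (norm \<xi>1)\<^sup>2)"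
    and "(norm (b_hom a v t1 \<xi>1 - b_hom a v t2 \<xi>2))\<^sup>2 \<le> C2 * ((norm (\<xi>1 - \<xi>2))\<^sup>2 + \<omega> (norm (t1 - t2)) * (norm \<xi>1)\<^sup>2)"
proof -
  let ?p1 = "pc \<xi>1 t1" and ?p2 = "pc \<xi>2 t2"
  define P where "P = (\<lambda>y. ?p1 y - ?p2 y)"
  \<comment> \<open>The flux difference passes through the flux of the first field at the second
    point: A contains only the change of the slow variable, B only the change of the field.\<close>
  define A where "A = (\<lambda>y. a t1 y (?p1 y) - a t2 y (?p1 y))"
  define B where "B = (\<lambda>y. a t2 y (?p1 y) - a t2 y (?p2 y))"
  let ?w = "\<omega> (norm (t1 - t2))" and ?X = "norm (\<xi>1 - \<xi>2)"
  have w0: "0 \<le> ?w" by (rule \<omega>_nonneg) simp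
  note L = pc_L2[OF t(1), of \<xi>1] pc_L2[OF t(2), of \<xi>2]
  have PL: "P \<in> L2 Y" unfolding P_def by (intro L2_diff L)
  have m: "(\<lambda>y. a t2 y (?p1 y)) \<in> borel_measurable (lebesgue_on Y)"
    using flux_measurable[OF Y_sets _ _ L2_measurable[OF L(1)], of "\<lambda>_. t2" 1] t by simp
  have ms: "(\<lambda>y. a t1 y (?p1 y)) \<in> borel_measurable (lebesgue_on Y)" "(\<lambda>y. a t2 y (?p2 y)) \<in> borel_measurable (lebesgue_on Y)"
    using L2_measurable[OF sig_L2[OF t(1), of \<xi>1]] L2_measurable[OF sig_L2[OF t(2), of \<xi>2]] by (simp_all add: sig_def[abs_def])
  have Am: "A \<in> borel_measurable (lebesgue_on Y)" and Bm: "B \<in> borel_measurable (lebesgue_on Y)"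
    unfolding A_def B_def using m ms by auto
  note g = AE_lebesgue_onI[OF Y_sets AE_good]
  have Ab: "AE y in lebesgue_on Y. norm (A y) \<le> sqrt ?w * norm (?p1 y)"
    using g by eventually_elim (simp add: A_def good_modulus t)
  have Bb: "AE y in lebesgue_on Y. norm (B y) \<le> \<beta> * norm (P y)"
    using g by eventually_elim (simp add: B_def P_def good_lip t)
  have AL: "A \<in> L2 Y" by (rule L2_bound[OF Am L(1) Ab])
  have BL: "B \<in> L2 Y" by (rule L2_bound[OF Bm PL Bb])
  define NA where "NA = L2_norm Y A"
  define D where "D = L2_norm Y P"
  have NB: "L2_norm Y B \<le> \<beta> * D" unfolding D_def using \<beta>_pos by (intro L2_norm_le[OF Bm PL _ Bb]) simp
  have NA: "NA \<le> sqrt ?w * L2_norm Y ?p1" unfolding NA_def using w0 by (intro L2_norm_le[OF Am L(1) _ Ab]) simp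
  have nn: "0 \<le> NA" "0 \<le> D" by (simp_all add: NA_def D_def L2_norm_nonneg)
  have cL: "(\<lambda>y. \<xi>1 - \<xi>2) \<in> L2 Y" by (rule L2_const[OF Y_lmeasurable])
  have sAB: "sig \<xi>1 t1 y - sig \<xi>2 t2 y = A y + B y" for y by (simp add: sig_def A_def B_def)
  have ABL: "(\<lambda>y. A y + B y) \<in> L2 Y" by (rule L2_add(1)[OF AL BL])
  have dL: "(\<lambda>y. wg \<xi>1 t1 y - wg \<xi>2 t2 y) \<in> L2 Y" by (intro L2_diff wg_L2 t)
  have orth: "(LINT y|lebesgue_on Y. (A y + B y) \<bullet> (wg \<xi>1 t1 y - wg \<xi>2 t2 y)) = 0"
  proof -
    note i = L2_inner_integrable[OF sig_L2[OF t(1), of \<xi>1] wg_L2[OF t(1), of \<xi>1]]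
      L2_inner_integrable[OF sig_L2[OF t(1), of \<xi>1] wg_L2[OF t(2), of \<xi>2]]
      L2_inner_integrable[OF sig_L2[OF t(2), of \<xi>2] wg_L2[OF t(1), of \<xi>1]]
      L2_inner_integrable[OF sig_L2[OF t(2), of \<xi>2] wg_L2[OF t(2), of \<xi>2]]
    show ?thesis unfolding sAB[symmetric] inner_diff_left inner_diff_right
      using i by (simp add: sig_orthogonal_wg t)
  qed
  have P_eq: "P y = (\<xi>1 - \<xi>2) + (wg \<xi>1 t1 y - wg \<xi>2 t2 y)" for y by (simp add: P_def pc_def)
  have "\<alpha> * D\<^sup>2 = (LINT y|lebesgue_on Y. \<alpha> * (norm (P y))\<^sup>2)" by (simp add: D_def L2_norm_power2)
  also have "\<dots> \<le> (LINT y|lebesgue_on Y. B y \<bullet> P y)"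
  proof (rule integral_mono_AE)
    show "AE y in lebesgue_on Y. \<alpha> * (norm (P y))\<^sup>2 \<le> B y \<bullet> P y"
      using g by eventually_elim (simp add: B_def P_def good_mono t)
  qed (use L2_integrable_sq[OF PL] L2_inner_integrable[OF BL PL] in auto)
  also have "\<dots> = (LINT y|lebesgue_on Y. (A y + B y) \<bullet> P y) - (LINT y|lebesgue_on Y. A y \<bullet> P y)"
    using L2_inner_integrable[OF BL PL] L2_inner_integrable[OF AL PL] by (simp add: inner_add_left)
  also have "(LINT y|lebesgue_on Y. (A y + B y) \<bullet> P y)
      = (LINT y|lebesgue_on Y. (A y + B y) \<bullet> (\<xi>1 - \<xi>2) + (A y + B y) \<bullet> (wg \<xi>1 t1 y - wg \<xi>2 t2 y))"
    unfolding P_eq inner_add_right ..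
  also have "\<dots> = (LINT y|lebesgue_on Y. (A y + B y) \<bullet> (\<xi>1 - \<xi>2))"
    using L2_inner_integrable[OF ABL cL] L2_inner_integrable[OF ABL dL] orth by simp
  also have "\<dots> - (LINT y|lebesgue_on Y. A y \<bullet> P y) \<le> (NA + \<beta> * D) * ?X + NA * D"
  proof -
    have "(LINT y|lebesgue_on Y. (A y + B y) \<bullet> (\<xi>1 - \<xi>2)) \<le> L2_norm Y (\<lambda>y. A y + B y) * ?X"
      using L2_inner_le[OF ABL cL] by (simp add: L2_norm_const_Y)
    also have "\<dots> \<le> (NA + \<beta> * D) * ?X"
      using L2_norm_add[OF AL BL] NB by (intro mult_right_mono) (auto simp: NA_def)
    finally have 1: "(LINT y|lebesgue_on Y. (A y + B y) \<bullet> (\<xi>1 - \<xi>2)) \<le> (NA + \<beta> * D) * ?X" .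
    have "\<bar>LINT y|lebesgue_on Y. A y \<bullet> P y\<bar> \<le> NA * D" unfolding NA_def D_def by (rule L2_Cauchy_Schwarz[OF AL PL])
    with 1 show ?thesis by linarith
  qed
  finally have main: "\<alpha> * D\<^sup>2 \<le> (NA + \<beta> * D) * ?X + NA * D" .
  have D2: "D\<^sup>2 \<le> (2 / \<alpha>) * (1 / \<alpha> + 1 + \<beta>\<^sup>2 / \<alpha>) * (NA\<^sup>2 + ?X\<^sup>2)"
    using \<alpha>\<beta> \<beta>_pos nn main by (intro energy_algebra) auto
  have NA2: "NA\<^sup>2 \<le> C0 * (?w * (norm \<xi>1)\<^sup>2)"
  proof -
    have "NA\<^sup>2 \<le> (sqrt ?w * L2_norm Y ?p1)\<^sup>2" using NA nn(1) by (rule power_mono)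
    also have "\<dots> = ?w * sqn Y ?p1" using w0 by (simp add: power_mult_distrib L2_norm_power2)
    also have "\<dots> \<le> ?w * (C0 * (norm \<xi>1)\<^sup>2)" using w0 by (intro mult_left_mono pc_energy t) auto
    finally show ?thesis by (simp add: mult_ac)
  qed
  have "NA\<^sup>2 + ?X\<^sup>2 \<le> C0 * (?w * (norm \<xi>1)\<^sup>2) + C0 * ?X\<^sup>2"
    using NA2 mult_right_mono[OF C0_ge, of "?X\<^sup>2"] by simp
  also have "\<dots> = C0 * (?X\<^sup>2 + ?w * (norm \<xi>1)\<^sup>2)" by (simp add: algebra_simps)
  finally have "(2 / \<alpha>) * (1 / \<alpha> + 1 + \<beta>\<^sup>2 / \<alpha>) * (NA\<^sup>2 + ?X\<^sup>2)
      \<le> (2 / \<alpha>) * (1 / \<alpha> + 1 + \<beta>\<^sup>2 / \<alpha>) * (C0 * (?X\<^sup>2 + ?w * (norm \<xi>1)\<^sup>2))"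
    using \<alpha>\<beta> by (intro mult_left_mono) auto
  with D2 have D3: "D\<^sup>2 \<le> C1 * (?X\<^sup>2 + ?w * (norm \<xi>1)\<^sup>2)" by (simp only: C1_def mult.assoc)
  then show "sqn Y (\<lambda>y. pc \<xi>1 t1 y - pc \<xi>2 t2 y) \<le> C1 * (?X\<^sup>2 + ?w * (norm \<xi>1)\<^sup>2)"
    by (simp add: D_def L2_norm_power2 P_def)
  have "(norm (b_hom a v t1 \<xi>1 - b_hom a v t2 \<xi>2))\<^sup>2 = (norm (LINT y|lebesgue_on Y. A y + B y))\<^sup>2"
    using L2_imp_integrable[OF sig_L2[OF t(1), of \<xi>1] Y_lmeasurable] L2_imp_integrable[OF sig_L2[OF t(2), of \<xi>2] Y_lmeasurable]
    unfolding sAB[symmetric] by (simp add: b_hom_eq t)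
  also have "\<dots> \<le> sqn Y (\<lambda>y. A y + B y)"
    using norm_integral_power2_le[OF ABL Y_lmeasurable] by (simp add: Y_measure)
  also have "\<dots> \<le> 2 * sqn Y A + 2 * sqn Y B" by (rule sqn_add_le[OF AL BL])
  also have "\<dots> \<le> 2 * (C0 * (?w * (norm \<xi>1)\<^sup>2)) + 2 * (\<beta>\<^sup>2 * (C1 * (?X\<^sup>2 + ?w * (norm \<xi>1)\<^sup>2)))"
  proof -
    have "sqn Y B \<le> \<beta>\<^sup>2 * sqn Y P" by (rule sqn_bound[OF Bm PL Bb])
    also have "\<dots> \<le> \<beta>\<^sup>2 * (C1 * (?X\<^sup>2 + ?w * (norm \<xi>1)\<^sup>2))" using D3 by (intro mult_left_mono) (auto simp: D_def L2_norm_power2)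
    finally show ?thesis using NA2 by (simp add: NA_def L2_norm_power2)
  qed
  also have "\<dots> \<le> C2 * (?X\<^sup>2 + ?w * (norm \<xi>1)\<^sup>2)"
  proof -
    have "0 \<le> C0 * ?X\<^sup>2" "0 \<le> \<beta>\<^sup>2 * C0 * ?X\<^sup>2" "0 \<le> \<beta>\<^sup>2 * C0 * (?w * (norm \<xi>1)\<^sup>2)"
      using C0_ge w0 by auto
    then show ?thesis by (simp add: C2_def algebra_simps)
  qed
  finally show "(norm (b_hom a v t1 \<xi>1 - b_hom a v t2 \<xi>2))\<^sup>2 \<le> C2 * (?X\<^sup>2 + ?w * (norm \<xi>1)\<^sup>2)" .
qed

end

subsection \<open>The Poincare inequality and duality\<close>

lemma le_of_le_add_mult_epsilon:
  fixes x y C :: real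
  assumes "0 \<le> C" "\<And>e. e > 0 \<Longrightarrow> x \<le> y + C * e" shows "x \<le> y"
proof (rule field_le_epsilon)
  fix e :: real assume "e > 0"
  then have "x \<le> y + C * (e / (C + 1))" using assms(1) by (intro assms(2)) simp
  also have "C * (e / (C + 1)) \<le> e" using \<open>e > 0\<close> assms(1) by (simp add: field_simps)
  finally show "x \<le> y + e" by simp
qed

text \<open>A translation longer than the diameter of S moves S off itself, so \<phi>(x) or \<phi>(x
  + z) vanishes and |\<phi>(x)| is at most the increment. The length 3R + 1 exceeds 2R even for R =
  0.\<close>

lemma poincare_test_functions:
  fixes S :: "(real^'n) set"
  assumes "S \<subseteq> cball 0 R" "open S" "0 \<le> R" "\<phi> \<in> test_functions S"
  shows "sqn S \<phi> \<le> (3 * R + 1)\<^sup>2 * sqn S (grad \<phi>)"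
proof -
  obtain i :: 'n where True by blast
  define z :: "real^'n" where "z = (3 * R + 1) *\<^sub>R axis i 1"
  have nz: "norm z = 3 * R + 1" using assms(3) by (simp add: z_def norm_axis_1)
  obtain K where K: "compact K" "K \<subseteq> S" "\<And>x. x \<notin> K \<Longrightarrow> \<phi> x = 0" "\<And>x. x \<notin> K \<Longrightarrow> grad \<phi> x = 0"
    by (rule test_functionsE[OF assms(4)]) (rule that)
  note U = test_functions_UNIV[OF assms(4)] and S = open_sets_lebesgue[OF assms(2)]
  have off: "\<phi> x = 0" "grad \<phi> x = 0" if "x \<notin> S" for x using K that by blast+
  have sup: "sqn S \<phi> = sqn UNIV \<phi>" "sqn S (grad \<phi>) = sqn UNIV (grad \<phi>)"
    using off S by (auto intro!: integral_lebesgue_on_support(1))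
  have 0: "\<phi> x = 0 \<or> \<phi> (x + z) = 0" for x
  proof (rule ccontr)
    assume "\<not> ?thesis"
    then have "x \<in> S" "x + z \<in> S" using K by blast+
    then have "norm x \<le> R" "norm (x + z) \<le> R" using assms(1) by auto
    moreover have "norm z \<le> norm (x + z) + norm x" using norm_triangle_ineq4[of "x + z" x] by simp
    ultimately show False using nz assms(3) by linarith
  qed
  have "(\<lambda>x. \<phi> (1 *\<^sub>R x + z)) \<in> test_functions UNIV" by (rule test_functions_affine[OF U]) simp
  then have sh: "(\<lambda>x. \<phi> (x + z)) \<in> test_functions UNIV" by simp
  have dL: "(\<lambda>x. \<phi> (x + z) - \<phi> x) \<in> L2 UNIV"
    using test_functions_L2(1)[OF sh, of UNIV] test_functions_L2(1)[OF U, of UNIV] by (intro L2_diff) auto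
  have "(LINT x|lebesgue. (\<phi> x)\<^sup>2) \<le> (LINT x|lebesgue. (\<phi> (x + z) - \<phi> x)\<^sup>2)"
  proof (rule integral_mono)
    show "integrable lebesgue (\<lambda>x. (\<phi> x)\<^sup>2)" using L2_integrable_sq[OF test_functions_L2(1)[OF U, of UNIV]] by (simp add: lebesgue_on_UNIV_eq)
    show "integrable lebesgue (\<lambda>x. (\<phi> (x + z) - \<phi> x)\<^sup>2)" using L2_integrable_sq[OF dL] by (simp add: lebesgue_on_UNIV_eq)
    show "(\<phi> x)\<^sup>2 \<le> (\<phi> (x + z) - \<phi> x)\<^sup>2" for x using 0[of x] by auto
  qed
  also have "\<dots> \<le> (norm z)\<^sup>2 * (LINT x|lebesgue. (norm (grad \<phi> x))\<^sup>2)" by (rule translation_estimate[OF U])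
  finally show ?thesis unfolding sup nz by (simp add: lebesgue_on_UNIV_eq)
qed

lemma poincare_H12_0:
  fixes S :: "(real^'n) set"
  assumes "open S" "bounded S"
  obtains C where "C \<ge> 0" "\<And>u. u \<in> H12_0 S \<Longrightarrow> sqn S u \<le> C * sqn S (weak_grad S u)"
proof -
  obtain R where R: "S \<subseteq> cball 0 R" "R > 0" using assms(2) by (meson bounded_subset_ballD ball_subset_cball order_trans)
  define C where "C = (3 * R + 1)\<^sup>2"
  \<comment> \<open>The factor 4 comes from splitting a square twice, once for u and once for its
    gradient, on passing to a nearby test function.\<close>
  have "sqn S u \<le> 4 * C * sqn S (weak_grad S u)" if u: "u \<in> H12_0 S" for u
  proof (rule le_of_le_add_mult_epsilon[of "4 * C + 2"])
    fix e :: real assume "e > 0"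
    obtain \<phi> where p: "\<phi> \<in> test_functions S" "sqn S (\<lambda>x. u x - \<phi> x) < e" "sqn S (\<lambda>x. weak_grad S u x - grad \<phi> x) < e"
      by (rule H12_0D[OF u assms(1) \<open>e > 0\<close>]) (rule that)
    note L = test_functions_L2[OF p(1) open_sets_lebesgue[OF assms(1)]] H12D(1,2)[OF H12_0_H12[OF u] assms(1)]
    have "sqn S u = sqn S (\<lambda>x. (u x - \<phi> x) + \<phi> x)" by simp
    also have "\<dots> \<le> 2 * sqn S (\<lambda>x. u x - \<phi> x) + 2 * sqn S \<phi>" by (intro sqn_add_le L2_diff L)
    finally have 1: "sqn S u \<le> 2 * e + 2 * sqn S \<phi>" using p(2) by linarith
    have 2: "sqn S \<phi> \<le> C * sqn S (grad \<phi>)" unfolding C_def using R by (intro poincare_test_functions assms p) auto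
    have "sqn S (grad \<phi>) = sqn S (\<lambda>x. weak_grad S u x - (weak_grad S u x - grad \<phi> x))" by simp
    also have "\<dots> \<le> 2 * sqn S (weak_grad S u) + 2 * sqn S (\<lambda>x. weak_grad S u x - grad \<phi> x)" by (intro sqn_diff_le L2_diff L)
    also have "\<dots> \<le> 2 * sqn S (weak_grad S u) + 2 * e" using p(3) by linarith
    finally have "C * sqn S (grad \<phi>) \<le> C * (2 * sqn S (weak_grad S u) + 2 * e)" by (intro mult_left_mono) (auto simp: C_def)
    with 1 2 show "sqn S u \<le> 4 * C * sqn S (weak_grad S u) + (4 * C + 2) * e" by (simp add: algebra_simps)
  qed (simp add: C_def)
  then show ?thesis by (intro that[of "4 * C"]) (auto simp: C_def)
qed

lemma H12_norm_le_L2_norm_weak_grad: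
  fixes S :: "(real^'n) set"
  assumes "open S" "bounded S"
  obtains C where "C \<ge> 0" "\<And>u. u \<in> H12_0 S \<Longrightarrow> H12_norm S u \<le> C * L2_norm S (weak_grad S u)"
proof -
  obtain C where C: "C \<ge> 0" "\<And>u. u \<in> H12_0 S \<Longrightarrow> sqn S u \<le> C * sqn S (weak_grad S u)"
    by (rule poincare_H12_0[OF assms]) (rule that)
  have "H12_norm S u \<le> sqrt (C + 1) * L2_norm S (weak_grad S u)" if "u \<in> H12_0 S" for u
  proof (rule power2_le_imp_le)
    show "(H12_norm S u)\<^sup>2 \<le> (sqrt (C + 1) * L2_norm S (weak_grad S u))\<^sup>2"
      using C(2)[OF that] C(1) by (simp add: H12_norm_power2 power_mult_distrib L2_norm_power2 algebra_simps)
  qed (use C(1) in \<open>simp add: L2_norm_nonneg\<close>)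
  then show ?thesis using C(1) by (intro that[of "sqrt (C + 1)"]) auto
qed

lemma H12_cmult:
  fixes u :: "real^'n \<Rightarrow> real"
  assumes "u \<in> H12 S" "open S"
  shows "(\<lambda>x. c * u x) \<in> H12 S" and "H12_norm S (\<lambda>x. c * u x) = \<bar>c\<bar> * H12_norm S u"
proof -
  note u = H12D[OF assms]
  have w: "is_weak_grad S (\<lambda>x. c * u x) (\<lambda>x. c *\<^sub>R weak_grad S u x)" by (rule is_weak_grad_cmult[OF u(3)])
  have L: "(\<lambda>x. c *\<^sub>R u x) \<in> L2 S" "(\<lambda>x. c *\<^sub>R weak_grad S u x) \<in> L2 S" by (rule L2_scaleR[OF u(1)]) (rule L2_scaleR[OF u(2)])
  then show "(\<lambda>x. c * u x) \<in> H12 S" using w by (intro H12I) auto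
  have "sqn S (weak_grad S (\<lambda>x. c * u x)) = c\<^sup>2 * sqn S (weak_grad S u)"
    using sqn_weak_grad[OF assms(2) w L(2)] sqn_scaleR[of S c "weak_grad S u"] by simp
  moreover have "sqn S (\<lambda>x. c * u x) = c\<^sup>2 * sqn S u" using sqn_scaleR[of S c u] by simp
  ultimately have "(H12_norm S (\<lambda>x. c * u x))\<^sup>2 = (\<bar>c\<bar> * H12_norm S u)\<^sup>2"
    by (simp only: H12_norm_power2 power_mult_distrib power2_abs distrib_left)
  then show "H12_norm S (\<lambda>x. c * u x) = \<bar>c\<bar> * H12_norm S u"
    by (rule power2_eq_imp_eq) (auto simp: H12_norm_nonneg)
qed

lemma H12_0_cmult:
  fixes u :: "real^'n \<Rightarrow> real"
  assumes "u \<in> H12_0 S" "open S" shows "(\<lambda>x. c * u x) \<in> H12_0 S"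
  unfolding H12_0_def mem_Collect_eq
proof (intro conjI allI impI)
  show "(\<lambda>x. c * u x) \<in> H12 S" by (rule H12_cmult(1)[OF H12_0_H12[OF assms(1)] assms(2)])
  fix e :: real assume e: "e > 0"
  then have "e / (\<bar>c\<bar> + 1) > 0" by simp
  then obtain \<phi> where p: "\<phi> \<in> test_functions S" "H12_norm S (\<lambda>x. u x - \<phi> x) < e / (\<bar>c\<bar> + 1)"
    using assms(1) unfolding H12_0_def by blast
  have d: "(\<lambda>x. u x - \<phi> x) \<in> H12 S"
    by (intro H12_0_H12 H12_0_diff test_functions_H12_0 assms p)
  have "H12_norm S (\<lambda>x. c * u x - c * \<phi> x) = \<bar>c\<bar> * H12_norm S (\<lambda>x. u x - \<phi> x)"
    using H12_cmult(2)[OF d assms(2), of c] by (simp add: right_diff_distrib)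
  also have "\<dots> \<le> (\<bar>c\<bar> + 1) * H12_norm S (\<lambda>x. u x - \<phi> x)" by (intro mult_right_mono H12_norm_nonneg) simp
  also have "\<dots> < e" using p(2) by (simp add: field_simps)
  finally show "\<exists>\<phi>\<in>test_functions S. H12_norm S (\<lambda>x. c * u x - \<phi> x) < e"
    using test_functions_cmult[OF p(1)] by (intro bexI[of _ "\<lambda>x. c * \<phi> x"])
qed

text \<open>By homogeneity u is scaled to norm 1, where the supremum applies. A supremum of reals is
  an upper bound only for a set bounded above, which boundedness of both functionals provides; it
  also settles the case of norm zero.\<close>

lemma H_minus_norm_bound:
  fixes S :: "(real^'n) set"
  assumes F: "F \<in> H_minus S" and G: "G \<in> H_minus S" and u: "u \<in> H12_0 S" and S: "open S"
  shows "\<bar>F u - G u\<bar> \<le> H_minus_norm S (\<lambda>\<phi>. F \<phi> - G \<phi>) * H12_norm S u"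
proof -
  define D where "D = (\<lambda>\<phi>. F \<phi> - G \<phi>)"
  obtain C1 C2 where C: "\<And>\<phi>. \<phi> \<in> H12_0 S \<Longrightarrow> \<bar>F \<phi>\<bar> \<le> C1 * H12_norm S \<phi>" "\<And>\<phi>. \<phi> \<in> H12_0 S \<Longrightarrow> \<bar>G \<phi>\<bar> \<le> C2 * H12_norm S \<phi>"
    using F G unfolding H_minus_def mem_Collect_eq by meson
  have D: "\<bar>D \<phi>\<bar> \<le> (C1 + C2) * H12_norm S \<phi>" if "\<phi> \<in> H12_0 S" for \<phi>
    using C(1)[OF that] C(2)[OF that] unfolding D_def distrib_right by linarith
  have hom: "D (\<lambda>x. c * u x) = c * D u" for c
    using F G u unfolding H_minus_def D_def by (simp add: right_diff_distrib)
  let ?N = "H12_norm S u"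
  show ?thesis
  proof (cases "?N = 0")
    case True
    then show ?thesis using D[OF u] by (simp add: D_def)
  next
    case False
    then have N: "?N > 0" using H12_norm_nonneg[of S u] by simp
    let ?w = "\<lambda>x. (1 / ?N) * u x"
    have w: "?w \<in> H12_0 S" "H12_norm S ?w = 1"
      using H12_0_cmult[OF u S, of "1 / ?N"] H12_cmult(2)[OF H12_0_H12[OF u] S, of "1 / ?N"] N by auto
    have "\<bar>D ?w\<bar> \<le> H_minus_norm S D"
      unfolding H_minus_norm_def
    proof (rule cSUP_upper)
      show "bdd_above ((\<lambda>\<phi>. \<bar>D \<phi>\<bar>) ` {\<phi> \<in> H12_0 S. H12_norm S \<phi> \<le> 1})"
      proof (rule bdd_aboveI2)
        fix \<phi> assume "\<phi> \<in> {\<phi> \<in> H12_0 S. H12_norm S \<phi> \<le> 1}"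
        then have p: "\<phi> \<in> H12_0 S" "H12_norm S \<phi> \<le> 1" by auto
        show "\<bar>D \<phi>\<bar> \<le> \<bar>C1 + C2\<bar>"
          using D[OF p(1)] mult_right_mono[OF abs_ge_self[of "C1 + C2"] H12_norm_nonneg[of S \<phi>]]
            mult_left_mono[OF p(2) abs_ge_zero[of "C1 + C2"]] by simp
      qed
    qed (use w in auto)
    then show ?thesis unfolding hom using N by (simp add: D_def[symmetric] abs_mult field_simps) (simp add: D_def)
  qed
qed

text \<open>Both sides are continuous in the L2 norm of the gradient, so a bound proved by calculus
  on test functions extends to the whole of \<open>H12_0\<close>.\<close>

lemma density_bound:
  fixes T :: "real^'n \<Rightarrow> real^'n"
  assumes S: "open S" and T: "T \<in> L2 S" and M: "0 \<le> M"
    and b: "\<And>\<phi>. \<phi> \<in> test_functions S \<Longrightarrow> (LINT x|lebesgue_on S. T x \<bullet> grad \<phi> x) \<le> M * L2_norm S (grad \<phi>)"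
    and u: "u \<in> H12_0 S"
  shows "(LINT x|lebesgue_on S. T x \<bullet> weak_grad S u x) \<le> M * L2_norm S (weak_grad S u)"
proof (rule le_of_le_add_mult_epsilon[of "M + L2_norm S T"])
  show "0 \<le> M + L2_norm S T" using M by (simp add: L2_norm_nonneg)
  fix e :: real assume e: "e > 0"
  then have "e\<^sup>2 > 0" by simp
  obtain \<phi> where p: "\<phi> \<in> test_functions S" "sqn S (\<lambda>x. weak_grad S u x - grad \<phi> x) < e\<^sup>2"
    by (rule H12_0D[OF u S \<open>e\<^sup>2 > 0\<close>]) (rule that)
  note L = test_functions_L2[OF p(1) open_sets_lebesgue[OF S]] H12D(1,2)[OF H12_0_H12[OF u] S]
  define d where "d = (\<lambda>x. weak_grad S u x - grad \<phi> x)"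
  have dL: "d \<in> L2 S" unfolding d_def by (intro L2_diff L)
  have de: "L2_norm S d \<le> e"
    by (rule power2_le_imp_le) (use p(2) e in \<open>auto simp: L2_norm_power2 d_def\<close>)
  have "(LINT x|lebesgue_on S. T x \<bullet> weak_grad S u x) = (LINT x|lebesgue_on S. T x \<bullet> grad \<phi> x + T x \<bullet> d x)"
    by (simp add: d_def inner_diff_right)
  also have "\<dots> = (LINT x|lebesgue_on S. T x \<bullet> grad \<phi> x) + (LINT x|lebesgue_on S. T x \<bullet> d x)"
    using L2_inner_integrable[OF T L(2)] L2_inner_integrable[OF T dL] by simp
  also have "\<dots> \<le> M * L2_norm S (grad \<phi>) + L2_norm S T * L2_norm S d"
    by (intro add_mono b p L2_inner_le T dL)
  also have "\<dots> \<le> M * (L2_norm S (weak_grad S u) + e) + L2_norm S T * e"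
  proof (intro add_mono mult_left_mono M L2_norm_nonneg de)
    have "L2_norm S (grad \<phi>) = L2_norm S (\<lambda>x. weak_grad S u x + - 1 *\<^sub>R d x)" by (simp add: d_def)
    also have "\<dots> \<le> L2_norm S (weak_grad S u) + L2_norm S (\<lambda>x. - 1 *\<^sub>R d x)" by (intro L2_norm_add L2_scaleR L dL)
    also have "L2_norm S (\<lambda>x. - 1 *\<^sub>R d x) = L2_norm S d" by (simp add: L2_norm_def)
    finally show "L2_norm S (grad \<phi>) \<le> L2_norm S (weak_grad S u) + e" using de by linarith
  qed
  finally show "(LINT x|lebesgue_on S. T x \<bullet> weak_grad S u x) \<le> M * L2_norm S (weak_grad S u) + (M + L2_norm S T) * e"
    by (simp add: algebra_simps)
qed

subsection \<open>Partitions of unity\<close>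

lemma closure_cell_dist:
  fixes x y :: "real^'n"
  assumes "\<epsilon> > 0" "x \<in> closure (cell \<epsilon> j)" "y \<in> cell \<epsilon> j"
  shows "dist x y \<le> real CARD('n) * \<epsilon>"
proof -
  have "closure (cell \<epsilon> j) \<subseteq> cball y (real CARD('n) * \<epsilon>)"
    using cell_dist(1)[OF assms(1) assms(3)] by (intro closure_minimal) (auto simp: dist_norm)
  then show ?thesis using assms(2) by (auto simp: dist_commute)
qed

lemma cell_nonempty:
  fixes j :: "int^'n"
  assumes "\<epsilon> > 0" shows "cell \<epsilon> j \<noteq> {}"
proof
  assume "cell \<epsilon> j = {}"
  with cell_measure[OF assms, of j] assms show False by simp
qed

text \<open>The weights are mollified indicators of small cells. They sum to 1 because the cells
  tile the space up to a null set and the mollifier has integral 1. A cell has diameter at most r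
  and the mollifier adds r on either side, which gives 3r.\<close>

lemma partition_exists:
  fixes S :: "(real^'n) set"
  assumes "bounded S" "r > 0"
  obtains K :: "(int^'n) set" and \<eta> where "finite K" "\<And>k. \<eta> k \<in> test_functions UNIV" "\<And>k x. 0 \<le> \<eta> k x"
    "\<And>x. x \<in> S \<Longrightarrow> (\<Sum>k\<in>K. \<eta> k x) = 1"
    "\<And>k x y. \<eta> k x \<noteq> 0 \<Longrightarrow> \<eta> k y \<noteq> 0 \<Longrightarrow> dist x y \<le> 3 * r"
    "\<And>k x T. \<eta> k x \<noteq> 0 \<Longrightarrow> cball x (3 * r) \<subseteq> T \<Longrightarrow> \<eta> k \<in> test_functions T"
proof -
  obtain R where R: "S \<subseteq> cball 0 R" using assms(1) by (meson bounded_subset_ballD ball_subset_cball order_trans)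
  obtain \<rho> :: "real^'n \<Rightarrow> real" where \<rho>: "\<rho> \<in> test_functions UNIV" "\<And>x. 0 \<le> \<rho> x" "\<And>x. norm x > r \<Longrightarrow> \<rho> x = 0" "(LINT x|lebesgue. \<rho> x) = 1"
    by (rule mollifier_exists[OF assms(2)]) (rule that)
  \<comment> \<open>Cells of side s have diameter at most r. In K the radius R + r takes in every
    cell that the mollifier can reach from a point of S.\<close>
  define s where "s = r / real CARD('n)"
  have s: "s > 0" "real CARD('n) * s = r" using assms(2) by (auto simp: s_def)
  define K :: "(int^'n) set" where "K = hit (R + r) s"
  define \<iota> :: "int^'n \<Rightarrow> real^'n \<Rightarrow> real" where "\<iota> k = indicat_real (cell s k)" for k
  define \<eta> where "\<eta> k = conv (\<iota> k) \<rho>" for k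
  have K: "finite K" unfolding K_def by (rule finite_hit[OF s(1)])
  have i: "integrable lebesgue (\<iota> k)" for k
    unfolding \<iota>_def using cell_lmeasurable[OF s(1), of k] by (intro integrable_real_indicator) (auto simp: fmeasurable_def)
  have near: "\<exists>y\<in>cell s k. dist x y \<le> r" if "\<eta> k x \<noteq> 0" for k x
  proof (rule ccontr)
    assume "\<not> ?thesis"
    then have "conv (\<iota> k) \<rho> x = 0"
      by (intro conv_eq_0[where K = "cell s k" and r = r]) (auto simp: \<iota>_def \<rho>(3))
    with that show False by (simp add: \<eta>_def)
  qed
  show ?thesis
  proof (rule that[of K \<eta>])
    show "finite K" by (rule K)
    show "\<eta> k \<in> test_functions UNIV" for k
      unfolding \<eta>_def
      by (rule conv_test_function[where K = "closure (cell s k)" and r = r])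
        (use \<rho> i cell_bounded[OF s(1), of k] closure_subset[of "cell s k"] in \<open>auto simp: \<iota>_def indicator_def\<close>)
    show "0 \<le> \<eta> k x" for k x
      unfolding \<eta>_def conv_def by (intro integral_nonneg_AE AE_I2) (auto simp: \<iota>_def \<rho>(2))
    show "(\<Sum>k\<in>K. \<eta> k x) = 1" if x: "x \<in> S" for x
    proof -
      have nx: "norm x \<le> R" using x R by auto
      have "(\<Sum>k\<in>K. \<eta> k x) = (LINT y|lebesgue. (\<Sum>k\<in>K. \<iota> k y * \<rho> (x - y)))"
        unfolding \<eta>_def conv_def by (rule Bochner_Integration.integral_sum[symmetric]) (rule conv_integrable(1)[OF \<rho>(1) i])
      also have "\<dots> = (LINT y|lebesgue. \<rho> (x - y))"
      proof (rule integral_cong_AE)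
        have "(\<lambda>y. \<Sum>k\<in>K. \<iota> k y * \<rho> (x - y)) \<in> borel_measurable lebesgue"
          by (intro borel_measurable_sum borel_measurable_integrable conv_integrable(1)[OF \<rho>(1) i])
        then show "(\<lambda>y. \<Sum>k\<in>K. \<iota> k y * \<rho> (x - y)) \<in> borel_measurable lebesgue" .
        show "(\<lambda>y. \<rho> (x - y)) \<in> borel_measurable lebesgue"
          using test_functions_integrable(1)[OF test_functions_reflect(1)[OF \<rho>(1), of x], of UNIV] by simp
        show "AE y in lebesgue. (\<Sum>k\<in>K. \<iota> k y * \<rho> (x - y)) = \<rho> (x - y)"
          using AE_hit[OF s(1), of "R + r"]
        proof eventually_elim
          case (elim y)
          show ?case
          proof (cases "norm (x - y) > r")
            case True then show ?thesis by (simp add: \<rho>(3))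
          next
            case False
            then have "norm y \<le> R + r" using nx norm_triangle_ineq4[of x "x - y"] by simp
            then obtain k where k: "k \<in> K" "y \<in> cell s k" using elim by (auto simp: K_def)
            have "\<iota> j y = (if j = k then 1 else 0)" for j
              using cell_unique[OF s(1) _ k(2), of j] k(2) by (cases "y \<in> cell s j") (simp_all add: \<iota>_def, blast)
            then have "(\<Sum>j\<in>K. \<iota> j y * \<rho> (x - y)) = (\<Sum>j\<in>K. if j = k then \<rho> (x - y) else 0)"
              by (intro sum.cong) simp_all
            then show ?thesis using K k(1) by simp
          qed
        qed
      qed
      also have "\<dots> = 1" using integral_reflect[of \<rho> x] \<rho>(4) by simp
      finally show ?thesis .
    qed
    show "dist x y \<le> 3 * r" if xy: "\<eta> k x \<noteq> 0" "\<eta> k y \<noteq> 0" for k x y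
    proof -
      obtain x' y' where *: "x' \<in> cell s k" "dist x x' \<le> r" "y' \<in> cell s k" "dist y y' \<le> r"
        using near[OF xy(1)] near[OF xy(2)] by blast
      have "dist x' y' \<le> r" using cell_dist(1)[OF s(1) *(1,3)] s(2) by (simp add: dist_norm)
      then show ?thesis using *(2,4) dist_triangle[of x y x'] dist_triangle[of x' y y'] by (simp add: dist_commute)
    qed
    show "\<eta> k \<in> test_functions T" if T: "\<eta> k x \<noteq> 0" "cball x (3 * r) \<subseteq> T" for k x T
      unfolding \<eta>_def
    proof (rule conv_test_function[where K = "closure (cell s k)" and r = r])
      obtain x' where *: "x' \<in> cell s k" "dist x x' \<le> r" using near[OF T(1)] by blast
      show "y' \<in> T" if y: "y \<in> closure (cell s k)" "dist y' y \<le> r" for y y'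
      proof -
        have "dist y x' \<le> r" using closure_cell_dist[OF s(1) y(1) *(1)] s(2) by simp
        then have "dist x y' \<le> 3 * r"
          using *(2) y(2) dist_triangle[of x y' x'] dist_triangle[of x' y' y] by (simp add: dist_commute)
        then show ?thesis using T(2) by auto
      qed
    qed (use \<rho> i cell_bounded[OF s(1), of k] closure_subset[of "cell s k"] in \<open>auto simp: \<iota>_def indicator_def\<close>)
  qed
qed

text \<open>A weight whose support meets the set where grad \<phi> does not vanish is frozen at such
  a point, which lies in a compact subset of S. Every other weight gets the vector 0, which there is
  exact.\<close>

lemma gradient_partition_exists:
  fixes S :: "(real^'n) set"
  assumes S: "open S" "bounded S" "S \<noteq> {}" and \<phi>: "\<phi> \<in> test_functions S" and \<tau>: "\<tau> > 0" and L: "\<And>x. norm (grad \<phi> x) \<le> L"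
  obtains K :: "(int^'n) set" and \<eta> z \<xi> where "finite K" "\<And>k. \<eta> k \<in> test_functions UNIV" "\<And>k x. 0 \<le> \<eta> k x"
    "\<And>x. x \<in> S \<Longrightarrow> (\<Sum>k\<in>K. \<eta> k x) = 1" "\<And>k. z k \<in> S" "\<And>k. norm (\<xi> k) \<le> L"
    "\<And>k x. x \<in> S \<Longrightarrow> \<eta> k x \<noteq> 0 \<Longrightarrow> norm (grad \<phi> x - \<xi> k) \<le> \<tau>"
    "\<And>k x. x \<in> S \<Longrightarrow> \<eta> k x \<noteq> 0 \<Longrightarrow> \<xi> k \<noteq> 0 \<Longrightarrow> norm (x - z k) \<le> \<tau>"
    "\<And>k. \<xi> k \<noteq> 0 \<Longrightarrow> \<eta> k \<in> test_functions S"
proof -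
  obtain B where B: "B > 0" "\<And>x y. norm (grad \<phi> x - grad \<phi> y) \<le> B * norm (x - y)"
    by (rule test_functions_grad_lipschitz[OF \<phi>]) (rule that)
  obtain Q where Q: "compact Q" "Q \<subseteq> S" "\<And>x. x \<notin> Q \<Longrightarrow> grad \<phi> x = 0"
    by (rule test_functionsE[OF \<phi>]) (rule that)
  obtain d where d: "d > 0" "(\<Union>x\<in>Q. cball x d) \<subseteq> S"
    by (rule compact_subset_open_imp_cball_epsilon_subset[OF Q(1) S(1) Q(2)]) (rule that)
  \<comment> \<open>The three bounds serve the distance to z_k, the oscillation of the gradient with
    Lipschitz constant B, and the inclusion of the support in S. The factor 3 is the one from the
    partition.\<close>
  define r where "r = min (min \<tau> (\<tau> / B)) d / 3"
  have r: "r > 0" "3 * r \<le> \<tau>" "B * (3 * r) \<le> \<tau>" "3 * r \<le> d"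
  proof -
    show "r > 0" using \<tau> B(1) d(1) by (simp add: r_def)
    show "3 * r \<le> \<tau>" "3 * r \<le> d" by (simp_all add: r_def)
    have "3 * r \<le> \<tau> / B" by (simp add: r_def)
    then show "B * (3 * r) \<le> \<tau>" using B(1) by (simp only: pos_le_divide_eq mult.commute)
  qed
  obtain K :: "(int^'n) set" and \<eta> where K: "finite K" "\<And>k. \<eta> k \<in> test_functions UNIV" "\<And>k x. 0 \<le> \<eta> k x"
    "\<And>x. x \<in> S \<Longrightarrow> (\<Sum>k\<in>K. \<eta> k x) = 1"
    "\<And>k x y. \<eta> k x \<noteq> 0 \<Longrightarrow> \<eta> k y \<noteq> 0 \<Longrightarrow> dist x y \<le> 3 * r"
    "\<And>k x T. \<eta> k x \<noteq> 0 \<Longrightarrow> cball x (3 * r) \<subseteq> T \<Longrightarrow> \<eta> k \<in> test_functions T"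
    by (rule partition_exists[OF S(2) r(1)]) (rule that)
  obtain z0 where z0: "z0 \<in> S" using S(3) by blast
  define P where "P k x \<longleftrightarrow> \<eta> k x \<noteq> 0 \<and> grad \<phi> x \<noteq> 0" for k x
  define z where "z k = (if \<exists>x. P k x then SOME x. P k x else z0)" for k
  define \<xi> where "\<xi> k = (if \<exists>x. P k x then grad \<phi> (z k) else 0)" for k
  have z: "P k (z k)" if "\<xi> k \<noteq> 0 \<or> (\<exists>x. P k x)" for k
  proof -
    have ex: "\<exists>x. P k x" using that unfolding \<xi>_def by presburger
    then have "z k = (SOME x. P k x)" by (simp only: z_def if_True)
    with someI_ex[OF ex] show ?thesis by simp
  qed
  show ?thesis
  proof (rule that[of K \<eta> z \<xi>])
    show "z k \<in> S" for k
    proof (cases "\<exists>x. P k x")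
      case True
      then have "grad \<phi> (z k) \<noteq> 0" using z[of k] by (simp add: P_def)
      then show ?thesis using Q(2,3) by blast
    qed (simp add: z_def z0)
    show "norm (\<xi> k) \<le> L" for k using L[of "z k"] order_trans[OF norm_ge_zero L] by (simp add: \<xi>_def)
    show "norm (grad \<phi> x - \<xi> k) \<le> \<tau>" if "x \<in> S" "\<eta> k x \<noteq> 0" for k x
    proof (cases "\<exists>x. P k x")
      case True
      then have "dist x (z k) \<le> 3 * r" using z[of k] that(2) by (intro K(5)) (auto simp: P_def)
      then have "B * norm (x - z k) \<le> B * (3 * r)" using B(1) by (intro mult_left_mono) (auto simp: dist_norm)
      with True show ?thesis using B(2)[of x "z k"] r(3) by (simp add: \<xi>_def)
    next
      case False
      then have "grad \<phi> x = 0" using that(2) by (auto simp: P_def)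
      with False show ?thesis using \<tau> by (simp add: \<xi>_def)
    qed
    show "norm (x - z k) \<le> \<tau>" if "x \<in> S" "\<eta> k x \<noteq> 0" "\<xi> k \<noteq> 0" for k x
      using K(5)[of k x "z k"] z[of k] that r(2) by (auto simp: P_def dist_norm)
    show "\<eta> k \<in> test_functions S" if "\<xi> k \<noteq> 0" for k
    proof (rule K(6))
      show "\<eta> k (z k) \<noteq> 0" using z[of k] that by (simp add: P_def)
      have "z k \<in> Q" using z[of k] that Q(3) by (auto simp: P_def)
      then have "cball (z k) d \<subseteq> S" using d(2) by (meson UN_subset_iff)
      then show "cball (z k) (3 * r) \<subseteq> S" using subset_cball[OF r(4), of "z k"] by (rule order_trans[rotated])
    qed
  qed (use K in auto)
qed

subsection \<open>The corrector\<close>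

lemma L2_extend:
  fixes f :: "real^'n \<Rightarrow> 'b::euclidean_space"
  assumes "f \<in> L2 T" "T \<subseteq> S" "T \<in> sets lebesgue" "S \<in> sets lebesgue" "\<And>x. x \<in> S \<Longrightarrow> x \<notin> T \<Longrightarrow> f x = 0"
  shows "f \<in> L2 S" "sqn S f = sqn T f"
proof -
  have "(\<lambda>x. if x \<in> T then f x else 0) \<in> borel_measurable lebesgue"
    using L2_measurable[OF assms(1)] assms(3) by (rule borel_measurable_if_I)
  then have m: "(\<lambda>x. if x \<in> T then f x else 0) \<in> borel_measurable (lebesgue_on S)" by (rule measurable_restrict_space1)
  have "f \<in> borel_measurable (lebesgue_on S) \<longleftrightarrow> (\<lambda>x. if x \<in> T then f x else 0) \<in> borel_measurable (lebesgue_on S)"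
    using assms(5) by (intro measurable_cong) auto
  with m have fm: "f \<in> borel_measurable (lebesgue_on S)" by simp
  have z: "(norm (f x))\<^sup>2 = 0" if "x \<in> S" "x \<notin> T" for x using assms(5)[OF that] by simp
  note I = integral_lebesgue_on_support[OF assms(2-4), of "\<lambda>x. (norm (f x))\<^sup>2", OF z]
  show "sqn S f = sqn T f" using I(1) by simp
  show "f \<in> L2 S" unfolding L2_def using fm I(2) L2_integrable_sq[OF assms(1)] by simp
qed

lemma ae_periodic_diff:
  fixes f g :: "real^'n \<Rightarrow> 'b::real_vector"
  assumes "ae_periodic f" "ae_periodic g" shows "ae_periodic (\<lambda>y. f y - g y)"
  unfolding ae_periodic_def
proof
  fix k :: "int^'n"
  have "AE y in lebesgue. f (y + lat k) = f y" "AE y in lebesgue. g (y + lat k) = g y"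
    using assms unfolding ae_periodic_def by blast+
  then show "AE y in lebesgue. f (y + lat k) - g (y + lat k) = f y - g y" by eventually_elim simp
qed

lemma ae_periodic_const: "ae_periodic (\<lambda>y. c)"
  by (simp add: ae_periodic_def)

lemma sum_weighted_integrable:
  fixes V :: "'k \<Rightarrow> real^'n \<Rightarrow> 'b::euclidean_space"
  assumes "\<And>k. k \<in> K \<Longrightarrow> \<eta> k \<in> test_functions UNIV" "\<And>k. k \<in> K \<Longrightarrow> V k \<in> L2 S"
  shows "integrable (lebesgue_on S) (\<lambda>x. \<Sum>k\<in>K. \<eta> k x * (norm (V k x))\<^sup>2)"
    and "(\<lambda>x. \<Sum>k\<in>K. \<eta> k x *\<^sub>R V k x) \<in> L2 S"
proof -
  have L: "(\<lambda>x. \<eta> k x *\<^sub>R V k x) \<in> L2 S" if k: "k \<in> K" for k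
  proof -
    obtain B where B: "\<And>x. \<bar>\<eta> k x\<bar> \<le> B" by (rule test_functions_bounded[OF assms(1)[OF k]]) (rule that)
    show ?thesis
      by (rule L2_scaleR_bounded(1)[OF assms(2)[OF k] smooth_measurable(1)[OF test_functions_smooth[OF assms(1)[OF k]]] B])
  qed
  then show "(\<lambda>x. \<Sum>k\<in>K. \<eta> k x *\<^sub>R V k x) \<in> L2 S" by (rule L2_sum)
  show "integrable (lebesgue_on S) (\<lambda>x. \<Sum>k\<in>K. \<eta> k x * (norm (V k x))\<^sup>2)"
  proof (rule Bochner_Integration.integrable_sum)
    fix k assume k: "k \<in> K"
    show "integrable (lebesgue_on S) (\<lambda>x. \<eta> k x * (norm (V k x))\<^sup>2)"
      using L2_inner_integrable[OF L[OF k] assms(2)[OF k]] by (simp add: dot_square_norm)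
  qed
qed

section \<open>The homogenized flux and the corrector as L2 functions\<close>

context homogenization
begin

lemma b_hom_norm:
  assumes t: "t \<in> \<Omega>" shows "norm (b_hom a v t \<xi>) \<le> \<beta> * (\<beta> / \<alpha>) * norm \<xi>"
proof -
  have "(norm (b_hom a v t \<xi>))\<^sup>2 \<le> (L2_norm Y (sig \<xi> t))\<^sup>2"
    using norm_integral_power2_le[OF sig_L2[OF t, of \<xi>] Y_lmeasurable] by (simp add: Y_measure b_hom_eq[OF t] L2_norm_power2)
  then have "norm (b_hom a v t \<xi>) \<le> L2_norm Y (sig \<xi> t)" by (rule power2_le_imp_le) (rule L2_norm_nonneg)
  also have "\<dots> \<le> \<beta> * (\<beta> / \<alpha> * norm \<xi>)"
    using sig_le[OF t, of \<xi>] mult_left_mono[OF pc_energy(1)[OF t, of \<xi>], of \<beta>] \<beta>_pos by linarith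
  finally show ?thesis by (simp add: mult.assoc)
qed

lemma b_hom_continuous: "continuous_on (\<Omega> \<times> UNIV) (\<lambda>q. b_hom a v (fst q) (snd q))"
  unfolding continuous_on
proof
  fix q assume q: "q \<in> \<Omega> \<times> (UNIV :: (real^'n) set)"
  let ?F = "at q within \<Omega> \<times> (UNIV :: (real^'n) set)"
  let ?h = "\<lambda>s. sqrt (C2 * ((norm (snd s - snd q))\<^sup>2 + \<omega> (norm (fst s - fst q)) * (norm (snd q))\<^sup>2))"
  have "((\<lambda>s. b_hom a v (fst s) (snd s) - b_hom a v (fst q) (snd q)) \<longlongrightarrow> 0) ?F"
  proof (rule Lim_null_comparison)
    have "norm (b_hom a v (fst s) (snd s) - b_hom a v (fst q) (snd q)) \<le> ?h s" if "s \<in> \<Omega> \<times> UNIV" for s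
      using that q pc_lipschitz(2)[of "fst q" "fst s" "snd q" "snd s"]
      by (intro real_le_rsqrt) (auto simp: norm_minus_commute)
    then show "\<forall>\<^sub>F s in ?F. norm (b_hom a v (fst s) (snd s) - b_hom a v (fst q) (snd q)) \<le> ?h s"
      by (auto simp: eventually_at_filter)
    have id: "((\<lambda>s. s) \<longlongrightarrow> q) ?F" by (rule tendsto_ident_at)
    have "((\<lambda>s. fst s - fst q) \<longlongrightarrow> fst q - fst q) ?F" "((\<lambda>s. snd s - snd q) \<longlongrightarrow> snd q - snd q) ?F"
      by (intro tendsto_diff tendsto_fst tendsto_snd id tendsto_const)+
    then have d: "((\<lambda>s. fst s - fst q) \<longlongrightarrow> 0) ?F" "((\<lambda>s. snd s - snd q) \<longlongrightarrow> 0) ?F" by simp_all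
    have "(?h \<longlongrightarrow> sqrt (C2 * ((norm (0 :: real^'n))\<^sup>2 + 0 * (norm (snd q))\<^sup>2))) ?F"
      by (intro tendsto_intros \<omega>_tendsto d)
    then show "(?h \<longlongrightarrow> 0) ?F" by simp
  qed
  then show "((\<lambda>s. b_hom a v (fst s) (snd s)) \<longlongrightarrow> b_hom a v (fst q) (snd q)) ?F" by (simp add: Lim_null[symmetric])
qed

lemma b_hom_L2:
  assumes g: "g \<in> L2 \<Omega>" shows "(\<lambda>x. b_hom a v x (g x)) \<in> L2 \<Omega>"
proof (rule L2_bound[OF _ g])
  have "(\<lambda>x. (\<lambda>q x. b_hom a v (fst q) (snd q)) (x, g x) x) \<in> borel_measurable (lebesgue_on \<Omega>)"
  proof (rule caratheodory_measurable[OF \<Omega>_sets, where P = "\<Omega> \<times> UNIV"])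
    have "(\<lambda>x. x) \<in> borel_measurable (lebesgue_on \<Omega>)"
      by (rule continuous_imp_measurable_on_sets_lebesgue[OF continuous_on_id \<Omega>_sets])
    then show "(\<lambda>x. (x, g x)) \<in> borel_measurable (lebesgue_on \<Omega>)" using L2_measurable[OF g] by (rule borel_measurable_Pair)
  qed (use b_hom_continuous in auto)
  then show "(\<lambda>x. b_hom a v x (g x)) \<in> borel_measurable (lebesgue_on \<Omega>)" by simp
  show "AE x in lebesgue_on \<Omega>. norm (b_hom a v x (g x)) \<le> \<beta> * (\<beta> / \<alpha>) * norm (g x)"
    using AE_in_lebesgue_on[OF \<Omega>_sets] by eventually_elim (rule b_hom_norm)
qed

lemma inner_cells_subset: "j \<in> inner_cells \<Omega> \<epsilon> \<Longrightarrow> cell \<epsilon> j \<subseteq> \<Omega>"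
  using closure_subset by (fastforce simp: inner_cells_def)

lemma inner_cells_finite:
  assumes "\<epsilon> > 0" shows "finite (inner_cells \<Omega> \<epsilon>)"
proof -
  obtain R where "\<Omega> \<subseteq> cball 0 R" using \<Omega>(2) by (meson bounded_subset_ballD ball_subset_cball order_trans)
  then have "inner_cells \<Omega> \<epsilon> \<subseteq> hit R \<epsilon>"
    using inner_cells_subset[of _ \<epsilon>] cell_nonempty[OF assms] unfolding hit_def by blast
  then show ?thesis using finite_hit[OF assms] by (rule finite_subset)
qed

lemma scaled_L2:
  fixes f :: "real^'n \<Rightarrow> 'b::euclidean_space"
  assumes "ae_periodic f" "f \<in> L2 Y" "\<epsilon> > 0" shows "(\<lambda>x. f (x /\<^sub>R \<epsilon>)) \<in> L2 \<Omega>"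
proof -
  obtain R where "\<Omega> \<subseteq> cball 0 R" using \<Omega>(2) by (meson bounded_subset_ballD ball_subset_cball order_trans)
  then show ?thesis by (rule periodic_L2_bounded(1)[OF assms \<Omega>_sets])
qed

lemma corrector_cell:
  assumes e: "\<epsilon> > 0" and j: "j \<in> inner_cells \<Omega> \<epsilon>" and x: "x \<in> cell \<epsilon> j"
  shows "corrector \<Omega> \<epsilon> v p g x = pc (cell_mean \<epsilon> g j) (p j) (x /\<^sub>R \<epsilon>)"
proof -
  have i: "indicat_real (cell \<epsilon> k) x = (if k = j then 1 else 0)" for k
    using cell_unique[OF e _ x, of k] x by (cases "x \<in> cell \<epsilon> k") auto
  have "(\<Sum>k\<in>inner_cells \<Omega> \<epsilon>. indicat_real (cell \<epsilon> k) x *\<^sub>R c k) = c j" for c :: "int^'n \<Rightarrow> real^'n"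
  proof -
    have "(\<Sum>k\<in>inner_cells \<Omega> \<epsilon>. indicat_real (cell \<epsilon> k) x *\<^sub>R c k) = (\<Sum>k\<in>inner_cells \<Omega> \<epsilon>. if k = j then c k else 0)"
      by (intro sum.cong) (auto simp: i)
    then show ?thesis using j inner_cells_finite[OF e] by simp
  qed
  then have "M_avg \<Omega> \<epsilon> g x = cell_mean \<epsilon> g j" "gamma_step \<Omega> \<epsilon> p x = p j"
    unfolding M_avg_def gamma_step_def by simp_all
  moreover have "x \<in> (\<Union>j\<in>inner_cells \<Omega> \<epsilon>. cell \<epsilon> j)" using j x by blast
  ultimately show ?thesis unfolding corrector_def by (simp only: if_True P_corr_eq)
qed

lemma corrector_off: "x \<notin> (\<Union>j\<in>inner_cells \<Omega> \<epsilon>. cell \<epsilon> j) \<Longrightarrow> corrector \<Omega> \<epsilon> v p g x = 0"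
  unfolding corrector_def by (simp only: if_False)

text \<open>Jensen on one cell. With \<xi> = 0 it bounds the average by g; with a frozen vector it
  measures how far the average is from that vector.\<close>

lemma cell_mean_deviation:
  fixes g :: "real^'n \<Rightarrow> real^'n"
  assumes e: "\<epsilon> > 0" and g: "g \<in> L2 (cell \<epsilon> j)"
  shows "\<epsilon> ^ CARD('n) * (norm (\<xi> - cell_mean \<epsilon> g j))\<^sup>2 \<le> sqn (cell \<epsilon> j) (\<lambda>x. \<xi> - g x)"
proof -
  let ?m = "\<epsilon> ^ CARD('n)"
  have m: "?m > 0" using e by simp
  have c: "(\<lambda>x. \<xi>) \<in> L2 (cell \<epsilon> j)" by (rule L2_const[OF cell_lmeasurable[OF e]])
  have dL: "(\<lambda>x. \<xi> - g x) \<in> L2 (cell \<epsilon> j)" by (rule L2_diff[OF c g])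
  have "(LINT x|lebesgue_on (cell \<epsilon> j). \<xi> - g x) = ?m *\<^sub>R \<xi> - (LINT x|lebesgue_on (cell \<epsilon> j). g x)"
    using L2_imp_integrable[OF c cell_lmeasurable[OF e]] L2_imp_integrable[OF g cell_lmeasurable[OF e]]
    by (simp add: measure_restrict_space cell_sets[OF e] cell_measure[OF e])
  also have "\<dots> = ?m *\<^sub>R (\<xi> - cell_mean \<epsilon> g j)" using e by (simp add: cell_mean_def cell_measure[OF e] scaleR_diff_right)
  finally have "(norm (?m *\<^sub>R (\<xi> - cell_mean \<epsilon> g j)))\<^sup>2 \<le> ?m * sqn (cell \<epsilon> j) (\<lambda>x. \<xi> - g x)"
    using norm_integral_power2_le[OF dL cell_lmeasurable[OF e]] by (simp add: cell_measure[OF e])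
  then have "?m * (?m * (norm (\<xi> - cell_mean \<epsilon> g j))\<^sup>2) \<le> ?m * sqn (cell \<epsilon> j) (\<lambda>x. \<xi> - g x)"
    using m by (simp add: power_mult_distrib power2_eq_square mult_ac)
  then show ?thesis using m by (simp only: mult_le_cancel_left_pos)
qed

text \<open>Cell by cell, the energy bound for the cell field meets Jensen for the average. The
  resulting constant is independent of \<epsilon> and of the points p, which keeps the modulus term
  in the flux comparison small.\<close>

lemma
  assumes e: "\<epsilon> > 0" and p: "\<And>j. j \<in> inner_cells \<Omega> \<epsilon> \<Longrightarrow> p j \<in> cell \<epsilon> j" and g: "g \<in> L2 \<Omega>"
  shows corrector_L2: "corrector \<Omega> \<epsilon> v p g \<in> L2 \<Omega>"
    and corrector_sqn: "sqn \<Omega> (corrector \<Omega> \<epsilon> v p g) \<le> C0 * sqn \<Omega> g"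
proof -
  let ?J = "inner_cells \<Omega> \<epsilon>" and ?q = "corrector \<Omega> \<epsilon> v p g"
  define A where "A = (\<Union>j\<in>?J. cell \<epsilon> j)"
  have J: "finite ?J" by (rule inner_cells_finite[OF e])
  have sub: "cell \<epsilon> j \<subseteq> \<Omega>" if "j \<in> ?J" for j by (rule inner_cells_subset[OF that])
  have pO: "p j \<in> \<Omega>" if "j \<in> ?J" for j using sub[OF that] p[OF that] by blast
  have A: "A \<in> sets lebesgue" "A \<subseteq> \<Omega>" unfolding A_def using J cell_sets[OF e] sub by (auto intro!: sets.finite_UN)
  note cs = cell_sets[OF e]
  have gc: "g \<in> L2 (cell \<epsilon> j)" if "j \<in> ?J" for j by (rule L2_subset[OF g sub[OF that] cs \<Omega>_sets])
  have qc: "?q \<in> L2 (cell \<epsilon> j)" "sqn (cell \<epsilon> j) ?q \<le> C0 * sqn (cell \<epsilon> j) g" if j: "j \<in> ?J" for j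
  proof -
    let ?p = "pc (cell_mean \<epsilon> g j) (p j)"
    note per = pc_periodic[OF pO[OF j], of "cell_mean \<epsilon> g j"] and L = pc_L2[OF pO[OF j], of "cell_mean \<epsilon> g j"]
    have L': "(\<lambda>x. ?p (x /\<^sub>R \<epsilon>)) \<in> L2 (cell \<epsilon> j)" by (rule L2_cell[OF per e L])
    then show "?q \<in> L2 (cell \<epsilon> j)" by (rule L2_cong) (rule corrector_cell[OF e j, symmetric])
    have "sqn (cell \<epsilon> j) ?q = sqn (cell \<epsilon> j) (\<lambda>x. ?p (x /\<^sub>R \<epsilon>))"
      by (intro Bochner_Integration.integral_cong refl) (simp add: corrector_cell[OF e j])
    also have "\<dots> = \<epsilon> ^ CARD('n) * sqn Y ?p" by (rule sqn_cell[OF per e L])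
    also have "\<dots> \<le> \<epsilon> ^ CARD('n) * (C0 * (norm (cell_mean \<epsilon> g j))\<^sup>2)"
      using e by (intro mult_left_mono pc_energy(2) pO j) auto
    also have "\<dots> = C0 * (\<epsilon> ^ CARD('n) * (norm (0 - cell_mean \<epsilon> g j))\<^sup>2)" by simp
    also have "\<dots> \<le> C0 * sqn (cell \<epsilon> j) (\<lambda>x. 0 - g x)"
      using C0_ge by (intro mult_left_mono cell_mean_deviation e gc j) auto
    finally show "sqn (cell \<epsilon> j) ?q \<le> C0 * sqn (cell \<epsilon> j) g" by simp
  qed
  have "?q \<in> L2 A" "sqn A ?q = (\<Sum>j\<in>?J. sqn (cell \<epsilon> j) ?q)"
  proof -
    have ind: "(\<lambda>x. indicat_real (cell \<epsilon> j) x *\<^sub>R ?q x) \<in> L2 A" if j: "j \<in> ?J" for j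
    proof (rule L2_extend(1)[OF _ _ cs A(1)])
      show "(\<lambda>x. indicat_real (cell \<epsilon> j) x *\<^sub>R ?q x) \<in> L2 (cell \<epsilon> j)" by (rule L2_cong[OF qc(1)[OF j]]) simp
      show "cell \<epsilon> j \<subseteq> A" using j by (auto simp: A_def)
    qed simp
    have "(\<lambda>x. \<Sum>j\<in>?J. indicat_real (cell \<epsilon> j) x *\<^sub>R ?q x) \<in> L2 A" by (rule L2_sum[OF ind])
    then show "?q \<in> L2 A"
    proof (rule L2_cong)
      fix x assume "x \<in> A"
      then obtain j where j: "j \<in> ?J" "x \<in> cell \<epsilon> j" by (auto simp: A_def)
      have i: "indicat_real (cell \<epsilon> k) x = (if k = j then 1 else 0)" for k
        using cell_unique[OF e _ j(2), of k] j(2) by (cases "x \<in> cell \<epsilon> k") auto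
      have "(\<Sum>k\<in>?J. indicat_real (cell \<epsilon> k) x *\<^sub>R ?q x) = (\<Sum>k\<in>?J. if k = j then ?q x else 0)"
        by (intro sum.cong) (auto simp: i)
      then show "(\<Sum>k\<in>?J. indicat_real (cell \<epsilon> k) x *\<^sub>R ?q x) = ?q x" using j J by simp
    qed
    show "sqn A ?q = (\<Sum>j\<in>?J. sqn (cell \<epsilon> j) ?q)"
      unfolding A_def by (rule integral_cells(2)[OF e J]) (rule L2_integrable_sq[OF qc(1)])
  qed
  note qA = this
  have off: "?q x = 0" if "x \<notin> A" for x using that unfolding A_def by (rule corrector_off)
  show "?q \<in> L2 \<Omega>" by (rule L2_extend(1)[OF qA(1) A(2,1) \<Omega>_sets off])
  have "sqn \<Omega> ?q = sqn A ?q" by (rule L2_extend(2)[OF qA(1) A(2,1) \<Omega>_sets off])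
  also have "\<dots> \<le> (\<Sum>j\<in>?J. C0 * sqn (cell \<epsilon> j) g)" unfolding qA(2) by (intro sum_mono qc(2))
  also have "\<dots> = C0 * (\<Sum>j\<in>?J. sqn (cell \<epsilon> j) g)" by (simp add: sum_distrib_left)
  also have "(\<Sum>j\<in>?J. sqn (cell \<epsilon> j) g) = sqn A g"
    unfolding A_def by (rule integral_cells(2)[OF e J, symmetric]) (rule L2_integrable_sq[OF gc])
  also have "C0 * sqn A g \<le> C0 * sqn \<Omega> g" using C0_ge by (intro mult_left_mono sqn_subset_le g A \<Omega>_sets) auto
  finally show "sqn \<Omega> ?q \<le> C0 * sqn \<Omega> g" .
qed

end

text \<open>
  Where $\xi_k = 0$ the cell field vanishes. Hence only the remaining indices contribute to $w$, and
  only for these must $z_k$ be close to the support of $\eta_k$ and the support lie inside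
  \<open>\<Omega>\<close>; near the boundary $D\psi = 0$ and neither could be achieved.
\<close>

locale homogenization_partition = homogenization \<Omega> a \<alpha> \<beta> \<omega> v
  for \<Omega> :: "(real^'n) set" and a :: "real^'n \<Rightarrow> real^'n \<Rightarrow> real^'n \<Rightarrow> real^'n" and \<alpha> \<beta> :: real
    and \<omega> :: "real \<Rightarrow> real" and v :: "real^'n \<Rightarrow> real^'n \<Rightarrow> real^'n \<Rightarrow> real" +
  fixes \<psi> :: "real^'n \<Rightarrow> real" and K :: "(int^'n) set" and \<eta> :: "int^'n \<Rightarrow> real^'n \<Rightarrow> real"
    and z \<xi> :: "int^'n \<Rightarrow> real^'n" and L \<tau> B :: real
  assumes \<psi>: "\<psi> \<in> test_functions \<Omega>" and \<tau>: "0 < \<tau>" and B: "0 \<le> B"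
    and K: "finite K" and \<eta>: "\<And>k. \<eta> k \<in> test_functions UNIV" and \<eta>_nonneg: "\<And>k x. 0 \<le> \<eta> k x"
    and \<eta>_sum: "\<And>x. x \<in> \<Omega> \<Longrightarrow> (\<Sum>k\<in>K. \<eta> k x) = 1"
    and z: "\<And>k. z k \<in> \<Omega>" and \<xi>: "\<And>k. norm (\<xi> k) \<le> L"
    and near_\<xi>: "\<And>k x. x \<in> \<Omega> \<Longrightarrow> \<eta> k x \<noteq> 0 \<Longrightarrow> norm (grad \<psi> x - \<xi> k) \<le> \<tau>"
    and near_z: "\<And>k x. x \<in> \<Omega> \<Longrightarrow> \<eta> k x \<noteq> 0 \<Longrightarrow> \<xi> k \<noteq> 0 \<Longrightarrow> norm (x - z k) \<le> \<tau>"
    and \<eta>_inside: "\<And>k. \<xi> k \<noteq> 0 \<Longrightarrow> \<eta> k \<in> test_functions \<Omega>"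
    and \<eta>_lipschitz: "\<And>k x y. k \<in> K \<Longrightarrow> \<bar>\<eta> k x - \<eta> k y\<bar> \<le> B * norm (x - y)"
    and \<psi>_lipschitz: "\<And>x y. norm (grad \<psi> x - grad \<psi> y) \<le> B * norm (x - y)"
begin

definition "Pk \<epsilon> k x = pc (\<xi> k) (z k) (x /\<^sub>R \<epsilon>)"

lemma Pk_L2: "\<epsilon> > 0 \<Longrightarrow> Pk \<epsilon> k \<in> L2 \<Omega>"
  unfolding Pk_def[abs_def] by (rule scaled_L2[OF pc_periodic[OF z] pc_L2[OF z]])

lemma inside_margin:
  obtains d where "d > 0" "\<And>k x. k \<in> K \<Longrightarrow> \<xi> k \<noteq> 0 \<Longrightarrow> \<eta> k x \<noteq> 0 \<Longrightarrow> cball x d \<subseteq> \<Omega>"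
proof -
  have "\<exists>Q. compact Q \<and> Q \<subseteq> \<Omega> \<and> (\<xi> k \<noteq> 0 \<longrightarrow> (\<forall>x. x \<notin> Q \<longrightarrow> \<eta> k x = 0))" for k
  proof (cases "\<xi> k = 0")
    case False
    obtain Q where "compact Q" "Q \<subseteq> \<Omega>" "\<And>x. x \<notin> Q \<Longrightarrow> \<eta> k x = 0"
      by (rule test_functionsE[OF \<eta>_inside[OF False]]) (rule that)
    then show ?thesis by blast
  qed (rule exI[of _ "{}"], simp)
  then obtain Q where Q: "\<And>k. compact (Q k)" "\<And>k. Q k \<subseteq> \<Omega>" "\<And>k x. \<xi> k \<noteq> 0 \<Longrightarrow> x \<notin> Q k \<Longrightarrow> \<eta> k x = 0"
    by metis
  have c: "compact (\<Union>k\<in>K. Q k)" "(\<Union>k\<in>K. Q k) \<subseteq> \<Omega>" using K Q(1,2) by (auto intro!: compact_UN)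
  obtain d where d: "d > 0" "(\<Union>x\<in>(\<Union>k\<in>K. Q k). cball x d) \<subseteq> \<Omega>"
    by (rule compact_subset_open_imp_cball_epsilon_subset[OF c(1) \<Omega>(1) c(2)]) (rule that)
  show ?thesis
  proof (rule that[OF d(1)])
    fix k x assume "k \<in> K" "\<xi> k \<noteq> 0" "\<eta> k x \<noteq> 0"
    then have "x \<in> (\<Union>k\<in>K. Q k)" using Q(3) by blast
    with d(2) show "cball x d \<subseteq> \<Omega>" by (meson UN_subset_iff)
  qed
qed

text \<open>On one cell the corrector is a single cell field, with the average of g and the point p
  as parameters, so each frozen field is compared with it by \<open>pc_lipschitz\<close>. The
  weights are frozen at p as well: they sum to 1 there, and their oscillation over the cell, summed
  over K, is at most 1. This produces the factor 2.\<close>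

lemma cell_error:
  assumes e: "\<epsilon> > 0" and j: "j \<in> inner_cells \<Omega> \<epsilon>" and p: "p j \<in> cell \<epsilon> j" and g: "g \<in> L2 \<Omega>"
    and small: "real CARD('n) * \<epsilon> \<le> \<tau>" "B * (real CARD('n) * \<epsilon>) \<le> \<tau>" "real (card K) * (B * (real CARD('n) * \<epsilon>)) \<le> 1"
  shows "(LINT x|lebesgue_on (cell \<epsilon> j). (\<Sum>k\<in>K. \<eta> k x * (norm (Pk \<epsilon> k x - corrector \<Omega> \<epsilon> v p g x))\<^sup>2))
    \<le> (LINT x|lebesgue_on (cell \<epsilon> j). 2 * C1 * (8 * \<tau>\<^sup>2 + \<omega> (2 * \<tau>) * L\<^sup>2 + 2 * (norm (grad \<psi> x - g x))\<^sup>2))"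
proof -
  let ?q = "corrector \<Omega> \<epsilon> v p g" and ?C = "cell \<epsilon> j"
  define m where "m = \<epsilon> ^ CARD('n)"
  define c where "c = cell_mean \<epsilon> g j"
  define \<delta> where "\<delta> = real CARD('n) * \<epsilon>"
  define A where "A = sqn ?C (\<lambda>x. grad \<psi> x - g x)"
  define W where "W = 8 * \<tau>\<^sup>2 + \<omega> (2 * \<tau>) * L\<^sup>2"
  have m: "m > 0" using e by (simp add: m_def)
  have sub: "?C \<subseteq> \<Omega>" by (rule inner_cells_subset[OF j])
  have pO: "p j \<in> \<Omega>" using sub p by blast
  note cs = cell_sets[OF e, of j] and cl = cell_lmeasurable[OF e, of j]
  have gL: "g \<in> L2 ?C" by (rule L2_subset[OF g sub cs \<Omega>_sets])
  have \<psi>L: "grad \<psi> \<in> L2 ?C" by (rule test_functions_L2(2)[OF \<psi> cs])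
  have qL: "?q \<in> L2 ?C"
    by (rule L2_cong[OF L2_cell[OF pc_periodic[OF pO] e pc_L2[OF pO], of c]]) (simp add: corrector_cell[OF e j] c_def)
  have PL: "Pk \<epsilon> k \<in> L2 ?C" for k by (rule L2_subset[OF Pk_L2[OF e] sub cs \<Omega>_sets])
  have dL: "(\<lambda>x. Pk \<epsilon> k x - ?q x) \<in> L2 ?C" for k by (rule L2_diff[OF PL qL])
  have A0: "0 \<le> A" unfolding A_def by (rule sqn_nonneg)
  have W0: "0 \<le> W" unfolding W_def using \<omega>_nonneg[of "2 * \<tau>"] \<tau> by simp
  have int: "integrable (lebesgue_on ?C) (\<lambda>x. \<eta> k x * (norm (Pk \<epsilon> k x - ?q x))\<^sup>2)" for k
    using sum_weighted_integrable(1)[of "{k}" \<eta> "\<lambda>k x. Pk \<epsilon> k x - ?q x" ?C] \<eta> dL by simp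
  have one: "(LINT x|lebesgue_on ?C. \<eta> k x * (norm (Pk \<epsilon> k x - ?q x))\<^sup>2) \<le> (\<eta> k (p j) + B * \<delta>) * (C1 * (m * W + 2 * A))"
    (is "?lhs \<le> _") if k: "k \<in> K" for k
  proof (cases "\<forall>x\<in>?C. \<eta> k x = 0")
    case True
    then have "?lhs = (LINT x|lebesgue_on ?C. 0)" by (intro Bochner_Integration.integral_cong refl) simp
    then show ?thesis using \<eta>_nonneg B e m W0 A0 C1_nonneg by (simp add: \<delta>_def)
  next
    case False
    then obtain x0 where x0: "x0 \<in> ?C" "\<eta> k x0 \<noteq> 0" by blast
    have x0O: "x0 \<in> \<Omega>" using x0(1) sub by blast
    have d2: "norm (\<xi> k - grad \<psi> x) \<le> 2 * \<tau>" if x: "x \<in> ?C" for x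
    proof -
      have "norm (grad \<psi> x0 - grad \<psi> x) \<le> B * norm (x0 - x)" by (rule \<psi>_lipschitz)
      also have "\<dots> \<le> B * \<delta>" unfolding \<delta>_def by (intro mult_left_mono B cell_dist(1)[OF e x0(1) x])
      also have "\<dots> \<le> \<tau>" using small(2) by (simp add: \<delta>_def)
      finally show ?thesis
        using near_\<xi>[OF x0O x0(2)] norm_triangle_ineq[of "\<xi> k - grad \<psi> x0" "grad \<psi> x0 - grad \<psi> x"] by (simp add: norm_minus_commute)
    qed
    have c\<xi>: "(\<lambda>x :: real^'n. \<xi> k) \<in> L2 ?C" by (rule L2_const[OF cl])
    have "m * (norm (\<xi> k - c))\<^sup>2 \<le> sqn ?C (\<lambda>x. \<xi> k - g x)" unfolding m_def c_def by (rule cell_mean_deviation[OF e gL])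
    also have "\<dots> = sqn ?C (\<lambda>x. (\<xi> k - grad \<psi> x) + (grad \<psi> x - g x))" by simp
    also have "\<dots> \<le> 2 * sqn ?C (\<lambda>x. \<xi> k - grad \<psi> x) + 2 * A" unfolding A_def by (intro sqn_add_le L2_diff c\<xi> \<psi>L gL)
    also have "sqn ?C (\<lambda>x. \<xi> k - grad \<psi> x) \<le> (2 * \<tau>)\<^sup>2 * measure lebesgue ?C"
      by (rule L2_bounded(2)[OF L2_measurable[OF L2_diff[OF c\<xi> \<psi>L]] cl d2])
    also have "(2 * \<tau>)\<^sup>2 * measure lebesgue ?C = 4 * \<tau>\<^sup>2 * m" by (simp add: cell_measure[OF e] m_def)
    finally have X: "m * (norm (\<xi> k - c))\<^sup>2 \<le> 8 * \<tau>\<^sup>2 * m + 2 * A" by simp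
    \<comment> \<open>If the vector is 0, then z_k may be far away but the term vanishes. Otherwise
      z_k and the point p both lie within \<tau> of x0.\<close>
    have w: "\<omega> (norm (z k - p j)) * (norm (\<xi> k))\<^sup>2 \<le> \<omega> (2 * \<tau>) * L\<^sup>2"
    proof (cases "\<xi> k = 0")
      case True then show ?thesis using \<omega>_nonneg[of "2 * \<tau>"] \<tau> by simp
    next
      case False
      have "norm (z k - p j) \<le> norm (x0 - z k) + norm (x0 - p j)"
        using norm_triangle_ineq4[of "x0 - p j" "x0 - z k"] by simp
      also have "\<dots> \<le> \<tau> + \<tau>" using near_z[OF x0O x0(2) False] cell_dist(1)[OF e x0(1) p] small(1) by linarith
      finally have "\<omega> (norm (z k - p j)) \<le> \<omega> (2 * \<tau>)" by (intro monoD[OF \<omega>(2)]) simp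
      then show ?thesis using \<xi>[of k] \<omega>_nonneg[of "2 * \<tau>"] \<tau> by (intro mult_mono power_mono) auto
    qed
    let ?P = "\<lambda>y. pc (\<xi> k) (z k) y - pc c (p j) y"
    have "sqn ?C (\<lambda>x. Pk \<epsilon> k x - ?q x) = sqn ?C (\<lambda>x. ?P (x /\<^sub>R \<epsilon>))"
      by (intro Bochner_Integration.integral_cong refl) (simp add: corrector_cell[OF e j] Pk_def c_def)
    also have "\<dots> = m * sqn Y ?P"
      unfolding m_def by (intro sqn_cell ae_periodic_diff pc_periodic L2_diff pc_L2 z pO e)
    also have "\<dots> \<le> m * (C1 * ((norm (\<xi> k - c))\<^sup>2 + \<omega> (norm (z k - p j)) * (norm (\<xi> k))\<^sup>2))"
      using m by (intro mult_left_mono pc_lipschitz(1) z pO) auto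
    also have "\<dots> \<le> m * (C1 * ((norm (\<xi> k - c))\<^sup>2 + \<omega> (2 * \<tau>) * L\<^sup>2))"
      using m w by (intro mult_left_mono C1_nonneg add_left_mono) auto
    also have "\<dots> = C1 * (m * (norm (\<xi> k - c))\<^sup>2 + m * (\<omega> (2 * \<tau>) * L\<^sup>2))" by (simp add: algebra_simps)
    also have "\<dots> \<le> C1 * ((8 * \<tau>\<^sup>2 * m + 2 * A) + m * (\<omega> (2 * \<tau>) * L\<^sup>2))"
      by (intro mult_left_mono C1_nonneg add_right_mono X)
    also have "\<dots> = C1 * (m * W + 2 * A)" by (simp add: W_def algebra_simps)
    finally have S: "sqn ?C (\<lambda>x. Pk \<epsilon> k x - ?q x) \<le> C1 * (m * W + 2 * A)" .
    have "?lhs \<le> (LINT x|lebesgue_on ?C. (\<eta> k (p j) + B * \<delta>) * (norm (Pk \<epsilon> k x - ?q x))\<^sup>2)"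
    proof (rule integral_mono)
      show "integrable (lebesgue_on ?C) (\<lambda>x. \<eta> k x * (norm (Pk \<epsilon> k x - ?q x))\<^sup>2)" by (rule int)
      show "integrable (lebesgue_on ?C) (\<lambda>x. (\<eta> k (p j) + B * \<delta>) * (norm (Pk \<epsilon> k x - ?q x))\<^sup>2)"
        using L2_integrable_sq[OF dL] by simp
      fix x assume "x \<in> space (lebesgue_on ?C)"
      then have x: "x \<in> ?C" by simp
      have "\<eta> k x - \<eta> k (p j) \<le> B * norm (x - p j)" using \<eta>_lipschitz[OF k, of x "p j"] by linarith
      also have "\<dots> \<le> B * \<delta>" unfolding \<delta>_def by (intro mult_left_mono B cell_dist(1)[OF e x p])
      finally show "\<eta> k x * (norm (Pk \<epsilon> k x - ?q x))\<^sup>2 \<le> (\<eta> k (p j) + B * \<delta>) * (norm (Pk \<epsilon> k x - ?q x))\<^sup>2"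
        by (intro mult_right_mono) auto
    qed
    also have "\<dots> = (\<eta> k (p j) + B * \<delta>) * sqn ?C (\<lambda>x. Pk \<epsilon> k x - ?q x)" by simp
    also have "\<dots> \<le> (\<eta> k (p j) + B * \<delta>) * (C1 * (m * W + 2 * A))"
      using \<eta>_nonneg[of k "p j"] B e by (intro mult_left_mono S) (auto simp: \<delta>_def)
    finally show ?thesis .
  qed
  have "(LINT x|lebesgue_on ?C. (\<Sum>k\<in>K. \<eta> k x * (norm (Pk \<epsilon> k x - ?q x))\<^sup>2))
      = (\<Sum>k\<in>K. (LINT x|lebesgue_on ?C. \<eta> k x * (norm (Pk \<epsilon> k x - ?q x))\<^sup>2))"
    by (rule Bochner_Integration.integral_sum) (rule int)
  also have "\<dots> \<le> (\<Sum>k\<in>K. (\<eta> k (p j) + B * \<delta>) * (C1 * (m * W + 2 * A)))" by (intro sum_mono one)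
  also have "\<dots> = (1 + real (card K) * (B * \<delta>)) * (C1 * (m * W + 2 * A))"
    by (simp add: sum_distrib_right[symmetric] sum.distrib \<eta>_sum[OF pO])
  also have "\<dots> \<le> 2 * (C1 * (m * W + 2 * A))"
    using small(3) C1_nonneg m W0 A0 by (intro mult_right_mono) (auto simp: \<delta>_def)
  also have "\<dots> = (LINT x|lebesgue_on ?C. 2 * C1 * (W + 2 * (norm (grad \<psi> x - g x))\<^sup>2))"
  proof -
    have i: "integrable (lebesgue_on ?C) (\<lambda>x. 2 * (norm (grad \<psi> x - g x))\<^sup>2)" using L2_integrable_sq[OF L2_diff[OF \<psi>L gL]] by simp
    have i2: "integrable (lebesgue_on ?C) (\<lambda>x. W)" using L2_imp_integrable[OF L2_const[OF cl] cl, of W] .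
    have "(LINT x|lebesgue_on ?C. 2 * C1 * (W + 2 * (norm (grad \<psi> x - g x))\<^sup>2)) = 2 * C1 * ((LINT x|lebesgue_on ?C. W) + 2 * A)"
      using i i2 by (simp add: A_def)
    also have "(LINT x|lebesgue_on ?C. W) = m * W" by (simp add: measure_restrict_space cs cell_measure[OF e] m_def)
    finally show ?thesis by (simp only: mult.assoc)
  qed
  finally show ?thesis by (simp add: W_def)
qed

text \<open>The estimate is summed over the inner cells. The bound involves \<epsilon> no longer,
  and the constants of the partition only enter the threshold below which \<epsilon> must
  lie.\<close>

lemma corrector_error:
  assumes g: "g \<in> L2 \<Omega>"
  obtains \<epsilon>0 where "\<epsilon>0 > 0" "\<And>\<epsilon> p. 0 < \<epsilon> \<Longrightarrow> \<epsilon> < \<epsilon>0 \<Longrightarrow> \<forall>j\<in>inner_cells \<Omega> \<epsilon>. p j \<in> cell \<epsilon> j \<Longrightarrow>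
    (LINT x|lebesgue_on \<Omega>. (\<Sum>k\<in>K. \<eta> k x * (norm (Pk \<epsilon> k x - corrector \<Omega> \<epsilon> v p g x))\<^sup>2))
    \<le> 2 * C1 * ((8 * \<tau>\<^sup>2 + \<omega> (2 * \<tau>) * L\<^sup>2) * measure lebesgue \<Omega> + 2 * sqn \<Omega> (\<lambda>x. grad \<psi> x - g x))"
proof -
  obtain d where d: "d > 0" "\<And>k x. k \<in> K \<Longrightarrow> \<xi> k \<noteq> 0 \<Longrightarrow> \<eta> k x \<noteq> 0 \<Longrightarrow> cball x d \<subseteq> \<Omega>"
    by (rule inside_margin) (rule that)
  define s where "s = min (min \<tau> 1) d"
  \<comment> \<open>Expanding the product shows that \<epsilon> D < s bounds the cell diameter, its
    product with B and its product with B and the size of K, all by s.\<close>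
  define D where "D = real CARD('n) * ((1 + B) * (1 + real (card K)))"
  have s: "s > 0" "s \<le> \<tau>" "s \<le> 1" "s \<le> d" using \<tau> d(1) by (auto simp: s_def)
  have D: "D > 0" using B by (simp add: D_def)
  show ?thesis
  proof (rule that[of "s / D"])
    show "s / D > 0" using s D by simp
    fix \<epsilon> p assume e: "0 < \<epsilon>" "\<epsilon> < s / D" and pc: "\<forall>j\<in>inner_cells \<Omega> \<epsilon>. p j \<in> cell \<epsilon> j"
    have p: "\<And>j. j \<in> inner_cells \<Omega> \<epsilon> \<Longrightarrow> p j \<in> cell \<epsilon> j" using pc by blast
    let ?q = "corrector \<Omega> \<epsilon> v p g" and ?J = "inner_cells \<Omega> \<epsilon>"
    define \<delta> where "\<delta> = real CARD('n) * \<epsilon>"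
    have \<delta>: "\<delta> \<ge> 0" using e by (simp add: \<delta>_def)
    have eq: "\<delta> * ((1 + B) * (1 + real (card K))) = \<epsilon> * D" by (simp add: \<delta>_def D_def)
    have "\<epsilon> * D < s" using e(2) D by (simp add: pos_less_divide_eq)
    then have "\<delta> + \<delta> * B + \<delta> * real (card K) + \<delta> * (B * real (card K)) < s"
      unfolding eq[symmetric] by (simp add: algebra_simps)
    moreover have "0 \<le> \<delta> * B" "0 \<le> \<delta> * real (card K)" "0 \<le> \<delta> * (B * real (card K))" using \<delta> B by auto
    ultimately have "\<delta> \<le> s" "\<delta> * B \<le> s" "\<delta> * (B * real (card K)) \<le> s" using \<delta> by linarith+
    then have small: "\<delta> \<le> s" "B * \<delta> \<le> s" "real (card K) * (B * \<delta>) \<le> s" by (simp_all add: mult_ac)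
    define H where "H = (\<lambda>x. \<Sum>k\<in>K. \<eta> k x * (norm (Pk \<epsilon> k x - ?q x))\<^sup>2)"
    define M where "M = (\<lambda>x. 2 * C1 * (8 * \<tau>\<^sup>2 + \<omega> (2 * \<tau>) * L\<^sup>2 + 2 * (norm (grad \<psi> x - g x))\<^sup>2))"
    define A where "A = (\<Union>j\<in>?J. cell \<epsilon> j)"
    have J: "finite ?J" by (rule inner_cells_finite[OF e(1)])
    have A: "A \<in> sets lebesgue" "A \<subseteq> \<Omega>"
      unfolding A_def using J cell_sets[OF e(1)] inner_cells_subset by (auto intro!: sets.finite_UN)
    have qL: "?q \<in> L2 \<Omega>" by (rule corrector_L2[OF e(1) p g])
    have Hint: "integrable (lebesgue_on \<Omega>) H"
      unfolding H_def by (intro sum_weighted_integrable(1) \<eta> L2_diff Pk_L2 e qL)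
    have \<psi>L: "grad \<psi> \<in> L2 \<Omega>" by (rule test_functions_L2(2)[OF \<psi> \<Omega>_sets])
    have ci: "integrable (lebesgue_on \<Omega>) (\<lambda>x. w)" for w :: real by (rule L2_imp_integrable[OF L2_const[OF \<Omega>_lmeasurable] \<Omega>_lmeasurable])
    have dint: "integrable (lebesgue_on \<Omega>) (\<lambda>x. (norm (grad \<psi> x - g x))\<^sup>2)" by (rule L2_integrable_sq[OF L2_diff[OF \<psi>L g]])
    have Mint: "integrable (lebesgue_on \<Omega>) M" unfolding M_def using ci dint by simp
    have M0: "0 \<le> M x" for x unfolding M_def using C1_nonneg \<omega>_nonneg[of "2 * \<tau>"] \<tau> by simp
    have "AE x in lebesgue. k \<in> K \<longrightarrow> \<xi> k = 0 \<longrightarrow> Pk \<epsilon> k x = 0" for k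
    proof (cases "\<xi> k = 0")
      case True
      have "AE x in lebesgue. pc 0 (z k) (inverse \<epsilon> *\<^sub>R x + 0) = 0" using e by (intro AE_affine pc_zero z) simp
      then show ?thesis by eventually_elim (simp add: Pk_def True)
    qed simp
    then have "AE x in lebesgue. \<forall>k. k \<in> K \<longrightarrow> \<xi> k = 0 \<longrightarrow> Pk \<epsilon> k x = 0" unfolding AE_all_countable by blast
    \<comment> \<open>Off the inner cells the corrector is 0. A zero vector gives a zero field; for
      a nonzero vector the margin d would turn the cell of x into an inner one if the weight did not
      vanish at x.\<close>
    with AE_cells[OF e(1)] have zero: "AE x in lebesgue. x \<notin> A \<longrightarrow> H x = 0"
    proof eventually_elim
      case (elim x)
      show ?case
      proof
        assume x: "x \<notin> A"
        obtain j where j: "x \<in> cell \<epsilon> j" using elim(1) by blast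
        then have jJ: "j \<notin> ?J" using x by (auto simp: A_def)
        have q0: "?q x = 0" using x unfolding A_def by (rule corrector_off)
        have "\<eta> k x * (norm (Pk \<epsilon> k x - ?q x))\<^sup>2 = 0" if k: "k \<in> K" for k
        proof (cases "\<xi> k = 0")
          case True then show ?thesis using elim(2) k q0 by simp
        next
          case False
          have "\<eta> k x = 0"
          proof (rule ccontr)
            assume "\<eta> k x \<noteq> 0"
            then have *: "cball x d \<subseteq> \<Omega>" by (rule d(2)[OF k False])
            have "closure (cell \<epsilon> j) \<subseteq> \<Omega>"
            proof
              fix y assume "y \<in> closure (cell \<epsilon> j)"
              then have "dist y x \<le> \<delta>" unfolding \<delta>_def by (rule closure_cell_dist[OF e(1) _ j])
              then have "y \<in> cball x d" using small(1) s(4) by (simp add: dist_commute)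
              with * show "y \<in> \<Omega>" by blast
            qed
            with jJ show False by (simp add: inner_cells_def)
          qed
          then show ?thesis by simp
        qed
        then show "H x = 0" unfolding H_def by (intro sum.neutral) blast
      qed
    qed
    define H' where "H' = (\<lambda>x. if x \<in> A then H x else 0)"
    have ae: "AE x in lebesgue_on \<Omega>. H x = H' x"
      using AE_lebesgue_onI[OF \<Omega>_sets zero] by eventually_elim (simp add: H'_def)
    have sub: "cell \<epsilon> j \<subseteq> \<Omega>" if "j \<in> ?J" for j by (rule inner_cells_subset[OF that])
    have "(LINT x|lebesgue_on \<Omega>. H x) = (LINT x|lebesgue_on \<Omega>. H' x)"
      using borel_measurable_integrable[OF Hint] borel_measurable_lebesgue_on_AE[OF borel_measurable_integrable[OF Hint] \<Omega>_sets ae] ae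
      by (rule integral_cong_AE)
    also have "\<dots> = (LINT x|lebesgue_on A. H' x)"
      by (rule integral_lebesgue_on_support(1)[OF A(2,1) \<Omega>_sets, symmetric]) (simp add: H'_def)
    also have "\<dots> = (LINT x|lebesgue_on A. H x)"
      by (intro Bochner_Integration.integral_cong refl) (simp add: H'_def)
    also have "\<dots> = (\<Sum>j\<in>?J. LINT x|lebesgue_on (cell \<epsilon> j). H x)"
      unfolding A_def by (rule integral_cells(2)[OF e(1) J]) (rule integrable_lebesgue_on_subset[OF sub cell_sets[OF e(1)] \<Omega>_sets Hint])
    also have "\<dots> \<le> (\<Sum>j\<in>?J. LINT x|lebesgue_on (cell \<epsilon> j). M x)"
    proof (rule sum_mono)
      fix j assume j: "j \<in> ?J"
      show "(LINT x|lebesgue_on (cell \<epsilon> j). H x) \<le> (LINT x|lebesgue_on (cell \<epsilon> j). M x)"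
        unfolding H_def M_def by (rule cell_error[where p = p, OF e(1) j p[OF j] g])
          (use small s in \<open>auto simp: \<delta>_def intro: order_trans\<close>)
    qed
    also have "\<dots> = (LINT x|lebesgue_on A. M x)"
      unfolding A_def by (rule integral_cells(2)[OF e(1) J, symmetric]) (rule integrable_lebesgue_on_subset[OF sub cell_sets[OF e(1)] \<Omega>_sets Mint])
    also have "\<dots> \<le> (LINT x|lebesgue_on \<Omega>. M x)" by (rule integral_lebesgue_on_le[OF A(2,1) \<Omega>_sets Mint M0])
    also have "\<dots> = 2 * C1 * ((8 * \<tau>\<^sup>2 + \<omega> (2 * \<tau>) * L\<^sup>2) * measure lebesgue \<Omega> + 2 * sqn \<Omega> (\<lambda>x. grad \<psi> x - g x))"
    proof -
      define W where "W = 8 * \<tau>\<^sup>2 + \<omega> (2 * \<tau>) * L\<^sup>2"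
      have "(LINT x|lebesgue_on \<Omega>. 2 * C1 * (W + 2 * (norm (grad \<psi> x - g x))\<^sup>2))
          = 2 * C1 * ((LINT x|lebesgue_on \<Omega>. W) + 2 * sqn \<Omega> (\<lambda>x. grad \<psi> x - g x))"
        using ci dint by simp
      also have "(LINT x|lebesgue_on \<Omega>. W) = W * measure lebesgue \<Omega>" by (simp add: measure_restrict_space \<Omega>_sets)
      finally show ?thesis unfolding M_def W_def .
    qed
    finally show "(LINT x|lebesgue_on \<Omega>. (\<Sum>k\<in>K. \<eta> k x * (norm (Pk \<epsilon> k x - ?q x))\<^sup>2))
      \<le> 2 * C1 * ((8 * \<tau>\<^sup>2 + \<omega> (2 * \<tau>) * L\<^sup>2) * measure lebesgue \<Omega> + 2 * sqn \<Omega> (\<lambda>x. grad \<psi> x - g x))" by (simp add: H_def)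
  qed
qed

end

subsection \<open>The approximate solution\<close>

text \<open>Jensen's inequality as nonnegativity of the weighted variance about m. The weights are
  the values of the partition at a point, so the estimate does not depend on how many of them
  overlap.\<close>

lemma norm_weighted_sum_power2_le:
  fixes V :: "'k \<Rightarrow> 'b::real_inner"
  assumes "\<And>k. k \<in> K \<Longrightarrow> 0 \<le> c k" "(\<Sum>k\<in>K. c k) = 1"
  shows "(norm (\<Sum>k\<in>K. c k *\<^sub>R V k))\<^sup>2 \<le> (\<Sum>k\<in>K. c k * (norm (V k))\<^sup>2)"
proof -
  define m where "m = (\<Sum>k\<in>K. c k *\<^sub>R V k)"
  have "0 \<le> (\<Sum>k\<in>K. c k * (norm (V k - m))\<^sup>2)" using assms(1) by (intro sum_nonneg) simp
  also have "\<dots> = (\<Sum>k\<in>K. c k * (norm (V k))\<^sup>2 - 2 * ((c k *\<^sub>R V k) \<bullet> m) + c k * (norm m)\<^sup>2)"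
    by (intro sum.cong refl) (simp add: power2_norm_eq_inner inner_diff inner_commute algebra_simps)
  also have "\<dots> = (\<Sum>k\<in>K. c k * (norm (V k))\<^sup>2) - 2 * (\<Sum>k\<in>K. (c k *\<^sub>R V k) \<bullet> m) + (\<Sum>k\<in>K. c k) * (norm m)\<^sup>2"
    by (simp only: sum.distrib sum_subtractf sum_distrib_left sum_distrib_right)
  also have "(\<Sum>k\<in>K. (c k *\<^sub>R V k) \<bullet> m) = m \<bullet> m" by (simp only: inner_sum_left[symmetric] m_def)
  finally have "0 \<le> (\<Sum>k\<in>K. c k * (norm (V k))\<^sup>2) - (norm m)\<^sup>2" by (simp add: assms(2) power2_norm_eq_inner)
  then show ?thesis by (simp add: m_def)
qed

text \<open>The gradient of \<phi>\<eta> contains \<phi> itself, which the Poincare inequality on S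
  bounds by grad \<phi>. The constant depends on \<eta> and s, but \<epsilon> appears as a separate
  factor.\<close>

lemma oscillating_product_bound:
  fixes S :: "(real^'n) set" and \<eta> s :: "real^'n \<Rightarrow> real"
  assumes S: "open S" "bounded S" and \<eta>: "\<eta> \<in> test_functions UNIV"
    and s: "ae_periodic s" "s \<in> L2 Y" "(LINT y|lebesgue_on Y. s y) = 0"
  obtains C where "C \<ge> 0" "\<And>\<epsilon> \<phi>. 0 < \<epsilon> \<Longrightarrow> \<epsilon> \<le> 1 \<Longrightarrow> \<phi> \<in> test_functions S \<Longrightarrow>
    \<bar>LINT x|lebesgue_on S. (\<phi> x * \<eta> x) * s (x /\<^sub>R \<epsilon>)\<bar> \<le> C * \<epsilon> * L2_norm S (grad \<phi>)"
proof -
  obtain R where R: "S \<subseteq> cball 0 R" using S(2) by (meson bounded_subset_ballD ball_subset_cball order_trans)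
  obtain B where B: "B > 0" "\<And>x. \<bar>\<eta> x\<bar> \<le> B" "\<And>x. norm (grad \<eta> x) \<le> B"
    by (rule test_functions_bounded[OF \<eta>]) (rule that)
  obtain C where C: "C \<ge> 0" "\<And>u. u \<in> H12_0 S \<Longrightarrow> sqn S u \<le> C * sqn S (weak_grad S u)"
    by (rule poincare_H12_0[OF S]) (rule that)
  define Q where "Q = 2 ^ CARD('n) * (real CARD('n))\<^sup>2 * measure lebesgue (cball (0 :: real^'n) (R + real CARD('n))) * sqn Y s"
  have Q: "0 \<le> Q" unfolding Q_def by (intro mult_nonneg_nonneg sqn_nonneg) auto
  define D where "D = Q * (2 * B\<^sup>2 * (C + 1))"
  have D: "0 \<le> D" using Q C(1) by (simp add: D_def)
  note Ss = open_sets_lebesgue[OF S(1)]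
  show ?thesis
  proof (rule that[of "sqrt D"])
    fix \<epsilon> :: real and \<phi> assume e: "0 < \<epsilon>" "\<epsilon> \<le> 1" and \<phi>: "\<phi> \<in> test_functions S"
    define f where "f = (\<lambda>x. \<phi> x * \<eta> x)"
    note sm = test_functions_smooth[OF \<phi>] test_functions_smooth[OF \<eta>]
    have f: "f \<in> test_functions S"
      using test_functions_mult[OF sm(2) \<phi>] by (simp add: f_def mult.commute)
    have fU: "f \<in> test_functions UNIV" by (rule test_functions_UNIV[OF f])
    obtain Q' where Q': "Q' \<subseteq> S" "\<And>x. x \<notin> Q' \<Longrightarrow> f x = 0" "\<And>x. x \<notin> Q' \<Longrightarrow> grad f x = 0"
      by (rule test_functionsE[OF f]) (rule that)
    have f0: "f x = 0" if "norm x > R" for x using that Q'(1,2) R by fastforce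
    have gf: "grad f x = \<phi> x *\<^sub>R grad \<eta> x + \<eta> x *\<^sub>R grad \<phi> x" for x unfolding f_def by (rule grad_mult[OF sm])
    note L = test_functions_L2[OF \<phi> Ss]
    have p: "sqn S \<phi> \<le> C * sqn S (grad \<phi>)"
      using C(2)[OF test_functions_H12_0[OF \<phi> S(1)]] sqn_weak_grad[OF S(1) is_weak_grad_smooth[OF sm(1) Ss] L(2)] by simp
    have b1: "(\<lambda>x. \<phi> x *\<^sub>R grad \<eta> x) \<in> L2 S" "sqn S (\<lambda>x. \<phi> x *\<^sub>R grad \<eta> x) \<le> B\<^sup>2 * sqn S \<phi>"
    proof -
      have m: "(\<lambda>x. \<phi> x *\<^sub>R grad \<eta> x) \<in> borel_measurable (lebesgue_on S)"
        using smooth_measurable(1)[OF sm(1)] smooth_measurable(2)[OF sm(2)] by (rule borel_measurable_scaleR)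
      have ae: "AE x in lebesgue_on S. norm (\<phi> x *\<^sub>R grad \<eta> x) \<le> B * norm (\<phi> x)"
      proof (rule AE_I2)
        fix x show "norm (\<phi> x *\<^sub>R grad \<eta> x) \<le> B * norm (\<phi> x)"
          using mult_right_mono[OF B(3)[of x] abs_ge_zero[of "\<phi> x"]] by (simp only: norm_scaleR real_norm_def mult.commute)
      qed
      show "(\<lambda>x. \<phi> x *\<^sub>R grad \<eta> x) \<in> L2 S" by (rule L2_bound[OF m L(1) ae])
      show "sqn S (\<lambda>x. \<phi> x *\<^sub>R grad \<eta> x) \<le> B\<^sup>2 * sqn S \<phi>" by (rule sqn_bound[OF m L(1) ae])
    qed
    note b2 = L2_scaleR_bounded[OF L(2) smooth_measurable(1)[OF sm(2)] B(2)]
    have "sqn UNIV (grad f) = sqn S (grad f)"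
    proof -
      have "(norm (grad f x))\<^sup>2 = 0" if "x \<notin> S" for x using Q'(1,3) that by (simp add: subset_iff) blast
      then show ?thesis using Ss by (intro integral_lebesgue_on_support(1)[symmetric]) auto
    qed
    also have "\<dots> \<le> 2 * sqn S (\<lambda>x. \<phi> x *\<^sub>R grad \<eta> x) + 2 * sqn S (\<lambda>x. \<eta> x *\<^sub>R grad \<phi> x)"
      unfolding gf by (rule sqn_add_le[OF b1(1) b2(1)])
    also have "\<dots> \<le> 2 * (B\<^sup>2 * (C * sqn S (grad \<phi>))) + 2 * (B\<^sup>2 * sqn S (grad \<phi>))"
      using b1(2) b2(2) mult_left_mono[OF p, of "B\<^sup>2"] by simp
    finally have G: "sqn UNIV (grad f) \<le> 2 * B\<^sup>2 * (C + 1) * sqn S (grad \<phi>)" by (simp add: algebra_simps)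
    have "(LINT x|lebesgue_on S. f x * s (x /\<^sub>R \<epsilon>)) = (LINT x|lebesgue. f x * s (x /\<^sub>R \<epsilon>))"
      using test_functions_integral_subset(1)[OF f _ _ Ss, of UNIV "\<lambda>x. s (x /\<^sub>R \<epsilon>)"] by (simp add: lebesgue_on_UNIV_eq)
    then have "(LINT x|lebesgue_on S. f x * s (x /\<^sub>R \<epsilon>))\<^sup>2 \<le> Q * \<epsilon>\<^sup>2 * sqn UNIV (grad f)"
      using oscillating_integral_bound[OF fU f0 s e] by (simp add: Q_def mult_ac)
    also have "\<dots> \<le> Q * \<epsilon>\<^sup>2 * (2 * B\<^sup>2 * (C + 1) * sqn S (grad \<phi>))" using Q by (intro mult_left_mono G) auto
    also have "\<dots> = (sqrt D * \<epsilon> * L2_norm S (grad \<phi>))\<^sup>2"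
      using D by (simp add: power_mult_distrib L2_norm_power2 D_def mult_ac)
    finally have "\<bar>LINT x|lebesgue_on S. f x * s (x /\<^sub>R \<epsilon>)\<bar> \<le> \<bar>sqrt D * \<epsilon> * L2_norm S (grad \<phi>)\<bar>"
      by (rule abs_le_square_iff[THEN iffD2])
    then show "\<bar>LINT x|lebesgue_on S. (\<phi> x * \<eta> x) * s (x /\<^sub>R \<epsilon>)\<bar> \<le> sqrt D * \<epsilon> * L2_norm S (grad \<phi>)"
      using D e L2_norm_nonneg[of S "grad \<phi>"] by (simp add: f_def abs_mult)
  qed (use D in simp)
qed

context homogenization
begin

text \<open>Write \<eta> s . grad \<phi> as s . grad(\<eta>\<phi>) minus \<phi> s . grad \<eta>. The
  first term integrates to zero because s is divergence free; the second no longer differentiates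
  \<phi>, so its oscillation yields the factor \<epsilon> component by component.\<close>

lemma oscillating_flux_bound:
  fixes \<eta> :: "real^'n \<Rightarrow> real" and s :: "real^'n \<Rightarrow> real^'n"
  assumes \<eta>: "\<eta> \<in> test_functions UNIV" and s: "ae_periodic s" "s \<in> L2 Y" "(LINT y|lebesgue_on Y. s y) = 0"
    and z: "\<And>\<epsilon> f. \<epsilon> > 0 \<Longrightarrow> f \<in> test_functions \<Omega> \<Longrightarrow> (LINT x|lebesgue_on \<Omega>. s (x /\<^sub>R \<epsilon>) \<bullet> grad f x) = 0"
  obtains C where "C \<ge> 0" "\<And>\<epsilon> \<phi>. 0 < \<epsilon> \<Longrightarrow> \<epsilon> \<le> 1 \<Longrightarrow> \<phi> \<in> test_functions \<Omega> \<Longrightarrow>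
    \<bar>LINT x|lebesgue_on \<Omega>. (\<eta> x *\<^sub>R s (x /\<^sub>R \<epsilon>)) \<bullet> grad \<phi> x\<bar> \<le> C * \<epsilon> * L2_norm \<Omega> (grad \<phi>)"
proof -
  define P where "P i C \<longleftrightarrow> 0 \<le> C \<and> (\<forall>\<epsilon> \<phi>. 0 < \<epsilon> \<longrightarrow> \<epsilon> \<le> 1 \<longrightarrow> \<phi> \<in> test_functions \<Omega> \<longrightarrow>
    \<bar>LINT x|lebesgue_on \<Omega>. (\<phi> x * grad \<eta> x $ i) * (s (x /\<^sub>R \<epsilon>) $ i)\<bar> \<le> C * \<epsilon> * L2_norm \<Omega> (grad \<phi>))" for i C
  have "\<exists>C. P i C" for i
  proof -
    have si: "ae_periodic (\<lambda>y. s y $ i)"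
      unfolding ae_periodic_def
    proof
      fix k have "AE y in lebesgue. s (y + lat k) = s y" using s(1) unfolding ae_periodic_def by blast
      then show "AE y in lebesgue. s (y + lat k) $ i = s y $ i" by eventually_elim simp
    qed
    have "(LINT y|lebesgue_on Y. s y $ i) = (LINT y|lebesgue_on Y. s y \<bullet> axis i 1)" by (simp add: inner_axis)
    also have "\<dots> = (LINT y|lebesgue_on Y. s y) \<bullet> axis i 1"
      by (rule integral_inner_left) (use L2_imp_integrable[OF s(2) Y_lmeasurable] in simp)
    finally have m: "(LINT y|lebesgue_on Y. s y $ i) = 0" by (simp add: s(3))
    obtain C where "C \<ge> 0" "\<And>\<epsilon> \<phi>. 0 < \<epsilon> \<Longrightarrow> \<epsilon> \<le> 1 \<Longrightarrow> \<phi> \<in> test_functions \<Omega> \<Longrightarrow>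
      \<bar>LINT x|lebesgue_on \<Omega>. (\<phi> x * grad \<eta> x $ i) * (s (x /\<^sub>R \<epsilon>) $ i)\<bar> \<le> C * \<epsilon> * L2_norm \<Omega> (grad \<phi>)"
      by (rule oscillating_product_bound[OF \<Omega> test_functions_grad[OF \<eta>] si sqn_components(1)[OF s(2)] m]) (rule that)
    then have "P i C" unfolding P_def by (intro conjI allI impI)
    then show ?thesis ..
  qed
  then obtain C where PC: "\<And>i. P i (C i)" by metis
  have C: "C i \<ge> 0" "0 < \<epsilon> \<Longrightarrow> \<epsilon> \<le> 1 \<Longrightarrow> \<phi> \<in> test_functions \<Omega> \<Longrightarrow>
      \<bar>LINT x|lebesgue_on \<Omega>. (\<phi> x * grad \<eta> x $ i) * (s (x /\<^sub>R \<epsilon>) $ i)\<bar> \<le> C i * \<epsilon> * L2_norm \<Omega> (grad \<phi>)" for i \<epsilon> \<phi>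
    using PC[of i] unfolding P_def by (rule conjunct1) (use PC[of i, unfolded P_def] in \<open>simp\<close>)
  show ?thesis
  proof (rule that[of "\<Sum>i\<in>UNIV. C i"])
    show "0 \<le> (\<Sum>i\<in>UNIV. C i)" by (intro sum_nonneg C)
    fix \<epsilon> :: real and \<phi> assume e: "0 < \<epsilon>" "\<epsilon> \<le> 1" and \<phi>: "\<phi> \<in> test_functions \<Omega>"
    define f where "f = (\<lambda>x. \<eta> x * \<phi> x)"
    let ?s = "\<lambda>x. s (x /\<^sub>R \<epsilon>)"
    note sm = test_functions_smooth[OF \<eta>] test_functions_smooth[OF \<phi>]
    have f: "f \<in> test_functions \<Omega>" unfolding f_def by (rule test_functions_mult[OF sm(1) \<phi>])
    have sL: "?s \<in> L2 \<Omega>" by (rule scaled_L2[OF s(1,2) e(1)])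
    have gf: "grad f x = \<eta> x *\<^sub>R grad \<phi> x + \<phi> x *\<^sub>R grad \<eta> x" for x unfolding f_def by (rule grad_mult[OF sm])
    have fg: "(\<lambda>x. \<phi> x * grad \<eta> x $ i) \<in> L2 \<Omega>" for i
    proof -
      have "(\<lambda>x. \<phi> x * grad \<eta> x $ i) \<in> test_functions UNIV" by (rule test_functions_mult[OF sm(2) test_functions_grad[OF \<eta>]])
      then show ?thesis by (rule test_functions_L2(1)[OF _ \<Omega>_sets])
    qed
    have int: "integrable (lebesgue_on \<Omega>) (\<lambda>x. (\<phi> x * grad \<eta> x $ i) * (?s x $ i))" for i
      using L2_inner_integrable[OF fg sqn_components(1)[OF sL]] by simp
    have "(\<eta> x *\<^sub>R ?s x) \<bullet> grad \<phi> x = ?s x \<bullet> grad f x - (\<Sum>i\<in>UNIV. (\<phi> x * grad \<eta> x $ i) * (?s x $ i))" for x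
    proof -
      have "(\<Sum>i\<in>UNIV. (\<phi> x * grad \<eta> x $ i) * (?s x $ i)) = ?s x \<bullet> (\<phi> x *\<^sub>R grad \<eta> x)"
        by (simp add: inner_vec_def mult_ac)
      then show ?thesis by (simp add: gf inner_add_right)
    qed
    then have "(LINT x|lebesgue_on \<Omega>. (\<eta> x *\<^sub>R ?s x) \<bullet> grad \<phi> x)
        = (LINT x|lebesgue_on \<Omega>. ?s x \<bullet> grad f x - (\<Sum>i\<in>UNIV. (\<phi> x * grad \<eta> x $ i) * (?s x $ i)))" by simp
    also have "\<dots> = (LINT x|lebesgue_on \<Omega>. ?s x \<bullet> grad f x) - (\<Sum>i\<in>UNIV. (LINT x|lebesgue_on \<Omega>. (\<phi> x * grad \<eta> x $ i) * (?s x $ i)))"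
      using int L2_inner_integrable[OF sL test_functions_L2(2)[OF f \<Omega>_sets]] by simp
    finally have "\<bar>LINT x|lebesgue_on \<Omega>. (\<eta> x *\<^sub>R ?s x) \<bullet> grad \<phi> x\<bar>
        = \<bar>\<Sum>i\<in>UNIV. (LINT x|lebesgue_on \<Omega>. (\<phi> x * grad \<eta> x $ i) * (?s x $ i))\<bar>"
      using z[OF e(1) f] by simp
    also have "\<dots> \<le> (\<Sum>i\<in>UNIV. \<bar>LINT x|lebesgue_on \<Omega>. (\<phi> x * grad \<eta> x $ i) * (?s x $ i)\<bar>)" by (rule sum_abs)
    also have "\<dots> \<le> (\<Sum>i\<in>UNIV. C i * \<epsilon> * L2_norm \<Omega> (grad \<phi>))" by (intro sum_mono C e \<phi>)
    finally show "\<bar>LINT x|lebesgue_on \<Omega>. (\<eta> x *\<^sub>R ?s x) \<bullet> grad \<phi> x\<bar> \<le> (\<Sum>i\<in>UNIV. C i) * \<epsilon> * L2_norm \<Omega> (grad \<phi>)"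
      by (simp add: sum_distrib_right)
  qed
qed

end

section \<open>The blended flux and its distance from the homogenized flux\<close>

context homogenization_partition
begin

definition "Sk \<epsilon> k x = sig (\<xi> k) (z k) (x /\<^sub>R \<epsilon>)"
definition "Wk \<epsilon> k x = wg (\<xi> k) (z k) (x /\<^sub>R \<epsilon>)"
definition "Vk \<epsilon> k x = per_ext (v (\<xi> k) (z k)) (x /\<^sub>R \<epsilon>)"
definition "bk k = b_hom a v (z k) (\<xi> k)"

definition "S_bar \<epsilon> x = (\<Sum>k\<in>K. \<eta> k x *\<^sub>R Sk \<epsilon> k x)"
definition "P_bar \<epsilon> x = (\<Sum>k\<in>K. \<eta> k x *\<^sub>R Pk \<epsilon> k x)"
definition "b_bar x = (\<Sum>k\<in>K. \<eta> k x *\<^sub>R bk k)"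

lemma Sk_L2: "\<epsilon> > 0 \<Longrightarrow> Sk \<epsilon> k \<in> L2 \<Omega>"
  unfolding Sk_def[abs_def] by (rule scaled_L2[OF sig_periodic[OF z] sig_L2[OF z]])

lemma S_bar_L2: "\<epsilon> > 0 \<Longrightarrow> S_bar \<epsilon> \<in> L2 \<Omega>"
  unfolding S_bar_def[abs_def] by (intro sum_weighted_integrable(2) \<eta> Sk_L2)

lemma P_bar_L2: "\<epsilon> > 0 \<Longrightarrow> P_bar \<epsilon> \<in> L2 \<Omega>"
  unfolding P_bar_def[abs_def] by (intro sum_weighted_integrable(2) \<eta> Pk_L2)

lemma b_bar_L2: "b_bar \<in> L2 \<Omega>"
  unfolding b_bar_def[abs_def] by (intro sum_weighted_integrable(2) \<eta> L2_const \<Omega>_lmeasurable)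

text \<open>The difference between the homogenized vector and the cell flux has mean zero by the
  definition of the former, and is divergence free since both parts are.\<close>

lemma flux_term_bound:
  obtains C where "C \<ge> 0" "\<And>\<epsilon> \<phi>. 0 < \<epsilon> \<Longrightarrow> \<epsilon> \<le> 1 \<Longrightarrow> \<phi> \<in> test_functions \<Omega> \<Longrightarrow>
    \<bar>LINT x|lebesgue_on \<Omega>. (\<eta> k x *\<^sub>R (bk k - Sk \<epsilon> k x)) \<bullet> grad \<phi> x\<bar> \<le> C * \<epsilon> * L2_norm \<Omega> (grad \<phi>)"
proof -
  define s where "s = (\<lambda>y. bk k - sig (\<xi> k) (z k) y)"
  note sg = sig_L2[OF z, of "\<xi> k" k] sig_periodic[OF z, of "\<xi> k" k]
  have cY: "(\<lambda>y :: real^'n. bk k) \<in> L2 Y" by (rule L2_const[OF Y_lmeasurable])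
  have s: "ae_periodic s" "s \<in> L2 Y" unfolding s_def by (intro ae_periodic_diff ae_periodic_const sg L2_diff cY)+
  have "(LINT y|lebesgue_on Y. s y) = (LINT y :: real^'n|lebesgue_on Y. bk k) - (LINT y|lebesgue_on Y. sig (\<xi> k) (z k) y)"
    unfolding s_def by (intro Bochner_Integration.integral_diff L2_imp_integrable cY sg Y_lmeasurable)
  then have s0: "(LINT y|lebesgue_on Y. s y) = 0"
    by (simp add: measure_restrict_space Y_sets Y_measure bk_def b_hom_eq[OF z])
  have z0: "(LINT x|lebesgue_on \<Omega>. s (x /\<^sub>R \<epsilon>) \<bullet> grad f x) = 0" if e: "\<epsilon> > 0" and f: "f \<in> test_functions \<Omega>" for \<epsilon> f
  proof -
    note fU = test_functions_UNIV[OF f] and gL = test_functions_L2(2)[OF f \<Omega>_sets]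
    have c: "(\<lambda>x :: real^'n. bk k) \<in> L2 \<Omega>" by (rule L2_const[OF \<Omega>_lmeasurable])
    have sc: "(\<lambda>x. sig (\<xi> k) (z k) (x /\<^sub>R \<epsilon>)) \<in> L2 \<Omega>" by (rule scaled_L2[OF sg(2,1) e])
    have toU: "(LINT x|lebesgue_on \<Omega>. w x \<bullet> grad f x) = (LINT x|lebesgue. w x \<bullet> grad f x)" for w
      using test_functions_integral_subset(3)[OF f subset_UNIV _ \<Omega>_sets, of w] by (simp add: lebesgue_on_UNIV_eq)
    have "(LINT x|lebesgue_on \<Omega>. sig (\<xi> k) (z k) (x /\<^sub>R \<epsilon>) \<bullet> grad f x) = 0"
      unfolding toU by (rule periodic_divergence_free[OF sg(2,1) sig_orthogonal[OF z] fU e])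
    moreover have "(LINT x|lebesgue_on \<Omega>. bk k \<bullet> grad f x) = 0"
    proof -
      have "(LINT x|lebesgue. bk k \<bullet> grad f x) = bk k \<bullet> (LINT x|lebesgue. grad f x)"
        by (rule integral_inner_right) (use test_functions_integrable(2)[OF f, of UNIV] in \<open>simp add: lebesgue_on_UNIV_eq\<close>)
      then show ?thesis unfolding toU by (simp add: integral_grad_test_function[OF fU])
    qed
    ultimately show ?thesis
      using L2_inner_integrable[OF c gL] L2_inner_integrable[OF sc gL] by (simp add: s_def inner_diff_left)
  qed
  show ?thesis
    by (rule oscillating_flux_bound[OF \<eta>[of k] s s0 z0]) (use that in \<open>simp_all add: s_def Sk_def\<close>)
qed

lemma flux_divergence_bound:
  obtains C where "C \<ge> 0" "\<And>\<epsilon> u. 0 < \<epsilon> \<Longrightarrow> \<epsilon> \<le> 1 \<Longrightarrow> u \<in> H12_0 \<Omega> \<Longrightarrow>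
    (LINT x|lebesgue_on \<Omega>. (b_bar x - S_bar \<epsilon> x) \<bullet> weak_grad \<Omega> u x) \<le> C * \<epsilon> * L2_norm \<Omega> (weak_grad \<Omega> u)"
proof -
  define P where "P k C \<longleftrightarrow> 0 \<le> C \<and> (\<forall>\<epsilon> \<phi>. 0 < \<epsilon> \<longrightarrow> \<epsilon> \<le> 1 \<longrightarrow> \<phi> \<in> test_functions \<Omega> \<longrightarrow>
    \<bar>LINT x|lebesgue_on \<Omega>. (\<eta> k x *\<^sub>R (bk k - Sk \<epsilon> k x)) \<bullet> grad \<phi> x\<bar> \<le> C * \<epsilon> * L2_norm \<Omega> (grad \<phi>))" for k C
  have "\<exists>C. P k C" for k
  proof -
    obtain C where "C \<ge> 0" "\<And>\<epsilon> \<phi>. 0 < \<epsilon> \<Longrightarrow> \<epsilon> \<le> 1 \<Longrightarrow> \<phi> \<in> test_functions \<Omega> \<Longrightarrow>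
      \<bar>LINT x|lebesgue_on \<Omega>. (\<eta> k x *\<^sub>R (bk k - Sk \<epsilon> k x)) \<bullet> grad \<phi> x\<bar> \<le> C * \<epsilon> * L2_norm \<Omega> (grad \<phi>)"
      by (rule flux_term_bound[of k]) (rule that)
    then have "P k C" unfolding P_def by (intro conjI allI impI)
    then show ?thesis ..
  qed
  then obtain C where PC: "\<And>k. P k (C k)" by metis
  have C: "C k \<ge> 0" "0 < \<epsilon> \<Longrightarrow> \<epsilon> \<le> 1 \<Longrightarrow> \<phi> \<in> test_functions \<Omega> \<Longrightarrow>
    \<bar>LINT x|lebesgue_on \<Omega>. (\<eta> k x *\<^sub>R (bk k - Sk \<epsilon> k x)) \<bullet> grad \<phi> x\<bar> \<le> C k * \<epsilon> * L2_norm \<Omega> (grad \<phi>)" for k \<epsilon> \<phi>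
    using PC[of k] unfolding P_def by (rule conjunct1) (use PC[of k, unfolded P_def] in \<open>simp\<close>)
  show ?thesis
  proof (rule that[of "\<Sum>k\<in>K. C k"])
    show C0: "0 \<le> (\<Sum>k\<in>K. C k)" by (intro sum_nonneg C)
    fix \<epsilon> :: real and u assume e: "0 < \<epsilon>" "\<epsilon> \<le> 1" and u: "u \<in> H12_0 \<Omega>"
    show "(LINT x|lebesgue_on \<Omega>. (b_bar x - S_bar \<epsilon> x) \<bullet> weak_grad \<Omega> u x) \<le> (\<Sum>k\<in>K. C k) * \<epsilon> * L2_norm \<Omega> (weak_grad \<Omega> u)"
    proof (rule density_bound[OF \<Omega>(1) L2_diff[OF b_bar_L2 S_bar_L2[OF e(1)]] _ _ u])
      show "0 \<le> (\<Sum>k\<in>K. C k) * \<epsilon>" using C0 e by simp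
      fix \<phi> assume \<phi>: "\<phi> \<in> test_functions \<Omega>"
      have int: "integrable (lebesgue_on \<Omega>) (\<lambda>x. (\<eta> k x *\<^sub>R (bk k - Sk \<epsilon> k x)) \<bullet> grad \<phi> x)" for k
      proof -
        have "(\<lambda>x. bk k - Sk \<epsilon> k x) \<in> L2 \<Omega>" by (intro L2_diff L2_const \<Omega>_lmeasurable Sk_L2 e)
        then have "(\<lambda>x. \<eta> k x *\<^sub>R (bk k - Sk \<epsilon> k x)) \<in> L2 \<Omega>"
          using sum_weighted_integrable(2)[of "{k}" \<eta> "\<lambda>k x. bk k - Sk \<epsilon> k x" \<Omega>] \<eta> by simp
        then show ?thesis by (rule L2_inner_integrable[OF _ test_functions_L2(2)[OF \<phi> \<Omega>_sets]])
      qed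
      have "(LINT x|lebesgue_on \<Omega>. (b_bar x - S_bar \<epsilon> x) \<bullet> grad \<phi> x)
          = (LINT x|lebesgue_on \<Omega>. (\<Sum>k\<in>K. (\<eta> k x *\<^sub>R (bk k - Sk \<epsilon> k x)) \<bullet> grad \<phi> x))"
        unfolding b_bar_def S_bar_def sum_subtractf[symmetric] scaleR_diff_right[symmetric] inner_sum_left ..
      also have "\<dots> = (\<Sum>k\<in>K. (LINT x|lebesgue_on \<Omega>. (\<eta> k x *\<^sub>R (bk k - Sk \<epsilon> k x)) \<bullet> grad \<phi> x))"
        by (rule Bochner_Integration.integral_sum) (rule int)
      also have "\<dots> \<le> (\<Sum>k\<in>K. C k * \<epsilon> * L2_norm \<Omega> (grad \<phi>))" by (intro sum_mono abs_le_D1[OF C(2)] e \<phi>)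
      finally show "(LINT x|lebesgue_on \<Omega>. (b_bar x - S_bar \<epsilon> x) \<bullet> grad \<phi> x) \<le> (\<Sum>k\<in>K. C k) * \<epsilon> * L2_norm \<Omega> (grad \<phi>)"
        by (simp add: sum_distrib_right)
    qed
  qed
qed

section \<open>The function w and its gradient\<close>

definition "K' = {k \<in> K. \<xi> k \<noteq> 0}"
text \<open>The part of Dw in which the derivative falls on the weights. It enters with the factor
  \<epsilon> and stays bounded in L2 for a fixed partition.\<close>

definition "R_bar \<epsilon> x = (\<Sum>k\<in>K'. Vk \<epsilon> k x *\<^sub>R grad (\<eta> k) x)"
definition "w \<epsilon> x = \<psi> x + (\<Sum>k\<in>K'. \<eta> k x * (\<epsilon> * Vk \<epsilon> k x))"
definition "gw \<epsilon> x = grad \<psi> x + (\<Sum>k\<in>K'. \<eta> k x *\<^sub>R Wk \<epsilon> k x) + \<epsilon> *\<^sub>R R_bar \<epsilon> x"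

lemma K'_finite: "finite K'"
  using K by (simp add: K'_def)

lemma
  assumes "\<epsilon> > 0" "S \<in> sets lebesgue" "bounded S"
  shows Vk_L2: "Vk \<epsilon> k \<in> L2 S" and Wk_L2: "Wk \<epsilon> k \<in> L2 S"
proof -
  obtain R where R: "S \<subseteq> cball 0 R" using assms(3) by (meson bounded_subset_ballD ball_subset_cball order_trans)
  have "ae_periodic (per_ext (v (\<xi> k) (z k)))" by (simp add: ae_periodic_def per_ext_lat)
  then show "Vk \<epsilon> k \<in> L2 S" unfolding Vk_def[abs_def]
    by (rule periodic_L2_bounded(1)[OF _ per_ext_weak_grad(2)[OF v_space[OF z] Y_sets Y_bounded] assms(1,2) R])
  show "Wk \<epsilon> k \<in> L2 S" unfolding Wk_def[abs_def]
    by (rule periodic_L2_bounded(1)[OF wg_periodic[OF z] wg_L2[OF z] assms(1,2) R])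
qed

lemma
  assumes "V \<in> L2 S" and b: "\<And>x. norm (grad (\<eta> k) x) \<le> M"
  shows scaleR_grad_\<eta>_L2: "(\<lambda>x. V x *\<^sub>R grad (\<eta> k) x) \<in> L2 S"
    and scaleR_grad_\<eta>_sqn: "sqn S (\<lambda>x. V x *\<^sub>R grad (\<eta> k) x) \<le> M\<^sup>2 * sqn S V"
proof -
  have m: "(\<lambda>x. V x *\<^sub>R grad (\<eta> k) x) \<in> borel_measurable (lebesgue_on S)"
    using L2_measurable[OF assms(1)] smooth_measurable(2)[OF test_functions_smooth[OF \<eta>]] by (rule borel_measurable_scaleR)
  have ae: "AE x in lebesgue_on S. norm (V x *\<^sub>R grad (\<eta> k) x) \<le> M * norm (V x)"
  proof (rule AE_I2)
    fix x show "norm (V x *\<^sub>R grad (\<eta> k) x) \<le> M * norm (V x)"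
      using mult_right_mono[OF b[of x] abs_ge_zero[of "V x"]] by (simp only: norm_scaleR real_norm_def mult.commute)
  qed
  show "(\<lambda>x. V x *\<^sub>R grad (\<eta> k) x) \<in> L2 S" by (rule L2_bound[OF m assms(1) ae])
  show "sqn S (\<lambda>x. V x *\<^sub>R grad (\<eta> k) x) \<le> M\<^sup>2 * sqn S V" by (rule sqn_bound[OF m assms(1) ae])
qed

lemma \<eta>_grad_bounded: obtains M where "\<And>x. norm (grad (\<eta> k) x) \<le> M"
  by (rule test_functions_bounded[OF \<eta>[of k]]) (rule that)

lemma R_bar_L2: "\<epsilon> > 0 \<Longrightarrow> S \<in> sets lebesgue \<Longrightarrow> bounded S \<Longrightarrow> R_bar \<epsilon> \<in> L2 S"
  unfolding R_bar_def[abs_def]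
proof (rule L2_sum)
  fix k assume *: "\<epsilon> > 0" "S \<in> sets lebesgue" "bounded S"
  obtain M where M: "\<And>x. norm (grad (\<eta> k) x) \<le> M" by (rule \<eta>_grad_bounded[of k]) (rule that)
  show "(\<lambda>x. Vk \<epsilon> k x *\<^sub>R grad (\<eta> k) x) \<in> L2 S" by (rule scaleR_grad_\<eta>_L2[OF Vk_L2[OF *] M])
qed

lemma gw_L2: "\<epsilon> > 0 \<Longrightarrow> S \<in> sets lebesgue \<Longrightarrow> bounded S \<Longrightarrow> gw \<epsilon> \<in> L2 S"
  unfolding gw_def[abs_def]
  by (intro L2_add(1) L2_scaleR R_bar_L2 sum_weighted_integrable(2) \<eta> Wk_L2 test_functions_L2(2)[OF \<psi>])

lemma w_L2: "\<epsilon> > 0 \<Longrightarrow> S \<in> sets lebesgue \<Longrightarrow> bounded S \<Longrightarrow> w \<epsilon> \<in> L2 S"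
  using sum_weighted_integrable(2)[of K' \<eta> "\<lambda>k x. \<epsilon> *\<^sub>R Vk \<epsilon> k x" S]
  unfolding w_def[abs_def] by (intro L2_add(1) test_functions_L2(1)[OF \<psi>]) (simp_all add: \<eta> L2_scaleR[OF Vk_L2, simplified])

lemma w_weak_grad:
  assumes e: "\<epsilon> > 0" shows "is_weak_grad UNIV (w \<epsilon>) (gw \<epsilon>)"
proof -
  have V: "is_weak_grad UNIV (\<lambda>x. \<epsilon> * Vk \<epsilon> k x) (Wk \<epsilon> k)" for k
  proof -
    have "is_weak_grad UNIV (\<lambda>x. per_ext (v (\<xi> k) (z k)) (inverse \<epsilon> *\<^sub>R x + 0)) (\<lambda>x. inverse \<epsilon> *\<^sub>R wg (\<xi> k) (z k) (inverse \<epsilon> *\<^sub>R x + 0))"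
      using e per_ext_weak_grad(1)[OF v_space[OF z], of "\<xi> k" k] unfolding wg_def by (intro is_weak_grad_affine) auto
    from is_weak_grad_cmult[OF this, of \<epsilon>] show ?thesis using e by (simp add: Vk_def[abs_def] Wk_def[abs_def])
  qed
  have "is_weak_grad UNIV (\<lambda>x. \<psi> x + (\<Sum>k\<in>K'. \<eta> k x * (\<epsilon> * Vk \<epsilon> k x)))
      (\<lambda>x. grad \<psi> x + (\<Sum>k\<in>K'. \<eta> k x *\<^sub>R Wk \<epsilon> k x + (\<epsilon> * Vk \<epsilon> k x) *\<^sub>R grad (\<eta> k) x))"
    by (intro is_weak_grad_add is_weak_grad_sum is_weak_grad_mult is_weak_grad_smooth V test_functions_smooth[OF \<psi>] test_functions_smooth[OF \<eta>]) auto
  then show ?thesis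
    unfolding w_def[abs_def] gw_def[abs_def] R_bar_def by (simp add: sum.distrib scaleR_sum_right add.assoc)
qed

text \<open>All weights in K' and \<psi> have compact support in \<Omega>, so w vanishes near the
  boundary whatever the cell functions do there.\<close>

lemma
  assumes e: "\<epsilon> > 0"
  shows w_H12_0: "w \<epsilon> \<in> H12_0 \<Omega>" and w_weak_grad_\<Omega>: "is_weak_grad \<Omega> (w \<epsilon>) (gw \<epsilon>)"
proof -
  have "\<exists>Q. compact Q \<and> Q \<subseteq> \<Omega> \<and> (\<xi> k \<noteq> 0 \<longrightarrow> (\<forall>x. x \<notin> Q \<longrightarrow> \<eta> k x = 0 \<and> grad (\<eta> k) x = 0))" for k
  proof (cases "\<xi> k = 0")
    case False
    obtain Q where "compact Q" "Q \<subseteq> \<Omega>" "\<And>x. x \<notin> Q \<Longrightarrow> \<eta> k x = 0" "\<And>x. x \<notin> Q \<Longrightarrow> grad (\<eta> k) x = 0"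
      by (rule test_functionsE[OF \<eta>_inside[OF False]]) (rule that)
    then show ?thesis by blast
  qed (rule exI[of _ "{}"], simp)
  from choice[OF allI[OF this]] obtain Q where QQ: "\<forall>k. compact (Q k) \<and> Q k \<subseteq> \<Omega> \<and> (\<xi> k \<noteq> 0 \<longrightarrow> (\<forall>x. x \<notin> Q k \<longrightarrow> \<eta> k x = 0 \<and> grad (\<eta> k) x = 0))" ..
  then have Q: "\<And>k. compact (Q k)" "\<And>k. Q k \<subseteq> \<Omega>" "\<And>k x. \<xi> k \<noteq> 0 \<Longrightarrow> x \<notin> Q k \<Longrightarrow> \<eta> k x = 0 \<and> grad (\<eta> k) x = 0"
    by blast+
  obtain Q0 where Q0: "compact Q0" "Q0 \<subseteq> \<Omega>" "\<And>x. x \<notin> Q0 \<Longrightarrow> \<psi> x = 0" "\<And>x. x \<notin> Q0 \<Longrightarrow> grad \<psi> x = 0"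
    by (rule test_functionsE[OF \<psi>]) (rule that)
  define C where "C = Q0 \<union> (\<Union>k\<in>K'. Q k)"
  have C: "compact C" "C \<subseteq> \<Omega>" unfolding C_def using K'_finite Q(1,2) Q0(1,2) by (auto intro!: compact_Un compact_UN)
  have z: "\<psi> x = 0" "grad \<psi> x = 0" "k \<in> K' \<Longrightarrow> \<eta> k x = 0" "k \<in> K' \<Longrightarrow> grad (\<eta> k) x = 0" if "x \<notin> C" for x k
    using that Q(3)[of k x] Q0(3,4)[of x] by (auto simp: C_def K'_def)
  have off: "w \<epsilon> x = 0" "gw \<epsilon> x = 0" if "x \<notin> C" for x
    using z[OF that] unfolding w_def gw_def R_bar_def by simp_all
  have Cs: "C \<in> sets lebesgue" "bounded C" using C(1) compact_imp_closed compact_imp_bounded by (auto intro: borel_closed[THEN sets_completionI_sets[of _ lborel, simplified]])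
  have "w \<epsilon> \<in> L2 UNIV" by (rule L2_extend(1)[OF w_L2[OF e Cs] subset_UNIV Cs(1) _ off(1)]) simp
  moreover have "gw \<epsilon> \<in> L2 UNIV" by (rule L2_extend(1)[OF gw_L2[OF e Cs] subset_UNIV Cs(1) _ off(2)]) simp
  ultimately show "w \<epsilon> \<in> H12_0 \<Omega>" "is_weak_grad \<Omega> (w \<epsilon>) (gw \<epsilon>)"
    using compact_support_H12_0[OF \<Omega>(1) _ _ w_weak_grad[OF e] C off] by blast+
qed

lemma R_bar_bound:
  obtains C where "\<And>\<epsilon>. 0 < \<epsilon> \<Longrightarrow> \<epsilon> \<le> 1 \<Longrightarrow> sqn \<Omega> (R_bar \<epsilon>) \<le> C"
proof -
  obtain R where R: "\<Omega> \<subseteq> cball 0 R" using \<Omega>(2) by (meson bounded_subset_ballD ball_subset_cball order_trans)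
  have one: "\<exists>C. \<forall>\<epsilon>. 0 < \<epsilon> \<longrightarrow> \<epsilon> \<le> 1 \<longrightarrow> sqn \<Omega> (\<lambda>x. Vk \<epsilon> k x *\<^sub>R grad (\<eta> k) x) \<le> C" for k
  proof -
    obtain M where M: "\<And>x. norm (grad (\<eta> k) x) \<le> M" by (rule \<eta>_grad_bounded[of k]) (rule that)
    let ?u = "per_ext (v (\<xi> k) (z k))"
    have per: "ae_periodic ?u" by (simp add: ae_periodic_def per_ext_lat)
    have "sqn \<Omega> (\<lambda>x. Vk \<epsilon> k x *\<^sub>R grad (\<eta> k) x) \<le> M\<^sup>2 * (measure lebesgue (cball (0 :: real^'n) (R + real CARD('n))) * sqn Y ?u)"
      if e: "0 < \<epsilon>" "\<epsilon> \<le> 1" for \<epsilon>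
    proof -
      have "sqn \<Omega> (\<lambda>x. Vk \<epsilon> k x *\<^sub>R grad (\<eta> k) x) \<le> M\<^sup>2 * sqn \<Omega> (Vk \<epsilon> k)"
        by (rule scaleR_grad_\<eta>_sqn[OF Vk_L2[OF e(1) \<Omega>_sets \<Omega>(2)] M])
      also have "\<dots> \<le> M\<^sup>2 * (measure lebesgue (cball (0 :: real^'n) (R + real CARD('n))) * sqn Y ?u)"
        unfolding Vk_def by (intro mult_left_mono
          periodic_L2_bounded(2)[OF per per_ext_weak_grad(2)[OF v_space[OF z] Y_sets Y_bounded] e(1) \<Omega>_sets R e(2)]) simp
      finally show ?thesis .
    qed
    then show ?thesis by blast
  qed
  have "\<exists>C. \<forall>\<epsilon>. 0 < \<epsilon> \<longrightarrow> \<epsilon> \<le> 1 \<longrightarrow> sqn \<Omega> (\<lambda>x. \<Sum>k\<in>A. Vk \<epsilon> k x *\<^sub>R grad (\<eta> k) x) \<le> C" if "finite A" for A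
    using that
  proof induction
    case empty
    show ?case by (rule exI[of _ 0]) simp
  next
    case (insert k A)
    obtain C where C: "\<And>\<epsilon>. 0 < \<epsilon> \<Longrightarrow> \<epsilon> \<le> 1 \<Longrightarrow> sqn \<Omega> (\<lambda>x. \<Sum>k\<in>A. Vk \<epsilon> k x *\<^sub>R grad (\<eta> k) x) \<le> C"
      using insert.IH by blast
    obtain D where D: "\<And>\<epsilon>. 0 < \<epsilon> \<Longrightarrow> \<epsilon> \<le> 1 \<Longrightarrow> sqn \<Omega> (\<lambda>x. Vk \<epsilon> k x *\<^sub>R grad (\<eta> k) x) \<le> D" using one[of k] by blast
    have L: "(\<lambda>x. Vk \<epsilon> k x *\<^sub>R grad (\<eta> k) x) \<in> L2 \<Omega>" if e: "0 < \<epsilon>" for \<epsilon> k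
    proof -
      obtain M where M: "\<And>x. norm (grad (\<eta> k) x) \<le> M" by (rule \<eta>_grad_bounded[of k]) (rule that)
      show ?thesis by (rule scaleR_grad_\<eta>_L2[OF Vk_L2[OF e \<Omega>_sets \<Omega>(2)] M])
    qed
    have "sqn \<Omega> (\<lambda>x. \<Sum>k\<in>insert k A. Vk \<epsilon> k x *\<^sub>R grad (\<eta> k) x) \<le> 2 * D + 2 * C" if e: "0 < \<epsilon>" "\<epsilon> \<le> 1" for \<epsilon>
    proof -
      have "sqn \<Omega> (\<lambda>x. \<Sum>k\<in>insert k A. Vk \<epsilon> k x *\<^sub>R grad (\<eta> k) x)
          = sqn \<Omega> (\<lambda>x. Vk \<epsilon> k x *\<^sub>R grad (\<eta> k) x + (\<Sum>k\<in>A. Vk \<epsilon> k x *\<^sub>R grad (\<eta> k) x))"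
        using insert.hyps by simp
      also have "\<dots> \<le> 2 * sqn \<Omega> (\<lambda>x. Vk \<epsilon> k x *\<^sub>R grad (\<eta> k) x) + 2 * sqn \<Omega> (\<lambda>x. \<Sum>k\<in>A. Vk \<epsilon> k x *\<^sub>R grad (\<eta> k) x)"
        by (rule sqn_add_le[OF L[OF e(1)] L2_sum[OF L[OF e(1)]]])
      finally show ?thesis using C[OF e] D[OF e] by linarith
    qed
    then show ?case by blast
  qed
  then show ?thesis using that K'_finite unfolding R_bar_def[abs_def] by blast
qed

lemma AE_Pk_zero:
  assumes "\<epsilon> > 0" shows "AE x in lebesgue. \<forall>k. \<xi> k = 0 \<longrightarrow> Pk \<epsilon> k x = 0"
  unfolding AE_all_countable
proof
  fix k show "AE x in lebesgue. \<xi> k = 0 \<longrightarrow> Pk \<epsilon> k x = 0"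
  proof (cases "\<xi> k = 0")
    case True
    have "AE x in lebesgue. pc 0 (z k) (inverse \<epsilon> *\<^sub>R x + 0) = 0" using assms by (intro AE_affine pc_zero z) simp
    then show ?thesis by eventually_elim (simp add: Pk_def True)
  qed simp
qed

text \<open>The two differ by the weighted mean of grad \<psi> - \<xi>_k, which is at most \<tau> by
  Jensen, and by \<epsilon> times \<open>R_bar\<close>.\<close>

lemma gw_P_bar:
  assumes e: "\<epsilon> > 0"
  shows "AE x in lebesgue_on \<Omega>. (norm (gw \<epsilon> x - P_bar \<epsilon> x))\<^sup>2 \<le> 2 * \<tau>\<^sup>2 + 2 * \<epsilon>\<^sup>2 * (norm (R_bar \<epsilon> x))\<^sup>2"
  using AE_in_lebesgue_on[OF \<Omega>_sets] AE_lebesgue_onI[OF \<Omega>_sets AE_Pk_zero[OF e]]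
proof eventually_elim
  case (elim x)
  have PW: "Pk \<epsilon> k x = \<xi> k + Wk \<epsilon> k x" for k by (simp add: Pk_def Wk_def pc_def)
  have "(\<Sum>k\<in>K'. \<eta> k x *\<^sub>R Wk \<epsilon> k x) = (\<Sum>k\<in>K. \<eta> k x *\<^sub>R Wk \<epsilon> k x)"
  proof (rule sum.mono_neutral_left[OF K])
    show "\<forall>k\<in>K - K'. \<eta> k x *\<^sub>R Wk \<epsilon> k x = 0"
    proof
      \<comment> \<open>For a zero vector the cell field is the cell gradient alone, and it
        vanishes; hence the sum over K' may be extended to K.\<close>
      fix k assume "k \<in> K - K'"
      then have "\<xi> k = 0" by (simp add: K'_def)
      then show "\<eta> k x *\<^sub>R Wk \<epsilon> k x = 0" using elim(2) PW[of k] by simp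
    qed
  qed (auto simp: K'_def)
  moreover have "grad \<psi> x = (\<Sum>k\<in>K. \<eta> k x *\<^sub>R grad \<psi> x)" by (simp add: scaleR_sum_left[symmetric] \<eta>_sum[OF elim(1)])
  ultimately have "gw \<epsilon> x - P_bar \<epsilon> x = (\<Sum>k\<in>K. \<eta> k x *\<^sub>R grad \<psi> x) + (\<Sum>k\<in>K. \<eta> k x *\<^sub>R Wk \<epsilon> k x) + \<epsilon> *\<^sub>R R_bar \<epsilon> x
      - (\<Sum>k\<in>K. \<eta> k x *\<^sub>R (\<xi> k + Wk \<epsilon> k x))"
    unfolding gw_def P_bar_def PW by simp
  also have "\<dots> = (\<Sum>k\<in>K. \<eta> k x *\<^sub>R (grad \<psi> x - \<xi> k)) + \<epsilon> *\<^sub>R R_bar \<epsilon> x"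
    by (simp add: scaleR_add_right scaleR_diff_right sum.distrib sum_subtractf)
  finally have "(norm (gw \<epsilon> x - P_bar \<epsilon> x))\<^sup>2 \<le> 2 * (norm (\<Sum>k\<in>K. \<eta> k x *\<^sub>R (grad \<psi> x - \<xi> k)))\<^sup>2 + 2 * (norm (\<epsilon> *\<^sub>R R_bar \<epsilon> x))\<^sup>2"
    by (simp only: norm_add_power2_le)
  moreover have "(norm (\<Sum>k\<in>K. \<eta> k x *\<^sub>R (grad \<psi> x - \<xi> k)))\<^sup>2 \<le> \<tau>\<^sup>2"
  proof -
    have "(norm (\<Sum>k\<in>K. \<eta> k x *\<^sub>R (grad \<psi> x - \<xi> k)))\<^sup>2 \<le> (\<Sum>k\<in>K. \<eta> k x * (norm (grad \<psi> x - \<xi> k))\<^sup>2)"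
      by (rule norm_weighted_sum_power2_le[OF \<eta>_nonneg \<eta>_sum[OF elim(1)]])
    also have "\<dots> \<le> (\<Sum>k\<in>K. \<eta> k x * \<tau>\<^sup>2)"
    proof (rule sum_mono)
      fix k show "\<eta> k x * (norm (grad \<psi> x - \<xi> k))\<^sup>2 \<le> \<eta> k x * \<tau>\<^sup>2"
        using near_\<xi>[OF elim(1), of k] \<eta>_nonneg[of k x] by (cases "\<eta> k x = 0") (auto intro!: mult_left_mono power_mono)
    qed
    finally show ?thesis by (simp add: sum_distrib_right[symmetric] \<eta>_sum[OF elim(1)])
  qed
  ultimately show ?case by (simp add: power_mult_distrib)
qed

lemma
  fixes q :: "real^'n \<Rightarrow> real^'n"
  assumes e: "\<epsilon> > 0"
  defines "H \<equiv> \<lambda>x. \<Sum>k\<in>K. \<eta> k x * (norm (Pk \<epsilon> k x - q x))\<^sup>2"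
  shows gw_q: "AE x in lebesgue_on \<Omega>. (norm (gw \<epsilon> x - q x))\<^sup>2 \<le> 2 * (norm (gw \<epsilon> x - P_bar \<epsilon> x))\<^sup>2 + 2 * H x"
    and flux_q: "AE x in lebesgue_on \<Omega>. (norm (S_bar \<epsilon> x - a x (x /\<^sub>R \<epsilon>) (gw \<epsilon> x)))\<^sup>2
      \<le> 8 * \<beta>\<^sup>2 * H x + 4 * \<omega> \<tau> * (norm (q x))\<^sup>2 + 4 * \<beta>\<^sup>2 * (norm (gw \<epsilon> x - P_bar \<epsilon> x))\<^sup>2"
proof -
  have G: "(norm (gw \<epsilon> x - q x))\<^sup>2 \<le> 2 * (norm (gw \<epsilon> x - P_bar \<epsilon> x))\<^sup>2 + 2 * H x" if x: "x \<in> \<Omega>" for x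
  proof -
    have "P_bar \<epsilon> x - q x = (\<Sum>k\<in>K. \<eta> k x *\<^sub>R Pk \<epsilon> k x) - (\<Sum>k\<in>K. \<eta> k x *\<^sub>R q x)"
      by (simp add: P_bar_def scaleR_sum_left[symmetric] \<eta>_sum[OF x])
    also have "\<dots> = (\<Sum>k\<in>K. \<eta> k x *\<^sub>R (Pk \<epsilon> k x - q x))" by (simp add: scaleR_diff_right sum_subtractf)
    finally have "(norm (P_bar \<epsilon> x - q x))\<^sup>2 \<le> H x"
      unfolding H_def by (simp add: norm_weighted_sum_power2_le[OF \<eta>_nonneg \<eta>_sum[OF x]])
    then show ?thesis using norm_add_power2_le[of "gw \<epsilon> x - P_bar \<epsilon> x" "P_bar \<epsilon> x - q x"] by simp
  qed
  show "AE x in lebesgue_on \<Omega>. (norm (gw \<epsilon> x - q x))\<^sup>2 \<le> 2 * (norm (gw \<epsilon> x - P_bar \<epsilon> x))\<^sup>2 + 2 * H x"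
    using AE_in_lebesgue_on[OF \<Omega>_sets] by eventually_elim (rule G)
  show "AE x in lebesgue_on \<Omega>. (norm (S_bar \<epsilon> x - a x (x /\<^sub>R \<epsilon>) (gw \<epsilon> x)))\<^sup>2
      \<le> 8 * \<beta>\<^sup>2 * H x + 4 * \<omega> \<tau> * (norm (q x))\<^sup>2 + 4 * \<beta>\<^sup>2 * (norm (gw \<epsilon> x - P_bar \<epsilon> x))\<^sup>2"
    using AE_in_lebesgue_on[OF \<Omega>_sets] AE_lebesgue_onI[OF \<Omega>_sets AE_Pk_zero[OF e]] AE_lebesgue_onI[OF \<Omega>_sets AE_good_scaled[OF e]]
  proof eventually_elim
    case (elim x)
    note x = elim(1) and good = elim(3)
    let ?y = "x /\<^sub>R \<epsilon>"
    define A where "A = a x ?y (q x)"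
    have est: "\<eta> k x * (norm (Sk \<epsilon> k x - A))\<^sup>2 \<le> \<eta> k x * (2 * \<beta>\<^sup>2 * (norm (Pk \<epsilon> k x - q x))\<^sup>2 + 2 * \<omega> \<tau> * (norm (q x))\<^sup>2)" for k
    proof (cases "\<eta> k x = 0")
      case False
      have Sk: "Sk \<epsilon> k x = a (z k) ?y (Pk \<epsilon> k x)" by (simp add: Sk_def sig_def Pk_def)
      have "(norm (Sk \<epsilon> k x - A))\<^sup>2 \<le> 2 * \<beta>\<^sup>2 * (norm (Pk \<epsilon> k x - q x))\<^sup>2 + 2 * \<omega> \<tau> * (norm (q x))\<^sup>2"
      proof (cases "\<xi> k = 0")
        case True
        then have P: "Pk \<epsilon> k x = 0" using elim(2) by blast
        have "norm (Sk \<epsilon> k x - A) \<le> \<beta> * norm (Pk \<epsilon> k x - q x)"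
          using good_bound[OF good x, of "q x"] by (simp add: Sk P good_zero[OF good z] A_def)
        then have "(norm (Sk \<epsilon> k x - A))\<^sup>2 \<le> (\<beta> * norm (Pk \<epsilon> k x - q x))\<^sup>2" by (intro power_mono) auto
        moreover have "0 \<le> \<beta>\<^sup>2 * (norm (Pk \<epsilon> k x - q x))\<^sup>2" "0 \<le> \<omega> \<tau> * (norm (q x))\<^sup>2" using \<omega>_nonneg[of \<tau>] \<tau> by auto
        ultimately show ?thesis unfolding power_mult_distrib by linarith
      next
        case nz: False
        have 1: "(norm (a (z k) ?y (Pk \<epsilon> k x) - a (z k) ?y (q x)))\<^sup>2 \<le> \<beta>\<^sup>2 * (norm (Pk \<epsilon> k x - q x))\<^sup>2"
          unfolding power_mult_distrib[symmetric] by (intro power_mono good_lip[OF good z]) auto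
        have "(norm (a (z k) ?y (q x) - A))\<^sup>2 \<le> \<omega> (norm (z k - x)) * (norm (q x))\<^sup>2"
          using good x z unfolding good_def A_def by blast
        also have "\<dots> \<le> \<omega> \<tau> * (norm (q x))\<^sup>2"
          using near_z[OF x False nz] by (intro mult_right_mono monoD[OF \<omega>(2)]) (auto simp: norm_minus_commute)
        finally have 2: "(norm (a (z k) ?y (q x) - A))\<^sup>2 \<le> \<omega> \<tau> * (norm (q x))\<^sup>2" .
        have "(norm (Sk \<epsilon> k x - A))\<^sup>2 \<le> 2 * (norm (a (z k) ?y (Pk \<epsilon> k x) - a (z k) ?y (q x)))\<^sup>2 + 2 * (norm (a (z k) ?y (q x) - A))\<^sup>2"
          using norm_add_power2_le[of "a (z k) ?y (Pk \<epsilon> k x) - a (z k) ?y (q x)" "a (z k) ?y (q x) - A"] by (simp add: Sk)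
        then show ?thesis using 1 2 by linarith
      qed
      then show ?thesis using \<eta>_nonneg by (rule mult_left_mono)
    qed simp
    have "S_bar \<epsilon> x - A = (\<Sum>k\<in>K. \<eta> k x *\<^sub>R Sk \<epsilon> k x) - (\<Sum>k\<in>K. \<eta> k x *\<^sub>R A)"
      by (simp add: S_bar_def scaleR_sum_left[symmetric] \<eta>_sum[OF x])
    also have "\<dots> = (\<Sum>k\<in>K. \<eta> k x *\<^sub>R (Sk \<epsilon> k x - A))" by (simp add: scaleR_diff_right sum_subtractf)
    finally have "(norm (S_bar \<epsilon> x - A))\<^sup>2 \<le> (\<Sum>k\<in>K. \<eta> k x * (norm (Sk \<epsilon> k x - A))\<^sup>2)"
      by (simp add: norm_weighted_sum_power2_le[OF \<eta>_nonneg \<eta>_sum[OF x]])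
    also have "\<dots> \<le> (\<Sum>k\<in>K. \<eta> k x * (2 * \<beta>\<^sup>2 * (norm (Pk \<epsilon> k x - q x))\<^sup>2 + 2 * \<omega> \<tau> * (norm (q x))\<^sup>2))" by (intro sum_mono est)
    also have "\<dots> = (\<Sum>k\<in>K. 2 * \<beta>\<^sup>2 * (\<eta> k x * (norm (Pk \<epsilon> k x - q x))\<^sup>2) + \<eta> k x * (2 * \<omega> \<tau> * (norm (q x))\<^sup>2))"
      by (intro sum.cong refl) (simp add: algebra_simps)
    also have "\<dots> = 2 * \<beta>\<^sup>2 * H x + 2 * \<omega> \<tau> * (norm (q x))\<^sup>2"
      unfolding sum.distrib sum_distrib_left[symmetric] sum_distrib_right[symmetric] \<eta>_sum[OF x] H_def by simp
    finally have SA: "(norm (S_bar \<epsilon> x - A))\<^sup>2 \<le> 2 * \<beta>\<^sup>2 * H x + 2 * \<omega> \<tau> * (norm (q x))\<^sup>2" .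
    have "(norm (A - a x ?y (gw \<epsilon> x)))\<^sup>2 \<le> \<beta>\<^sup>2 * (norm (gw \<epsilon> x - q x))\<^sup>2"
      using power_mono[OF good_lip[OF good x, of "q x" "gw \<epsilon> x"], of 2] by (simp add: A_def power_mult_distrib norm_minus_commute)
    also have "\<dots> \<le> \<beta>\<^sup>2 * (2 * (norm (gw \<epsilon> x - P_bar \<epsilon> x))\<^sup>2 + 2 * H x)" by (intro mult_left_mono G x) simp
    finally have "(norm (A - a x ?y (gw \<epsilon> x)))\<^sup>2 \<le> 2 * \<beta>\<^sup>2 * (norm (gw \<epsilon> x - P_bar \<epsilon> x))\<^sup>2 + 2 * \<beta>\<^sup>2 * H x" by (simp add: algebra_simps)
    then show ?case
      using SA norm_add_power2_le[of "S_bar \<epsilon> x - A" "A - a x ?y (gw \<epsilon> x)"] by simp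
  qed
qed

lemma b_bar_error:
  fixes g :: "real^'n \<Rightarrow> real^'n"
  assumes x: "x \<in> \<Omega>"
  shows "(norm (b_hom a v x \<zeta> - b_bar x))\<^sup>2 \<le> C2 * (2 * \<tau>\<^sup>2 + 2 * (norm (grad \<psi> x - \<zeta>))\<^sup>2 + \<omega> \<tau> * L\<^sup>2)"
proof -
  let ?D = "2 * \<tau>\<^sup>2 + 2 * (norm (grad \<psi> x - \<zeta>))\<^sup>2 + \<omega> \<tau> * L\<^sup>2"
  have est: "\<eta> k x * (norm (b_hom a v x \<zeta> - bk k))\<^sup>2 \<le> \<eta> k x * (C2 * ?D)" for k
  proof (cases "\<eta> k x = 0")
    case False
    have 1: "(norm (\<xi> k - \<zeta>))\<^sup>2 \<le> 2 * \<tau>\<^sup>2 + 2 * (norm (grad \<psi> x - \<zeta>))\<^sup>2"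
    proof -
      have "(norm (grad \<psi> x - \<xi> k))\<^sup>2 \<le> \<tau>\<^sup>2" by (intro power_mono near_\<xi>[OF x False]) simp
      then show ?thesis using norm_add_power2_le[of "\<xi> k - grad \<psi> x" "grad \<psi> x - \<zeta>"] by (simp add: norm_minus_commute)
    qed
    have 2: "\<omega> (norm (z k - x)) * (norm (\<xi> k))\<^sup>2 \<le> \<omega> \<tau> * L\<^sup>2"
    proof (cases "\<xi> k = 0")
      case True then show ?thesis using \<omega>_nonneg[of \<tau>] \<tau> by simp
    next
      case nz: False
      have "\<omega> (norm (z k - x)) \<le> \<omega> \<tau>" using near_z[OF x False nz] by (intro monoD[OF \<omega>(2)]) (simp add: norm_minus_commute)
      then show ?thesis using \<xi>[of k] \<omega>_nonneg[of \<tau>] \<tau> by (intro mult_mono power_mono) auto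
    qed
    have "(norm (bk k - b_hom a v x \<zeta>))\<^sup>2 \<le> C2 * ((norm (\<xi> k - \<zeta>))\<^sup>2 + \<omega> (norm (z k - x)) * (norm (\<xi> k))\<^sup>2)"
      unfolding bk_def by (rule pc_lipschitz(2)[OF z x])
    also have "\<dots> \<le> C2 * ?D" using 1 2 by (intro mult_left_mono C2_nonneg) linarith
    finally show ?thesis using \<eta>_nonneg by (intro mult_left_mono) (auto simp: norm_minus_commute)
  qed simp
  have "b_hom a v x \<zeta> - b_bar x = (\<Sum>k\<in>K. \<eta> k x *\<^sub>R b_hom a v x \<zeta>) - (\<Sum>k\<in>K. \<eta> k x *\<^sub>R bk k)"
    by (simp add: b_bar_def scaleR_sum_left[symmetric] \<eta>_sum[OF x])
  also have "\<dots> = (\<Sum>k\<in>K. \<eta> k x *\<^sub>R (b_hom a v x \<zeta> - bk k))" by (simp add: scaleR_diff_right sum_subtractf)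
  finally have "(norm (b_hom a v x \<zeta> - b_bar x))\<^sup>2 \<le> (\<Sum>k\<in>K. \<eta> k x * (norm (b_hom a v x \<zeta> - bk k))\<^sup>2)"
    by (simp add: norm_weighted_sum_power2_le[OF \<eta>_nonneg \<eta>_sum[OF x]])
  also have "\<dots> \<le> (\<Sum>k\<in>K. \<eta> k x * (C2 * ?D))" by (intro sum_mono est)
  also have "\<dots> = C2 * ?D" by (simp only: sum_distrib_right[symmetric] \<eta>_sum[OF x] mult_1)
  finally show ?thesis .
qed

end

subsection \<open>Convergence\<close>

context homogenization
begin

lemma flux_L2:
  assumes e: "\<epsilon> > 0" and g: "g \<in> L2 \<Omega>" shows "(\<lambda>x. a x (x /\<^sub>R \<epsilon>) (g x)) \<in> L2 \<Omega>"
proof (rule L2_bound[OF _ g])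
  have "(\<lambda>x. x) \<in> borel_measurable (lebesgue_on \<Omega>)"
    by (rule continuous_imp_measurable_on_sets_lebesgue[OF continuous_on_id \<Omega>_sets])
  then show "(\<lambda>x. a x (x /\<^sub>R \<epsilon>) (g x)) \<in> borel_measurable (lebesgue_on \<Omega>)"
    by (rule flux_measurable[OF \<Omega>_sets _ _ L2_measurable[OF g] e])
  show "AE x in lebesgue_on \<Omega>. norm (a x (x /\<^sub>R \<epsilon>) (g x)) \<le> \<beta> * norm (g x)"
    using AE_in_lebesgue_on[OF \<Omega>_sets] AE_lebesgue_onI[OF \<Omega>_sets AE_good_scaled[OF e]]
    by eventually_elim (rule good_bound)
qed

lemma monotone_energy:
  assumes e: "\<epsilon> > 0" and g: "g1 \<in> L2 \<Omega>" "g2 \<in> L2 \<Omega>" "d \<in> L2 \<Omega>" and d: "AE x in lebesgue_on \<Omega>. d x = g1 x - g2 x"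
  shows "\<alpha> * sqn \<Omega> d \<le> (LINT x|lebesgue_on \<Omega>. a x (x /\<^sub>R \<epsilon>) (g1 x) \<bullet> d x) - (LINT x|lebesgue_on \<Omega>. a x (x /\<^sub>R \<epsilon>) (g2 x) \<bullet> d x)"
proof -
  note i = L2_inner_integrable[OF flux_L2[OF e g(1)] g(3)] L2_inner_integrable[OF flux_L2[OF e g(2)] g(3)]
  have "\<alpha> * sqn \<Omega> d = (LINT x|lebesgue_on \<Omega>. \<alpha> * (norm (d x))\<^sup>2)" by simp
  also have "\<dots> \<le> (LINT x|lebesgue_on \<Omega>. a x (x /\<^sub>R \<epsilon>) (g1 x) \<bullet> d x - a x (x /\<^sub>R \<epsilon>) (g2 x) \<bullet> d x)"
  proof (rule integral_mono_AE)
    show "integrable (lebesgue_on \<Omega>) (\<lambda>x. \<alpha> * (norm (d x))\<^sup>2)" using L2_integrable_sq[OF g(3)] by simp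
    show "integrable (lebesgue_on \<Omega>) (\<lambda>x. a x (x /\<^sub>R \<epsilon>) (g1 x) \<bullet> d x - a x (x /\<^sub>R \<epsilon>) (g2 x) \<bullet> d x)" using i by simp
    show "AE x in lebesgue_on \<Omega>. \<alpha> * (norm (d x))\<^sup>2 \<le> a x (x /\<^sub>R \<epsilon>) (g1 x) \<bullet> d x - a x (x /\<^sub>R \<epsilon>) (g2 x) \<bullet> d x"
      using d AE_in_lebesgue_on[OF \<Omega>_sets] AE_lebesgue_onI[OF \<Omega>_sets AE_good_scaled[OF e]]
    proof eventually_elim
      case (elim x)
      show ?case using good_mono[OF elim(3,2), of "g1 x" "g2 x"] by (simp only: elim(1) inner_diff_left)
    qed
  qed
  also have "\<dots> = (LINT x|lebesgue_on \<Omega>. a x (x /\<^sub>R \<epsilon>) (g1 x) \<bullet> d x) - (LINT x|lebesgue_on \<Omega>. a x (x /\<^sub>R \<epsilon>) (g2 x) \<bullet> d x)"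
    using i by simp
  finally show ?thesis .
qed

text \<open>\<open>C3\<close> bounds the flux error: 8 \<open>\<beta>\<^sup>2\<close> times 22
  \<open>C1\<close> from H, 4 \<open>C0\<close> from the modulus at the corrector and 4
  \<open>\<beta>\<^sup>2\<close> times 3 from the distance between Dw and the blended field. In
  \<open>C4\<close> the summand 2 stands for the right-hand sides and the oscillating flux,
  \<open>sqrt (5 * C2)\<close> for the homogenized flux, and the last root for the distance between
  Dw and the corrector.\<close>

definition C3 :: real where "C3 = 176 * \<beta>\<^sup>2 * C1 + 4 * C0 + 12 * \<beta>\<^sup>2"
definition C4 :: real where "C4 = (2 + sqrt (5 * C2) + sqrt C3) / \<alpha> + sqrt (6 + 44 * C1)"

lemma C3_nonneg: "0 \<le> C3" and C4_nonneg: "0 \<le> C4"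
proof -
  show "0 \<le> C3" using C0_ge C1_nonneg by (simp add: C3_def)
  then show "0 \<le> C4" using C1_nonneg C2_nonneg \<alpha>\<beta> by (simp add: C4_def)
qed

end

lemma L2_norm_le_sqrt: "sqn S g \<le> c * \<theta> \<Longrightarrow> L2_norm S g \<le> sqrt c * sqrt \<theta>"
  unfolding L2_norm_def real_sqrt_mult[symmetric] by (rule real_sqrt_le_mono)

context homogenization_partition
begin

text \<open>All approximation errors are calibrated to one level \<theta>, with constants that
  ignore the partition; only the threshold for \<epsilon> depends on it. The solution U and the
  right-hand side F are arbitrary, so that a single threshold serves all members of the
  sequence.\<close>

lemma corrector_estimate:
  assumes u: "u \<in> H12_0 \<Omega>"
    and f: "\<forall>\<phi>\<in>H12_0 \<Omega>. (LINT x|lebesgue_on \<Omega>. b_hom a v x (weak_grad \<Omega> u x) \<bullet> weak_grad \<Omega> \<phi> x) = f \<phi>"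
    and \<theta>: "\<theta> > 0" "sqn \<Omega> (\<lambda>x. grad \<psi> x - weak_grad \<Omega> u x) \<le> \<theta>" "\<tau>\<^sup>2 * measure lebesgue \<Omega> \<le> \<theta>"
      "\<omega> (2 * \<tau>) * L\<^sup>2 * measure lebesgue \<Omega> \<le> \<theta>" "\<omega> (2 * \<tau>) * sqn \<Omega> (weak_grad \<Omega> u) \<le> \<theta>"
  obtains \<epsilon>1 where "\<epsilon>1 > 0" "\<And>\<epsilon> p U F. 0 < \<epsilon> \<Longrightarrow> \<epsilon> < \<epsilon>1 \<Longrightarrow> \<forall>j\<in>inner_cells \<Omega> \<epsilon>. p j \<in> cell \<epsilon> j \<Longrightarrow>
      U \<in> H12_0 \<Omega> \<Longrightarrow>
      \<forall>\<phi>\<in>H12_0 \<Omega>. (LINT x|lebesgue_on \<Omega>. a x (x /\<^sub>R \<epsilon>) (weak_grad \<Omega> U x) \<bullet> weak_grad \<Omega> \<phi> x) = F \<phi> \<Longrightarrow>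
      \<forall>\<phi>\<in>H12_0 \<Omega>. F \<phi> - f \<phi> \<le> sqrt \<theta> * L2_norm \<Omega> (weak_grad \<Omega> \<phi>) \<Longrightarrow>
      L2_norm \<Omega> (\<lambda>x. weak_grad \<Omega> U x - corrector \<Omega> \<epsilon> v p (weak_grad \<Omega> u) x) \<le> C4 * sqrt \<theta>"
proof -
  define g where "g = weak_grad \<Omega> u"
  define m where "m = measure lebesgue \<Omega>"
  have m0: "0 \<le> m" by (simp add: m_def)
  have gL: "g \<in> L2 \<Omega>" unfolding g_def by (rule H12D(2)[OF H12_0_H12[OF u] \<Omega>(1)])
  obtain \<epsilon>0 where \<epsilon>0: "\<epsilon>0 > 0" "\<And>\<epsilon> p. 0 < \<epsilon> \<Longrightarrow> \<epsilon> < \<epsilon>0 \<Longrightarrow> \<forall>j\<in>inner_cells \<Omega> \<epsilon>. p j \<in> cell \<epsilon> j \<Longrightarrow>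
    (LINT x|lebesgue_on \<Omega>. (\<Sum>k\<in>K. \<eta> k x * (norm (Pk \<epsilon> k x - corrector \<Omega> \<epsilon> v p g x))\<^sup>2))
    \<le> 2 * C1 * ((8 * \<tau>\<^sup>2 + \<omega> (2 * \<tau>) * L\<^sup>2) * measure lebesgue \<Omega> + 2 * sqn \<Omega> (\<lambda>x. grad \<psi> x - g x))"
    by (rule corrector_error[OF gL]) (rule that)
  obtain CR where CR: "\<And>\<epsilon>. 0 < \<epsilon> \<Longrightarrow> \<epsilon> \<le> 1 \<Longrightarrow> sqn \<Omega> (R_bar \<epsilon>) \<le> CR"
    by (rule R_bar_bound) (rule that)
  obtain Cd where Cd: "Cd \<ge> 0" "\<And>\<epsilon> u. 0 < \<epsilon> \<Longrightarrow> \<epsilon> \<le> 1 \<Longrightarrow> u \<in> H12_0 \<Omega> \<Longrightarrow>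
    (LINT x|lebesgue_on \<Omega>. (b_bar x - S_bar \<epsilon> x) \<bullet> weak_grad \<Omega> u x) \<le> Cd * \<epsilon> * L2_norm \<Omega> (weak_grad \<Omega> u)"
    by (rule flux_divergence_bound) (rule that)
  \<comment> \<open>The entries serve the corrector error, the uniform bounds for \<epsilon> at most
    1, the oscillating flux and the remainder \<open>R_bar\<close>. The modulus of CR and the added
    1 keep the last divisor positive.\<close>
  define \<epsilon>1 where "\<epsilon>1 = min (min \<epsilon>0 1) (min (sqrt \<theta> / (Cd + 1)) (\<theta> / (2 * \<bar>CR\<bar> + 1)))"
  have st: "sqrt \<theta> > 0" "(sqrt \<theta>)\<^sup>2 = \<theta>" using \<theta>(1) by auto
  have w\<tau>: "0 \<le> \<omega> \<tau>" "\<omega> \<tau> \<le> \<omega> (2 * \<tau>)" using \<omega>_nonneg[of \<tau>] \<tau> by (auto intro: monoD[OF \<omega>(2)])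
  show ?thesis
  proof (rule that[of \<epsilon>1])
    show "\<epsilon>1 > 0" using \<epsilon>0(1) Cd(1) st(1) \<theta>(1) by (simp add: \<epsilon>1_def)
    fix \<epsilon> :: real and p U F
    assume e: "0 < \<epsilon>" "\<epsilon> < \<epsilon>1" and ps: "\<forall>j\<in>inner_cells \<Omega> \<epsilon>. p j \<in> cell \<epsilon> j"
      and U: "U \<in> H12_0 \<Omega>"
      and F: "\<forall>\<phi>\<in>H12_0 \<Omega>. (LINT x|lebesgue_on \<Omega>. a x (x /\<^sub>R \<epsilon>) (weak_grad \<Omega> U x) \<bullet> weak_grad \<Omega> \<phi> x) = F \<phi>"
      and Ff: "\<forall>\<phi>\<in>H12_0 \<Omega>. F \<phi> - f \<phi> \<le> sqrt \<theta> * L2_norm \<Omega> (weak_grad \<Omega> \<phi>)"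
    have p: "\<And>j. j \<in> inner_cells \<Omega> \<epsilon> \<Longrightarrow> p j \<in> cell \<epsilon> j" using ps by blast
    have e1: "\<epsilon> < \<epsilon>0" "\<epsilon> \<le> 1" "\<epsilon> < sqrt \<theta> / (Cd + 1)" "\<epsilon> < \<theta> / (2 * \<bar>CR\<bar> + 1)" using e(2) by (auto simp: \<epsilon>1_def)
    have eCd: "Cd * \<epsilon> \<le> sqrt \<theta>"
    proof -
      have "\<epsilon> * (Cd + 1) < sqrt \<theta>" using e1(3) Cd(1) by (simp add: pos_less_divide_eq)
      then show ?thesis using e(1) by (simp add: algebra_simps)
    qed
    have eCR: "2 * \<epsilon>\<^sup>2 * CR \<le> \<theta>"
    proof -
      have "\<epsilon> * (2 * \<bar>CR\<bar> + 1) < \<theta>" using e1(4) by (simp add: pos_less_divide_eq)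
      then have "\<epsilon> * (2 * \<bar>CR\<bar>) \<le> \<theta>" using e(1) by (simp add: algebra_simps)
      moreover have "\<epsilon>\<^sup>2 * (2 * CR) \<le> \<epsilon>\<^sup>2 * (2 * \<bar>CR\<bar>)" by (intro mult_left_mono) simp_all
      moreover have "\<epsilon>\<^sup>2 * (2 * \<bar>CR\<bar>) \<le> \<epsilon> * (2 * \<bar>CR\<bar>)"
        using e(1) e1(2) by (intro mult_right_mono) (simp_all add: power2_eq_square mult_left_le)
      ultimately show ?thesis by (simp add: mult_ac)
    qed
    define q where "q = corrector \<Omega> \<epsilon> v p g"
    define H where "H = (\<lambda>x. \<Sum>k\<in>K. \<eta> k x * (norm (Pk \<epsilon> k x - q x))\<^sup>2)"
    define D where "D = weak_grad \<Omega> U"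
    define N where "N = (\<lambda>x. gw \<epsilon> x - P_bar \<epsilon> x)"
    have qL: "q \<in> L2 \<Omega>" unfolding q_def by (rule corrector_L2[OF e(1) p gL])
    have qs: "sqn \<Omega> q \<le> C0 * sqn \<Omega> g" unfolding q_def by (rule corrector_sqn[OF e(1) p gL])
    have DL: "D \<in> L2 \<Omega>" unfolding D_def by (rule H12D(2)[OF H12_0_H12[OF U] \<Omega>(1)])
    have WL: "gw \<epsilon> \<in> L2 \<Omega>" by (rule gw_L2[OF e(1) \<Omega>_sets \<Omega>(2)])
    have NL: "N \<in> L2 \<Omega>" unfolding N_def by (intro L2_diff WL P_bar_L2 e)
    have RL: "R_bar \<epsilon> \<in> L2 \<Omega>" by (rule R_bar_L2[OF e(1) \<Omega>_sets \<Omega>(2)])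
    have ci: "integrable (lebesgue_on \<Omega>) (\<lambda>x. c)" for c :: real by (rule L2_imp_integrable[OF L2_const[OF \<Omega>_lmeasurable] \<Omega>_lmeasurable])
    have Hi: "integrable (lebesgue_on \<Omega>) H" unfolding H_def by (intro sum_weighted_integrable(1) \<eta> L2_diff Pk_L2 e qL)
    have "(LINT x|lebesgue_on \<Omega>. H x) \<le> 2 * C1 * ((8 * \<tau>\<^sup>2 + \<omega> (2 * \<tau>) * L\<^sup>2) * m + 2 * sqn \<Omega> (\<lambda>x. grad \<psi> x - g x))"
      unfolding H_def q_def m_def by (rule \<epsilon>0(2)[OF e(1) e1(1) ps])
    \<comment> \<open>The 11 is 8 from the term with the square of \<tau>, 1 from the modulus and 2
      from the distance of grad \<psi> to Du.\<close>
    also have "\<dots> \<le> 2 * C1 * (11 * \<theta>)"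
      using \<theta>(2-4) C1_nonneg by (intro mult_left_mono) (auto simp: g_def m_def algebra_simps)
    finally have EH: "(LINT x|lebesgue_on \<Omega>. H x) \<le> 22 * C1 * \<theta>" by simp
    \<comment> \<open>Two \<theta> come from the oscillation of grad \<psi>, one from the remainder
      with factor \<epsilon>^2.\<close>
    have sN: "sqn \<Omega> N \<le> 3 * \<theta>"
    proof -
      have i: "integrable (lebesgue_on \<Omega>) (\<lambda>x. 2 * \<epsilon>\<^sup>2 * (norm (R_bar \<epsilon> x))\<^sup>2)" using L2_integrable_sq[OF RL] by simp
      have "sqn \<Omega> N \<le> (LINT x|lebesgue_on \<Omega>. 2 * \<tau>\<^sup>2 + 2 * \<epsilon>\<^sup>2 * (norm (R_bar \<epsilon> x))\<^sup>2)"
        using Bochner_Integration.integrable_add[OF ci i] gw_P_bar[OF e(1)] unfolding N_def[symmetric]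
        by (intro integral_mono_AE L2_integrable_sq[OF NL]) (simp_all add: N_def)
      also have "\<dots> = 2 * (\<tau>\<^sup>2 * m) + 2 * \<epsilon>\<^sup>2 * sqn \<Omega> (R_bar \<epsilon>)"
        using Bochner_Integration.integral_add[OF ci i, of "2 * \<tau>\<^sup>2"] by (simp add: m_def measure_restrict_space \<Omega>_sets)
      also have "2 * \<epsilon>\<^sup>2 * sqn \<Omega> (R_bar \<epsilon>) \<le> 2 * \<epsilon>\<^sup>2 * CR" by (intro mult_left_mono CR e e1) simp
      finally show ?thesis using \<theta>(3) eCR by (simp add: m_def)
    qed
    have sWq: "sqn \<Omega> (\<lambda>x. gw \<epsilon> x - q x) \<le> (6 + 44 * C1) * \<theta>"
    proof -
      have i: "integrable (lebesgue_on \<Omega>) (\<lambda>x. 2 * (norm (N x))\<^sup>2)" "integrable (lebesgue_on \<Omega>) (\<lambda>x. 2 * H x)" using L2_integrable_sq[OF NL] Hi by simp_all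
      have "sqn \<Omega> (\<lambda>x. gw \<epsilon> x - q x) \<le> (LINT x|lebesgue_on \<Omega>. 2 * (norm (N x))\<^sup>2 + 2 * H x)"
      proof (rule integral_mono_AE[OF L2_integrable_sq[OF L2_diff[OF WL qL]] Bochner_Integration.integrable_add[OF i]])
        show "AE x in lebesgue_on \<Omega>. (norm (gw \<epsilon> x - q x))\<^sup>2 \<le> 2 * (norm (N x))\<^sup>2 + 2 * H x"
          unfolding N_def H_def by (rule gw_q[OF e(1)])
      qed
      also have "\<dots> = 2 * sqn \<Omega> N + 2 * (LINT x|lebesgue_on \<Omega>. H x)" using Bochner_Integration.integral_add[OF i] by simp
      finally show ?thesis using sN EH by (simp add: algebra_simps)
    qed
    define T where "T = (\<lambda>x. S_bar \<epsilon> x - a x (x /\<^sub>R \<epsilon>) (gw \<epsilon> x))"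
    have aW: "(\<lambda>x. a x (x /\<^sub>R \<epsilon>) (gw \<epsilon> x)) \<in> L2 \<Omega>" by (rule flux_L2[OF e(1) WL])
    have TL: "T \<in> L2 \<Omega>" unfolding T_def by (intro L2_diff S_bar_L2 aW e)
    have sT: "sqn \<Omega> T \<le> C3 * \<theta>"
    proof -
      have i: "integrable (lebesgue_on \<Omega>) (\<lambda>x. 8 * \<beta>\<^sup>2 * H x)" "integrable (lebesgue_on \<Omega>) (\<lambda>x. 4 * \<omega> \<tau> * (norm (q x))\<^sup>2)"
        "integrable (lebesgue_on \<Omega>) (\<lambda>x. 4 * \<beta>\<^sup>2 * (norm (N x))\<^sup>2)"
        using L2_integrable_sq[OF NL] L2_integrable_sq[OF qL] Hi by simp_all
      note i2 = Bochner_Integration.integrable_add[OF i(1,2)]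
      have "sqn \<Omega> T \<le> (LINT x|lebesgue_on \<Omega>. 8 * \<beta>\<^sup>2 * H x + 4 * \<omega> \<tau> * (norm (q x))\<^sup>2 + 4 * \<beta>\<^sup>2 * (norm (N x))\<^sup>2)"
      proof (rule integral_mono_AE[OF L2_integrable_sq[OF TL] Bochner_Integration.integrable_add[OF i2 i(3)]])
        show "AE x in lebesgue_on \<Omega>. (norm (T x))\<^sup>2 \<le> 8 * \<beta>\<^sup>2 * H x + 4 * \<omega> \<tau> * (norm (q x))\<^sup>2 + 4 * \<beta>\<^sup>2 * (norm (N x))\<^sup>2"
          unfolding T_def N_def H_def by (rule flux_q[OF e(1)])
      qed
      also have "\<dots> = 8 * \<beta>\<^sup>2 * (LINT x|lebesgue_on \<Omega>. H x) + 4 * (\<omega> \<tau> * sqn \<Omega> q) + 4 * \<beta>\<^sup>2 * sqn \<Omega> N"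
        using Bochner_Integration.integral_add[OF i2 i(3)] Bochner_Integration.integral_add[OF i(1,2)] by simp
      also have "\<dots> \<le> 8 * \<beta>\<^sup>2 * (22 * C1 * \<theta>) + 4 * (C0 * \<theta>) + 4 * \<beta>\<^sup>2 * (3 * \<theta>)"
      proof (intro add_mono mult_left_mono EH sN)
        have "\<omega> \<tau> * sqn \<Omega> q \<le> \<omega> (2 * \<tau>) * (C0 * sqn \<Omega> g)" using w\<tau> qs by (intro mult_mono) (auto simp: sqn_nonneg)
        also have "\<dots> = C0 * (\<omega> (2 * \<tau>) * sqn \<Omega> g)" by simp
        also have "\<dots> \<le> C0 * \<theta>" using \<theta>(5) C0_ge by (intro mult_left_mono) (auto simp: g_def)
        finally show "\<omega> \<tau> * sqn \<Omega> q \<le> C0 * \<theta>" .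
      qed auto
      finally show ?thesis by (simp add: C3_def algebra_simps)
    qed
    define b where "b = (\<lambda>x. b_hom a v x (g x))"
    have bL: "b \<in> L2 \<Omega>" unfolding b_def by (rule b_hom_L2[OF gL])
    have dbL: "(\<lambda>x. b x - b_bar x) \<in> L2 \<Omega>" by (rule L2_diff[OF bL b_bar_L2])
    have sb: "sqn \<Omega> (\<lambda>x. b x - b_bar x) \<le> 5 * C2 * \<theta>"
    proof -
      have \<psi>L: "grad \<psi> \<in> L2 \<Omega>" by (rule test_functions_L2(2)[OF \<psi> \<Omega>_sets])
      define c where "c = 2 * \<tau>\<^sup>2 + \<omega> \<tau> * L\<^sup>2"
      have i: "integrable (lebesgue_on \<Omega>) (\<lambda>x. 2 * (norm (grad \<psi> x - g x))\<^sup>2)" using L2_integrable_sq[OF L2_diff[OF \<psi>L gL]] by simp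
      note i2 = Bochner_Integration.integrable_add[OF ci[of c] i]
      have "sqn \<Omega> (\<lambda>x. b x - b_bar x) \<le> (LINT x|lebesgue_on \<Omega>. C2 * (c + 2 * (norm (grad \<psi> x - g x))\<^sup>2))"
      proof (rule integral_mono_AE[OF L2_integrable_sq[OF dbL]])
        show "integrable (lebesgue_on \<Omega>) (\<lambda>x. C2 * (c + 2 * (norm (grad \<psi> x - g x))\<^sup>2))" using i2 by simp
        show "AE x in lebesgue_on \<Omega>. (norm (b x - b_bar x))\<^sup>2 \<le> C2 * (c + 2 * (norm (grad \<psi> x - g x))\<^sup>2)"
          using AE_in_lebesgue_on[OF \<Omega>_sets]
        proof eventually_elim
          case (elim x)
          show ?case using b_bar_error[OF elim, of "g x"] by (simp add: b_def c_def algebra_simps)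
        qed
      qed
      also have "\<dots> = C2 * (LINT x|lebesgue_on \<Omega>. c + 2 * (norm (grad \<psi> x - g x))\<^sup>2)" by simp
      also have "(LINT x|lebesgue_on \<Omega>. c + 2 * (norm (grad \<psi> x - g x))\<^sup>2) = c * m + 2 * sqn \<Omega> (\<lambda>x. grad \<psi> x - g x)"
        using Bochner_Integration.integral_add[OF ci[of c] i] by (simp add: m_def measure_restrict_space \<Omega>_sets)
      \<comment> \<open>The 5 is 2 from the square of \<tau>, 1 from the modulus and 2 from the
        distance of grad \<psi> to Du.\<close>
      also have "C2 * \<dots> \<le> C2 * (5 * \<theta>)"
      proof (rule mult_left_mono[OF _ C2_nonneg])
        have "\<omega> \<tau> * (L\<^sup>2 * m) \<le> \<omega> (2 * \<tau>) * (L\<^sup>2 * m)" using w\<tau> m0 by (intro mult_right_mono) auto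
        then show "c * m + 2 * sqn \<Omega> (\<lambda>x. grad \<psi> x - g x) \<le> 5 * \<theta>"
          using \<theta>(2-4) by (simp add: c_def m_def g_def algebra_simps)
      qed
      finally show ?thesis by simp
    qed
    define \<chi>' where "\<chi>' = (\<lambda>x. U x - w \<epsilon> x)"
    define d where "d = weak_grad \<Omega> \<chi>'"
    have \<chi>: "\<chi>' \<in> H12_0 \<Omega>" unfolding \<chi>'_def by (rule H12_0_diff[OF U w_H12_0[OF e(1)] \<Omega>(1)])
    have dL: "d \<in> L2 \<Omega>" unfolding d_def by (rule H12D(2)[OF H12_0_H12[OF \<chi>] \<Omega>(1)])
    have dg: "AE x in lebesgue_on \<Omega>. d x = D x - gw \<epsilon> x"
      unfolding d_def \<chi>'_def D_def
      by (rule weak_grad_AE[OF \<Omega>(1) is_weak_grad_diff[OF H12D(3)[OF H12_0_H12[OF U] \<Omega>(1)] w_weak_grad_\<Omega>[OF e(1)] \<Omega>_sets]])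
    define X where "X = L2_norm \<Omega> d"
    have X0: "0 \<le> X" unfolding X_def by (rule L2_norm_nonneg)
    have "\<alpha> * X\<^sup>2 \<le> (LINT x|lebesgue_on \<Omega>. a x (x /\<^sub>R \<epsilon>) (D x) \<bullet> d x) - (LINT x|lebesgue_on \<Omega>. a x (x /\<^sub>R \<epsilon>) (gw \<epsilon> x) \<bullet> d x)"
      unfolding X_def L2_norm_power2 by (rule monotone_energy[OF e(1) DL WL dL dg])
    also have "(LINT x|lebesgue_on \<Omega>. a x (x /\<^sub>R \<epsilon>) (D x) \<bullet> d x) = F \<chi>'" unfolding D_def d_def by (rule bspec[OF F \<chi>])
    \<comment> \<open>The flux of w is reached from the homogenized flux by a telescoping sum
      through \<open>b_bar\<close> and \<open>S_bar\<close>. Only the middle difference oscillates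
      without being small in L2; it is small solely when tested with a gradient such as d.\<close>
    also have "(LINT x|lebesgue_on \<Omega>. a x (x /\<^sub>R \<epsilon>) (gw \<epsilon> x) \<bullet> d x)
        = f \<chi>' - (LINT x|lebesgue_on \<Omega>. (b x - b_bar x) \<bullet> d x) - (LINT x|lebesgue_on \<Omega>. (b_bar x - S_bar \<epsilon> x) \<bullet> d x) - (LINT x|lebesgue_on \<Omega>. T x \<bullet> d x)"
    proof -
      have "f \<chi>' = (LINT x|lebesgue_on \<Omega>. b x \<bullet> d x)" unfolding b_def d_def g_def by (rule bspec[OF f \<chi>, symmetric])
      moreover have "(LINT x|lebesgue_on \<Omega>. (b x - b_bar x) \<bullet> d x) = (LINT x|lebesgue_on \<Omega>. b x \<bullet> d x) - (LINT x|lebesgue_on \<Omega>. b_bar x \<bullet> d x)"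
        using L2_inner_integrable[OF bL dL] L2_inner_integrable[OF b_bar_L2 dL] by (simp add: inner_diff_left)
      moreover have "(LINT x|lebesgue_on \<Omega>. (b_bar x - S_bar \<epsilon> x) \<bullet> d x) = (LINT x|lebesgue_on \<Omega>. b_bar x \<bullet> d x) - (LINT x|lebesgue_on \<Omega>. S_bar \<epsilon> x \<bullet> d x)"
        using L2_inner_integrable[OF S_bar_L2[OF e(1)] dL] L2_inner_integrable[OF b_bar_L2 dL] by (simp add: inner_diff_left)
      moreover have "(LINT x|lebesgue_on \<Omega>. T x \<bullet> d x) = (LINT x|lebesgue_on \<Omega>. S_bar \<epsilon> x \<bullet> d x) - (LINT x|lebesgue_on \<Omega>. a x (x /\<^sub>R \<epsilon>) (gw \<epsilon> x) \<bullet> d x)"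
        using L2_inner_integrable[OF S_bar_L2[OF e(1)] dL] L2_inner_integrable[OF aW dL] by (simp add: T_def inner_diff_left)
      ultimately show ?thesis by simp
    qed
    finally have "\<alpha> * X\<^sup>2 \<le> (F \<chi>' - f \<chi>') + (LINT x|lebesgue_on \<Omega>. (b x - b_bar x) \<bullet> d x)
        + (LINT x|lebesgue_on \<Omega>. (b_bar x - S_bar \<epsilon> x) \<bullet> d x) + (LINT x|lebesgue_on \<Omega>. T x \<bullet> d x)" by simp
    also have "\<dots> \<le> sqrt \<theta> * X + (sqrt (5 * C2) * sqrt \<theta>) * X + sqrt \<theta> * X + (sqrt C3 * sqrt \<theta>) * X"
    proof (intro add_mono)
      show "F \<chi>' - f \<chi>' \<le> sqrt \<theta> * X" unfolding X_def d_def by (rule bspec[OF Ff \<chi>])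
      have "(LINT x|lebesgue_on \<Omega>. (b x - b_bar x) \<bullet> d x) \<le> L2_norm \<Omega> (\<lambda>x. b x - b_bar x) * X" unfolding X_def by (rule L2_inner_le[OF dbL dL])
      also have "\<dots> \<le> (sqrt (5 * C2) * sqrt \<theta>) * X" by (intro mult_right_mono L2_norm_le_sqrt sb X0)
      finally show "(LINT x|lebesgue_on \<Omega>. (b x - b_bar x) \<bullet> d x) \<le> (sqrt (5 * C2) * sqrt \<theta>) * X" .
      have "(LINT x|lebesgue_on \<Omega>. (b_bar x - S_bar \<epsilon> x) \<bullet> d x) \<le> Cd * \<epsilon> * X" unfolding X_def d_def by (rule Cd(2)[OF e(1) e1(2) \<chi>])
      also have "\<dots> \<le> sqrt \<theta> * X" by (intro mult_right_mono eCd X0)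
      finally show "(LINT x|lebesgue_on \<Omega>. (b_bar x - S_bar \<epsilon> x) \<bullet> d x) \<le> sqrt \<theta> * X" .
      have "(LINT x|lebesgue_on \<Omega>. T x \<bullet> d x) \<le> L2_norm \<Omega> T * X" unfolding X_def by (rule L2_inner_le[OF TL dL])
      also have "\<dots> \<le> (sqrt C3 * sqrt \<theta>) * X" by (intro mult_right_mono L2_norm_le_sqrt sT X0)
      finally show "(LINT x|lebesgue_on \<Omega>. T x \<bullet> d x) \<le> (sqrt C3 * sqrt \<theta>) * X" .
    qed
    finally have E: "(\<alpha> * X) * X \<le> ((2 + sqrt (5 * C2) + sqrt C3) * sqrt \<theta>) * X" by (simp add: power2_eq_square algebra_simps)
    have "X \<le> (2 + sqrt (5 * C2) + sqrt C3) / \<alpha> * sqrt \<theta>"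
    proof (cases "X = 0")
      case True then show ?thesis using C3_nonneg C2_nonneg \<alpha>\<beta> st(1) by simp
    next
      case False
      then have "X > 0" using X0 by simp
      with E have "\<alpha> * X \<le> (2 + sqrt (5 * C2) + sqrt C3) * sqrt \<theta>" by (rule mult_right_le_imp_le)
      then show ?thesis using \<alpha>\<beta> by (simp add: pos_le_divide_eq mult_ac)
    qed
    moreover have "L2_norm \<Omega> (\<lambda>x. gw \<epsilon> x - q x) \<le> sqrt (6 + 44 * C1) * sqrt \<theta>" by (rule L2_norm_le_sqrt[OF sWq])
    moreover have "L2_norm \<Omega> (\<lambda>x. D x - q x) \<le> X + L2_norm \<Omega> (\<lambda>x. gw \<epsilon> x - q x)"
    proof -
      have "L2_norm \<Omega> (\<lambda>x. D x - q x) = L2_norm \<Omega> (\<lambda>x. d x + (gw \<epsilon> x - q x))"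
        unfolding L2_norm_def
        by (rule arg_cong[where f = sqrt], rule sqn_cong_AE[OF L2_diff[OF DL qL] \<Omega>_sets]) (use dg in eventually_elim, simp)
      also have "\<dots> \<le> X + L2_norm \<Omega> (\<lambda>x. gw \<epsilon> x - q x)" unfolding X_def by (intro L2_norm_add dL L2_diff WL qL)
      finally show ?thesis .
    qed
    ultimately have "L2_norm \<Omega> (\<lambda>x. D x - q x) \<le> C4 * sqrt \<theta>" by (simp add: C4_def distrib_right)
    then show "L2_norm \<Omega> (\<lambda>x. weak_grad \<Omega> U x - corrector \<Omega> \<epsilon> v p (weak_grad \<Omega> u) x) \<le> C4 * sqrt \<theta>"
      by (simp add: D_def q_def g_def)
  qed
qed

end

context homogenization
begin

lemma modulus_small:
  assumes "e > 0" "c \<ge> 0" "e' > 0"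
  obtains \<tau> where "\<tau> > 0" "\<tau>\<^sup>2 * c \<le> e" "\<omega> (2 * \<tau>) \<le> e'"
proof -
  have "((\<lambda>\<tau>::real. 2 * \<tau>) \<longlongrightarrow> 2 * 0) (at_right 0)" by (intro tendsto_intros)
  then have "((\<lambda>\<tau>. \<omega> (2 * \<tau>)) \<longlongrightarrow> \<omega> (2 * 0)) (at_right 0)"
    by (rule continuous_on_tendsto_compose[OF \<omega>(1)]) simp_all
  then have 1: "\<forall>\<^sub>F \<tau> in at_right 0. \<omega> (2 * \<tau>) < e'" using assms(3) \<omega>(3) by (intro order_tendstoD(2)) auto
  have "((\<lambda>\<tau>::real. \<tau>\<^sup>2 * c) \<longlongrightarrow> 0\<^sup>2 * c) (at_right 0)" by (intro tendsto_intros)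
  then have 2: "\<forall>\<^sub>F \<tau> in at_right 0. \<tau>\<^sup>2 * c < e" using assms(1) by (intro order_tendstoD(2)) auto
  have 3: "\<forall>\<^sub>F \<tau> in at_right (0::real). \<tau> > 0" by (rule eventually_at_right_less)
  have "\<forall>\<^sub>F \<tau> in at_right 0. \<tau> > 0 \<and> \<tau>\<^sup>2 * c \<le> e \<and> \<omega> (2 * \<tau>) \<le> e'" using 1 2 3 by eventually_elim simp
  then obtain \<tau> where "\<tau> > 0 \<and> \<tau>\<^sup>2 * c \<le> e \<and> \<omega> (2 * \<tau>) \<le> e'"
    using eventually_happens'[OF trivial_limit_at_right_real] by blast
  then show ?thesis by (intro that[of \<tau>]) auto
qed

text \<open>Here the parameters are chosen: \<psi> from \<theta>, then the gradient bound L, then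
  \<tau> from the modulus, then the partition with its Lipschitz constant B.\<close>

lemma corrector_estimate_small:
  assumes ne: "\<Omega> \<noteq> {}" and u: "u \<in> H12_0 \<Omega>"
    and f: "\<forall>\<phi>\<in>H12_0 \<Omega>. (LINT x|lebesgue_on \<Omega>. b_hom a v x (weak_grad \<Omega> u x) \<bullet> weak_grad \<Omega> \<phi> x) = f \<phi>"
    and \<theta>: "\<theta> > 0"
  obtains \<epsilon>1 where "\<epsilon>1 > 0" "\<And>\<epsilon> p U F. 0 < \<epsilon> \<Longrightarrow> \<epsilon> < \<epsilon>1 \<Longrightarrow> \<forall>j\<in>inner_cells \<Omega> \<epsilon>. p j \<in> cell \<epsilon> j \<Longrightarrow>
      U \<in> H12_0 \<Omega> \<Longrightarrow>
      \<forall>\<phi>\<in>H12_0 \<Omega>. (LINT x|lebesgue_on \<Omega>. a x (x /\<^sub>R \<epsilon>) (weak_grad \<Omega> U x) \<bullet> weak_grad \<Omega> \<phi> x) = F \<phi> \<Longrightarrow>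
      \<forall>\<phi>\<in>H12_0 \<Omega>. F \<phi> - f \<phi> \<le> sqrt \<theta> * L2_norm \<Omega> (weak_grad \<Omega> \<phi>) \<Longrightarrow>
      L2_norm \<Omega> (\<lambda>x. weak_grad \<Omega> U x - corrector \<Omega> \<epsilon> v p (weak_grad \<Omega> u) x) \<le> C4 * sqrt \<theta>"
proof -
  let ?g = "weak_grad \<Omega> u" and ?m = "measure lebesgue \<Omega>"
  obtain \<psi> where \<psi>: "\<psi> \<in> test_functions \<Omega>" "sqn \<Omega> (\<lambda>x. ?g x - grad \<psi> x) < \<theta>"
    by (rule H12_0D[OF u \<Omega>(1) \<theta>]) (rule that)
  obtain L where L: "L > 0" "\<And>x. norm (grad \<psi> x) \<le> L" by (rule test_functions_bounded[OF \<psi>(1)]) (rule that)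
  obtain B0 where B0: "B0 > 0" "\<And>x y. norm (grad \<psi> x - grad \<psi> y) \<le> B0 * norm (x - y)"
    by (rule test_functions_grad_lipschitz[OF \<psi>(1)]) (rule that)
  \<comment> \<open>M dominates both quantities that the modulus has to beat, so one bound
    \<theta>/M on it settles both conditions; the added 1 makes M positive.\<close>
  define M where "M = L\<^sup>2 * ?m + sqn \<Omega> ?g + 1"
  have G0: "0 \<le> sqn \<Omega> ?g" by (rule sqn_nonneg)
  have M: "M > 0" "L\<^sup>2 * ?m \<le> M" "sqn \<Omega> ?g \<le> M"
  proof -
    have "0 \<le> L\<^sup>2 * ?m" by simp
    with G0 show "M > 0" "L\<^sup>2 * ?m \<le> M" "sqn \<Omega> ?g \<le> M" unfolding M_def by linarith+
  qed
  obtain \<tau> where \<tau>: "\<tau> > 0" "\<tau>\<^sup>2 * ?m \<le> \<theta>" "\<omega> (2 * \<tau>) \<le> \<theta> / M"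
    by (rule modulus_small[of \<theta> ?m "\<theta> / M"]) (use \<theta> M that in auto)
  have w0: "0 \<le> \<omega> (2 * \<tau>)" using \<tau>(1) by (intro \<omega>_nonneg) simp
  have wM: "\<omega> (2 * \<tau>) * c \<le> \<theta>" if "0 \<le> c" "c \<le> M" for c
  proof -
    have "\<omega> (2 * \<tau>) * c \<le> (\<theta> / M) * M" using that \<tau>(3) w0 \<theta> M(1) by (intro mult_mono) auto
    then show ?thesis using M(1) by simp
  qed
  obtain K :: "(int^'n) set" and \<eta> z \<xi> where K: "finite K" "\<And>k. \<eta> k \<in> test_functions UNIV" "\<And>k x. 0 \<le> \<eta> k x"
    "\<And>x. x \<in> \<Omega> \<Longrightarrow> (\<Sum>k\<in>K. \<eta> k x) = 1" "\<And>k. z k \<in> \<Omega>" "\<And>k. norm (\<xi> k) \<le> L"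
    "\<And>k x. x \<in> \<Omega> \<Longrightarrow> \<eta> k x \<noteq> 0 \<Longrightarrow> norm (grad \<psi> x - \<xi> k) \<le> \<tau>"
    "\<And>k x. x \<in> \<Omega> \<Longrightarrow> \<eta> k x \<noteq> 0 \<Longrightarrow> \<xi> k \<noteq> 0 \<Longrightarrow> norm (x - z k) \<le> \<tau>"
    "\<And>k. \<xi> k \<noteq> 0 \<Longrightarrow> \<eta> k \<in> test_functions \<Omega>"
    by (rule gradient_partition_exists[OF \<Omega> ne \<psi>(1) \<tau>(1) L(2)]) (rule that)
  have "\<exists>B. 0 < B \<and> (\<forall>x y. \<bar>\<eta> k x - \<eta> k y\<bar> \<le> B * norm (x - y))" for k
  proof -
    obtain B where "B > 0" "\<And>x y. \<bar>\<eta> k x - \<eta> k y\<bar> \<le> B * norm (x - y)"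
      by (rule test_functions_bounded[OF K(2)[of k]]) (rule that)
    then show ?thesis by blast
  qed
  from choice[OF allI[OF this]] obtain Bk where Bk: "\<forall>k. 0 < Bk k \<and> (\<forall>x y. \<bar>\<eta> k x - \<eta> k y\<bar> \<le> Bk k * norm (x - y))" ..
  define B where "B = B0 + (\<Sum>k\<in>K. Bk k)"
  have Bs: "0 \<le> (\<Sum>k\<in>K. Bk k)" using Bk by (intro sum_nonneg) (simp add: less_imp_le)
  interpret P: homogenization_partition \<Omega> a \<alpha> \<beta> \<omega> v \<psi> K \<eta> z \<xi> L \<tau> B
  proof
    show "0 \<le> B" using B0(1) Bs by (simp add: B_def)
    show "\<bar>\<eta> k x - \<eta> k y\<bar> \<le> B * norm (x - y)" if k: "k \<in> K" for k x y
    proof -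
      have "Bk k \<le> (\<Sum>k\<in>K. Bk k)" using K(1) Bk k by (intro member_le_sum) (simp_all add: less_imp_le)
      then have "Bk k * norm (x - y) \<le> B * norm (x - y)" using B0(1) by (intro mult_right_mono) (simp_all add: B_def)
      then show ?thesis using Bk by (meson order_trans)
    qed
    show "norm (grad \<psi> x - grad \<psi> y) \<le> B * norm (x - y)" for x y
    proof -
      have "B0 * norm (x - y) \<le> B * norm (x - y)" using Bs by (intro mult_right_mono) (simp_all add: B_def)
      with B0(2)[of x y] show ?thesis by (rule order_trans)
    qed
  qed (fact \<psi>(1) \<tau>(1) K)+
  have \<Delta>: "sqn \<Omega> (\<lambda>x. grad \<psi> x - ?g x) \<le> \<theta>" using \<psi>(2) by (simp add: norm_minus_commute)
  have 4: "\<omega> (2 * \<tau>) * L\<^sup>2 * ?m \<le> \<theta>" using wM[OF _ M(2)] by (simp add: mult.assoc)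
  have 5: "\<omega> (2 * \<tau>) * sqn \<Omega> ?g \<le> \<theta>" by (rule wM[OF G0 M(3)])
  show ?thesis by (rule P.corrector_estimate[OF u f \<theta> \<Delta> \<tau>(2) 4 5]) (rule that)
qed

end

theorem theorem5:
  fixes \<Omega> :: "(real^'n) set"
    and \<epsilon> :: "nat \<Rightarrow> real"
    and a :: "real^'n \<Rightarrow> real^'n \<Rightarrow> real^'n \<Rightarrow> real^'n"
    and \<alpha> \<beta> :: real
    and \<omega> :: "real \<Rightarrow> real"
    and F :: "nat \<Rightarrow> (real^'n \<Rightarrow> real) \<Rightarrow> real"
    and f :: "(real^'n \<Rightarrow> real) \<Rightarrow> real"
    and U :: "nat \<Rightarrow> real^'n \<Rightarrow> real"
    and u :: "real^'n \<Rightarrow> real"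
    and v :: "real^'n \<Rightarrow> real^'n \<Rightarrow> real^'n \<Rightarrow> real"
    and p :: "nat \<Rightarrow> int^'n \<Rightarrow> real^'n"
  assumes \<Omega>: "open \<Omega>" "bounded \<Omega>"
    and \<epsilon>: "decseq \<epsilon>" "\<And>h. 0 < \<epsilon> h" "\<epsilon> \<longlonglongrightarrow> 0"
    and a_measurable: "\<And>x \<xi>. x \<in> \<Omega> \<Longrightarrow> (\<lambda>y. a x y \<xi>) \<in> borel_measurable lebesgue"
    and a_periodic: "\<And>x \<xi>. x \<in> \<Omega> \<Longrightarrow> Y_periodic (\<lambda>y. a x y \<xi>)"
    and \<alpha>\<beta>: "0 < \<alpha>" "\<alpha> \<le> \<beta>"
    and \<omega>: "continuous_on UNIV \<omega>" "mono \<omega>" "\<omega> 0 = 0"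
    and a_monotone: "AE y in lebesgue. \<forall>x\<in>\<Omega>. \<forall>\<xi>1 \<xi>2.
          (a x y \<xi>1 - a x y \<xi>2) \<bullet> (\<xi>1 - \<xi>2) \<ge> \<alpha> * (norm (\<xi>1 - \<xi>2))\<^sup>2"
    and a_lipschitz: "AE y in lebesgue. \<forall>x\<in>\<Omega>. \<forall>\<xi>1 \<xi>2.
          norm (a x y \<xi>1 - a x y \<xi>2) \<le> \<beta> * norm (\<xi>1 - \<xi>2)"
    and a_zero: "AE y in lebesgue. \<forall>x\<in>\<Omega>. a x y 0 = 0"
    and a_modulus: "AE y in lebesgue. \<forall>x1\<in>\<Omega>. \<forall>x2\<in>\<Omega>. \<forall>\<xi>.
          (norm (a x1 y \<xi> - a x2 y \<xi>))\<^sup>2 \<le> \<omega> (norm (x1 - x2)) * (norm \<xi>)\<^sup>2"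
    and F_tendsto: "tendsto_H_minus \<Omega> F f"
    and U_space: "\<And>h. U h \<in> H12_0 \<Omega>"
    and U_solution: "\<And>h \<phi>. \<phi> \<in> H12_0 \<Omega> \<Longrightarrow>
          (LINT x|lebesgue_on \<Omega>. a x (x /\<^sub>R \<epsilon> h) (weak_grad \<Omega> (U h) x) \<bullet> weak_grad \<Omega> \<phi> x) = F h \<phi>"
    and v_space: "\<And>\<xi> x. x \<in> \<Omega> \<Longrightarrow> v \<xi> x \<in> H12_per"
    and v_solution: "\<And>\<xi> x \<phi>. x \<in> \<Omega> \<Longrightarrow> \<phi> \<in> H12_per \<Longrightarrow>
          (LINT y|lebesgue_on Y. a x y (\<xi> + weak_grad Y (v \<xi> x) y) \<bullet> weak_grad Y \<phi> y) = 0"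
    and u_space: "u \<in> H12_0 \<Omega>"
    and u_solution: "\<And>\<phi>. \<phi> \<in> H12_0 \<Omega> \<Longrightarrow>
          (LINT x|lebesgue_on \<Omega>. b_hom a v x (weak_grad \<Omega> u x) \<bullet> weak_grad \<Omega> \<phi> x) = f \<phi>"
    and p_in_cell: "\<And>h j. j \<in> inner_cells \<Omega> (\<epsilon> h) \<Longrightarrow> p h j \<in> cell (\<epsilon> h) j"
  shows "tendsto_L2 \<Omega>
           (\<lambda>h x. weak_grad \<Omega> (U h) x - corrector \<Omega> (\<epsilon> h) v (p h) (weak_grad \<Omega> u) x)
           (\<lambda>x. 0)"
proof -
  interpret homogenization \<Omega> a \<alpha> \<beta> \<omega> v
    by standard (fact \<Omega> a_measurable a_periodic \<alpha>\<beta> \<omega> a_monotone a_lipschitz a_zero a_modulus v_space v_solution)+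
  let ?g = "weak_grad \<Omega> u"
  define E where "E h = (\<lambda>x. weak_grad \<Omega> (U h) x - corrector \<Omega> (\<epsilon> h) v (p h) ?g x)" for h
  have gL: "?g \<in> L2 \<Omega>" by (rule H12D(2)[OF H12_0_H12[OF u_space] \<Omega>(1)])
  have EL: "E h \<in> L2 \<Omega>" for h
    unfolding E_def by (intro L2_diff H12D(2)[OF H12_0_H12[OF U_space] \<Omega>(1)] corrector_L2[OF \<epsilon>(2) p_in_cell gL])
  have FH: "F h \<in> H_minus \<Omega>" "f \<in> H_minus \<Omega>" and Fl: "(\<lambda>h. H_minus_norm \<Omega> (\<lambda>\<phi>. F h \<phi> - f \<phi>)) \<longlonglongrightarrow> 0" for h
    using F_tendsto unfolding tendsto_H_minus_def by blast+
  have us: "\<forall>\<phi>\<in>H12_0 \<Omega>. (LINT x|lebesgue_on \<Omega>. b_hom a v x (?g x) \<bullet> weak_grad \<Omega> \<phi> x) = f \<phi>" using u_solution by blast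
  have "(\<lambda>h. L2_norm \<Omega> (E h)) \<longlonglongrightarrow> 0"
  proof (cases "\<Omega> = {}")
    \<comment> \<open>The partition takes its points z_k from \<Omega>, so the empty set is treated
      apart; there every L2 norm is 0.\<close>
    case True
    have "L2_norm {} g = 0" for g :: "real^'n \<Rightarrow> real^'n"
    proof -
      have "sqn {} g = (LINT x :: real^'n|lebesgue_on {}. 0)" by (rule Bochner_Integration.integral_cong) auto
      then show ?thesis by (simp add: L2_norm_def)
    qed
    then show ?thesis by (simp add: True)
  next
    case False
    obtain C where C: "C \<ge> 0" "\<And>u. u \<in> H12_0 \<Omega> \<Longrightarrow> H12_norm \<Omega> u \<le> C * L2_norm \<Omega> (weak_grad \<Omega> u)"
      by (rule H12_norm_le_L2_norm_weak_grad[OF \<Omega>]) (rule that)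
    show ?thesis
    proof (rule LIMSEQ_I)
      fix e :: real assume e: "e > 0"
      \<comment> \<open>The estimate is used with \<theta> = s^2; the added 1 makes the divisor
        positive and the final inequality strict.\<close>
      define s where "s = e / (C4 + 1)"
      have s: "s > 0" "C4 * s < e" using e C4_nonneg by (simp_all add: s_def field_simps)
      have sq: "sqrt (s\<^sup>2) = s" using s(1) by simp
      have "s\<^sup>2 > 0" using s(1) by simp
      obtain \<epsilon>1 where \<epsilon>1: "\<epsilon>1 > 0" "\<And>\<epsilon> p U F. 0 < \<epsilon> \<Longrightarrow> \<epsilon> < \<epsilon>1 \<Longrightarrow> \<forall>j\<in>inner_cells \<Omega> \<epsilon>. p j \<in> cell \<epsilon> j \<Longrightarrow>
        U \<in> H12_0 \<Omega> \<Longrightarrow>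
        \<forall>\<phi>\<in>H12_0 \<Omega>. (LINT x|lebesgue_on \<Omega>. a x (x /\<^sub>R \<epsilon>) (weak_grad \<Omega> U x) \<bullet> weak_grad \<Omega> \<phi> x) = F \<phi> \<Longrightarrow>
        \<forall>\<phi>\<in>H12_0 \<Omega>. F \<phi> - f \<phi> \<le> sqrt (s\<^sup>2) * L2_norm \<Omega> (weak_grad \<Omega> \<phi>) \<Longrightarrow>
        L2_norm \<Omega> (\<lambda>x. weak_grad \<Omega> U x - corrector \<Omega> \<epsilon> v p ?g x) \<le> C4 * sqrt (s\<^sup>2)"
        by (rule corrector_estimate_small[OF False u_space us \<open>s\<^sup>2 > 0\<close>]) (rule that)
      have "\<forall>\<^sub>F h in sequentially. \<epsilon> h < \<epsilon>1" using \<epsilon>(3) \<epsilon>1(1) by (rule order_tendstoD(2))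
      \<comment> \<open>The Poincare constant C converts the Sobolev norm of a test function into
        the norm of its gradient; the quotient C/(C + 1) that results is at most 1.\<close>
      moreover have "\<forall>\<^sub>F h in sequentially. H_minus_norm \<Omega> (\<lambda>\<phi>. F h \<phi> - f \<phi>) < s / (C + 1)"
        using Fl s(1) C(1) by (intro order_tendstoD(2)[OF Fl]) simp
      ultimately have "\<forall>\<^sub>F h in sequentially. L2_norm \<Omega> (E h) < e"
      proof eventually_elim
        case (elim h)
        have Ff: "F h \<phi> - f \<phi> \<le> sqrt (s\<^sup>2) * L2_norm \<Omega> (weak_grad \<Omega> \<phi>)" if \<phi>: "\<phi> \<in> H12_0 \<Omega>" for \<phi>
        proof -
          have "F h \<phi> - f \<phi> \<le> H_minus_norm \<Omega> (\<lambda>\<phi>. F h \<phi> - f \<phi>) * H12_norm \<Omega> \<phi>"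
            using H_minus_norm_bound[OF FH(1) FH(2) \<phi> \<Omega>(1), of h] by linarith
          also have "\<dots> \<le> (s / (C + 1)) * H12_norm \<Omega> \<phi>" using elim(2) by (intro mult_right_mono H12_norm_nonneg) simp
          also have "\<dots> \<le> (s / (C + 1)) * (C * L2_norm \<Omega> (weak_grad \<Omega> \<phi>))" using s(1) C by (intro mult_left_mono C(2) \<phi>) simp
          also have "\<dots> = (s * (C / (C + 1))) * L2_norm \<Omega> (weak_grad \<Omega> \<phi>)" by simp
          also have "\<dots> \<le> s * L2_norm \<Omega> (weak_grad \<Omega> \<phi>)"
            using s(1) C(1) by (intro mult_right_mono L2_norm_nonneg mult_left_le) simp_all
          finally show ?thesis unfolding sq .
        qed
        have "L2_norm \<Omega> (E h) \<le> C4 * sqrt (s\<^sup>2)"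
          unfolding E_def by (intro \<epsilon>1(2)[OF \<epsilon>(2) elim(1) _ U_space, where F = "F h"] ballI p_in_cell U_solution Ff)
        then show ?case using s(2) by (simp only: sq)
      qed
      then show "\<exists>no. \<forall>h\<ge>no. norm (L2_norm \<Omega> (E h) - 0) < e"
        by (simp add: eventually_sequentially L2_norm_nonneg)
    qed
  qed
  then show ?thesis unfolding tendsto_L2_def using EL by (simp add: E_def)
qed

end
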